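(* Let $X$ and $Y$ be vertex transitive graphs. If $\mathrm{Qut}(X[Y])\neq\mathrm{Qut}(Y)\wr_*\mathrm{Qut}(X)$, then there exist positive integers $\alpha,\beta>1$ and vertex transitive graphs $X',Y'$ such that either $X=X'[\overline{K_\alpha}]$ and $Y=\overline{K_\beta}[Y']$, or $X=X'[K_\alpha]$ and $Y=K_\beta[Y']$. Moreover, if $\alpha,\beta$ are chosen to be maximal, then $\mathrm{Qut}(X[Y])=(\mathrm{Qut}(Y')\wr_*\mathbb{S}^+_{\alpha\beta})\wr_*\mathrm{Qut}(X')$.
   Context: All graphs are finite and simple, with nonempty vertex set, not necessarily connected. $K_m$ is the complete graph on $m$ vertices; $\overline{X}$ is the complement of $X$, so $\overline{K_m}$ is the edgeless graph on $m$ vertices. A graph is vertex transitive if its automorphism group acts transitively on its vertices. Equalities between graphs are understood up to isomorphism, and equalities of quantum permutation groups are understood after the corresponding identification of vertex sets (e.g. $V(X[Y])$ with $V(X')\times[\alpha\beta]\times V(Y')$). In each of the two cases, $\alpha$ (respectively $\beta$) maximal means that $\alpha$ (respectively $\beta$) is as large as possible among all decompositions of $X$ (respectively $Y$) of the form displayed in that case. Lexicographic product: $X[Y]$ has vertex set $V(X)\times V(Y)$ and edge set $\{(x,y)(x',y') : xx'\in E(X)\}\cup\{(x,y)(x,y') : yy'\in E(Y)\}$. A magic unitary is a matrix $u=[u_{ij}]$ with entries in a unital $C^*$-algebra such that $u_{ij}^2=u_{ij}^*=u_{ij}$ for all $i,j$ and every row and every column sums to $1$. A quantum permutation group acting on a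 finite set $I$ is a pair $\mathbb{G}=(C(\mathbb{G}),u)$, where $C(\mathbb{G})$ is a unital $C^*$-algebra generated by the entries of a magic unitary $u=[u_{ij}]_{i,j\in I}$ (the fundamental representation), such that $\Delta(u_{ij})=\sum_k u_{ik}\otimes u_{kj}$ defines a unital $*$-homomorphism making $(C(\mathbb{G}),\Delta)$ a compact quantum group. Two quantum permutation groups $(C(\mathbb{G}),u)$ and $(C(\mathbb{H}),v)$ acting on the same set are equal if $u_{ij}\mapsto v_{ij}$ defines a $*$-isomorphism $C(\mathbb{G})\to C(\mathbb{H})$. $\mathbb{S}_n^+$ is the quantum permutation group on $[n]$ whose algebra $C(\mathbb{S}_n^+)$ is the universal unital $C^*$-algebra generated by the entries of an $n\times n$ magic unitary. $\mathrm{Qut}(X)=(C(\mathrm{Qut}(X)),u)$, where $C(\mathrm{Qut}(X))$ is the universal unital $C^*$-algebra generated by $[u_{ij}]_{i,j\in V(X)}$ subject to: $u$ is a magic unitary and $A_Xu=uA_X$ ($A_X$ the adjacency matrix). Free wreath product: for quantum permutation groups $\mathbb{G}=(C(\mathbb{G}),[u_{ij}]_{i,j\in[m]})$ and $\mathbb{H}=(C(\mathbb{H}),[v_{ab}]_{a,b\in[n]})$, let $C(\mathbb{G}^{*n})$ be the free product, amalgamated over $\mathbb{C}$ (coproduct of unital $C^*$-algebras), of $n$ copies of $C(\mathbb{G})$, and let $u^{(a)}$ be the fundamental representation of the $a$-th copy. Then $\mathbb{G}\wr_*\mathbb{H}$ is the quantum permutation group acting on $[n]\times[m]$ with $C(\mathbb{G}\wr_*\mathbb{H})=(C(\mathbb{G}^{*n})*_{\mathbb{C}}C(\mathbb{H}))/\langle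 u^{(a)}_{ij}v_{ab}=v_{ab}u^{(a)}_{ij} \mid i,j\in[m],\ a,b\in[n]\rangle$ and fundamental representation $w_{(a,i)(b,j)}=u^{(a)}_{ij}v_{ab}$. *)

theory Defs
  imports
    Complex_Main
    "HOL-Library.Poly_Mapping"
    "HOL-Algebra.QuotRing"
    "HOL-Algebra.Module"
    "Graph_Theory.Pair_Digraph"
begin

section \<open>Graphs\<close>

definition simple_graph :: "'v pair_pre_digraph \<Rightarrow> bool" where
  "simple_graph X \<longleftrightarrow> pair_graph X \<and> pverts X \<noteq> {}"

definition graph_isomorphism ::
    "('v \<Rightarrow> 'w) \<Rightarrow> 'v pair_pre_digraph \<Rightarrow> 'w pair_pre_digraph \<Rightarrow> bool" where
  "graph_isomorphism f X Y \<longleftrightarrow>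
     bij_betw f (pverts X) (pverts Y) \<and>
     (\<forall>x\<in>pverts X. \<forall>y\<in>pverts X. (x, y) \<in> parcs X \<longleftrightarrow> (f x, f y) \<in> parcs Y)"

definition isomorphic :: "'v pair_pre_digraph \<Rightarrow> 'w pair_pre_digraph \<Rightarrow> bool" where
  "isomorphic X Y \<longleftrightarrow> (\<exists>f. graph_isomorphism f X Y)"

definition vertex_transitive :: "'v pair_pre_digraph \<Rightarrow> bool" where
  "vertex_transitive X \<longleftrightarrow>
     (\<forall>x\<in>pverts X. \<forall>y\<in>pverts X. \<exists>f. graph_isomorphism f X X \<and> f x = y)"

definition complete_graph :: "nat \<Rightarrow> nat pair_pre_digraph" where
  "complete_graph n =
     \<lparr> pverts = {..<n}, parcs = {(i, j). i < n \<and> j < n \<and> i \<noteq> j} \<rparr>"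

definition graph_complement :: "'v pair_pre_digraph \<Rightarrow> 'v pair_pre_digraph" where
  "graph_complement X =
     \<lparr> pverts = pverts X,
       parcs = {(x, y). x \<in> pverts X \<and> y \<in> pverts X \<and> x \<noteq> y \<and> (x, y) \<notin> parcs X} \<rparr>"

definition edgeless_graph :: "nat \<Rightarrow> nat pair_pre_digraph" where
  "edgeless_graph n = graph_complement (complete_graph n)"

definition lex_product ::
    "'v pair_pre_digraph \<Rightarrow> 'w pair_pre_digraph \<Rightarrow> ('v \<times> 'w) pair_pre_digraph" where
  "lex_product X Y =
     \<lparr> pverts = pverts X \<times> pverts Y,
       parcs = {((x, y), (x', y')) | x y x' y'.
                  (x, x') \<in> parcs X \<and> y \<in> pverts Y \<and> y' \<in> pverts Y}
             \<union> {((x, y), (x, y')) | x y y'. x \<in> pverts X \<and> (y, y') \<in> parcs Y} \<rparr>"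


section \<open>Unital \<open>C\<^sup>*\<close>-algebras\<close>

text \<open>
  \<open>C\<^sup>*\<close>-algebras are explicit-carrier structures extending the HOL-Algebra records, so that
  algebras over different HOL types can be compared.
\<close>

record 'a cstar = "(complex, 'a) module" +
  star :: "'a \<Rightarrow> 'a"
  nrm :: "'a \<Rightarrow> real"

definition complex_field :: "complex ring" where
  "complex_field = \<lparr> carrier = UNIV, monoid.mult = (*), one = 1, zero = 0, add = (+) \<rparr>"

locale star_algebra = ring A + scal: Module.module complex_field A for A :: "'a cstar" (structure) +
  assumes smult_mult_left:
      "\<lbrakk>x \<in> carrier A; y \<in> carrier A\<rbrakk> \<Longrightarrow> (c \<odot> x) \<otimes> y = c \<odot> (x \<otimes> y)"
    and smult_mult_right:
      "\<lbrakk>x \<in> carrier A; y \<in> carrier A\<rbrakk> \<Longrightarrow> x \<otimes> (c \<odot> y) = c \<odot> (x \<otimes> y)"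
    and star_closed: "x \<in> carrier A \<Longrightarrow> star A x \<in> carrier A"
    and star_star: "x \<in> carrier A \<Longrightarrow> star A (star A x) = x"
    and star_add:
      "\<lbrakk>x \<in> carrier A; y \<in> carrier A\<rbrakk> \<Longrightarrow> star A (x \<oplus> y) = star A x \<oplus> star A y"
    and star_mult:
      "\<lbrakk>x \<in> carrier A; y \<in> carrier A\<rbrakk> \<Longrightarrow> star A (x \<otimes> y) = star A y \<otimes> star A x"
    and star_smult: "x \<in> carrier A \<Longrightarrow> star A (c \<odot> x) = cnj c \<odot> star A x"

definition cstar_seminorm :: "'a cstar \<Rightarrow> ('a \<Rightarrow> real) \<Rightarrow> bool" where
  "cstar_seminorm A p \<longleftrightarrow>
     (\<forall>x\<in>carrier A. 0 \<le> p x) \<and>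
     (\<forall>x\<in>carrier A. \<forall>y\<in>carrier A. p (x \<oplus>\<^bsub>A\<^esub> y) \<le> p x + p y) \<and>
     (\<forall>c. \<forall>x\<in>carrier A. p (c \<odot>\<^bsub>A\<^esub> x) = cmod c * p x) \<and>
     (\<forall>x\<in>carrier A. \<forall>y\<in>carrier A. p (x \<otimes>\<^bsub>A\<^esub> y) \<le> p x * p y) \<and>
     (\<forall>x\<in>carrier A. p (star A x \<otimes>\<^bsub>A\<^esub> x) = (p x)\<^sup>2)"

definition cauchy_in :: "'a cstar \<Rightarrow> (nat \<Rightarrow> 'a) \<Rightarrow> bool" where
  "cauchy_in A s \<longleftrightarrow>
     (\<forall>n. s n \<in> carrier A) \<and>
     (\<forall>e>0. \<exists>N. \<forall>m\<ge>N. \<forall>n\<ge>N. nrm A (s m \<ominus>\<^bsub>A\<^esub> s n) < e)"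

locale seminormed_star_algebra = star_algebra A for A :: "'a cstar" (structure) +
  assumes nrm_seminorm: "cstar_seminorm A (nrm A)"

locale cstar_algebra = seminormed_star_algebra A for A :: "'a cstar" (structure) +
  assumes nrm_definite: "\<lbrakk>x \<in> carrier A; nrm A x = 0\<rbrakk> \<Longrightarrow> x = \<zero>"
    and nrm_complete:
      "cauchy_in A s \<Longrightarrow> \<exists>x\<in>carrier A. (\<lambda>n. nrm A (s n \<ominus> x)) \<longlonglongrightarrow> 0"

definition star_hom ::
    "'a cstar \<Rightarrow> 'b cstar \<Rightarrow> ('a \<Rightarrow> 'b) set" where
  "star_hom A B =
     {h. h \<in> ring_hom A B \<and>
         (\<forall>c. \<forall>x\<in>carrier A. h (c \<odot>\<^bsub>A\<^esub> x) = c \<odot>\<^bsub>B\<^esub> h x) \<and>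
         (\<forall>x\<in>carrier A. h (star A x) = star B (h x))}"

definition star_iso ::
    "'a cstar \<Rightarrow> 'b cstar \<Rightarrow> ('a \<Rightarrow> 'b) set" where
  "star_iso A B = {h \<in> star_hom A B. bij_betw h (carrier A) (carrier B)}"

definition cstar_quotient :: "'a cstar \<Rightarrow> 'a set \<Rightarrow> 'a set cstar" where
  "cstar_quotient A I =
     \<lparr> carrier = carrier (A Quot I), monoid.mult = monoid.mult (A Quot I), one = one (A Quot I),
       zero = zero (A Quot I), add = add (A Quot I),
       smult = (\<lambda>c S. \<Union>x\<in>S. I +>\<^bsub>A\<^esub> (c \<odot>\<^bsub>A\<^esub> x)),
       star = (\<lambda>S. \<Union>x\<in>S. I +>\<^bsub>A\<^esub> star A x),
       nrm = (\<lambda>S. INF x\<in>S. nrm A x) \<rparr>"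

definition closed_in :: "'a cstar \<Rightarrow> 'a set \<Rightarrow> bool" where
  "closed_in A I \<longleftrightarrow>
     (\<forall>x\<in>carrier A. (\<forall>e>0. \<exists>y\<in>I. nrm A (x \<ominus>\<^bsub>A\<^esub> y) < e) \<longrightarrow> x \<in> I)"

definition closed_ideal_generated :: "'a cstar \<Rightarrow> 'a set \<Rightarrow> 'a set" where
  "closed_ideal_generated A S = \<Inter>{I. ideal I A \<and> closed_in A I \<and> S \<subseteq> I}"

definition cauchy_algebra :: "'a cstar \<Rightarrow> (nat \<Rightarrow> 'a) cstar" where
  "cauchy_algebra A =
     \<lparr> carrier = {s. cauchy_in A s},
       monoid.mult = (\<lambda>s t n. s n \<otimes>\<^bsub>A\<^esub> t n), one = (\<lambda>n. \<one>\<^bsub>A\<^esub>),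
       zero = (\<lambda>n. \<zero>\<^bsub>A\<^esub>), add = (\<lambda>s t n. s n \<oplus>\<^bsub>A\<^esub> t n),
       smult = (\<lambda>c s n. c \<odot>\<^bsub>A\<^esub> s n), star = (\<lambda>s n. star A (s n)),
       nrm = (\<lambda>s. lim (\<lambda>n. nrm A (s n))) \<rparr>"

definition null_sequences :: "'a cstar \<Rightarrow> (nat \<Rightarrow> 'a) set" where
  "null_sequences A = {s. (\<forall>n. s n \<in> carrier A) \<and> (\<lambda>n. nrm A (s n)) \<longlonglongrightarrow> 0}"

text \<open>
  The Hausdorff completion: \<^term>\<open>nrm A\<close> need only be a seminorm, and elements of seminorm
  zero are identified with zero.
\<close>

definition cstar_completion :: "'a cstar \<Rightarrow> (nat \<Rightarrow> 'a) set cstar" where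
  "cstar_completion A = cstar_quotient (cauchy_algebra A) (null_sequences A)"

definition to_completion :: "'a cstar \<Rightarrow> 'a \<Rightarrow> (nat \<Rightarrow> 'a) set" where
  "to_completion A x = null_sequences A +>\<^bsub>cauchy_algebra A\<^esub> (\<lambda>n. x)"


section \<open>The free unital \<open>*\<close>-algebra\<close>

text \<open>
  A letter \<open>(g, False)\<close> stands for the generator \<open>g\<close>, and \<open>(g, True)\<close> for its adjoint. With
  concatenation as addition on words, the product of \<open>'g word \<Rightarrow>\<^sub>0 complex\<close> is the product
  of noncommutative polynomials.
\<close>

datatype 'g word = Word (letters: "('g \<times> bool) list")

instantiation word :: (type) monoid_add
begin

definition "0 = Word []"
definition "v + w = Word (letters v @ letters w)"

instance
  by standard (auto simp: zero_word_def plus_word_def)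

end

definition word_star :: "'g word \<Rightarrow> 'g word" where
  "word_star w = Word (rev (map (\<lambda>(g, b). (g, \<not> b)) (letters w)))"

lemma word_star_word_star [simp]: "word_star (word_star w) = w"
  by (cases w) (auto simp: word_star_def rev_map comp_def case_prod_beta)

type_synonym 'g star_poly = "'g word \<Rightarrow>\<^sub>0 complex"

lift_definition poly_star :: "'g star_poly \<Rightarrow> 'g star_poly" is "\<lambda>f w. cnj (f (word_star w))"
proof -
  fix f :: "'g word \<Rightarrow> complex"
  assume "finite {w. f w \<noteq> 0}"
  moreover have "{w. cnj (f (word_star w)) \<noteq> 0} = word_star ` {w. f w \<noteq> 0}"
    by (auto simp: image_iff) (metis word_star_word_star)
  ultimately show "finite {w. cnj (f (word_star w)) \<noteq> 0}"
    by simp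
qed

definition gen :: "'g \<Rightarrow> 'g star_poly" where
  "gen g = Poly_Mapping.single (Word [(g, False)]) 1"

definition scalar :: "complex \<Rightarrow> 'g star_poly" where
  "scalar c = Poly_Mapping.single 0 c"

definition star_polys :: "'g set \<Rightarrow> 'g star_poly set" where
  "star_polys G = {f. \<forall>w\<in>Poly_Mapping.keys f. fst ` set (letters w) \<subseteq> G}"

definition free_star_algebra :: "'g set \<Rightarrow> ('g star_poly \<Rightarrow> real) \<Rightarrow> 'g star_poly cstar" where
  "free_star_algebra G p =
     \<lparr> carrier = star_polys G,
       monoid.mult = (*), one = 1, zero = 0, add = (+),
       smult = (\<lambda>c f. scalar c * f), star = poly_star, nrm = p \<rparr>"


section \<open>Universal \<open>C\<^sup>*\<close>-algebras\<close>

text \<open>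
  The universal unital \<open>C\<^sup>*\<close>-algebra with generators \<open>G\<close> subject to \<open>r = 0\<close> for \<open>r \<in> R\<close> is the
  completion of the free unital \<open>*\<close>-algebra on \<open>G\<close> in its largest \<open>C\<^sup>*\<close>-seminorm vanishing on
  \<open>R\<close>. The \<open>C\<^sup>*\<close>-seminorms vanishing on \<open>R\<close> are exactly the functions
  \<open>f \<mapsto> \<parallel>\<pi> f\<parallel>\<close> for unital \<open>*\<close>-homomorphisms \<open>\<pi>\<close> into unital \<open>C\<^sup>*\<close>-algebras killing
  \<open>R\<close>, so no quantification over \<open>C\<^sup>*\<close>-algebras, hence over types, is needed.
  As usual, the presentation has to bound the seminorms of the generators for this to make sense.
\<close>

definition universal_seminorm :: "'g set \<Rightarrow> 'g star_poly set \<Rightarrow> 'g star_poly \<Rightarrow> real" where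
  "universal_seminorm G R f =
     (SUP p \<in> {p. cstar_seminorm (free_star_algebra G p) p \<and> (\<forall>r\<in>R. p r = 0)}. p f)"

definition presented_star_algebra :: "'g set \<Rightarrow> 'g star_poly set \<Rightarrow> 'g star_poly cstar" where
  "presented_star_algebra G R = free_star_algebra G (universal_seminorm G R)"

definition universal_cstar ::
    "'g set \<Rightarrow> 'g star_poly set \<Rightarrow> (nat \<Rightarrow> 'g star_poly) set cstar" where
  "universal_cstar G R = cstar_completion (presented_star_algebra G R)"

definition universal_gen ::
    "'g set \<Rightarrow> 'g star_poly set \<Rightarrow> 'g \<Rightarrow> (nat \<Rightarrow> 'g star_poly) set" where
  "universal_gen G R g = to_completion (presented_star_algebra G R) (gen g)"

text \<open>
  \<open>hom_relations A f\<close> says that \<open>x \<mapsto> gen (f x)\<close> is a unital \<open>*\<close>-homomorphism on \<open>A\<close>. The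
  coproduct of unital \<open>C\<^sup>*\<close>-algebras, i.e. their free product amalgamated over the complex
  numbers, is generated by disjoint copies of the carriers subject to these relations.
\<close>

definition hom_relations :: "'a cstar \<Rightarrow> ('a \<Rightarrow> 'g) \<Rightarrow> 'g star_poly set" where
  "hom_relations A f =
     {gen (f \<one>\<^bsub>A\<^esub>) - 1} \<union>
     {gen (f (x \<oplus>\<^bsub>A\<^esub> y)) - (gen (f x) + gen (f y)) | x y. x \<in> carrier A \<and> y \<in> carrier A} \<union>
     {gen (f (x \<otimes>\<^bsub>A\<^esub> y)) - gen (f x) * gen (f y) | x y. x \<in> carrier A \<and> y \<in> carrier A} \<union>
     {gen (f (c \<odot>\<^bsub>A\<^esub> x)) - scalar c * gen (f x) | c x. x \<in> carrier A} \<union>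
     {gen (f (star A x)) - poly_star (gen (f x)) | x. x \<in> carrier A}"

definition family_coproduct ::
    "'k set \<Rightarrow> ('k \<Rightarrow> 'a cstar) \<Rightarrow> (nat \<Rightarrow> ('k \<times> 'a) star_poly) set cstar" where
  "family_coproduct K A =
     universal_cstar (Sigma K (\<lambda>k. carrier (A k))) (\<Union>k\<in>K. hom_relations (A k) (Pair k))"

definition family_inj ::
    "'k set \<Rightarrow> ('k \<Rightarrow> 'a cstar) \<Rightarrow> 'k \<Rightarrow> 'a \<Rightarrow> (nat \<Rightarrow> ('k \<times> 'a) star_poly) set" where
  "family_inj K A k x =
     universal_gen (Sigma K (\<lambda>k. carrier (A k))) (\<Union>k\<in>K. hom_relations (A k) (Pair k)) (k, x)"

definition coproduct ::
    "'a cstar \<Rightarrow> 'b cstar \<Rightarrow> (nat \<Rightarrow> ('a + 'b) star_poly) set cstar" where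
  "coproduct A B =
     universal_cstar (carrier A <+> carrier B) (hom_relations A Inl \<union> hom_relations B Inr)"

definition coproduct_inl ::
    "'a cstar \<Rightarrow> 'b cstar \<Rightarrow> 'a \<Rightarrow> (nat \<Rightarrow> ('a + 'b) star_poly) set" where
  "coproduct_inl A B x =
     universal_gen (carrier A <+> carrier B) (hom_relations A Inl \<union> hom_relations B Inr) (Inl x)"

definition coproduct_inr ::
    "'a cstar \<Rightarrow> 'b cstar \<Rightarrow> 'b \<Rightarrow> (nat \<Rightarrow> ('a + 'b) star_poly) set" where
  "coproduct_inr A B y =
     universal_gen (carrier A <+> carrier B) (hom_relations A Inl \<union> hom_relations B Inr) (Inr y)"


section \<open>Quantum permutation groups\<close>

text \<open>
  Only the data \<open>(C(G), u)\<close> are recorded: the comultiplication is determined by the fundamental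
  representation \<open>u\<close>, and neither equality nor the free wreath product refers to it.
\<close>

record ('i, 'a) qpg =
  qpoints :: "'i set"
  qalg :: "'a cstar"
  qrep :: "'i \<Rightarrow> 'i \<Rightarrow> 'a"

definition qpg_eq :: "('i, 'a) qpg \<Rightarrow> ('i, 'b) qpg \<Rightarrow> bool" where
  "qpg_eq G H \<longleftrightarrow>
     qpoints G = qpoints H \<and>
     (\<exists>\<phi>\<in>star_iso (qalg G) (qalg H).
        \<forall>i\<in>qpoints G. \<forall>j\<in>qpoints G. \<phi> (qrep G i j) = qrep H i j)"

definition qpg_relabel :: "('i \<Rightarrow> 'j) \<Rightarrow> ('i, 'a) qpg \<Rightarrow> ('j, 'a) qpg" where
  "qpg_relabel f G =
     \<lparr> qpoints = f ` qpoints G, qalg = qalg G,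
       qrep = (\<lambda>i j. qrep G (the_inv_into (qpoints G) f i) (the_inv_into (qpoints G) f j)) \<rparr>"

definition magic_relations :: "'i set \<Rightarrow> ('i \<times> 'i) star_poly set" where
  "magic_relations I =
     {gen (i, j) * gen (i, j) - gen (i, j) | i j. i \<in> I \<and> j \<in> I} \<union>
     {poly_star (gen (i, j)) - gen (i, j) | i j. i \<in> I \<and> j \<in> I} \<union>
     {(\<Sum>j\<in>I. gen (i, j)) - 1 | i. i \<in> I} \<union>
     {(\<Sum>i\<in>I. gen (i, j)) - 1 | j. j \<in> I}"

definition presented_qpg ::
    "'i set \<Rightarrow> ('i \<times> 'i) star_poly set \<Rightarrow> ('i, (nat \<Rightarrow> ('i \<times> 'i) star_poly) set) qpg" where
  "presented_qpg I R =
     \<lparr> qpoints = I, qalg = universal_cstar (I \<times> I) R,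
       qrep = (\<lambda>i j. universal_gen (I \<times> I) R (i, j)) \<rparr>"

definition quantum_symmetric_group ::
    "nat \<Rightarrow> (nat, (nat \<Rightarrow> (nat \<times> nat) star_poly) set) qpg" where
  "quantum_symmetric_group n = presented_qpg {..<n} (magic_relations {..<n})"

definition adjacency :: "'v pair_pre_digraph \<Rightarrow> 'v \<Rightarrow> 'v \<Rightarrow> ('v \<times> 'v) star_poly" where
  "adjacency X i j = (if (i, j) \<in> parcs X then 1 else 0)"

definition commutation_relations :: "'v pair_pre_digraph \<Rightarrow> ('v \<times> 'v) star_poly set" where
  "commutation_relations X =
     {(\<Sum>k\<in>pverts X. adjacency X i k * gen (k, j)) - (\<Sum>k\<in>pverts X. gen (i, k) * adjacency X k j)
       | i j. i \<in> pverts X \<and> j \<in> pverts X}"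

definition Qut :: "'v pair_pre_digraph \<Rightarrow> ('v, (nat \<Rightarrow> ('v \<times> 'v) star_poly) set) qpg" where
  "Qut X = presented_qpg (pverts X) (magic_relations (pverts X) \<union> commutation_relations X)"

context
  fixes G :: "('i, 'a) qpg" and H :: "('j, 'b) qpg"
begin

definition wreath_power :: "(nat \<Rightarrow> ('j \<times> 'a) star_poly) set cstar" where
  "wreath_power = family_coproduct (qpoints H) (\<lambda>_. qalg G)"

definition wreath_coproduct ::
    "(nat \<Rightarrow> ((nat \<Rightarrow> ('j \<times> 'a) star_poly) set + 'b) star_poly) set cstar" where
  "wreath_coproduct = coproduct wreath_power (qalg H)"

definition wreath_u ::
    "'j \<Rightarrow> 'i \<Rightarrow> 'i \<Rightarrow> (nat \<Rightarrow> ((nat \<Rightarrow> ('j \<times> 'a) star_poly) set + 'b) star_poly) set" where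
  "wreath_u a i j =
     coproduct_inl wreath_power (qalg H) (family_inj (qpoints H) (\<lambda>_. qalg G) a (qrep G i j))"

definition wreath_v ::
    "'j \<Rightarrow> 'j \<Rightarrow> (nat \<Rightarrow> ((nat \<Rightarrow> ('j \<times> 'a) star_poly) set + 'b) star_poly) set" where
  "wreath_v a b = coproduct_inr wreath_power (qalg H) (qrep H a b)"

definition wreath_ideal ::
    "(nat \<Rightarrow> ((nat \<Rightarrow> ('j \<times> 'a) star_poly) set + 'b) star_poly) set set" where
  "wreath_ideal = closed_ideal_generated wreath_coproduct
     {wreath_u a i j \<otimes>\<^bsub>wreath_coproduct\<^esub> wreath_v a b
        \<ominus>\<^bsub>wreath_coproduct\<^esub> wreath_v a b \<otimes>\<^bsub>wreath_coproduct\<^esub> wreath_u a i j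
      | i j a b. i \<in> qpoints G \<and> j \<in> qpoints G \<and> a \<in> qpoints H \<and> b \<in> qpoints H}"

definition free_wreath ::
    "('j \<times> 'i, (nat \<Rightarrow> ((nat \<Rightarrow> ('j \<times> 'a) star_poly) set + 'b) star_poly) set set) qpg"
  where
  "free_wreath =
     \<lparr> qpoints = qpoints H \<times> qpoints G,
       qalg = cstar_quotient wreath_coproduct wreath_ideal,
       qrep = (\<lambda>(a, i) (b, j). wreath_ideal +>\<^bsub>wreath_coproduct\<^esub>
                  (wreath_u a i j \<otimes>\<^bsub>wreath_coproduct\<^esub> wreath_v a b)) \<rparr>"

end

end

theory Submission
  imports Defs
begin

text \<open>
  A \<open>C\<^sup>*\<close>-algebra generated by a magic unitary is determined by the magic unitaries \<open>w\<close> in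
  \<open>C\<^sup>*\<close>-algebras \<open>D\<close> that are images of its fundamental representation. It therefore suffices to
  describe these \<open>w\<close> for the two sides of each equality. For \<open>Qut X\<close> they are the \<open>w\<close> with
  \<open>w i j * w k l = 0\<close> whenever \<open>(i, k)\<close> and \<open>(j, l)\<close> are distinguished by adjacency, and the relations
  in place of adjacency for which this holds are closed under Boolean operations, composition and
  counting of common neighbours.

  A magic unitary for \<open>X[Y]\<close> decomposes as in the free wreath product as soon as the relation ``being
  in the same fibre over \<open>X\<close>'' is among them. If \<open>X\<close> is regular and has no non-adjacent twins, the
  number of common neighbours distinguishes non-adjacent pairs in a fibre from those in different
  fibres; the complementary statement treats adjacent pairs. As a vertex-transitive graph cannot have
  both kinds of twins, at most one of the two fails, and then the fibres are still the connected
  components of the other relation provided that \<open>Y\<close>, respectively its complement, is connected.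
  Twin classes, connected components and their complementary versions give the decompositions of \<open>X\<close>
  and \<open>Y\<close> in the remaining cases. For maximal \<open>\<alpha>\<close> and \<open>\<beta>\<close> the criterion applies to \<open>X'[K[Y']]\<close> and
  to \<open>K[Y']\<close>, where \<open>K\<close> is the complete or edgeless graph on \<open>\<alpha>\<beta>\<close> vertices.
\<close>


section \<open>Star algebras and seminorms\<close>

text \<open>The two sides of each equality live on different HOL types, and the factors of a nested
  wreath product on yet others. Every comparison is therefore an equivalence about matrices over a
  test algebra \<open>D\<close> of arbitrary type, which is instantiated at both algebras only at
  the end. To treat such matrices algebraically, three facts about norms are needed. Distinct
  entries in a row or column of a magic unitary are orthogonal, which its definition does not state.
  Star-homomorphisms are contractive, which bounds the generators of a coproduct. Quotient seminorms
  satisfy the C*-identity, which makes completions and wreath products C*-algebras. The usual proofs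
  run through spectra, positive elements or representations. Here all three rest on approximate
  square roots of \<open>1 - c\<close> for self-adjoint \<open>c\<close> of norm below one, and
  positivity of \<open>b\<close> is replaced by a bound on the norm of \<open>1 - b\<close>.
  Approximating sequences take the place of exact roots because quotients and completions are taken
  of algebras that are only seminormed.\<close>

lemma cring_complex_field: "cring complex_field"
proof -
  have "\<exists>y. y + x = 0" for x :: complex
    by (rule exI[of _ "- x"]) simp
  then show ?thesis
    by (intro cringI abelian_groupI comm_monoidI) (auto simp: complex_field_def algebra_simps)
qed

text \<open>Additive inverses are supplied by \<open>(-1) \<odot> x\<close>, so no existential is
  left: each hypothesis is an identity or a closure condition, which pointwise and quotient
  constructions inherit at once.\<close>

lemma star_algebraI:
  fixes A :: "'a cstar" (structure)
  assumes closed: "\<zero> \<in> carrier A" "\<one> \<in> carrier A"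
      "\<And>x y. \<lbrakk>x \<in> carrier A; y \<in> carrier A\<rbrakk> \<Longrightarrow> x \<oplus> y \<in> carrier A"
      "\<And>x y. \<lbrakk>x \<in> carrier A; y \<in> carrier A\<rbrakk> \<Longrightarrow> x \<otimes> y \<in> carrier A"
      "\<And>c x. x \<in> carrier A \<Longrightarrow> c \<odot> x \<in> carrier A"
      "\<And>x. x \<in> carrier A \<Longrightarrow> star A x \<in> carrier A"
    and add: "\<And>x y z. \<lbrakk>x \<in> carrier A; y \<in> carrier A; z \<in> carrier A\<rbrakk> \<Longrightarrow> (x \<oplus> y) \<oplus> z = x \<oplus> (y \<oplus> z)"
      "\<And>x y. \<lbrakk>x \<in> carrier A; y \<in> carrier A\<rbrakk> \<Longrightarrow> x \<oplus> y = y \<oplus> x"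
      "\<And>x. x \<in> carrier A \<Longrightarrow> \<zero> \<oplus> x = x"
      "\<And>x. x \<in> carrier A \<Longrightarrow> ((-1) \<odot> x) \<oplus> x = \<zero>"
    and mult: "\<And>x y z. \<lbrakk>x \<in> carrier A; y \<in> carrier A; z \<in> carrier A\<rbrakk> \<Longrightarrow> (x \<otimes> y) \<otimes> z = x \<otimes> (y \<otimes> z)"
      "\<And>x. x \<in> carrier A \<Longrightarrow> \<one> \<otimes> x = x" "\<And>x. x \<in> carrier A \<Longrightarrow> x \<otimes> \<one> = x"
      "\<And>x y z. \<lbrakk>x \<in> carrier A; y \<in> carrier A; z \<in> carrier A\<rbrakk> \<Longrightarrow> (x \<oplus> y) \<otimes> z = x \<otimes> z \<oplus> y \<otimes> z"
      "\<And>x y z. \<lbrakk>x \<in> carrier A; y \<in> carrier A; z \<in> carrier A\<rbrakk> \<Longrightarrow> z \<otimes> (x \<oplus> y) = z \<otimes> x \<oplus> z \<otimes> y"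
    and smult: "\<And>c d x. x \<in> carrier A \<Longrightarrow> (c + d) \<odot> x = c \<odot> x \<oplus> d \<odot> x"
      "\<And>c x y. \<lbrakk>x \<in> carrier A; y \<in> carrier A\<rbrakk> \<Longrightarrow> c \<odot> (x \<oplus> y) = c \<odot> x \<oplus> c \<odot> y"
      "\<And>c d x. x \<in> carrier A \<Longrightarrow> (c * d) \<odot> x = c \<odot> (d \<odot> x)"
      "\<And>x. x \<in> carrier A \<Longrightarrow> 1 \<odot> x = x"
      "\<And>c x y. \<lbrakk>x \<in> carrier A; y \<in> carrier A\<rbrakk> \<Longrightarrow> (c \<odot> x) \<otimes> y = c \<odot> (x \<otimes> y)"
      "\<And>c x y. \<lbrakk>x \<in> carrier A; y \<in> carrier A\<rbrakk> \<Longrightarrow> x \<otimes> (c \<odot> y) = c \<odot> (x \<otimes> y)"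
    and star: "\<And>x. x \<in> carrier A \<Longrightarrow> star A (star A x) = x"
      "\<And>x y. \<lbrakk>x \<in> carrier A; y \<in> carrier A\<rbrakk> \<Longrightarrow> star A (x \<oplus> y) = star A x \<oplus> star A y"
      "\<And>x y. \<lbrakk>x \<in> carrier A; y \<in> carrier A\<rbrakk> \<Longrightarrow> star A (x \<otimes> y) = star A y \<otimes> star A x"
      "\<And>c x. x \<in> carrier A \<Longrightarrow> star A (c \<odot> x) = cnj c \<odot> star A x"
  shows "star_algebra A"
proof -
  have ag: "abelian_group A"
  proof (rule abelian_groupI)
    show "\<exists>y\<in>carrier A. y \<oplus> x = \<zero>" if "x \<in> carrier A" for x
      using that closed(5) add(4) by blast
  qed (use closed add in auto)
  have "monoid A"
    by (rule monoidI) (use closed mult in auto)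
  then have "ring A"
    using ag mult by (intro ringI) auto
  moreover have "Module.module complex_field A"
    using ag closed smult by (intro moduleI cring_complex_field) (auto simp: complex_field_def)
  ultimately show ?thesis
    by (intro star_algebra.intro star_algebra_axioms.intro) (use closed smult star in auto)
qed

context star_algebra
begin

lemma smult_in [simp, intro]: "x \<in> carrier A \<Longrightarrow> c \<odot> x \<in> carrier A"
  using scal.smult_closed[of c x] by (simp add: complex_field_def)

lemma star_in [simp, intro]: "x \<in> carrier A \<Longrightarrow> star A x \<in> carrier A"
  by (rule star_closed)

lemma smult_add_left: "x \<in> carrier A \<Longrightarrow> (c + d) \<odot> x = c \<odot> x \<oplus> d \<odot> x"
  using scal.smult_l_distr[of c d x] by (simp add: complex_field_def)

lemma smult_add_right: "\<lbrakk>x \<in> carrier A; y \<in> carrier A\<rbrakk> \<Longrightarrow> c \<odot> (x \<oplus> y) = c \<odot> x \<oplus> c \<odot> y"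
  using scal.smult_r_distr[of c x y] by (simp add: complex_field_def)

lemma smult_smult: "x \<in> carrier A \<Longrightarrow> c \<odot> (d \<odot> x) = (c * d) \<odot> x"
  using scal.smult_assoc1[of c d x] by (simp add: complex_field_def)

lemma one_smult [simp]: "x \<in> carrier A \<Longrightarrow> 1 \<odot> x = x"
  using scal.smult_one[of x] by (simp add: complex_field_def)

lemma zero_smult [simp]: "x \<in> carrier A \<Longrightarrow> 0 \<odot> x = \<zero>"
  using scal.smult_l_null[of x] by (simp add: complex_field_def)

lemma smult_zero [simp]: "c \<odot> \<zero> = \<zero>"
  using scal.smult_r_null[of c] by (simp add: complex_field_def)

lemma minus_smult: "x \<in> carrier A \<Longrightarrow> (- c) \<odot> x = \<ominus> (c \<odot> x)"
  using smult_add_left[of x "-c" c] minus_equality[of "(-c) \<odot> x" "c \<odot> x"] by simp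

lemma smult_minus: "x \<in> carrier A \<Longrightarrow> c \<odot> (\<ominus> x) = \<ominus> (c \<odot> x)"
  using minus_smult[of x 1] minus_smult[of x c] smult_smult[of x c "-1"] by simp

lemma smult_diff: "\<lbrakk>x \<in> carrier A; y \<in> carrier A\<rbrakk> \<Longrightarrow> c \<odot> (x \<ominus> y) = c \<odot> x \<ominus> c \<odot> y"
  by (simp add: minus_eq smult_add_right smult_minus)

lemma diff_smult: "x \<in> carrier A \<Longrightarrow> (c - d) \<odot> x = c \<odot> x \<ominus> d \<odot> x"
  using smult_add_left[of x c "-d"] by (simp add: minus_eq minus_smult)

lemma star_zero [simp]: "star A \<zero> = \<zero>"
  using star_smult[of \<zero> 0] by simp

lemma star_one [simp]: "star A \<one> = \<one>"
  by (metis one_closed r_one star_closed star_mult star_star)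

lemma star_minus: "x \<in> carrier A \<Longrightarrow> star A (\<ominus> x) = \<ominus> star A x"
  using star_smult[of x "-1"] by (simp add: minus_smult)

lemma star_diff: "\<lbrakk>x \<in> carrier A; y \<in> carrier A\<rbrakk> \<Longrightarrow> star A (x \<ominus> y) = star A x \<ominus> star A y"
  by (simp add: minus_eq star_add star_minus)

lemma ideal_smult:
  assumes "ideal I A" "x \<in> I" shows "c \<odot> x \<in> I"
proof -
  have "x \<in> carrier A" using assms by (simp add: ideal.Icarr)
  then have "c \<odot> x = (c \<odot> \<one>) \<otimes> x" by (simp add: smult_mult_left)
  then show ?thesis using assms by (simp add: ideal.I_l_closed)
qed

end

text \<open>Identities survive surjections. Norms do not occur, so this covers quotients as well as
  the replacement of one norm by another in \<open>star_algebra_nrm_update\<close>.\<close>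

lemma star_algebra_image:
  fixes A :: "'a cstar" (structure) and B :: "'b cstar"
  assumes A: "star_algebra A" and im: "f ` carrier A = carrier B"
    and one: "f \<one> = \<one>\<^bsub>B\<^esub>" and zero: "f \<zero> = \<zero>\<^bsub>B\<^esub>"
    and add: "\<And>x y. \<lbrakk>x \<in> carrier A; y \<in> carrier A\<rbrakk> \<Longrightarrow> f (x \<oplus> y) = f x \<oplus>\<^bsub>B\<^esub> f y"
    and mult: "\<And>x y. \<lbrakk>x \<in> carrier A; y \<in> carrier A\<rbrakk> \<Longrightarrow> f (x \<otimes> y) = f x \<otimes>\<^bsub>B\<^esub> f y"
    and smult: "\<And>c x. x \<in> carrier A \<Longrightarrow> f (c \<odot> x) = c \<odot>\<^bsub>B\<^esub> f x"
    and star: "\<And>x. x \<in> carrier A \<Longrightarrow> f (star A x) = star B (f x)"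
  shows "star_algebra B"
proof -
  interpret star_algebra A by fact
  have B: "carrier B = f ` carrier A" using im by simp
  note eqs = one[symmetric] zero[symmetric] add[symmetric] mult[symmetric] smult[symmetric] star[symmetric]
  note S = smult_add_left smult_add_right smult_smult smult_mult_left smult_mult_right
    star_star star_add star_mult star_smult minus_smult
  show ?thesis
    by (rule star_algebraI)
       (auto simp: B eqs a_assoc m_assoc l_distr r_distr S l_neg intro: arg_cong[of _ _ f, OF a_comm])
qed

context seminormed_star_algebra
begin

lemma nrm_nonneg [simp]: "x \<in> carrier A \<Longrightarrow> 0 \<le> nrm A x"
  and nrm_triangle: "\<lbrakk>x \<in> carrier A; y \<in> carrier A\<rbrakk> \<Longrightarrow> nrm A (x \<oplus> y) \<le> nrm A x + nrm A y"
  and nrm_smult: "x \<in> carrier A \<Longrightarrow> nrm A (c \<odot> x) = cmod c * nrm A x"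
  and nrm_mult: "\<lbrakk>x \<in> carrier A; y \<in> carrier A\<rbrakk> \<Longrightarrow> nrm A (x \<otimes> y) \<le> nrm A x * nrm A y"
  and nrm_cstar: "x \<in> carrier A \<Longrightarrow> nrm A (star A x \<otimes> x) = (nrm A x)\<^sup>2"
  using nrm_seminorm by (auto simp: cstar_seminorm_def)

lemma nrm_zero [simp]: "nrm A \<zero> = 0"
  using nrm_smult[of \<zero> 0] by simp

lemma nrm_minus [simp]: "x \<in> carrier A \<Longrightarrow> nrm A (\<ominus> x) = nrm A x"
  using nrm_smult[of x "-1"] by (simp add: minus_smult)

lemma nrm_diff: "\<lbrakk>x \<in> carrier A; y \<in> carrier A\<rbrakk> \<Longrightarrow> nrm A (x \<ominus> y) \<le> nrm A x + nrm A y"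
  using nrm_triangle[of x "\<ominus> y"] by (simp add: minus_eq)

lemma nrm_diff_commute: "\<lbrakk>x \<in> carrier A; y \<in> carrier A\<rbrakk> \<Longrightarrow> nrm A (x \<ominus> y) = nrm A (y \<ominus> x)"
  using nrm_minus[of "x \<ominus> y"] by (simp add: minus_eq minus_add a_comm)

lemma nrm_diff_triangle:
  assumes "x \<in> carrier A" "y \<in> carrier A" "z \<in> carrier A"
  shows "nrm A (x \<ominus> z) \<le> nrm A (x \<ominus> y) + nrm A (y \<ominus> z)"
proof -
  have "x \<ominus> z = (x \<ominus> y) \<oplus> (y \<ominus> z)" using assms by algebra
  then show ?thesis using nrm_triangle assms by simp
qed

lemma nrm_diff_abs:
  assumes "x \<in> carrier A" "y \<in> carrier A"
  shows "\<bar>nrm A x - nrm A y\<bar> \<le> nrm A (x \<ominus> y)"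
  using nrm_diff_triangle[of x y \<zero>] nrm_diff_triangle[of y x \<zero>] assms nrm_diff_commute[of x y]
  by (simp add: minus_eq abs_le_iff)

text \<open>The C*-identity gives \<open>(nrm A x)\<^sup>2 \<le> nrm A (star A x) * nrm A x\<close>.
  Isometry of the star is thus a consequence and not an axiom.\<close>

lemma nrm_star_le:
  assumes "x \<in> carrier A"
  shows "nrm A x \<le> nrm A (star A x)"
proof (cases "nrm A x = 0")
  case False
  then have "nrm A x > 0" using nrm_nonneg[OF assms] by simp
  moreover have "nrm A x * nrm A x \<le> nrm A (star A x) * nrm A x"
    using nrm_mult[of "star A x" x] nrm_cstar[of x] assms by (simp add: power2_eq_square)
  ultimately show ?thesis by simp
qed (use assms in simp)

lemma nrm_star [simp]: "x \<in> carrier A \<Longrightarrow> nrm A (star A x) = nrm A x"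
  using nrm_star_le[of x] nrm_star_le[of "star A x"] by (simp add: star_star)

lemma nrm_selfadjoint_square:
  "\<lbrakk>x \<in> carrier A; star A x = x\<rbrakk> \<Longrightarrow> nrm A (x \<otimes> x) = (nrm A x)\<^sup>2"
  using nrm_cstar[of x] by simp

text \<open>The C*-identity makes the value an idempotent real. Zero cannot be excluded, as the zero
  seminorm is a C*-seminorm.\<close>

lemma nrm_one_le: "nrm A \<one> \<le> 1"
proof -
  have "nrm A \<one> = (nrm A \<one>)\<^sup>2" using nrm_cstar[of \<one>] by simp
  then have "nrm A \<one> = 0 \<or> nrm A \<one> = 1" by (simp add: power2_eq_square)
  then show ?thesis by auto
qed

lemma nrm_mult_le:
  assumes "x \<in> carrier A" "y \<in> carrier A" "nrm A x \<le> a" "nrm A y \<le> b"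
  shows "nrm A (x \<otimes> y) \<le> a * b"
proof -
  have "nrm A (x \<otimes> y) \<le> nrm A x * nrm A y" using assms nrm_mult by simp
  also have "\<dots> \<le> a * b" using assms nrm_nonneg by (intro mult_mono) (auto intro: order_trans[OF nrm_nonneg])
  finally show ?thesis .
qed

lemma nrm_smult_one_le: "nrm A (c \<odot> \<one>) \<le> cmod c"
  using nrm_one_le by (simp add: nrm_smult mult_left_le)

end


section \<open>Square roots and approximate units in algebras that need not be complete\<close>

context seminormed_star_algebra
begin

lemma nrm_diff_sum_le:
  assumes y: "\<And>n. y n \<in> carrier A" and "\<And>n. nrm A (y (Suc n) \<ominus> y n) \<le> a n" and "n \<le> m"
  shows "nrm A (y m \<ominus> y n) \<le> sum a {n..<m}"
  using \<open>n \<le> m\<close>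
proof (induction m rule: dec_induct)
  case base
  then show ?case using y by (simp add: minus_eq r_neg)
next
  case (step m)
  then show ?case
    using nrm_diff_triangle[of "y (Suc m)" "y m" "y n"] assms(1) assms(2)[of m] by (simp add: sum.atLeastLessThan_Suc)
qed

lemma cauchy_inI_summable:
  assumes y: "\<And>n. y n \<in> carrier A" and a: "\<And>n. nrm A (y (Suc n) \<ominus> y n) \<le> a n" and "summable a"
  shows "cauchy_in A y"
  unfolding cauchy_in_def
proof (intro conjI allI impI)
  fix e :: real assume "e > 0"
  then obtain N where N: "\<And>m n. m \<ge> N \<Longrightarrow> norm (sum a {m..<n}) < e"
    using \<open>summable a\<close> unfolding summable_Cauchy by blast
  have *: "nrm A (y m \<ominus> y n) < e" if "n \<ge> N" "n \<le> m" for m n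
    using nrm_diff_sum_le[of y a n m] N[OF that(1), of m] assms that by (simp add: abs_less_iff)
  show "\<exists>N. \<forall>m\<ge>N. \<forall>n\<ge>N. nrm A (y m \<ominus> y n) < e"
  proof (intro exI[of _ N] allI impI)
    fix m n assume "m \<ge> N" "n \<ge> N"
    then show "nrm A (y m \<ominus> y n) < e"
      using *[of n m] *[of m n] nrm_diff_commute[of "y m" "y n"] y by (cases "n \<le> m") auto
  qed
qed (use y in auto)

text \<open>
  The iteration \<open>y \<mapsto> (c + y\<^sup>2) / 2\<close> is a contraction whose fixed point is \<open>1 - \<surd>(1 - c)\<close>.
\<close>

lemma sqrt_sequence:
  assumes c: "c \<in> carrier A" "star A c = c" "nrm A c < 1"
  obtains s where "cauchy_in A s" "\<And>n. s n \<in> carrier A" "\<And>n. star A (s n) = s n"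
    "\<And>n z. \<lbrakk>z \<in> carrier A; c \<otimes> z = z \<otimes> c\<rbrakk> \<Longrightarrow> s n \<otimes> z = z \<otimes> s n"
    "(\<lambda>n. nrm A ((\<one> \<ominus> c) \<ominus> s n \<otimes> s n)) \<longlonglongrightarrow> 0"
proof -
  define r where "r = nrm A c"
  have r: "0 \<le> r" "r < 1" using c by (auto simp: r_def)
  define y where "y = rec_nat \<zero> (\<lambda>n v. (1/2) \<odot> (c \<oplus> v \<otimes> v))"
  have y0: "y 0 = \<zero>" and yS: "y (Suc n) = (1/2) \<odot> (c \<oplus> y n \<otimes> y n)" for n
    by (auto simp: y_def)
  have yc [simp]: "y n \<in> carrier A" for n
    by (induction n) (use c in \<open>auto simp: y0 yS\<close>)
  have ystar: "star A (y n) = y n" for n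
    by (induction n) (use c in \<open>auto simp: y0 yS star_smult star_add star_mult\<close>)
  have ycomm: "y n \<otimes> z = z \<otimes> y n" if z: "z \<in> carrier A" "c \<otimes> z = z \<otimes> c" for n z
  proof (induction n)
    case (Suc n)
    have "(y n \<otimes> y n) \<otimes> z = z \<otimes> (y n \<otimes> y n)"
      using Suc z by (metis m_assoc yc)
    then show ?case
      using c z by (simp add: yS smult_mult_left smult_mult_right l_distr r_distr)
  qed (use z in \<open>simp add: y0\<close>)
  have ybound: "nrm A (y n) \<le> r" for n
  proof (induction n)
    case (Suc n)
    have "nrm A (y (Suc n)) \<le> 1/2 * (r + nrm A (y n \<otimes> y n))"
      using c nrm_triangle[of c "y n \<otimes> y n"] by (simp add: yS nrm_smult r_def)
    also have "nrm A (y n \<otimes> y n) \<le> r * r" by (rule nrm_mult_le) (use Suc in auto)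
    also have "r * r \<le> r" using r by (simp add: mult_left_le)
    finally show ?case by simp
  qed (use r in \<open>simp add: y0\<close>)
  have step: "nrm A (y (Suc n) \<ominus> y n) \<le> r ^ Suc n" for n
  proof (induction n)
    case 0
    then show ?case using c r by (simp add: yS y0 minus_eq nrm_smult r_def)
  next
    case (Suc n)
    \<comment> \<open>The iterates are polynomials in \<open>c\<close>; two applications of
      \<open>ycomm\<close> replace that description.\<close>
    have cc: "y (Suc n) \<otimes> y n = y n \<otimes> y (Suc n)"
      using c by (intro ycomm) (simp_all add: ycomm[symmetric])
    have "y (Suc (Suc n)) \<ominus> y (Suc n) = (1/2) \<odot> ((c \<oplus> y (Suc n) \<otimes> y (Suc n)) \<ominus> (c \<oplus> y n \<otimes> y n))"
      using c by (simp add: yS smult_diff del: smult_add_right)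
    \<comment> \<open>Difference of squares in a noncommutative ring: the commutator is the
      correction term, and \<open>cc\<close> removes it.\<close>
    also have "(c \<oplus> y (Suc n) \<otimes> y (Suc n)) \<ominus> (c \<oplus> y n \<otimes> y n)
        = ((y (Suc n) \<oplus> y n) \<otimes> (y (Suc n) \<ominus> y n)) \<oplus> (y (Suc n) \<otimes> y n \<ominus> y n \<otimes> y (Suc n))"
    proof -
      have gen: "\<lbrakk>a \<in> carrier A; b \<in> carrier A\<rbrakk> \<Longrightarrow> (c \<oplus> a \<otimes> a) \<ominus> (c \<oplus> b \<otimes> b)
        = ((a \<oplus> b) \<otimes> (a \<ominus> b)) \<oplus> (a \<otimes> b \<ominus> b \<otimes> a)" for a b
        using c(1) by algebra
      show ?thesis by (rule gen) auto
    qed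
    also have "\<dots> = (y (Suc n) \<oplus> y n) \<otimes> (y (Suc n) \<ominus> y n)"
      by (simp add: cc minus_eq r_neg)
    finally have eq: "y (Suc (Suc n)) \<ominus> y (Suc n) = (1/2) \<odot> ((y (Suc n) \<oplus> y n) \<otimes> (y (Suc n) \<ominus> y n))" .
    have "nrm A ((y (Suc n) \<oplus> y n) \<otimes> (y (Suc n) \<ominus> y n)) \<le> (2 * r) * r ^ Suc n"
      by (rule nrm_mult_le)
        (use Suc ybound[of n] ybound[of "Suc n"] nrm_triangle[of "y (Suc n)" "y n"] in auto)
    then show ?case unfolding eq by (simp add: nrm_smult)
  qed
  define s where "s n = \<one> \<ominus> y n" for n
  have sc: "s n \<in> carrier A" for n by (simp add: s_def)
  have sdiff: "s m \<ominus> s n = y n \<ominus> y m" for m n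
  proof -
    have "\<lbrakk>a \<in> carrier A; b \<in> carrier A\<rbrakk> \<Longrightarrow> (\<one> \<ominus> a) \<ominus> (\<one> \<ominus> b) = b \<ominus> a" for a b by algebra
    then show ?thesis by (simp add: s_def)
  qed
  have "cauchy_in A s"
  proof (rule cauchy_inI_summable)
    show "nrm A (s (Suc n) \<ominus> s n) \<le> r ^ Suc n" for n
      using step[of n] by (simp add: sdiff nrm_diff_commute)
    show "summable (\<lambda>n. r ^ Suc n)"
      using r summable_geometric[of r] by (simp only: summable_Suc_iff) simp
  qed (rule sc)
  moreover have "star A (s n) = s n" for n by (simp add: s_def star_diff ystar)
  moreover have "s n \<otimes> z = z \<otimes> s n" if "z \<in> carrier A" "c \<otimes> z = z \<otimes> c" for n z
    using that ycomm[OF that, of n] by (simp add: s_def minus_eq l_distr r_distr l_minus r_minus)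
  moreover have "(\<lambda>n. nrm A ((\<one> \<ominus> c) \<ominus> s n \<otimes> s n)) \<longlonglongrightarrow> 0"
  proof (rule tendsto_sandwich[OF _ _ tendsto_const])
    have "nrm A ((\<one> \<ominus> c) \<ominus> s n \<otimes> s n) \<le> 2 * r ^ Suc n" for n
    proof -
      \<comment> \<open>By the recursion the error of \<open>s n\<close> as a square root is exactly
        twice an increment of \<open>y\<close>, which decays geometrically.\<close>
      have "c \<oplus> y n \<otimes> y n = 2 \<odot> y (Suc n)"
        using c by (simp add: yS smult_smult)
      moreover have "a \<in> carrier A \<Longrightarrow> (\<one> \<ominus> c) \<ominus> (\<one> \<ominus> a) \<otimes> (\<one> \<ominus> a) = (a \<oplus> a) \<ominus> (c \<oplus> a \<otimes> a)" for a
        using c(1) by (algebra, simp)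
      moreover have "y n \<oplus> y n = 2 \<odot> y n"
        using smult_add_left[of "y n" 1 1] by simp
      ultimately have "(\<one> \<ominus> c) \<ominus> s n \<otimes> s n = 2 \<odot> (y n \<ominus> y (Suc n))"
        by (simp add: s_def smult_diff)
      then show ?thesis using step[of n] nrm_diff_commute[of "y n" "y (Suc n)"] by (simp add: nrm_smult)
    qed
    then show "\<forall>\<^sub>F n in sequentially. nrm A ((\<one> \<ominus> c) \<ominus> s n \<otimes> s n) \<le> 2 * r ^ Suc n" by simp
    show "(\<lambda>n. 2 * r ^ Suc n) \<longlonglongrightarrow> 0"
      using r LIMSEQ_Suc[OF LIMSEQ_realpow_zero[of r]] tendsto_mult_right_zero by blast
  qed (use c sc in auto)
  ultimately show ?thesis using that sc by blast
qed

text \<open>Replaces the order argument \<open>x\<^sup>2 \<le> x\<^sup>2 + y\<^sup>2\<close>. For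
  \<open>u = x + \<i> y\<close> commutation makes the product of \<open>star u\<close> and
  \<open>u\<close> equal to \<open>x\<^sup>2 + y\<^sup>2\<close>, and \<open>x\<close> is the real
  part of \<open>u\<close>, so its norm is at most that of \<open>u\<close>.\<close>

lemma nrm_square_le_sum_squares:
  assumes x: "x \<in> carrier A" "star A x = x" and y: "y \<in> carrier A" "star A y = y"
    and comm: "x \<otimes> y = y \<otimes> x"
  shows "(nrm A x)\<^sup>2 \<le> nrm A (x \<otimes> x \<oplus> y \<otimes> y)"
proof -
  define z where "z = \<i> \<odot> y"
  define u where "u = x \<oplus> z"
  have zc: "z \<in> carrier A" and uc: "u \<in> carrier A" using x y by (auto simp: u_def z_def)
  have su: "star A u = x \<oplus> \<ominus> z"
    using x y by (simp add: u_def z_def star_add star_smult minus_smult)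
  have "star A u \<otimes> u = x \<otimes> x \<oplus> (x \<otimes> z \<ominus> z \<otimes> x) \<ominus> z \<otimes> z"
    unfolding su unfolding u_def using x(1) zc by algebra
  also have "x \<otimes> z = z \<otimes> x"
    using x y comm by (simp add: z_def smult_mult_left smult_mult_right)
  also have "z \<otimes> z = \<ominus> (y \<otimes> y)"
    using y by (simp add: z_def smult_mult_left smult_mult_right smult_smult minus_smult)
  also have "x \<otimes> x \<oplus> (z \<otimes> x \<ominus> z \<otimes> x) \<ominus> \<ominus> (y \<otimes> y) = x \<otimes> x \<oplus> y \<otimes> y"
    using x(1) y(1) zc by algebra
  finally have su_u: "(nrm A u)\<^sup>2 = nrm A (x \<otimes> x \<oplus> y \<otimes> y)"
    using nrm_cstar[OF uc] by simp
  have "u \<oplus> star A u = x \<oplus> x" unfolding su unfolding u_def using x(1) zc by algebra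
  also have "\<dots> = 2 \<odot> x" using smult_add_left[of x 1 1] x by simp
  finally have "2 * nrm A x \<le> nrm A u + nrm A (star A u)"
    using nrm_triangle[of u "star A u"] uc x by (simp add: nrm_smult)
  then have "nrm A x \<le> nrm A u" using uc by simp
  then show ?thesis unfolding su_u[symmetric] using x by (simp add: power_mono)
qed

text \<open>If \<open>s\<close> approximates a square root of \<open>1 - b\<^sup>2\<close>, then
  \<open>s\<^sup>2 + b\<^sup>2\<close> is close to one, so \<open>nrm_square_le_sum_squares\<close>
  bounds \<open>s\<^sup>2\<close>, which is close to \<open>1 - b\<^sup>2\<close>. The triangle
  inequality alone would only give 2.\<close>

lemma nrm_one_minus_square_le:
  assumes b: "b \<in> carrier A" "star A b = b" "nrm A b < 1"
  shows "nrm A (\<one> \<ominus> b \<otimes> b) \<le> 1"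
proof (rule field_le_epsilon)
  fix e :: real assume e: "e > 0"
  define c where "c = b \<otimes> b"
  have c: "c \<in> carrier A" "star A c = c" "nrm A c < 1"
    using b nrm_selfadjoint_square[of b] nrm_nonneg[of b] abs_square_less_1[of "nrm A b"] by (simp_all add: c_def star_mult)
  obtain s where s0: "cauchy_in A s" and s: "\<And>n. s n \<in> carrier A" "\<And>n. star A (s n) = s n"
    "\<And>n z. \<lbrakk>z \<in> carrier A; c \<otimes> z = z \<otimes> c\<rbrakk> \<Longrightarrow> s n \<otimes> z = z \<otimes> s n"
    "(\<lambda>n. nrm A ((\<one> \<ominus> c) \<ominus> s n \<otimes> s n)) \<longlonglongrightarrow> 0"
    by (rule sqrt_sequence[OF c]) (rule that)
  have "\<forall>\<^sub>F n in sequentially. nrm A ((\<one> \<ominus> c) \<ominus> s n \<otimes> s n) < e/2"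
    by (rule order_tendstoD(2)[OF s(4)]) (use e in simp)
  then have "\<exists>n. nrm A ((\<one> \<ominus> c) \<ominus> s n \<otimes> s n) < e/2"
    by (rule eventually_happens'[OF sequentially_bot])
  then obtain n where n: "nrm A ((\<one> \<ominus> c) \<ominus> s n \<otimes> s n) < e/2" ..
  define d where "d = (\<one> \<ominus> c) \<ominus> s n \<otimes> s n"
  have nd: "nrm A d < e/2" using n by (simp only: d_def)
  have dc: "d \<in> carrier A" using c s(1) by (simp add: d_def)
  have "s n \<otimes> b = b \<otimes> s n"
    using b by (intro s(3)) (auto simp: c_def m_assoc)
  then have "(nrm A (s n))\<^sup>2 \<le> nrm A (s n \<otimes> s n \<oplus> b \<otimes> b)"
    using s(1,2) b by (intro nrm_square_le_sum_squares) auto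
  also have "s n \<otimes> s n \<oplus> b \<otimes> b = \<one> \<ominus> d"
  proof -
    have "\<lbrakk>p \<in> carrier A; q \<in> carrier A\<rbrakk> \<Longrightarrow> p \<oplus> q = \<one> \<ominus> ((\<one> \<ominus> q) \<ominus> p)" for p q by algebra
    then show ?thesis unfolding d_def c_def using s(1)[of n] b(1) m_closed by presburger
  qed
  also have "nrm A (\<one> \<ominus> d) \<le> 1 + e/2"
    using nrm_diff[of \<one> d] nrm_one_le nd dc by simp
  finally have "nrm A (s n \<otimes> s n) \<le> 1 + e/2" using nrm_selfadjoint_square s(1,2) by simp
  moreover have "\<one> \<ominus> c = d \<oplus> s n \<otimes> s n"
  proof -
    have "\<lbrakk>p \<in> carrier A; q \<in> carrier A\<rbrakk> \<Longrightarrow> \<one> \<ominus> q = ((\<one> \<ominus> q) \<ominus> p) \<oplus> p" for p q by algebra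
    then show ?thesis unfolding d_def using s(1)[of n] c(1) m_closed by presburger
  qed
  ultimately show "nrm A (\<one> \<ominus> b \<otimes> b) \<le> 1 + e"
    using nrm_triangle[of d "s n \<otimes> s n"] dc s(1) nd by (simp add: c_def[symmetric])
qed

lemma averaging:
  assumes c: "c \<in> carrier A" "star A c = c" "nrm A (\<one> \<ominus> c) \<le> 1"
  obtains M where "M \<in> carrier A" "star A M = M" "nrm A M \<le> real N" "nrm A (c \<otimes> M) \<le> 2"
    "\<And>z. \<lbrakk>z \<in> carrier A; c \<otimes> z = z \<otimes> c\<rbrakk> \<Longrightarrow> M \<otimes> z = z \<otimes> M"
    "\<And>I. \<lbrakk>ideal I A; c \<in> I\<rbrakk> \<Longrightarrow> (of_nat N \<odot> \<one>) \<ominus> M \<in> I"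
proof -
  \<comment> \<open>\<open>P\<close> stands for \<open>(1 - c)^N\<close>, the remainder of the
    geometric sum.\<close>
  have "\<exists>M P. M \<in> carrier A \<and> star A M = M \<and> nrm A M \<le> real N \<and> P \<in> carrier A \<and> nrm A P \<le> 1 \<and>
      c \<otimes> M = \<one> \<ominus> P \<and> (\<forall>z. z \<in> carrier A \<longrightarrow> c \<otimes> z = z \<otimes> c \<longrightarrow> M \<otimes> z = z \<otimes> M) \<and>
      (\<forall>I. ideal I A \<longrightarrow> c \<in> I \<longrightarrow> (of_nat N \<odot> \<one>) \<ominus> M \<in> I)"
  proof (induction N)
    case 0
    show ?case
      by (rule exI[of _ \<zero>], rule exI[of _ \<one>])
        (use c nrm_one_le in \<open>auto simp: minus_eq r_neg additive_subgroup.zero_closed ideal_def\<close>)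
  next
    case (Suc N)
    then obtain M P where M: "M \<in> carrier A" "star A M = M" "nrm A M \<le> real N"
      and P: "P \<in> carrier A" "nrm A P \<le> 1" "c \<otimes> M = \<one> \<ominus> P"
      and comm: "\<And>z. z \<in> carrier A \<Longrightarrow> c \<otimes> z = z \<otimes> c \<Longrightarrow> M \<otimes> z = z \<otimes> M"
      and I: "\<And>I. ideal I A \<Longrightarrow> c \<in> I \<Longrightarrow> (of_nat N \<odot> \<one>) \<ominus> M \<in> I"
      by blast
    have Mc: "M \<otimes> c = c \<otimes> M" using comm c by auto
    define M' where "M' = \<one> \<oplus> (\<one> \<ominus> c) \<otimes> M"
    have M': "M' \<in> carrier A" using M c by (simp add: M'_def)
    have "star A M' = M'"
      using M c Mc by (simp add: M'_def star_add star_mult star_minus minus_eq l_distr r_distr l_minus r_minus)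
    moreover have "nrm A M' \<le> real (Suc N)"
      using nrm_triangle[of \<one> "(\<one> \<ominus> c) \<otimes> M"] nrm_mult_le[of "\<one> \<ominus> c" M 1 "real N"] c M nrm_one_le
      by (simp add: M'_def)
    moreover have "nrm A ((\<one> \<ominus> c) \<otimes> P) \<le> 1"
      using nrm_mult_le[of "\<one> \<ominus> c" P 1 1] c P by simp
    moreover have "c \<otimes> M' = \<one> \<ominus> (\<one> \<ominus> c) \<otimes> P"
    proof -
      have "c \<otimes> M' = c \<oplus> (\<one> \<ominus> c) \<otimes> (c \<otimes> M)"
        unfolding M'_def using c(1) M(1) by (algebra, simp)
      also have "\<dots> = \<one> \<ominus> (\<one> \<ominus> c) \<otimes> P"
        unfolding P(3) using c(1) P(1) by (algebra, simp add: r_neg2)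
      finally show ?thesis .
    qed
    moreover have "M' \<otimes> z = z \<otimes> M'" if z: "z \<in> carrier A" "c \<otimes> z = z \<otimes> c" for z
    proof -
      have "M' \<otimes> z = z \<oplus> (M \<otimes> z) \<ominus> c \<otimes> (M \<otimes> z)"
        unfolding M'_def using c(1) z(1) M(1) by algebra
      also have "\<dots> = z \<oplus> z \<otimes> M \<ominus> (c \<otimes> z) \<otimes> M"
        by (simp only: comm[OF z] m_assoc[OF c(1) z(1) M(1)])
      also have "\<dots> = z \<otimes> M'"
        unfolding z(2) M'_def using c(1) z(1) M(1) by (algebra, simp)
      finally show ?thesis .
    qed
    moreover have "(of_nat (Suc N) \<odot> \<one>) \<ominus> M' \<in> I" if "ideal I A" "c \<in> I" for I
    proof -
      interpret I: ideal I A by fact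
      define t where "t = (of_nat N :: complex) \<odot> \<one>"
      have "(of_nat (Suc N) \<odot> \<one>) \<ominus> M' = (\<one> \<oplus> t) \<ominus> M'"
        by (simp add: t_def smult_add_left)
      also have "\<dots> = (t \<ominus> M) \<oplus> c \<otimes> M"
        unfolding M'_def using c(1) M(1) by (subgoal_tac "t \<in> carrier A", algebra, simp add: t_def)
      finally show ?thesis using I[OF that] I.I_r_closed[OF that(2) M(1)] by (simp add: t_def)
    qed
    ultimately show ?case using M' c P by (intro exI[of _ M'] exI[of _ "(\<one> \<ominus> c) \<otimes> P"]) auto
  qed
  then obtain M P where *: "M \<in> carrier A" "star A M = M" "nrm A M \<le> real N" "P \<in> carrier A" "nrm A P \<le> 1"
      "c \<otimes> M = \<one> \<ominus> P" "\<And>z. z \<in> carrier A \<Longrightarrow> c \<otimes> z = z \<otimes> c \<Longrightarrow> M \<otimes> z = z \<otimes> M"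
      "\<And>I. ideal I A \<Longrightarrow> c \<in> I \<Longrightarrow> (of_nat N \<odot> \<one>) \<ominus> M \<in> I"
    by blast
  have "nrm A (c \<otimes> M) \<le> 2" using *(4-6) nrm_diff[of \<one> P] nrm_one_le by simp
  with * show ?thesis using that by blast
qed

text \<open>
  This is the \<open>C\<^sup>*\<close>-identity of the quotient norm. One takes \<open>x + j = x (1 - e)\<close> for a member \<open>e\<close> of
  an approximate unit of the ideal, built from the self-adjoint part of \<open>i\<close>.
\<close>

lemma quotient_nrm_square_le:
  assumes I: "ideal I A" "\<And>i. i \<in> I \<Longrightarrow> star A i \<in> I"
    and x: "x \<in> carrier A" and i: "i \<in> I" and e: "e > 0"
  obtains j where "j \<in> I" "(nrm A (x \<oplus> j))\<^sup>2 \<le> nrm A (star A x \<otimes> x \<oplus> i) + e"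
proof -
  interpret I: ideal I A by fact
  define z where "z = star A x \<otimes> x"
  have z: "z \<in> carrier A" "star A z = z" using x by (auto simp: z_def star_mult star_star)
  have ic: "i \<in> carrier A" using i by simp
  define h where "h = (1/2) \<odot> (i \<oplus> star A i)"
  have hI: "h \<in> I" using i I by (simp add: h_def ideal_smult I.a_closed)
  then have hc: "h \<in> carrier A" by simp
  have hs: "star A h = h" using ic by (simp add: h_def star_smult star_add star_star a_comm)
  \<comment> \<open>\<open>z\<close> is self-adjoint, so \<open>z + h\<close> is the real part of
    \<open>z + i\<close>, and passing from \<open>i\<close> to \<open>h\<close> does not raise the
    norm.\<close>
  have "z \<oplus> h = (1/2) \<odot> ((z \<oplus> i) \<oplus> star A (z \<oplus> i))"
  proof -
    have "(z \<oplus> i) \<oplus> star A (z \<oplus> i) = (z \<oplus> z) \<oplus> (i \<oplus> star A i)"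
      using z ic by (simp add: star_add a_ac)
    also have "z \<oplus> z = 2 \<odot> z" using smult_add_left[of z 1 1] z by simp
    finally show ?thesis using z ic by (simp add: h_def smult_add_right smult_smult)
  qed
  then have zh: "nrm A (z \<oplus> h) \<le> nrm A (z \<oplus> i)"
    using nrm_triangle[of "z \<oplus> i" "star A (z \<oplus> i)"] z ic by (simp add: nrm_smult)
  \<comment> \<open>The summand 1 makes \<open>b\<close> a strict contraction, as
    \<open>nrm_one_minus_square_le\<close> requires, and keeps \<open>t\<close> positive when
    \<open>h\<close> has norm zero.\<close>
  define t where "t = nrm A h + 1"
  have t: "t > 0" using hc nrm_nonneg[of h] by (simp add: t_def add_nonneg_pos)
  define b where "b = complex_of_real (1/t) \<odot> h"
  have b: "b \<in> carrier A" "star A b = b"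
    using hc hs by (auto simp: b_def star_smult)
  have "nrm A b = nrm A h / t"
    using hc t by (simp add: b_def nrm_smult norm_divide)
  then have b1: "nrm A b < 1" using t by (simp add: t_def)
  define c where "c = b \<otimes> b"
  have c: "c \<in> carrier A" "star A c = c" "nrm A (\<one> \<ominus> c) \<le> 1"
    using b b1 nrm_one_minus_square_le by (auto simp: c_def star_mult)
  have cI: "c \<in> I" using hI b by (simp add: c_def b_def ideal_smult[OF I(1)] I.I_l_closed)
  \<comment> \<open>Chosen such that \<open>2 / N\<close> is below \<open>(e / t)^2\<close>. This
    bounds \<open>b m\<close> by \<open>e / t\<close> and hence \<open>h m\<close> by
    \<open>e\<close>.\<close>
  obtain N :: nat where N: "N > 0" "2 * t\<^sup>2 / e\<^sup>2 < real N"
    using reals_Archimedean2[of "2 * t\<^sup>2 / e\<^sup>2"] e t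
    by (metis divide_nonneg_nonneg gr0I mult_nonneg_nonneg not_less of_nat_0 zero_le_numeral zero_le_power2)
  obtain M where M: "M \<in> carrier A" "star A M = M" "nrm A M \<le> real N" "nrm A (c \<otimes> M) \<le> 2"
    and MI: "(of_nat N \<odot> \<one>) \<ominus> M \<in> I"
    using averaging[OF c, of N] cI I(1) by metis
  define m where "m = complex_of_real (1/real N) \<odot> M"
  have m: "m \<in> carrier A" "star A m = m" "nrm A m \<le> 1" "nrm A (c \<otimes> m) \<le> 2 / real N"
    using M N c by (auto simp: m_def star_smult nrm_smult smult_mult_right norm_divide field_simps)
  have "\<one> \<ominus> m = complex_of_real (1/real N) \<odot> ((of_nat N \<odot> \<one>) \<ominus> M)"
    using M N by (simp add: m_def smult_diff smult_smult)
  then have mI: "\<one> \<ominus> m \<in> I" using MI ideal_smult[OF I(1)] by metis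
  have "(nrm A (b \<otimes> m))\<^sup>2 = nrm A (m \<otimes> (c \<otimes> m))"
    using nrm_cstar[of "b \<otimes> m"] m b by (simp add: star_mult c_def m_assoc)
  also have "\<dots> \<le> 1 * (2 / real N)" using m c by (intro nrm_mult_le) auto
  also have "\<dots> \<le> (e / t)\<^sup>2"
  proof -
    have le: "2 * t\<^sup>2 \<le> real N * e\<^sup>2"
      using N(2) e pos_divide_less_eq[of "e\<^sup>2" "2 * t\<^sup>2" "real N"] by simp
    have "1 * (2 / real N) = (2 * t\<^sup>2) / (real N * t\<^sup>2)" using t by simp
    also have "\<dots> \<le> (real N * e\<^sup>2) / (real N * t\<^sup>2)"
      using le by (rule divide_right_mono) simp
    also have "\<dots> = (e / t)\<^sup>2" using N(1) by (simp add: power_divide)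
    finally show ?thesis .
  qed
  finally have bm: "nrm A (b \<otimes> m) \<le> e / t"
    by (rule power2_le_imp_le) (use e t in simp)
  have "h = complex_of_real t \<odot> b" using t hc by (simp add: b_def smult_smult)
  then have hm: "nrm A (h \<otimes> m) \<le> e"
    using bm b m t by (simp add: smult_mult_left nrm_smult field_simps)
  define j where "j = \<ominus> (x \<otimes> (\<one> \<ominus> m))"
  have "j \<in> I" using I.I_l_closed[OF mI x] by (simp add: j_def)
  moreover have "x \<oplus> j = x \<otimes> m" unfolding j_def using x m(1) by (algebra, simp add: r_neg2)
  moreover have "(nrm A (x \<otimes> m))\<^sup>2 \<le> nrm A (z \<oplus> i) + e"
  proof -
    have "(nrm A (x \<otimes> m))\<^sup>2 = nrm A (m \<otimes> (z \<otimes> m))"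
      using nrm_cstar[of "x \<otimes> m"] m x by (simp add: star_mult z_def m_assoc)
    \<comment> \<open>Multiplying by the contraction \<open>m\<close> on both sides does not raise
      the norm of \<open>z + h\<close> and makes the unwanted \<open>h\<close> small.\<close>
    also have "m \<otimes> (z \<otimes> m) = m \<otimes> ((z \<oplus> h) \<otimes> m) \<ominus> m \<otimes> (h \<otimes> m)"
      using m(1) z(1) hc by algebra
    also have "nrm A \<dots> \<le> nrm A (m \<otimes> ((z \<oplus> h) \<otimes> m)) + nrm A (m \<otimes> (h \<otimes> m))"
      using m z hc by (intro nrm_diff) auto
    also have "nrm A (m \<otimes> ((z \<oplus> h) \<otimes> m)) \<le> 1 * (nrm A (z \<oplus> h) * 1)"
      using m z hc by (intro nrm_mult_le) auto
    also have "nrm A (m \<otimes> (h \<otimes> m)) \<le> 1 * e"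
      using m hm hc by (intro nrm_mult_le) auto
    finally show ?thesis using zh by simp
  qed
  ultimately show ?thesis using that unfolding z_def by metis
qed

end


section \<open>Quotients and completions\<close>

locale star_ideal = star_algebra A + ideal I A for A :: "'a cstar" (structure) and I +
  assumes star_mem: "i \<in> I \<Longrightarrow> star A i \<in> I"
begin

lemma coset_eq_iff: "\<lbrakk>x \<in> carrier A; y \<in> carrier A\<rbrakk> \<Longrightarrow> I +> x = I +> y \<longleftrightarrow> x \<ominus> y \<in> I"
  using quotient_eq_iff_same_a_r_cos[OF is_ideal] by simp

lemma coset_mem_iff: "x \<in> carrier A \<Longrightarrow> y \<in> I +> x \<longleftrightarrow> y \<in> carrier A \<and> y \<ominus> x \<in> I"
  using a_rcos_module_minus[OF ring_axioms, of x y] a_elemrcos_carrier[of x y] by blast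

lemma coset_self: "x \<in> carrier A \<Longrightarrow> x \<in> I +> x"
  by (rule a_rcos_self)

lemma coset_eq: "\<lbrakk>x \<in> carrier A; y \<in> I +> x\<rbrakk> \<Longrightarrow> I +> y = I +> x"
  using coset_mem_iff coset_eq_iff by blast

lemma quotient_simps:
  "carrier (cstar_quotient A I) = (+>) I ` carrier A"
  "\<one>\<^bsub>cstar_quotient A I\<^esub> = I +> \<one>"
  "\<zero>\<^bsub>cstar_quotient A I\<^esub> = I +> \<zero>"
  "nrm (cstar_quotient A I) S = (INF x\<in>S. nrm A x)"
  by (auto simp: cstar_quotient_def FactRing_def A_RCOSETS_def' a_subset)

lemma quotient_mult: "\<lbrakk>x \<in> carrier A; y \<in> carrier A\<rbrakk> \<Longrightarrow>
    (I +> x) \<otimes>\<^bsub>cstar_quotient A I\<^esub> (I +> y) = I +> (x \<otimes> y)"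
  by (simp add: cstar_quotient_def FactRing_def rcoset_mult_add)

lemma quotient_add: "\<lbrakk>x \<in> carrier A; y \<in> carrier A\<rbrakk> \<Longrightarrow>
    (I +> x) \<oplus>\<^bsub>cstar_quotient A I\<^esub> (I +> y) = I +> (x \<oplus> y)"
  by (simp add: cstar_quotient_def FactRing_def a_rcos_sum)

text \<open>The operation is a union over all representatives of a coset. All members of that union
  coincide because ideals of a unital algebra are stable under scalars.\<close>

lemma quotient_smult:
  assumes x: "x \<in> carrier A"
  shows "c \<odot>\<^bsub>cstar_quotient A I\<^esub> (I +> x) = I +> (c \<odot> x)"
proof -
  have "I +> (c \<odot> y) = I +> (c \<odot> x)" if "y \<in> I +> x" for y
    using that x ideal_smult[OF is_ideal, of "y \<ominus> x" c]
    by (simp add: coset_mem_iff coset_eq_iff smult_diff)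
  then have "(\<Union>y\<in>I +> x. I +> (c \<odot> y)) = (\<Union>y\<in>I +> x. I +> (c \<odot> x))"
    by (intro SUP_cong) auto
  also have "\<dots> = I +> (c \<odot> x)" using coset_self[OF x] by auto
  finally show ?thesis by (simp add: cstar_quotient_def)
qed

lemma quotient_star:
  assumes x: "x \<in> carrier A"
  shows "star (cstar_quotient A I) (I +> x) = I +> star A x"
proof -
  have "I +> star A y = I +> star A x" if "y \<in> I +> x" for y
    using that x star_mem[of "y \<ominus> x"] by (simp add: coset_mem_iff coset_eq_iff star_diff)
  then have "(\<Union>y\<in>I +> x. I +> star A y) = (\<Union>y\<in>I +> x. I +> star A x)"
    by (intro SUP_cong) auto
  also have "\<dots> = I +> star A x" using coset_self[OF x] by auto
  finally show ?thesis by (simp add: cstar_quotient_def)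
qed

lemma quotient_star_algebra: "star_algebra (cstar_quotient A I)"
  by (rule star_algebra_image[OF star_algebra_axioms, of "(+>) I"])
    (simp_all add: quotient_simps quotient_mult quotient_add quotient_smult quotient_star)

lemma quotient_hom: "(+>) I \<in> star_hom A (cstar_quotient A I)"
  by (auto simp: star_hom_def quotient_simps quotient_mult quotient_add quotient_smult quotient_star
      intro!: ring_hom_memI)

end

locale seminormed_star_ideal = seminormed_star_algebra A + star_ideal A I for A :: "'a cstar" (structure) and I
begin

abbreviation "Q \<equiv> cstar_quotient A I"

lemma quotient_nrm_le: "\<lbrakk>x \<in> carrier A; y \<in> I +> x\<rbrakk> \<Longrightarrow> nrm Q (I +> x) \<le> nrm A y"
  unfolding quotient_simps
  by (rule cINF_lower) (auto intro!: bdd_belowI[of _ 0] simp: coset_mem_iff)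

lemma quotient_nrm_le_self: "x \<in> carrier A \<Longrightarrow> nrm Q (I +> x) \<le> nrm A x"
  by (rule quotient_nrm_le) (auto simp: coset_self)

lemma quotient_nrm_less:
  assumes "x \<in> carrier A" "nrm Q (I +> x) < a"
  obtains y where "y \<in> carrier A" "I +> x = I +> y" "nrm A y < a"
proof -
  have "bdd_below (nrm A ` (I +> x))"
    using assms by (auto intro!: bdd_belowI[of _ 0] simp: coset_mem_iff)
  then have "\<exists>y\<in>I +> x. nrm A y < a"
    using assms coset_self by (subst (asm) quotient_simps, subst (asm) cINF_less_iff) auto
  then show ?thesis using that assms coset_eq coset_mem_iff by metis
qed

lemma quotient_nrm_eps:
  assumes "x \<in> carrier A" "e > 0"
  shows "\<exists>y. y \<in> carrier A \<and> I +> x = I +> y \<and> nrm A y < nrm Q (I +> x) + e"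
  using quotient_nrm_less[OF assms(1), of "nrm Q (I +> x) + e"] assms(2) by (metis less_add_same_cancel1)

lemma quotient_nrm_nonneg: "x \<in> carrier A \<Longrightarrow> 0 \<le> nrm Q (I +> x)"
  by (metis leI nrm_nonneg not_less_iff_gr_or_eq order_less_le_trans quotient_nrm_less)

lemma quotient_seminorm: "cstar_seminorm Q (nrm Q)"
proof -
  interpret q: star_algebra Q by (rule quotient_star_algebra)
  have tri: "nrm Q (I +> (x \<oplus> y)) \<le> nrm Q (I +> x) + nrm Q (I +> y)"
    if xy: "x \<in> carrier A" "y \<in> carrier A" for x y
  proof (rule field_le_epsilon)
    fix e :: real assume "e > 0"
    obtain x' where x': "x' \<in> carrier A" "I +> x = I +> x'" "nrm A x' < nrm Q (I +> x) + e/2"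
      using quotient_nrm_eps[of x "e/2"] \<open>e > 0\<close> xy by (metis half_gt_zero)
    obtain y' where y': "y' \<in> carrier A" "I +> y = I +> y'" "nrm A y' < nrm Q (I +> y) + e/2"
      using quotient_nrm_eps[of y "e/2"] \<open>e > 0\<close> xy by (metis half_gt_zero)
    have "I +> (x \<oplus> y) = I +> (x' \<oplus> y')"
      using x' y' xy by (metis quotient_add)
    then have "nrm Q (I +> (x \<oplus> y)) \<le> nrm A (x' \<oplus> y')"
      using x' y' by (simp add: quotient_nrm_le_self)
    then show "nrm Q (I +> (x \<oplus> y)) \<le> nrm Q (I +> x) + nrm Q (I +> y) + e"
      using nrm_triangle[of x' y'] x' y' by simp
  qed
  have sm: "nrm Q (I +> (c \<odot> x)) \<le> cmod c * nrm Q (I +> x)" if xc: "x \<in> carrier A" for c x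
  proof (cases "c = 0")
    case True
    then show ?thesis using xc quotient_nrm_le_self[of \<zero>] by simp
  next
    case False
    show ?thesis
    proof (rule field_le_epsilon)
      fix e :: real assume "e > 0"
      then obtain x' where x': "x' \<in> carrier A" "I +> x = I +> x'" "nrm A x' < nrm Q (I +> x) + e/cmod c"
        using quotient_nrm_eps[of x "e/cmod c"] False xc by (metis divide_pos_pos zero_less_norm_iff)
      have "I +> (c \<odot> x) = I +> (c \<odot> x')"
        using x' xc by (metis quotient_smult)
      then have "nrm Q (I +> (c \<odot> x)) \<le> cmod c * nrm A x'"
        using x' quotient_nrm_le_self[of "c \<odot> x'"] by (simp add: nrm_smult)
      also have "\<dots> \<le> cmod c * (nrm Q (I +> x) + e/cmod c)"
        using x' by (intro mult_left_mono) auto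
      finally show "nrm Q (I +> (c \<odot> x)) \<le> cmod c * nrm Q (I +> x) + e"
        using False by (simp add: distrib_left)
    qed
  qed
  have smult: "nrm Q (I +> (c \<odot> x)) = cmod c * nrm Q (I +> x)" if x: "x \<in> carrier A" for c x
  proof (cases "c = 0")
    case True
    then show ?thesis using x sm[of x c] quotient_nrm_nonneg[of \<zero>] by simp
  next
    case False
    \<comment> \<open>The reverse inequality is \<open>sm\<close> for the inverse scalar.\<close>
    have "cmod c * nrm Q (I +> x) = cmod c * nrm Q (I +> (inverse c \<odot> (c \<odot> x)))"
      using False x by (simp add: smult_smult)
    also have "\<dots> \<le> cmod c * (cmod (inverse c) * nrm Q (I +> (c \<odot> x)))"
      using x by (intro mult_left_mono sm) auto
    also have "\<dots> = nrm Q (I +> (c \<odot> x))"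
      using False by (simp add: norm_inverse)
    finally show ?thesis using sm[OF x, of c] by simp
  qed
  have mult: "nrm Q (I +> (x \<otimes> y)) \<le> nrm Q (I +> x) * nrm Q (I +> y)"
    if xy: "x \<in> carrier A" "y \<in> carrier A" for x y
  proof -
    define a b where "a = nrm Q (I +> x)" "b = nrm Q (I +> y)"
    have ab: "a \<ge> 0" "b \<ge> 0" using xy by (auto simp: a_b_def quotient_nrm_nonneg)
    have "nrm Q (I +> (x \<otimes> y)) \<le> (a + e) * (b + e)" if "e > 0" for e
    proof -
      obtain x' where x': "x' \<in> carrier A" "I +> x = I +> x'" "nrm A x' < a + e"
        using quotient_nrm_eps[of x "e"] \<open>e > 0\<close> xy unfolding a_b_def by blast
      obtain y' where y': "y' \<in> carrier A" "I +> y = I +> y'" "nrm A y' < b + e"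
        using quotient_nrm_eps[of y "e"] \<open>e > 0\<close> xy unfolding a_b_def by blast
      have "I +> (x \<otimes> y) = I +> (x' \<otimes> y')"
        using x' y' xy by (metis quotient_mult)
      then have "nrm Q (I +> (x \<otimes> y)) \<le> nrm A (x' \<otimes> y')"
        using x' y' by (simp add: quotient_nrm_le_self)
      also have "\<dots> \<le> (a + e) * (b + e)" using x' y' by (intro nrm_mult_le) auto
      finally show ?thesis .
    qed
    \<comment> \<open>The error is not of the form \<open>+ e\<close>, so \<open>e\<close> is sent
      to zero instead.\<close>
    moreover have "((\<lambda>e. (a + e) * (b + e)) \<longlongrightarrow> (a + 0) * (b + 0)) (at_right 0)"
      by (intro tendsto_intros)
    ultimately show ?thesis
      unfolding a_b_def[symmetric]
      by (intro tendsto_lowerbound[of _ _ "at_right 0"]) (auto simp: eventually_at_right_less eventually_at_filter)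
  qed
  have star: "nrm Q (I +> star A x) \<le> nrm Q (I +> x)" if x: "x \<in> carrier A" for x
  proof (rule field_le_epsilon)
    fix e :: real assume "e > 0"
    then obtain x' where x': "x' \<in> carrier A" "I +> x = I +> x'" "nrm A x' < nrm Q (I +> x) + e"
      using quotient_nrm_eps[of x "e"] x by blast
    have "I +> star A x = I +> star A x'" using x' x by (metis quotient_star)
    then show "nrm Q (I +> star A x) \<le> nrm Q (I +> x) + e"
      using quotient_nrm_le_self[of "star A x'"] x' by simp
  qed
  have cst: "nrm Q (I +> (star A x \<otimes> x)) = (nrm Q (I +> x))\<^sup>2" if x: "x \<in> carrier A" for x
  proof (rule antisym)
    have "nrm Q (I +> (star A x \<otimes> x)) \<le> nrm Q (I +> star A x) * nrm Q (I +> x)"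
      using x by (intro mult) auto
    also have "\<dots> \<le> nrm Q (I +> x) * nrm Q (I +> x)"
      using x by (intro mult_right_mono star quotient_nrm_nonneg)
    finally show "nrm Q (I +> (star A x \<otimes> x)) \<le> (nrm Q (I +> x))\<^sup>2" by (simp add: power2_eq_square)
  next
    \<comment> \<open>A nearly optimal representative \<open>w\<close> of the product coset differs
      from the product by some \<open>i\<close> in the ideal, which is the situation of
      \<open>quotient_nrm_square_le\<close>.\<close>
    show "(nrm Q (I +> x))\<^sup>2 \<le> nrm Q (I +> (star A x \<otimes> x))"
    proof (rule field_le_epsilon)
      fix e :: real assume "e > 0"
      then obtain w where w: "w \<in> carrier A" "I +> (star A x \<otimes> x) = I +> w"
          "nrm A w < nrm Q (I +> (star A x \<otimes> x)) + e/2"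
        using quotient_nrm_eps[of "star A x \<otimes> x" "e/2"] x by (metis half_gt_zero m_closed star_in)
      define i where "i = w \<ominus> star A x \<otimes> x"
      have i: "i \<in> I" using w x coset_eq_iff[of w "star A x \<otimes> x"] by (simp add: i_def)
      have wi: "star A x \<otimes> x \<oplus> i = w"
      proof -
        have "a \<in> carrier A \<Longrightarrow> a \<oplus> (w \<ominus> a) = w" for a using w(1) by algebra
        then show ?thesis using x by (simp add: i_def)
      qed
      obtain j where j: "j \<in> I" "(nrm A (x \<oplus> j))\<^sup>2 \<le> nrm A w + e/2"
        using quotient_nrm_square_le[OF is_ideal star_mem x i, of "e/2"] \<open>e > 0\<close> wi by auto
      have jc: "j \<in> carrier A" using j by simp
      have "x \<oplus> j \<ominus> x = j" using x jc by algebra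
      then have "nrm Q (I +> x) \<le> nrm A (x \<oplus> j)"
        using x j jc by (intro quotient_nrm_le) (auto simp: coset_mem_iff)
      then have "(nrm Q (I +> x))\<^sup>2 \<le> (nrm A (x \<oplus> j))\<^sup>2"
        using x quotient_nrm_nonneg by (intro power_mono) auto
      then show "(nrm Q (I +> x))\<^sup>2 \<le> nrm Q (I +> (star A x \<otimes> x)) + e"
        using j w by simp
    qed
  qed
  show ?thesis
    unfolding cstar_seminorm_def quotient_simps(1)
    using tri smult mult cst
    by (auto simp: quotient_mult quotient_add quotient_smult quotient_star quotient_nrm_nonneg)
qed

lemma quotient_seminormed: "seminormed_star_algebra Q"
  by (intro seminormed_star_algebra.intro seminormed_star_algebra_axioms.intro
      quotient_star_algebra quotient_seminorm)

lemma quotient_diff: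
  assumes "x \<in> carrier A" "y \<in> carrier A"
  shows "(I +> x) \<ominus>\<^bsub>Q\<^esub> (I +> y) = I +> (x \<ominus> y)"
proof -
  interpret q: star_algebra Q by (rule quotient_star_algebra)
  have "\<ominus>\<^bsub>Q\<^esub> (I +> y) = I +> \<ominus> y"
    using q.minus_smult[of "I +> y" 1] assms quotient_smult[of y "-1"] minus_smult[of y 1]
    by (simp add: quotient_simps)
  then show ?thesis using assms by (simp add: q.minus_eq minus_eq quotient_add)
qed

text \<open>Completeness of \<open>A\<close> is assumed on its own, not as part of
  \<open>cstar_algebra A\<close>: the main application is the algebra of Cauchy sequences, which is
  complete but has nonzero elements of seminorm zero.\<close>

lemma quotient_complete:
  assumes complete: "\<And>s. cauchy_in A s \<Longrightarrow> \<exists>x\<in>carrier A. (\<lambda>n. nrm A (s n \<ominus> x)) \<longlonglongrightarrow> 0"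
    and S: "cauchy_in Q S"
  shows "\<exists>X\<in>carrier Q. (\<lambda>n. nrm Q (S n \<ominus>\<^bsub>Q\<^esub> X)) \<longlonglongrightarrow> 0"
proof -
  interpret q: seminormed_star_algebra Q by (rule quotient_seminormed)
  have Sc: "S n \<in> carrier Q" for n using S by (simp add: cauchy_in_def)
  have "\<forall>k. \<exists>N. \<forall>m\<ge>N. \<forall>n\<ge>N. nrm Q (S m \<ominus>\<^bsub>Q\<^esub> S n) < (1/2) ^ k"
    using S by (auto simp: cauchy_in_def)
  then obtain N where N: "\<And>k m n. \<lbrakk>m \<ge> N k; n \<ge> N k\<rbrakk> \<Longrightarrow> nrm Q (S m \<ominus>\<^bsub>Q\<^esub> S n) < (1/2) ^ k"
    by metis
  \<comment> \<open>A running maximum, so that the indices increase and still dominate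
    \<open>N k\<close>.\<close>
  define r where "r k = Max (N ` {..k})" for k
  have r1: "N k \<le> r k" for k by (auto simp: r_def)
  have r2: "r k \<le> r (Suc k)" for k unfolding r_def by (rule Max_mono) auto
  have step: "nrm Q (S (r (Suc k)) \<ominus>\<^bsub>Q\<^esub> S (r k)) < (1/2) ^ k" for k
    using N r1[of k] r2[of k] by simp
  \<comment> \<open>Each new representative is the preceding one plus a small member of the coset of
    differences, so the lifted sequence has summable increments.\<close>
  have "\<exists>x. \<forall>k. (x k \<in> carrier A \<and> S (r k) = I +> x k) \<and> nrm A (x (Suc k) \<ominus> x k) < (1/2) ^ k"
  proof (rule dependent_nat_choice)
    show "\<exists>x. x \<in> carrier A \<and> S (r 0) = I +> x" using Sc[of "r 0"] by (auto simp: quotient_simps)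
  next
    fix x k assume x: "x \<in> carrier A \<and> S (r k) = I +> x"
    then have xc: "x \<in> carrier A" by simp
    obtain y where y: "y \<in> carrier A" "S (r (Suc k)) = I +> y"
      using Sc[of "r (Suc k)"] by (auto simp: quotient_simps)
    have "nrm Q (I +> (y \<ominus> x)) < (1/2) ^ k" using step[of k] x y by (simp add: quotient_diff)
    then obtain d where d: "d \<in> carrier A" "I +> (y \<ominus> x) = I +> d" "nrm A d < (1/2) ^ k"
      using quotient_nrm_less[of "y \<ominus> x"] x y by auto
    have xd: "x \<oplus> d \<ominus> x = d" using d(1) xc by algebra
    have "I +> (x \<oplus> d) = I +> (x \<oplus> (y \<ominus> x))"
      using d x y by (metis quotient_add minus_closed)
    also have "x \<oplus> (y \<ominus> x) = y" using xc y(1) by algebra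
    finally show "\<exists>z. (z \<in> carrier A \<and> S (r (Suc k)) = I +> z) \<and> nrm A (z \<ominus> x) < (1/2) ^ k"
      using d x y xd by (intro exI[of _ "x \<oplus> d"]) auto
  qed
  then obtain x where x: "\<And>k. x k \<in> carrier A" "\<And>k. S (r k) = I +> x k"
      "\<And>k. nrm A (x (Suc k) \<ominus> x k) < (1/2) ^ k"
    by blast
  have "cauchy_in A x"
    by (rule cauchy_inI_summable[of x "\<lambda>k. (1/2) ^ k"])
      (use x in \<open>auto intro: less_imp_le summable_geometric\<close>)
  then obtain l where l: "l \<in> carrier A" "(\<lambda>n. nrm A (x n \<ominus> l)) \<longlonglongrightarrow> 0"
    using complete by blast
  have lQ: "I +> l \<in> carrier Q" using l by (simp add: quotient_simps)
  have "(\<lambda>n. nrm Q (S n \<ominus>\<^bsub>Q\<^esub> (I +> l))) \<longlonglongrightarrow> 0"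
  proof (rule LIMSEQ_I)
    fix e :: real assume e: "e > 0"
    obtain k1 where k1: "\<And>n. n \<ge> k1 \<Longrightarrow> nrm A (x n \<ominus> l) < e/2"
      using LIMSEQ_D[OF l(2), of "e/2"] e x l by auto
    obtain k2 where k2: "(1/2 :: real) ^ k2 < e/2"
      using real_arch_pow_inv[of "e/2" "1/2"] e by auto
    define k where "k = max k1 k2"
    have "nrm Q (S n \<ominus>\<^bsub>Q\<^esub> (I +> l)) < e" if n: "n \<ge> r k" for n
    proof -
      have "(1/2 :: real) ^ k \<le> (1/2) ^ k2" by (rule power_decreasing) (auto simp: k_def)
      moreover have "nrm Q (S n \<ominus>\<^bsub>Q\<^esub> S (r k)) < (1/2) ^ k" using N n r1[of k] by simp
      moreover have "nrm Q (S (r k) \<ominus>\<^bsub>Q\<^esub> (I +> l)) \<le> nrm A (x k \<ominus> l)"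
        using x l quotient_nrm_le_self[of "x k \<ominus> l"] by (simp add: quotient_diff)
      moreover have "nrm A (x k \<ominus> l) < e/2" using k1 by (simp add: k_def)
      ultimately show ?thesis
        using q.nrm_diff_triangle[OF Sc[of n] Sc[of "r k"] lQ] k2 by linarith
    qed
    then show "\<exists>no. \<forall>n\<ge>no. norm (nrm Q (S n \<ominus>\<^bsub>Q\<^esub> (I +> l)) - 0) < e"
      using q.nrm_nonneg Sc lQ by (intro exI[of _ "r k"]) auto
  qed
  then show ?thesis using lQ by blast
qed

text \<open>A coset has quotient norm zero only if its elements are approximated by members of
  \<open>I\<close>, so closedness of the ideal is what makes the quotient norm definite.\<close>

lemma quotient_cstar_algebra:
  assumes closed: "closed_in A I"
    and complete: "\<And>s. cauchy_in A s \<Longrightarrow> \<exists>x\<in>carrier A. (\<lambda>n. nrm A (s n \<ominus> x)) \<longlonglongrightarrow> 0"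
  shows "cstar_algebra Q"
proof -
  interpret q: seminormed_star_algebra Q by (rule quotient_seminormed)
  show ?thesis
  proof
    fix X assume "X \<in> carrier Q" and 0: "nrm Q X = 0"
    then obtain x where x: "x \<in> carrier A" "X = I +> x" by (auto simp: quotient_simps)
    have "\<exists>y\<in>I. nrm A (x \<ominus> y) < e" if e: "e > 0" for e
    proof -
      obtain y where y: "y \<in> carrier A" "I +> x = I +> y" "nrm A y < e"
        using quotient_nrm_eps[OF x(1) e] 0 x(2) by auto
      have "x \<ominus> (x \<ominus> y) = y" using x(1) y(1) by algebra
      then show ?thesis using y x coset_eq_iff by (intro bexI[of _ "x \<ominus> y"]) auto
    qed
    then have "x \<in> I" using closed x by (auto simp: closed_in_def)
    then show "X = \<zero>\<^bsub>Q\<^esub>" using x by (simp add: quotient_simps coset_eq_iff minus_eq)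
  next
    fix S assume "cauchy_in Q S"
    then show "\<exists>X\<in>carrier Q. (\<lambda>n. nrm Q (S n \<ominus>\<^bsub>Q\<^esub> X)) \<longlonglongrightarrow> 0"
      using quotient_complete complete by blast
  qed
qed

end


lemma (in ring) minus_eq_zero_iff:
  assumes "x \<in> carrier R" "y \<in> carrier R"
  shows "x \<ominus> y = \<zero> \<longleftrightarrow> x = y"
proof
  assume "x \<ominus> y = \<zero>"
  moreover have "(x \<ominus> y) \<oplus> y = x" using assms by algebra
  ultimately show "x = y" using assms by simp
qed (use assms in \<open>simp add: minus_eq r_neg\<close>)

section \<open>Limits, Cauchy sequences and the completion\<close>

context seminormed_star_algebra
begin

definition tends :: "(nat \<Rightarrow> 'a) \<Rightarrow> 'a \<Rightarrow> bool" where
  "tends s x \<longleftrightarrow> (\<forall>n. s n \<in> carrier A) \<and> x \<in> carrier A \<and> (\<lambda>n. nrm A (s n \<ominus> x)) \<longlonglongrightarrow> 0"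

lemma tendsD: "tends s x \<Longrightarrow> s n \<in> carrier A" "tends s x \<Longrightarrow> x \<in> carrier A"
    "tends s x \<Longrightarrow> (\<lambda>n. nrm A (s n \<ominus> x)) \<longlonglongrightarrow> 0"
  by (auto simp: tends_def)

lemma tendsI:
  assumes "\<And>n. s n \<in> carrier A" "x \<in> carrier A" "\<And>n. nrm A (s n \<ominus> x) \<le> e n" "e \<longlonglongrightarrow> 0"
  shows "tends s x"
  unfolding tends_def using assms
  by (auto intro!: tendsto_sandwich[OF _ _ tendsto_const, of _ _ _ e] always_eventually)

lemma tends_const: "x \<in> carrier A \<Longrightarrow> tends (\<lambda>n. x) x"
  by (simp add: tends_def minus_eq r_neg)

lemma tends_add:
  assumes s: "tends s x" and t: "tends t y" shows "tends (\<lambda>n. s n \<oplus> t n) (x \<oplus> y)"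
proof (rule tendsI)
  note c = tendsD(1,2)[OF s] tendsD(1,2)[OF t]
  show "nrm A ((s n \<oplus> t n) \<ominus> (x \<oplus> y)) \<le> nrm A (s n \<ominus> x) + nrm A (t n \<ominus> y)" for n
  proof -
    have "\<lbrakk>a \<in> carrier A; b \<in> carrier A; p \<in> carrier A; q \<in> carrier A\<rbrakk> \<Longrightarrow>
      (a \<oplus> b) \<ominus> (p \<oplus> q) = (a \<ominus> p) \<oplus> (b \<ominus> q)" for a b p q by algebra
    then show ?thesis using c nrm_triangle[of "s n \<ominus> x" "t n \<ominus> y"] by simp
  qed
  show "(\<lambda>n. nrm A (s n \<ominus> x) + nrm A (t n \<ominus> y)) \<longlonglongrightarrow> 0"
    using tendsto_add[OF tendsD(3)[OF s] tendsD(3)[OF t]] by simp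
qed (use tendsD[OF s] tendsD[OF t] in auto)

lemma tends_smult:
  assumes s: "tends s x" shows "tends (\<lambda>n. c \<odot> s n) (c \<odot> x)"
proof (rule tendsI)
  show "nrm A (c \<odot> s n \<ominus> c \<odot> x) \<le> cmod c * nrm A (s n \<ominus> x)" for n
    using tendsD(1,2)[OF s] by (simp add: smult_diff[symmetric] nrm_smult)
  show "(\<lambda>n. cmod c * nrm A (s n \<ominus> x)) \<longlonglongrightarrow> 0"
    using tendsto_mult_right_zero[OF tendsD(3)[OF s]] by simp
qed (use tendsD[OF s] in auto)

lemma tends_star:
  assumes s: "tends s x" shows "tends (\<lambda>n. star A (s n)) (star A x)"
proof (rule tendsI)
  show "nrm A (star A (s n) \<ominus> star A x) \<le> nrm A (s n \<ominus> x)" for n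
    using tendsD(1,2)[OF s] by (simp add: star_diff[symmetric])
qed (use tendsD[OF s] in auto)

lemma tends_nrm:
  assumes s: "tends s x" shows "(\<lambda>n. nrm A (s n)) \<longlonglongrightarrow> nrm A x"
proof -
  have "(\<lambda>n. \<bar>nrm A (s n) - nrm A x\<bar>) \<longlonglongrightarrow> 0"
    by (rule tendsto_sandwich[OF _ _ tendsto_const tendsD(3)[OF s]])
      (use nrm_diff_abs tendsD(1,2)[OF s] in auto)
  then have "(\<lambda>n. nrm A (s n) - nrm A x) \<longlonglongrightarrow> 0"
    by (rule tendsto_rabs_zero_cancel)
  then show ?thesis by (rule LIM_zero_cancel)
qed

lemma tends_mult:
  assumes s: "tends s x" and t: "tends t y" shows "tends (\<lambda>n. s n \<otimes> t n) (x \<otimes> y)"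
proof (rule tendsI)
  note c = tendsD(1,2)[OF s] tendsD(1,2)[OF t]
  show "nrm A (s n \<otimes> t n \<ominus> x \<otimes> y) \<le> nrm A (s n \<ominus> x) * nrm A (t n) + nrm A x * nrm A (t n \<ominus> y)" for n
  proof -
    have "\<lbrakk>a \<in> carrier A; b \<in> carrier A; p \<in> carrier A; q \<in> carrier A\<rbrakk> \<Longrightarrow>
      a \<otimes> b \<ominus> p \<otimes> q = (a \<ominus> p) \<otimes> b \<oplus> p \<otimes> (b \<ominus> q)" for a b p q by algebra
    then show ?thesis
      using c nrm_triangle[of "(s n \<ominus> x) \<otimes> t n" "x \<otimes> (t n \<ominus> y)"]
        nrm_mult[of "s n \<ominus> x" "t n"] nrm_mult[of x "t n \<ominus> y"] by simp
  qed
  show "(\<lambda>n. nrm A (s n \<ominus> x) * nrm A (t n) + nrm A x * nrm A (t n \<ominus> y)) \<longlonglongrightarrow> 0"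
    using tendsto_add[OF tendsto_mult[OF tendsD(3)[OF s] tends_nrm[OF t]]
        tendsto_mult[OF tendsto_const tendsD(3)[OF t]], of "nrm A x"] by simp
qed (use tendsD[OF s] tendsD[OF t] in auto)

lemma cauchy_in_tends: "tends s x \<Longrightarrow> cauchy_in A s"
proof -
  assume s: "tends s x"
  show ?thesis unfolding cauchy_in_def
  proof (intro conjI allI impI)
    fix e :: real assume "e > 0"
    then obtain N where N: "\<And>n. n \<ge> N \<Longrightarrow> nrm A (s n \<ominus> x) < e/2"
      using LIMSEQ_D[OF tendsD(3)[OF s], of "e/2"] tendsD(1,2)[OF s] by auto
    have "nrm A (s m \<ominus> s n) < e" if "m \<ge> N" "n \<ge> N" for m n
      using N[OF that(1)] N[OF that(2)] nrm_diff_triangle[of "s m" x "s n"] nrm_diff_commute[of "s n" x]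
        tendsD(1,2)[OF s] by simp
    then show "\<exists>N. \<forall>m\<ge>N. \<forall>n\<ge>N. nrm A (s m \<ominus> s n) < e" by blast
  qed (use tendsD[OF s] in auto)
qed

lemma cauchy_const: "x \<in> carrier A \<Longrightarrow> cauchy_in A (\<lambda>n. x)"
  by (rule cauchy_in_tends[OF tends_const])

lemma cauchy_nrm:
  assumes "cauchy_in A s"
  shows "(\<lambda>n. nrm A (s n)) \<longlonglongrightarrow> lim (\<lambda>n. nrm A (s n))"
proof -
  have sc: "s n \<in> carrier A" for n using assms by (simp add: cauchy_in_def)
  have "Cauchy (\<lambda>n. nrm A (s n))"
    unfolding Cauchy_def dist_real_def
  proof (intro allI impI)
    fix e :: real assume "e > 0"
    then obtain N where "\<And>m n. \<lbrakk>m \<ge> N; n \<ge> N\<rbrakk> \<Longrightarrow> nrm A (s m \<ominus> s n) < e"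
      using assms unfolding cauchy_in_def by blast
    then show "\<exists>N. \<forall>m\<ge>N. \<forall>n\<ge>N. \<bar>nrm A (s m) - nrm A (s n)\<bar> < e"
      using nrm_diff_abs[OF sc sc] by (meson le_less_trans)
  qed
  then show ?thesis using Cauchy_convergent convergent_LIMSEQ_iff by blast
qed

lemma cauchy_bounded:
  assumes "cauchy_in A s"
  obtains B where "B > 0" "\<And>n. nrm A (s n) \<le> B"
proof -
  have "Bseq (\<lambda>n. nrm A (s n))"
    using cauchy_nrm[OF assms] by (meson convergentI convergent_imp_Bseq)
  then obtain B where B: "B > 0" "\<And>n. norm (nrm A (s n)) \<le> B" by (auto elim: BseqE)
  then show ?thesis using that[of B] by (metis abs_le_D1 real_norm_def)
qed

lemma cauchy_inI:
  assumes "\<And>n. s n \<in> carrier A"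
    and "\<And>e. e > 0 \<Longrightarrow> \<exists>N. \<forall>m\<ge>N. \<forall>n\<ge>N. nrm A (s m \<ominus> s n) < e"
  shows "cauchy_in A s"
  using assms by (auto simp: cauchy_in_def)

lemma cauchy_inD:
  "cauchy_in A s \<Longrightarrow> s n \<in> carrier A"
  "\<lbrakk>cauchy_in A s; e > 0\<rbrakk> \<Longrightarrow> \<exists>N. \<forall>m\<ge>N. \<forall>n\<ge>N. nrm A (s m \<ominus> s n) < e"
  by (auto simp: cauchy_in_def)

lemma cauchy_add:
  assumes s: "cauchy_in A s" and t: "cauchy_in A t"
  shows "cauchy_in A (\<lambda>n. s n \<oplus> t n)"
proof (rule cauchy_inI)
  note c = cauchy_inD(1)[OF s] cauchy_inD(1)[OF t]
  fix e :: real assume "e > 0"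
  then have e: "e/2 > 0" by simp
  obtain M where M: "\<forall>m\<ge>M. \<forall>n\<ge>M. nrm A (s m \<ominus> s n) < e/2" using cauchy_inD(2)[OF s e] by blast
  obtain N where N: "\<forall>m\<ge>N. \<forall>n\<ge>N. nrm A (t m \<ominus> t n) < e/2" using cauchy_inD(2)[OF t e] by blast
  have "nrm A ((s m \<oplus> t m) \<ominus> (s n \<oplus> t n)) < e" if "m \<ge> max M N" "n \<ge> max M N" for m n
  proof -
    have "\<lbrakk>a \<in> carrier A; b \<in> carrier A; p \<in> carrier A; q \<in> carrier A\<rbrakk> \<Longrightarrow>
      (a \<oplus> b) \<ominus> (p \<oplus> q) = (a \<ominus> p) \<oplus> (b \<ominus> q)" for a b p q by algebra
    then have "nrm A ((s m \<oplus> t m) \<ominus> (s n \<oplus> t n)) \<le> nrm A (s m \<ominus> s n) + nrm A (t m \<ominus> t n)"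
      using c nrm_triangle[of "s m \<ominus> s n" "t m \<ominus> t n"] by simp
    moreover have "nrm A (s m \<ominus> s n) < e/2" "nrm A (t m \<ominus> t n) < e/2" using M N that by auto
    ultimately show ?thesis by linarith
  qed
  then show "\<exists>N. \<forall>m\<ge>N. \<forall>n\<ge>N. nrm A ((s m \<oplus> t m) \<ominus> (s n \<oplus> t n)) < e" by blast
qed (use cauchy_inD(1)[OF s] cauchy_inD(1)[OF t] in auto)

lemma cauchy_mult:
  assumes s: "cauchy_in A s" and t: "cauchy_in A t"
  shows "cauchy_in A (\<lambda>n. s n \<otimes> t n)"
proof (rule cauchy_inI)
  note c = cauchy_inD(1)[OF s] cauchy_inD(1)[OF t]
  obtain B where B: "B > 0" "\<And>n. nrm A (s n) \<le> B" using cauchy_bounded[OF s] by blast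
  obtain C where C: "C > 0" "\<And>n. nrm A (t n) \<le> C" using cauchy_bounded[OF t] by blast
  fix e :: real assume "e > 0"
  then have e: "e/2/C > 0" "e/2/B > 0" using B C by auto
  obtain M where M: "\<forall>m\<ge>M. \<forall>n\<ge>M. nrm A (s m \<ominus> s n) < e/2/C" using cauchy_inD(2)[OF s e(1)] by blast
  obtain N where N: "\<forall>m\<ge>N. \<forall>n\<ge>N. nrm A (t m \<ominus> t n) < e/2/B" using cauchy_inD(2)[OF t e(2)] by blast
  have "nrm A (s m \<otimes> t m \<ominus> s n \<otimes> t n) < e" if "m \<ge> max M N" "n \<ge> max M N" for m n
  proof -
    have "\<lbrakk>a \<in> carrier A; b \<in> carrier A; p \<in> carrier A; q \<in> carrier A\<rbrakk> \<Longrightarrow>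
      a \<otimes> b \<ominus> p \<otimes> q = (a \<ominus> p) \<otimes> b \<oplus> p \<otimes> (b \<ominus> q)" for a b p q by algebra
    then have "nrm A (s m \<otimes> t m \<ominus> s n \<otimes> t n)
        \<le> nrm A ((s m \<ominus> s n) \<otimes> t m) + nrm A (s n \<otimes> (t m \<ominus> t n))"
      using c nrm_triangle[of "(s m \<ominus> s n) \<otimes> t m" "s n \<otimes> (t m \<ominus> t n)"] by simp
    also have "nrm A ((s m \<ominus> s n) \<otimes> t m) \<le> nrm A (s m \<ominus> s n) * C"
      using c C by (intro nrm_mult_le) auto
    also have "nrm A (s n \<otimes> (t m \<ominus> t n)) \<le> B * nrm A (t m \<ominus> t n)"
      using c B by (intro nrm_mult_le) auto
    also have "nrm A (s m \<ominus> s n) * C < (e/2/C) * C" using M C that by (intro mult_strict_right_mono) auto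
    also have "B * nrm A (t m \<ominus> t n) < B * (e/2/B)" using N B that by (intro mult_strict_left_mono) auto
    finally show ?thesis using B C by simp
  qed
  then show "\<exists>N. \<forall>m\<ge>N. \<forall>n\<ge>N. nrm A (s m \<otimes> t m \<ominus> s n \<otimes> t n) < e" by blast
qed (use cauchy_inD(1)[OF s] cauchy_inD(1)[OF t] in auto)

lemma cauchy_smult:
  assumes s: "cauchy_in A s" shows "cauchy_in A (\<lambda>n. c \<odot> s n)"
  using cauchy_mult[OF cauchy_const s, of "c \<odot> \<one>"] cauchy_inD(1)[OF s]
  by (simp add: smult_mult_left)

lemma cauchy_star:
  assumes s: "cauchy_in A s" shows "cauchy_in A (\<lambda>n. star A (s n))"
  using s unfolding cauchy_in_def by (simp add: star_diff[symmetric])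

lemma cauchy_algebra_simps:
  "carrier (cauchy_algebra A) = {s. cauchy_in A s}"
  "s \<otimes>\<^bsub>cauchy_algebra A\<^esub> t = (\<lambda>n. s n \<otimes> t n)"
  "s \<oplus>\<^bsub>cauchy_algebra A\<^esub> t = (\<lambda>n. s n \<oplus> t n)"
  "c \<odot>\<^bsub>cauchy_algebra A\<^esub> s = (\<lambda>n. c \<odot> s n)"
  "\<one>\<^bsub>cauchy_algebra A\<^esub> = (\<lambda>n. \<one>)" "\<zero>\<^bsub>cauchy_algebra A\<^esub> = (\<lambda>n. \<zero>)"
  "star (cauchy_algebra A) s = (\<lambda>n. star A (s n))"
  "nrm (cauchy_algebra A) s = lim (\<lambda>n. nrm A (s n))"
  by (simp_all add: cauchy_algebra_def)

lemma cauchy_star_algebra: "star_algebra (cauchy_algebra A)"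
proof -
  note c = cauchy_inD(1)
  note S = smult_add_left smult_add_right smult_smult smult_mult_left smult_mult_right
    star_star star_add star_mult star_smult minus_smult
  show ?thesis
    by (rule star_algebraI)
      (auto simp: cauchy_algebra_simps c a_assoc m_assoc l_distr r_distr S l_neg fun_eq_iff
        intro!: cauchy_add cauchy_mult cauchy_smult cauchy_star cauchy_const a_comm)
qed

lemma cauchy_seminormed: "seminormed_star_algebra (cauchy_algebra A)"
proof -
  have "cstar_seminorm (cauchy_algebra A) (nrm (cauchy_algebra A))"
    unfolding cstar_seminorm_def cauchy_algebra_simps
  proof (intro conjI ballI allI; unfold mem_Collect_eq)
    fix s assume s: "cauchy_in A s"
    show "0 \<le> lim (\<lambda>n. nrm A (s n))"
      using cauchy_nrm[OF s] by (rule LIMSEQ_le_const) (use cauchy_inD(1)[OF s] in auto)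
    fix t assume t: "cauchy_in A t"
    show "lim (\<lambda>n. nrm A (s n \<oplus> t n)) \<le> lim (\<lambda>n. nrm A (s n)) + lim (\<lambda>n. nrm A (t n))"
      by (rule LIMSEQ_le[OF cauchy_nrm[OF cauchy_add[OF s t]] tendsto_add[OF cauchy_nrm[OF s] cauchy_nrm[OF t]]])
        (use cauchy_inD(1)[OF s] cauchy_inD(1)[OF t] nrm_triangle in auto)
    show "lim (\<lambda>n. nrm A (s n \<otimes> t n)) \<le> lim (\<lambda>n. nrm A (s n)) * lim (\<lambda>n. nrm A (t n))"
      by (rule LIMSEQ_le[OF cauchy_nrm[OF cauchy_mult[OF s t]] tendsto_mult[OF cauchy_nrm[OF s] cauchy_nrm[OF t]]])
        (use cauchy_inD(1)[OF s] cauchy_inD(1)[OF t] nrm_mult in auto)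
  next
    fix c s assume s: "cauchy_in A s"
    have "(\<lambda>n. nrm A (c \<odot> s n)) = (\<lambda>n. cmod c * nrm A (s n))"
      using cauchy_inD(1)[OF s] by (simp add: nrm_smult)
    then show "lim (\<lambda>n. nrm A (c \<odot> s n)) = cmod c * lim (\<lambda>n. nrm A (s n))"
      using limI[OF tendsto_mult_left[OF cauchy_nrm[OF s]]] by simp
  next
    fix s assume s: "cauchy_in A s"
    have "(\<lambda>n. nrm A (star A (s n) \<otimes> s n)) = (\<lambda>n. (nrm A (s n))\<^sup>2)"
      using cauchy_inD(1)[OF s] by (simp add: nrm_cstar)
    then show "lim (\<lambda>n. nrm A (star A (s n) \<otimes> s n)) = (lim (\<lambda>n. nrm A (s n)))\<^sup>2"
      using limI[OF tendsto_power[OF cauchy_nrm[OF s]]] by simp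
  qed
  then show ?thesis
    by (intro seminormed_star_algebra.intro seminormed_star_algebra_axioms.intro cauchy_star_algebra)
qed

lemma kernel_star_ideal: "star_ideal A {x \<in> carrier A. nrm A x = 0}"
proof -
  have sub: "nrm A x = 0" if "nrm A x \<le> 0" "x \<in> carrier A" for x
    using that nrm_nonneg[of x] by (metis order_antisym)
  have "subgroup {x \<in> carrier A. nrm A x = 0} (add_monoid A)"
  proof (rule subgroup.intro)
    fix x y assume "x \<in> {x \<in> carrier A. nrm A x = 0}" "y \<in> {x \<in> carrier A. nrm A x = 0}"
    then show "x \<otimes>\<^bsub>add_monoid A\<^esub> y \<in> {x \<in> carrier A. nrm A x = 0}"
      using nrm_triangle[of x y] by (auto intro: sub)
  qed (auto simp: a_inv_def[symmetric])
  then have "ideal {x \<in> carrier A. nrm A x = 0} A"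
  proof (rule idealI[OF ring_axioms])
    fix a x assume "a \<in> {x \<in> carrier A. nrm A x = 0}" "x \<in> carrier A"
    then show "x \<otimes> a \<in> {x \<in> carrier A. nrm A x = 0}" "a \<otimes> x \<in> {x \<in> carrier A. nrm A x = 0}"
      using nrm_mult[of x a] nrm_mult[of a x] by (auto intro: sub)
  qed
  then show ?thesis
    by (intro star_ideal.intro star_ideal_axioms.intro star_algebra_axioms) auto
qed

lemma kernel_closed: "closed_in A {x \<in> carrier A. nrm A x = 0}"
  unfolding closed_in_def
proof (intro ballI impI)
  fix x assume x: "x \<in> carrier A" and *: "\<forall>e>0. \<exists>y\<in>{x \<in> carrier A. nrm A x = 0}. nrm A (x \<ominus> y) < e"
  have "nrm A x \<le> 0"
  proof (rule field_le_epsilon)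
    fix e :: real assume "e > 0"
    then obtain y where "y \<in> carrier A" "nrm A y = 0" "nrm A (x \<ominus> y) < e" using * by auto
    then show "nrm A x \<le> 0 + e" using nrm_diff_abs[OF x, of y] by simp
  qed
  then show "x \<in> {x \<in> carrier A. nrm A x = 0}" using x nrm_nonneg[of x] order_antisym by blast
qed

text \<open>Exhibits the null sequences as the kernel of a C*-seminorm, so that they form a closed
  star-closed ideal by \<open>kernel_star_ideal\<close> and \<open>kernel_closed\<close>.\<close>

lemma null_sequences_eq:
  "null_sequences A = {s \<in> carrier (cauchy_algebra A). nrm (cauchy_algebra A) s = 0}"
proof -
  have "cauchy_in A s" if "\<forall>n. s n \<in> carrier A" "(\<lambda>n. nrm A (s n)) \<longlonglongrightarrow> 0" for s
    by (rule cauchy_in_tends[of _ \<zero>]) (use that in \<open>auto simp: tends_def minus_eq\<close>)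
  moreover have "(\<lambda>n. nrm A (s n)) \<longlonglongrightarrow> 0" if "cauchy_in A s" "lim (\<lambda>n. nrm A (s n)) = 0" for s
    using cauchy_nrm[OF that(1)] that(2) by simp
  ultimately show ?thesis
    by (auto simp: null_sequences_def cauchy_algebra_simps cauchy_inD(1) limI)
qed

text \<open>Diagonal argument: the limit takes from \<open>S k\<close> the term at an index past
  which \<open>S k\<close> varies by less than \<open>1 / (k + 1)\<close>.\<close>

lemma cauchy_complete:
  assumes S: "cauchy_in (cauchy_algebra A) S"
  shows "\<exists>x\<in>carrier (cauchy_algebra A).
    (\<lambda>n. nrm (cauchy_algebra A) (S n \<ominus>\<^bsub>cauchy_algebra A\<^esub> x)) \<longlonglongrightarrow> 0"
proof -
  interpret C: seminormed_star_algebra "cauchy_algebra A" by (rule cauchy_seminormed)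
  have Sc: "cauchy_in A (S k)" for k using C.cauchy_inD(1)[OF S] by (simp add: cauchy_algebra_simps)
  have sc: "S k n \<in> carrier A" for k n using cauchy_inD(1)[OF Sc] .
  have diff: "s \<ominus>\<^bsub>cauchy_algebra A\<^esub> t = (\<lambda>n. s n \<ominus> t n)"
    if "cauchy_in A s" "cauchy_in A t" for s t
  proof -
    have "\<ominus>\<^bsub>cauchy_algebra A\<^esub> t = (\<lambda>n. \<ominus> t n)"
      using C.minus_smult[of t 1] that cauchy_inD(1)[OF that(2)]
      by (simp add: cauchy_algebra_simps minus_smult)
    then show ?thesis by (simp add: C.minus_eq cauchy_algebra_simps minus_eq)
  qed
  have "\<exists>N. \<forall>m\<ge>N. \<forall>n\<ge>N. nrm A (S k m \<ominus> S k n) < 1 / real (Suc k)" for k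
    using cauchy_inD(2)[OF Sc, of "1 / real (Suc k)"] by simp
  then obtain N where N: "\<And>k m n. \<lbrakk>m \<ge> N k; n \<ge> N k\<rbrakk> \<Longrightarrow> nrm A (S k m \<ominus> S k n) < 1 / real (Suc k)"
    by metis
  define t where "t k = S k (N k)" for k
  have tc: "t k \<in> carrier A" for k by (simp add: t_def sc)
  have inv: "\<exists>M. \<forall>k\<ge>M. 1 / real (Suc k) < e" if e: "e > 0" for e
  proof -
    obtain M where M: "inverse (real (Suc M)) < e" using reals_Archimedean e by blast
    have "1 / real (Suc k) < e" if "k \<ge> M" for k
      using that M frac_le[of 1 1 "real (Suc M)" "real (Suc k)"] by (simp add: inverse_eq_divide)
    then show ?thesis by blast
  qed
  have t: "cauchy_in A t"
  proof (rule cauchy_inI)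
    fix e :: real assume "e > 0"
    then have e: "e/4 > 0" by simp
    obtain M1 where M1: "\<forall>k\<ge>M1. \<forall>l\<ge>M1. nrm (cauchy_algebra A) (S k \<ominus>\<^bsub>cauchy_algebra A\<^esub> S l) < e/4"
      using C.cauchy_inD(2)[OF S e] by blast
    obtain M2 where M2: "\<forall>k\<ge>M2. 1 / real (Suc k) < e/4" using inv[OF e] by blast
    have "nrm A (t k \<ominus> t l) < e" if k: "k \<ge> max M1 M2" and l: "l \<ge> max M1 M2" for k l
    proof -
      have "lim (\<lambda>m. nrm A (S k m \<ominus> S l m)) < e/4"
        using M1 k l by (simp add: diff Sc cauchy_algebra_simps)
      moreover have "(\<lambda>m. nrm A (S k m \<ominus> S l m)) \<longlonglongrightarrow> lim (\<lambda>m. nrm A (S k m \<ominus> S l m))"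
        using cauchy_nrm[OF cauchy_add[OF Sc[of k] cauchy_smult[OF Sc[of l], of "-1"]]] sc
        by (simp add: minus_smult minus_eq)
      ultimately have "\<forall>\<^sub>F m in sequentially. nrm A (S k m \<ominus> S l m) < e/4"
        by (rule order_tendstoD(2)[rotated])
      \<comment> \<open>One index late enough for both sequences and for the limit norm of their
        difference allows \<open>t k\<close> and \<open>t l\<close> to be compared through
        \<open>S k m\<close> and \<open>S l m\<close>.\<close>
      then have "\<forall>\<^sub>F m in sequentially. nrm A (S k m \<ominus> S l m) < e/4 \<and> m \<ge> N k \<and> m \<ge> N l"
        by (intro eventually_conj eventually_ge_at_top)
      then have "\<exists>m. nrm A (S k m \<ominus> S l m) < e/4 \<and> m \<ge> N k \<and> m \<ge> N l"
        by (rule eventually_happens'[OF sequentially_bot])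
      then obtain m where m: "nrm A (S k m \<ominus> S l m) < e/4" "m \<ge> N k" "m \<ge> N l" by blast
      have "nrm A (t k \<ominus> S k m) < 1 / real (Suc k)" unfolding t_def by (rule N) (use m in auto)
      moreover have "nrm A (S l m \<ominus> t l) < 1 / real (Suc l)" unfolding t_def by (rule N) (use m in auto)
      moreover have "1 / real (Suc k) < e/4" "1 / real (Suc l) < e/4" using M2 k l by auto
      ultimately show ?thesis
        using nrm_diff_triangle[OF tc[of k] sc[of k m] tc[of l]] nrm_diff_triangle[OF sc[of k m] sc[of l m] tc[of l]]
          m(1) \<open>e > 0\<close> by linarith
    qed
    then show "\<exists>N. \<forall>m\<ge>N. \<forall>n\<ge>N. nrm A (t m \<ominus> t n) < e" by blast
  qed (rule tc)
  have "(\<lambda>k. nrm (cauchy_algebra A) (S k \<ominus>\<^bsub>cauchy_algebra A\<^esub> t)) \<longlonglongrightarrow> 0"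
  proof (rule LIMSEQ_I)
    fix e :: real assume "e > 0"
    then have e: "e/3 > 0" by simp
    obtain M1 where M1: "\<forall>k\<ge>M1. \<forall>l\<ge>M1. nrm A (t k \<ominus> t l) < e/3"
      using cauchy_inD(2)[OF t e] by blast
    obtain M2 where M2: "\<forall>k\<ge>M2. 1 / real (Suc k) < e/3" using inv[OF e] by blast
    have "nrm (cauchy_algebra A) (S k \<ominus>\<^bsub>cauchy_algebra A\<^esub> t) < e" if k: "k \<ge> max M1 M2" for k
    proof -
      have "nrm A (S k m \<ominus> t m) \<le> 2 * e/3" if m: "m \<ge> max (N k) M1" for m
      proof -
        have "nrm A (S k m \<ominus> t k) < 1 / real (Suc k)" unfolding t_def by (rule N) (use m in auto)
        moreover have "nrm A (t k \<ominus> t m) < e/3" using M1 k m by auto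
        moreover have "1 / real (Suc k) < e/3" using M2 k by auto
        ultimately show ?thesis using nrm_diff_triangle[OF sc[of k m] tc[of k] tc[of m]] by linarith
      qed
      moreover have "(\<lambda>m. nrm A (S k m \<ominus> t m)) \<longlonglongrightarrow> lim (\<lambda>m. nrm A (S k m \<ominus> t m))"
        using cauchy_nrm[OF cauchy_add[OF Sc[of k] cauchy_smult[OF t, of "-1"]]] sc tc
        by (simp add: minus_smult minus_eq)
      ultimately have "lim (\<lambda>m. nrm A (S k m \<ominus> t m)) \<le> 2 * e/3"
        by (intro LIMSEQ_le_const2) blast+
      then show ?thesis using \<open>e > 0\<close> by (simp add: diff Sc t cauchy_algebra_simps)
    qed
    moreover have "0 \<le> nrm (cauchy_algebra A) (S k \<ominus>\<^bsub>cauchy_algebra A\<^esub> t)" for k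
      using Sc t by (intro C.nrm_nonneg C.minus_closed) (auto simp: cauchy_algebra_simps(1))
    ultimately show "\<exists>no. \<forall>k\<ge>no. norm (nrm (cauchy_algebra A) (S k \<ominus>\<^bsub>cauchy_algebra A\<^esub> t) - 0) < e"
      by (intro exI[of _ "max M1 M2"]) auto
  qed
  then show ?thesis using t by (auto simp: cauchy_algebra_simps)
qed

lemma null_sequences_ideal: "seminormed_star_ideal (cauchy_algebra A) (null_sequences A)"
  unfolding null_sequences_eq
  by (intro seminormed_star_ideal.intro cauchy_seminormed seminormed_star_algebra.kernel_star_ideal)

lemma completion_cstar_algebra: "cstar_algebra (cstar_completion A)"
  unfolding cstar_completion_def
  by (intro seminormed_star_ideal.quotient_cstar_algebra null_sequences_ideal cauchy_complete)
    (simp_all add: null_sequences_eq seminormed_star_algebra.kernel_closed[OF cauchy_seminormed])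

lemma to_completion_hom: "to_completion A \<in> star_hom A (cstar_completion A)"
proof -
  interpret N: seminormed_star_ideal "cauchy_algebra A" "null_sequences A" by (rule null_sequences_ideal)
  have c: "x \<in> carrier A \<Longrightarrow> (\<lambda>n. x) \<in> carrier (cauchy_algebra A)" for x
    by (simp add: cauchy_algebra_simps cauchy_const)
  have "to_completion A \<in> ring_hom A (cstar_completion A)"
    unfolding to_completion_def cstar_completion_def
    by (rule ring_hom_memI)
      (auto simp: N.quotient_simps N.quotient_mult N.quotient_add c simp flip: cauchy_algebra_simps(2,3,5))
  then show ?thesis
    using c by (auto simp: star_hom_def to_completion_def cstar_completion_def N.quotient_smult N.quotient_star
        simp flip: cauchy_algebra_simps(4,7))
qed

text \<open>The infimum in the quotient norm is over a constant: representatives differ by null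
  sequences and so have the same limiting norm.\<close>

lemma nrm_to_completion:
  assumes x: "x \<in> carrier A"
  shows "nrm (cstar_completion A) (to_completion A x) = nrm A x"
proof -
  interpret N: seminormed_star_ideal "cauchy_algebra A" "null_sequences A" by (rule null_sequences_ideal)
  define s where "s = (\<lambda>n::nat. x)"
  have s: "s \<in> carrier (cauchy_algebra A)" "nrm (cauchy_algebra A) s = nrm A x"
    by (auto simp: s_def cauchy_algebra_simps cauchy_const[OF x])
  have "nrm (cauchy_algebra A) s \<le> nrm N.Q (null_sequences A +>\<^bsub>cauchy_algebra A\<^esub> s)"
  proof (rule field_le_epsilon)
    fix e :: real assume "e > 0"
    then obtain y where y: "y \<in> carrier (cauchy_algebra A)"
      "null_sequences A +>\<^bsub>cauchy_algebra A\<^esub> s = null_sequences A +>\<^bsub>cauchy_algebra A\<^esub> y"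
      "nrm (cauchy_algebra A) y < nrm N.Q (null_sequences A +>\<^bsub>cauchy_algebra A\<^esub> s) + e"
      using N.quotient_nrm_eps[OF s(1)] by blast
    have "s \<ominus>\<^bsub>cauchy_algebra A\<^esub> y \<in> null_sequences A" using y s N.coset_eq_iff by blast
    then have "nrm (cauchy_algebra A) (s \<ominus>\<^bsub>cauchy_algebra A\<^esub> y) = 0"
      unfolding null_sequences_eq by blast
    then have "nrm (cauchy_algebra A) s = nrm (cauchy_algebra A) y"
      using N.nrm_diff_abs[OF s(1) y(1)] by simp
    then show "nrm (cauchy_algebra A) s \<le> nrm N.Q (null_sequences A +>\<^bsub>cauchy_algebra A\<^esub> s) + e"
      using y by simp
  qed
  then show ?thesis
    using N.quotient_nrm_le_self[OF s(1)] s by (simp add: to_completion_def cstar_completion_def s_def)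
qed

lemma to_completion_dense:
  assumes X: "X \<in> carrier (cstar_completion A)" and "e > 0"
  obtains x where "x \<in> carrier A"
    "nrm (cstar_completion A) (X \<ominus>\<^bsub>cstar_completion A\<^esub> to_completion A x) < e"
proof -
  interpret N: seminormed_star_ideal "cauchy_algebra A" "null_sequences A" by (rule null_sequences_ideal)
  obtain s where s: "cauchy_in A s" "X = null_sequences A +>\<^bsub>cauchy_algebra A\<^esub> s"
    using X by (auto simp: cstar_completion_def N.quotient_simps cauchy_algebra_simps)
  have sc: "s n \<in> carrier A" for n using cauchy_inD(1)[OF s(1)] .
  obtain M where M: "\<forall>m\<ge>M. \<forall>n\<ge>M. nrm A (s m \<ominus> s n) < e/2"
    using cauchy_inD(2)[OF s(1), of "e/2"] \<open>e > 0\<close> by auto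
  define t where "t = (\<lambda>n::nat. s M)"
  have t: "cauchy_in A t" unfolding t_def by (rule cauchy_const[OF sc])
  have diff: "s \<ominus>\<^bsub>cauchy_algebra A\<^esub> t = (\<lambda>n. s n \<ominus> s M)"
  proof -
    have "\<ominus>\<^bsub>cauchy_algebra A\<^esub> t = (\<lambda>n. \<ominus> t n)"
      using N.minus_smult[of t 1] t cauchy_inD(1)[OF t]
      by (simp add: cauchy_algebra_simps minus_smult)
    then show ?thesis by (simp add: N.minus_eq cauchy_algebra_simps minus_eq t_def)
  qed
  have "(\<lambda>n. nrm A (s n \<ominus> s M)) \<longlonglongrightarrow> lim (\<lambda>n. nrm A (s n \<ominus> s M))"
    using cauchy_nrm[OF cauchy_add[OF s(1) cauchy_smult[OF t, of "-1"]]] sc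
    by (simp add: minus_smult minus_eq t_def)
  then have "lim (\<lambda>n. nrm A (s n \<ominus> s M)) \<le> e/2"
    by (rule LIMSEQ_le_const2) (use M in \<open>auto intro!: exI[of _ M] less_imp_le\<close>)
  then have le: "nrm (cauchy_algebra A) (s \<ominus>\<^bsub>cauchy_algebra A\<^esub> t) \<le> e/2"
    unfolding diff by (simp add: cauchy_algebra_simps(8))
  have c: "s \<in> carrier (cauchy_algebra A)" "t \<in> carrier (cauchy_algebra A)"
    using s(1) t by (auto simp: cauchy_algebra_simps(1))
  have "nrm N.Q ((null_sequences A +>\<^bsub>cauchy_algebra A\<^esub> s) \<ominus>\<^bsub>N.Q\<^esub> (null_sequences A +>\<^bsub>cauchy_algebra A\<^esub> t)) \<le> e/2"
    unfolding N.quotient_diff[OF c]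
    by (rule order_trans[OF N.quotient_nrm_le_self le]) (use c in auto)
  then show ?thesis
    using that[OF sc[of M]] \<open>e > 0\<close> by (simp add: s(2) cstar_completion_def to_completion_def t_def)
qed

end

context cstar_algebra
begin

lemma tends_unique:
  assumes s: "tends s x" and t: "tends s y" shows "x = y"
proof -
  note c = tendsD(1,2)[OF s] tendsD(2)[OF t]
  have "nrm A (x \<ominus> y) \<le> 0"
  proof (rule LIMSEQ_le_const)
    show "(\<lambda>n. nrm A (s n \<ominus> x) + nrm A (s n \<ominus> y)) \<longlonglongrightarrow> 0"
      using tendsto_add[OF tendsD(3)[OF s] tendsD(3)[OF t]] by simp
    show "\<exists>N. \<forall>n\<ge>N. nrm A (x \<ominus> y) \<le> nrm A (s n \<ominus> x) + nrm A (s n \<ominus> y)"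
      using nrm_diff_triangle[of x "s n" y for n] c nrm_diff_commute[of x] by auto
  qed
  moreover have "0 \<le> nrm A (x \<ominus> y)" using c by (intro nrm_nonneg) auto
  ultimately have "x \<ominus> y = \<zero>" using c by (intro nrm_definite) auto
  then show ?thesis using c by (simp add: minus_eq_zero_iff)
qed

lemma cauchy_tends: "cauchy_in A s \<Longrightarrow> \<exists>x. tends s x"
  using nrm_complete[of s] by (auto simp: tends_def cauchy_inD(1))

end


section \<open>Homomorphisms\<close>

lemma star_homI:
  assumes "\<And>x. x \<in> carrier A \<Longrightarrow> h x \<in> carrier B"
    and "\<And>x y. \<lbrakk>x \<in> carrier A; y \<in> carrier A\<rbrakk> \<Longrightarrow> h (x \<oplus>\<^bsub>A\<^esub> y) = h x \<oplus>\<^bsub>B\<^esub> h y"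
    and "\<And>x y. \<lbrakk>x \<in> carrier A; y \<in> carrier A\<rbrakk> \<Longrightarrow> h (x \<otimes>\<^bsub>A\<^esub> y) = h x \<otimes>\<^bsub>B\<^esub> h y"
    and "h \<one>\<^bsub>A\<^esub> = \<one>\<^bsub>B\<^esub>"
    and "\<And>c x. x \<in> carrier A \<Longrightarrow> h (c \<odot>\<^bsub>A\<^esub> x) = c \<odot>\<^bsub>B\<^esub> h x"
    and "\<And>x. x \<in> carrier A \<Longrightarrow> h (star A x) = star B (h x)"
  shows "h \<in> star_hom A B"
  using assms by (auto simp: star_hom_def intro!: ring_hom_memI)

lemma star_homD:
  assumes "h \<in> star_hom A B"
  shows "x \<in> carrier A \<Longrightarrow> h x \<in> carrier B"
    and "\<lbrakk>x \<in> carrier A; y \<in> carrier A\<rbrakk> \<Longrightarrow> h (x \<oplus>\<^bsub>A\<^esub> y) = h x \<oplus>\<^bsub>B\<^esub> h y"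
    and "\<lbrakk>x \<in> carrier A; y \<in> carrier A\<rbrakk> \<Longrightarrow> h (x \<otimes>\<^bsub>A\<^esub> y) = h x \<otimes>\<^bsub>B\<^esub> h y"
    and "h \<one>\<^bsub>A\<^esub> = \<one>\<^bsub>B\<^esub>"
    and "x \<in> carrier A \<Longrightarrow> h (c \<odot>\<^bsub>A\<^esub> x) = c \<odot>\<^bsub>B\<^esub> h x"
    and "x \<in> carrier A \<Longrightarrow> h (star A x) = star B (h x)"
  using assms by (auto simp: star_hom_def ring_hom_closed ring_hom_add ring_hom_mult ring_hom_one)

lemma star_hom_comp:
  "\<lbrakk>g \<in> star_hom A B; h \<in> star_hom B C\<rbrakk> \<Longrightarrow> (\<lambda>x. h (g x)) \<in> star_hom A C"
  by (rule star_homI) (simp_all add: star_homD[of g A B] star_homD[of h B C])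

lemma star_hom_id: "(\<lambda>x. x) \<in> star_hom A A"
  by (rule star_homI) simp_all

lemma star_hom_zero:
  assumes "star_algebra A" "star_algebra B" "h \<in> star_hom A B"
  shows "h \<zero>\<^bsub>A\<^esub> = \<zero>\<^bsub>B\<^esub>"
proof -
  interpret A: star_algebra A by fact
  interpret B: star_algebra B by fact
  show ?thesis
    using star_homD(5)[OF assms(3), of "\<zero>\<^bsub>A\<^esub>" 0] star_homD(1)[OF assms(3)] by simp
qed

lemma star_hom_minus:
  assumes "star_algebra A" "star_algebra B" "h \<in> star_hom A B" "x \<in> carrier A"
  shows "h (\<ominus>\<^bsub>A\<^esub> x) = \<ominus>\<^bsub>B\<^esub> h x"
proof -
  interpret A: star_algebra A by fact
  interpret B: star_algebra B by fact
  show ?thesis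
    using star_homD(5)[OF assms(3,4), of "-1"] star_homD(1)[OF assms(3)] assms(4)
      A.minus_smult[of x 1] B.minus_smult[of "h x" 1] by simp
qed

lemma star_hom_diff:
  assumes "star_algebra A" "star_algebra B" "h \<in> star_hom A B" "x \<in> carrier A" "y \<in> carrier A"
  shows "h (x \<ominus>\<^bsub>A\<^esub> y) = h x \<ominus>\<^bsub>B\<^esub> h y"
proof -
  interpret A: star_algebra A by fact
  interpret B: star_algebra B by fact
  show ?thesis
    using assms star_homD(2)[OF assms(3), of x "\<ominus>\<^bsub>A\<^esub> y"] star_hom_minus[OF assms(1-3,5)]
    by (simp add: A.minus_eq B.minus_eq)
qed

lemma star_hom_finsum:
  assumes "star_algebra A" "star_algebra B" "h \<in> star_hom A B" "finite S" "\<And>i. i \<in> S \<Longrightarrow> f i \<in> carrier A"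
  shows "h (finsum A f S) = finsum B (\<lambda>i. h (f i)) S"
  using assms(4,5)
proof (induction S)
  case empty
  interpret A: star_algebra A by fact
  interpret B: star_algebra B by fact
  show ?case using star_hom_zero[OF assms(1-3)] by simp
next
  case (insert i S)
  interpret A: star_algebra A by fact
  interpret B: star_algebra B by fact
  show ?case
    using insert star_homD(1,2)[OF assms(3)] by (simp add: Pi_def A.finsum_closed)
qed

lemma star_algebra_nrm_update:
  assumes "star_algebra A" shows "star_algebra (A\<lparr>nrm := q\<rparr>)"
  by (rule star_algebra_image[OF assms, of "\<lambda>x. x"]) auto

lemma seminormed_nrm_update:
  assumes "star_algebra A" "cstar_seminorm A q" shows "seminormed_star_algebra (A\<lparr>nrm := q\<rparr>)"
  using assms(2)
  by (intro seminormed_star_algebra.intro seminormed_star_algebra_axioms.intro star_algebra_nrm_update assms(1))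
    (simp add: cstar_seminorm_def)

lemma cstar_seminorm_hom:
  assumes A: "star_algebra A" and B: "seminormed_star_algebra B" and h: "h \<in> star_hom A B"
  shows "cstar_seminorm A (\<lambda>x. nrm B (h x))"
proof -
  interpret A: star_algebra A by fact
  interpret B: seminormed_star_algebra B by fact
  show ?thesis
    using star_homD[OF h] B.nrm_nonneg B.nrm_triangle B.nrm_mult B.nrm_smult B.nrm_cstar
    by (auto simp: cstar_seminorm_def)
qed

context seminormed_star_ideal
begin

lemma quotient_hom_lift:
  assumes D: "star_algebra D" and h: "h \<in> star_hom A D" and ker: "\<And>x. x \<in> I \<Longrightarrow> h x = \<zero>\<^bsub>D\<^esub>"
  obtains g where "g \<in> star_hom Q D" "\<And>x. x \<in> carrier A \<Longrightarrow> g (I +> x) = h x"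
proof -
  interpret D: star_algebra D by fact
  define g where "g S = h (SOME x. x \<in> S)" for S
  have g: "g (I +> x) = h x" if x: "x \<in> carrier A" for x
  proof -
    define y where "y = (SOME y. y \<in> I +> x)"
    have "y \<in> I +> x" unfolding y_def using coset_self[OF x] by (rule someI)
    then have y: "y \<in> carrier A" "y \<ominus> x \<in> I" using coset_mem_iff[OF x] by auto
    then have "h y \<ominus>\<^bsub>D\<^esub> h x = \<zero>\<^bsub>D\<^esub>"
      using ker[OF y(2)] star_hom_diff[OF star_algebra_axioms D h y(1) x] by simp
    then show ?thesis
      using star_homD(1)[OF h y(1)] star_homD(1)[OF h x]
      by (simp add: g_def y_def[symmetric] D.minus_eq_zero_iff)
  qed
  have "g \<in> star_hom Q D"
    by (rule star_homI)
      (use star_homD[OF h] in \<open>auto simp: quotient_simps quotient_add quotient_mult quotient_smult quotient_star g\<close>)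
  then show ?thesis using that g by blast
qed

end

text \<open>The lift passes through the algebra of Cauchy sequences, on which the limit of the
  images is a star-homomorphism that kills the null sequences.\<close>

lemma completion_hom_lift:
  fixes A :: "'a cstar" and D :: "'d cstar"
  assumes A: "seminormed_star_algebra A" and D: "cstar_algebra D"
    and h: "h \<in> star_hom A D" and le: "\<And>x. x \<in> carrier A \<Longrightarrow> nrm D (h x) \<le> nrm A x"
  obtains g where "g \<in> star_hom (cstar_completion A) D" "\<And>x. x \<in> carrier A \<Longrightarrow> g (to_completion A x) = h x"
proof -
  interpret A: seminormed_star_algebra A by fact
  interpret D: cstar_algebra D by fact
  interpret N: seminormed_star_ideal "cauchy_algebra A" "null_sequences A" by (rule A.null_sequences_ideal)
  define L where "L s = (SOME x. D.tends (\<lambda>n. h (s n)) x)" for s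
  have L: "D.tends (\<lambda>n. h (s n)) (L s)" if s: "cauchy_in A s" for s
  proof -
    have "cauchy_in D (\<lambda>n. h (s n))"
    proof (rule D.cauchy_inI)
      fix e :: real assume "e > 0"
      then obtain M where M: "\<forall>m\<ge>M. \<forall>n\<ge>M. nrm A (s m \<ominus>\<^bsub>A\<^esub> s n) < e" using A.cauchy_inD(2)[OF s] by blast
      have "nrm D (h (s m) \<ominus>\<^bsub>D\<^esub> h (s n)) \<le> nrm A (s m \<ominus>\<^bsub>A\<^esub> s n)" for m n
        using le[of "s m \<ominus>\<^bsub>A\<^esub> s n"] A.cauchy_inD(1)[OF s]
        by (simp add: star_hom_diff[OF A.star_algebra_axioms D.star_algebra_axioms h])
      then show "\<exists>N. \<forall>m\<ge>N. \<forall>n\<ge>N. nrm D (h (s m) \<ominus>\<^bsub>D\<^esub> h (s n)) < e"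
        using M by (meson le_less_trans)
    qed (use A.cauchy_inD(1)[OF s] star_homD(1)[OF h] in auto)
    then have "\<exists>x. D.tends (\<lambda>n. h (s n)) x" by (rule D.cauchy_tends)
    then show ?thesis unfolding L_def by (rule someI_ex)
  qed
  have Leq: "L s = x" if "cauchy_in A s" "D.tends (\<lambda>n. h (s n)) x" for s x
    using D.tends_unique L that by blast
  note c = A.cauchy_inD(1)
  have "L \<in> star_hom (cauchy_algebra A) D"
  proof (rule star_homI; unfold A.cauchy_algebra_simps mem_Collect_eq)
    show "L x \<in> carrier D" if "cauchy_in A x" for x using D.tendsD(2)[OF L[OF that]] .
    show "L (\<lambda>n. x n \<oplus>\<^bsub>A\<^esub> y n) = L x \<oplus>\<^bsub>D\<^esub> L y" if "cauchy_in A x" "cauchy_in A y" for x y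
      using D.tends_add[OF L[OF that(1)] L[OF that(2)]] star_homD(2)[OF h] c that
      by (intro Leq A.cauchy_add) auto
    show "L (\<lambda>n. x n \<otimes>\<^bsub>A\<^esub> y n) = L x \<otimes>\<^bsub>D\<^esub> L y" if "cauchy_in A x" "cauchy_in A y" for x y
      using D.tends_mult[OF L[OF that(1)] L[OF that(2)]] star_homD(3)[OF h] c that
      by (intro Leq A.cauchy_mult) auto
    show "L (\<lambda>n. \<one>\<^bsub>A\<^esub>) = \<one>\<^bsub>D\<^esub>"
      using star_homD(4)[OF h] by (intro Leq A.cauchy_const) (auto intro: D.tends_const)
    show "L (\<lambda>n. k \<odot>\<^bsub>A\<^esub> x n) = k \<odot>\<^bsub>D\<^esub> L x" if "cauchy_in A x" for k x
      using D.tends_smult[OF L[OF that]] star_homD(5)[OF h] c that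
      by (intro Leq A.cauchy_smult) auto
    show "L (\<lambda>n. star A (x n)) = star D (L x)" if "cauchy_in A x" for x
      using D.tends_star[OF L[OF that]] star_homD(6)[OF h] c that
      by (intro Leq A.cauchy_star) auto
  qed
  moreover have "L s = \<zero>\<^bsub>D\<^esub>" if s: "s \<in> null_sequences A" for s
  proof (rule Leq)
    show "cauchy_in A s" using s by (simp add: A.null_sequences_eq A.cauchy_algebra_simps)
    have sc: "\<And>n. s n \<in> carrier A" and s0: "(\<lambda>n. nrm A (s n)) \<longlonglongrightarrow> 0" using s by (auto simp: null_sequences_def)
    show "D.tends (\<lambda>n. h (s n)) \<zero>\<^bsub>D\<^esub>"
      by (rule D.tendsI[OF _ _ _ s0]) (use le sc star_homD(1)[OF h] in \<open>auto simp: D.minus_eq\<close>)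
  qed
  ultimately obtain g where g: "g \<in> star_hom N.Q D"
      "\<And>x. x \<in> carrier (cauchy_algebra A) \<Longrightarrow> g (null_sequences A +>\<^bsub>cauchy_algebra A\<^esub> x) = L x"
    using N.quotient_hom_lift[OF D.star_algebra_axioms] by blast
  have "g (to_completion A x) = h x" if x: "x \<in> carrier A" for x
    unfolding to_completion_def using x star_homD(1)[OF h x]
    by (subst g(2)) (auto simp: A.cauchy_algebra_simps A.cauchy_const intro: Leq D.tends_const)
  with g(1) show ?thesis using that by (simp add: cstar_completion_def)
qed

text \<open>
  A self-adjoint \<open>b\<close> of norm less than \<open>1\<close> is the real part of the unitary \<open>b + i\<surd>(1 - b\<^sup>2)\<close>,
  on which every \<open>C\<^sup>*\<close>-seminorm is at most \<open>1\<close>.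
\<close>

theorem cstar_seminorm_le_nrm:
  fixes A :: "'a cstar" (structure)
  assumes A: "cstar_algebra A" and q: "cstar_seminorm A q" and x: "x \<in> carrier A"
  shows "q x \<le> nrm A x"
proof -
  interpret cstar_algebra A by fact
  define B where "B = A\<lparr>nrm := q\<rparr>"
  interpret B: seminormed_star_algebra B
    unfolding B_def by (rule seminormed_nrm_update[OF star_algebra_axioms q])
  have B: "carrier B = carrier A" "(\<oplus>\<^bsub>B\<^esub>) = (\<oplus>)" "(\<otimes>\<^bsub>B\<^esub>) = (\<otimes>)" "\<one>\<^bsub>B\<^esub> = \<one>" "star B = star A"
      "(\<odot>\<^bsub>B\<^esub>) = (\<odot>)" "nrm B = q"
    by (auto simp: B_def)
  have 1: "q b \<le> 1" if b: "b \<in> carrier A" "star A b = b" "nrm A b < 1" for b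
  proof -
    define c where "c = b \<otimes> b"
    have c: "c \<in> carrier A" "star A c = c" "nrm A c < 1"
      using b nrm_selfadjoint_square[of b] nrm_nonneg[of b] abs_square_less_1[of "nrm A b"]
      by (simp_all add: c_def star_mult)
    obtain s where s0: "cauchy_in A s" and s: "\<And>n. s n \<in> carrier A" "\<And>n. star A (s n) = s n"
      "\<And>n z. \<lbrakk>z \<in> carrier A; c \<otimes> z = z \<otimes> c\<rbrakk> \<Longrightarrow> s n \<otimes> z = z \<otimes> s n"
      "(\<lambda>n. nrm A ((\<one> \<ominus> c) \<ominus> s n \<otimes> s n)) \<longlonglongrightarrow> 0"
      by (rule sqrt_sequence[OF c]) (rule that)
    \<comment> \<open>Completeness turns the approximate root into an element with
      \<open>b\<^sup>2 + r\<^sup>2 = 1\<close> exactly. An approximation in \<open>nrm A\<close>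
      would not be enough, because continuity of \<open>q\<close> is just what is being
      proved.\<close>
    obtain r where r: "tends s r" using cauchy_tends[OF s0] by blast
    have rc: "r \<in> carrier A" using tendsD(2)[OF r] .
    have "star A r = r"
      using tends_unique[OF tends_star[OF r]] r s(2) by simp
    moreover have "b \<otimes> r = r \<otimes> b"
    proof -
      have "s n \<otimes> b = b \<otimes> s n" for n using b by (intro s(3)) (auto simp: c_def m_assoc)
      then show ?thesis
        using tends_unique[OF tends_mult[OF tends_const[OF b(1)] r]] tends_mult[OF r tends_const[OF b(1)]] by simp
    qed
    moreover have "b \<otimes> b \<oplus> r \<otimes> r = \<one>"
    proof -
      have "tends (\<lambda>n. s n \<otimes> s n) (\<one> \<ominus> c)"
        unfolding tends_def using s(1,4) c nrm_diff_commute[of "\<one> \<ominus> c"] by simp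
      then have "r \<otimes> r = \<one> \<ominus> c" using tends_unique tends_mult[OF r r] by blast
      moreover have "c \<oplus> (\<one> \<ominus> c) = \<one>" using c(1) by algebra
      ultimately show ?thesis by (simp add: c_def)
    qed
    ultimately have "(q b)\<^sup>2 \<le> q \<one>"
      using B.nrm_square_le_sum_squares[of b r] b rc by (simp add: B)
    also have "\<dots> \<le> 1" using B.nrm_one_le by (simp add: B)
    finally show ?thesis
      using power2_le_imp_le[of "q b" 1] by simp
  qed
  have 2: "q b \<le> nrm A b" if b: "b \<in> carrier A" "star A b = b" for b
  proof (rule dense_ge)
    fix t assume t: "nrm A b < t"
    have t0: "t > 0" using nrm_nonneg[OF b(1)] t by linarith
    define d where "d = complex_of_real (1/t) \<odot> b"
    have "q d \<le> 1"
    proof (rule 1)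
      show "d \<in> carrier A" "star A d = d" using b by (auto simp: d_def star_smult)
      have "nrm A d = nrm A b / t" using b t0 by (simp add: d_def nrm_smult norm_divide)
      then show "nrm A d < 1" using t t0 by simp
    qed
    moreover have "q d = q b / t" using b t0 B.nrm_smult[of b] by (simp add: d_def B norm_divide)
    ultimately show "q b \<le> t" using t0 by simp
  qed
  \<comment> \<open>The C*-identity for both seminorms reduces the general case to a self-adjoint
    element.\<close>
  have "(q x)\<^sup>2 = q (star A x \<otimes> x)" using B.nrm_cstar[of x] x by (simp add: B)
  also have "\<dots> \<le> nrm A (star A x \<otimes> x)" using x by (intro 2) (auto simp: star_mult star_star)
  also have "\<dots> = (nrm A x)\<^sup>2" using nrm_cstar x by simp
  finally show ?thesis using power2_le_imp_le nrm_nonneg[OF x] by blast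
qed

lemma star_hom_contractive:
  assumes "cstar_algebra A" "seminormed_star_algebra B" "h \<in> star_hom A B" "x \<in> carrier A"
  shows "nrm B (h x) \<le> nrm A x"
  using assms
  by (intro cstar_seminorm_le_nrm cstar_seminorm_hom)
    (auto simp: cstar_algebra_def seminormed_star_algebra_def)

section \<open>Projections summing to one\<close>

context cstar_algebra
begin

text \<open>Norm form of the fact that only zero is both positive and negative: for self-adjoint
  \<open>b\<close>, the bound on \<open>1 - b\<close> says that \<open>b\<close> is positive and the
  bound on \<open>1 + b\<close> says the same of its negative.\<close>

lemma nrm_one_plus_minus_imp_zero:
  assumes b: "b \<in> carrier A" "star A b = b" "nrm A (\<one> \<oplus> b) \<le> 1" "nrm A (\<one> \<ominus> b) \<le> 1"
  shows "b = \<zero>"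
proof (rule nrm_definite[OF b(1)])
  text \<open>With \<open>s\<^sup>2 \<approx> 1 - t(1 - b)\<close> and \<open>r\<^sup>2 \<approx> 1 - t(1 + b)\<close> one has \<open>s\<^sup>2 + r\<^sup>2 \<approx> 2 - 2t\<close>.\<close>
  have main: "nrm A (complex_of_real t \<odot> b) \<le> 3 * (1 - t)" if t: "0 < t" "t < 1" for t
  proof (rule field_le_epsilon)
    fix e :: real assume "e > 0"
    then have e: "e/3 > 0" by simp
    define k where "k = complex_of_real t"
    \<comment> \<open>The factor \<open>t < 1\<close> makes \<open>c\<close> and \<open>d\<close>
      strict contractions, as \<open>sqrt_sequence\<close> requires; it tends to one at the
      end.\<close>
    define c where "c = k \<odot> (\<one> \<ominus> b)"
    define d where "d = k \<odot> (\<one> \<oplus> b)"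
    have c: "c \<in> carrier A" "star A c = c" "nrm A c < 1" and d: "d \<in> carrier A" "star A d = d" "nrm A d < 1"
      using b t by (auto simp: c_def d_def k_def star_smult star_diff star_add nrm_smult
          intro: le_less_trans[OF mult_left_le])
    obtain s where s0: "cauchy_in A s" and s: "\<And>n. s n \<in> carrier A" "\<And>n. star A (s n) = s n"
      "\<And>n z. \<lbrakk>z \<in> carrier A; c \<otimes> z = z \<otimes> c\<rbrakk> \<Longrightarrow> s n \<otimes> z = z \<otimes> s n"
      "(\<lambda>n. nrm A ((\<one> \<ominus> c) \<ominus> s n \<otimes> s n)) \<longlonglongrightarrow> 0"
      by (rule sqrt_sequence[OF c]) (rule that)
    obtain r where r0: "cauchy_in A r" and r: "\<And>n. r n \<in> carrier A" "\<And>n. star A (r n) = r n"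
      "\<And>n z. \<lbrakk>z \<in> carrier A; d \<otimes> z = z \<otimes> d\<rbrakk> \<Longrightarrow> r n \<otimes> z = z \<otimes> r n"
      "(\<lambda>n. nrm A ((\<one> \<ominus> d) \<ominus> r n \<otimes> r n)) \<longlonglongrightarrow> 0"
      by (rule sqrt_sequence[OF d]) (rule that)
    have "\<forall>\<^sub>F n in sequentially. nrm A ((\<one> \<ominus> c) \<ominus> s n \<otimes> s n) < e/3 \<and> nrm A ((\<one> \<ominus> d) \<ominus> r n \<otimes> r n) < e/3"
      by (intro eventually_conj order_tendstoD(2)[OF s(4) e] order_tendstoD(2)[OF r(4) e])
    then have "\<exists>n. nrm A ((\<one> \<ominus> c) \<ominus> s n \<otimes> s n) < e/3 \<and> nrm A ((\<one> \<ominus> d) \<ominus> r n \<otimes> r n) < e/3"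
      by (rule eventually_happens'[OF sequentially_bot])
    then obtain n where n: "nrm A ((\<one> \<ominus> c) \<ominus> s n \<otimes> s n) < e/3" "nrm A ((\<one> \<ominus> d) \<ominus> r n \<otimes> r n) < e/3"
      by blast
    define v w f g where "v = s n" "w = r n" "f = (\<one> \<ominus> c) \<ominus> v \<otimes> v" "g = (\<one> \<ominus> d) \<ominus> w \<otimes> w"
    have vw: "v \<in> carrier A" "w \<in> carrier A" "star A v = v" "star A w = w" 
      using s(1,2) r(1,2) by (auto simp: v_w_f_g_def)
    have fg: "nrm A f < e/3" "nrm A g < e/3" using n by (auto simp: v_w_f_g_def)
    have fgc: "f \<in> carrier A" "g \<in> carrier A" using vw c d by (auto simp: v_w_f_g_def(3,4))
    have cd: "c \<otimes> d = d \<otimes> c"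
    proof -
      have "(\<one> \<ominus> b) \<otimes> (\<one> \<oplus> b) = (\<one> \<oplus> b) \<otimes> (\<one> \<ominus> b)" using b(1) by (algebra, simp add: r_neg1 r_neg2)
      then show ?thesis using b(1) by (simp add: c_def d_def smult_mult_left smult_mult_right)
    qed
    have "w \<otimes> c = c \<otimes> w" using r(3)[of c n] c cd by (simp add: v_w_f_g_def)
    then have "v \<otimes> w = w \<otimes> v" using s(3)[of w n] vw by (simp add: v_w_f_g_def)
    then have "(nrm A v)\<^sup>2 \<le> nrm A (v \<otimes> v \<oplus> w \<otimes> w)"
      using vw by (intro nrm_square_le_sum_squares) auto
    also have "v \<otimes> v \<oplus> w \<otimes> w = ((\<one> \<oplus> \<one>) \<ominus> (c \<oplus> d)) \<ominus> (f \<oplus> g)"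
    proof -
      have "\<lbrakk>p \<in> carrier A; q \<in> carrier A\<rbrakk> \<Longrightarrow>
        p \<oplus> q = ((\<one> \<oplus> \<one>) \<ominus> (c \<oplus> d)) \<ominus> (((\<one> \<ominus> c) \<ominus> p) \<oplus> ((\<one> \<ominus> d) \<ominus> q))" for p q
        using c(1) d(1) by algebra
      then show ?thesis unfolding v_w_f_g_def(3,4) using vw(1,2) m_closed by presburger
    qed
    also have "(\<one> \<oplus> \<one>) \<ominus> (c \<oplus> d) = complex_of_real (2 * (1 - t)) \<odot> \<one>"
    proof -
      have "c \<oplus> d = k \<odot> ((\<one> \<ominus> b) \<oplus> (\<one> \<oplus> b))" using b by (simp add: c_def d_def smult_add_right)
      also have "(\<one> \<ominus> b) \<oplus> (\<one> \<oplus> b) = \<one> \<oplus> \<one>" using b(1) by algebra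
      also have "\<one> \<oplus> \<one> = 2 \<odot> \<one>" using smult_add_left[of \<one> 1 1] by simp
      finally show ?thesis using diff_smult[of \<one> 2 "2 * k"] smult_add_left[of \<one> 1 1]
        by (simp add: smult_smult k_def algebra_simps)
    qed
    also have "nrm A (complex_of_real (2 * (1 - t)) \<odot> \<one> \<ominus> (f \<oplus> g)) \<le> 2 * (1 - t) + (e/3 + e/3)"
    proof -
      have "nrm A (complex_of_real (2 * (1 - t)) \<odot> \<one>) \<le> 2 * (1 - t)"
        using nrm_smult_one_le[of "complex_of_real (2 * (1 - t))"] t by (simp only: norm_of_real) simp
      then show ?thesis
        using nrm_diff[of "complex_of_real (2 * (1 - t)) \<odot> \<one>" "f \<oplus> g"] nrm_triangle[of f g] fg fgc by simp
    qed
    finally have vv: "nrm A (v \<otimes> v) \<le> 2 * (1 - t) + (e/3 + e/3)"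
      using nrm_selfadjoint_square vw by simp
    \<comment> \<open>Besides the \<open>2 (1 - t)\<close> that bounds \<open>v v\<close>, the
      scalar term contributes \<open>1 - t\<close>; this is the origin of the factor 3.\<close>
    have "k \<odot> b = (v \<otimes> v \<oplus> f) \<ominus> (1 - k) \<odot> \<one>"
    proof -
      have "v \<otimes> v \<oplus> f = \<one> \<ominus> c"
      proof -
        have "p \<in> carrier A \<Longrightarrow> p \<oplus> ((\<one> \<ominus> c) \<ominus> p) = \<one> \<ominus> c" for p using c(1) by algebra
        then show ?thesis unfolding v_w_f_g_def(3) using vw(1) m_closed by presburger
      qed
      also have "c = k \<odot> \<one> \<ominus> k \<odot> b" using b by (simp add: c_def smult_diff)
      also have "\<lbrakk>p \<in> carrier A; q \<in> carrier A\<rbrakk> \<Longrightarrow> (\<one> \<ominus> (p \<ominus> q)) \<ominus> (\<one> \<ominus> p) = q" for p q by algebra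
      ultimately show ?thesis using b by (simp add: diff_smult)
    qed
    then have "nrm A (k \<odot> b) \<le> nrm A (v \<otimes> v) + nrm A f + nrm A ((1 - k) \<odot> \<one>)"
      using nrm_diff[of "v \<otimes> v \<oplus> f" "(1 - k) \<odot> \<one>"] nrm_triangle[of "v \<otimes> v" f] vw fgc by simp
    also have "nrm A ((1 - k) \<odot> \<one>) \<le> 1 - t"
    proof -
      have "1 - k = complex_of_real (1 - t)" by (simp add: k_def)
      then have "cmod (1 - k) = 1 - t" unfolding \<open>1 - k = _\<close> norm_of_real using t by simp
      then show ?thesis using nrm_smult_one_le[of "1 - k"] by simp
    qed
    finally show "nrm A (complex_of_real t \<odot> b) \<le> 3 * (1 - t) + e"
      using vv fg by (simp add: k_def)
  qed
  have "nrm A b \<le> 0"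
  proof (rule tendsto_le[OF trivial_limit_at_left_real])
    show "((\<lambda>t. 3 * (1 - t)) \<longlongrightarrow> 0) (at_left (1::real))"
      by (rule tendsto_eq_intros | simp)+
    show "((\<lambda>t. t * nrm A b) \<longlongrightarrow> nrm A b) (at_left (1::real))"
      by (rule tendsto_eq_intros | simp)+
    show "\<forall>\<^sub>F t in at_left (1::real). t * nrm A b \<le> 3 * (1 - t)"
      using main b by (auto simp: eventually_at_left[of 0] nrm_smult intro!: exI[of _ 0])
  qed
  then show "nrm A b = 0" using b nrm_nonneg[of b] by linarith
qed

lemma nrm_one_minus_compression_le:
  assumes p: "p \<in> carrier A" "p \<otimes> p = p" "star A p = p"
    and q: "q \<in> carrier A" "q \<otimes> q = q" "star A q = q"
  shows "nrm A (\<one> \<ominus> p \<otimes> q \<otimes> p) \<le> 1"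
proof -
  text \<open>\<open>1 - p q p\<close> is the orthogonal sum of the projection \<open>1 - p\<close> and the contraction \<open>p (1 - q) p\<close>,
    so that its powers are bounded by \<open>2\<close>.\<close>
  have proj1: "nrm A r \<le> 1" if "r \<in> carrier A" "r \<otimes> r = r" "star A r = r" for r
  proof -
    have "nrm A r = (nrm A r)\<^sup>2" using nrm_selfadjoint_square[of r] that by simp
    then have "nrm A r = 0 \<or> nrm A r = 1" by (simp add: power2_eq_square)
    then show ?thesis by auto
  qed
  have proj_compl: "(\<one> \<ominus> r) \<otimes> (\<one> \<ominus> r) = \<one> \<ominus> r" if "r \<in> carrier A" "r \<otimes> r = r" for r
    using that by (simp add: minus_eq l_distr r_distr l_minus r_minus a_ac r_neg2 r_neg)
  define e where "e = \<one> \<ominus> p"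
  define c where "c = p \<otimes> (\<one> \<ominus> q) \<otimes> p"
  have ec: "e \<in> carrier A" "c \<in> carrier A" using p q by (auto simp: e_def c_def)
  have star: "star A e = e" "star A c = c"
    using p q by (auto simp: e_def c_def star_diff star_mult m_assoc)
  have ee: "e \<otimes> e = e" using proj_compl p by (simp add: e_def)
  have pe: "p \<otimes> e = \<zero>" "e \<otimes> p = \<zero>" using p by (auto simp: e_def minus_eq r_distr l_distr r_minus l_minus r_neg)
  have ce0: "c \<otimes> e = \<zero>" using p q ec pe by (simp add: c_def m_assoc)
  have ec0: "e \<otimes> c = \<zero>"
  proof -
    have "e \<otimes> c = (e \<otimes> p) \<otimes> ((\<one> \<ominus> q) \<otimes> p)" using p q ec by (simp add: c_def m_assoc)
    then show ?thesis using pe p q by simp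
  qed
  have y: "\<one> \<ominus> p \<otimes> q \<otimes> p = e \<oplus> c"
  proof -
    have "e \<oplus> c = \<one> \<ominus> p \<oplus> (p \<otimes> p \<ominus> p \<otimes> q \<otimes> p)"
      unfolding e_def c_def using p(1) q(1) by algebra
    also have "\<dots> = \<one> \<ominus> p \<otimes> q \<otimes> p"
      unfolding p(2) using p(1) q(1) by algebra
    finally show ?thesis by simp
  qed
  have nc: "nrm A c \<le> 1"
    unfolding c_def
    using nrm_mult_le[of "p \<otimes> (\<one> \<ominus> q)" p 1 1] nrm_mult_le[of p "\<one> \<ominus> q" 1 1]
      proj1[OF p] proj1[of "\<one> \<ominus> q"] proj_compl[of q] p q by (simp add: star_diff)
  \<comment> \<open>Powers are formed by repeated squaring because the C*-identity determines the
    norm of the square of a self-adjoint element exactly. As \<open>e\<close> and \<open>d\<close>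
    annihilate each other, squaring \<open>e + d\<close> affects only \<open>d\<close>.\<close>
  have iter: "\<exists>d. d \<in> carrier A \<and> star A d = d \<and> nrm A d \<le> 1 \<and> e \<otimes> d = \<zero> \<and> d \<otimes> e = \<zero> \<and>
      nrm A (e \<oplus> d) = (nrm A (e \<oplus> c)) ^ (2 ^ n)" for n
  proof (induction n)
    case 0
    then show ?case using ec star nc ce0 ec0 by (intro exI[of _ c]) auto
  next
    case (Suc n)
    then obtain d where d: "d \<in> carrier A" "star A d = d" "nrm A d \<le> 1" "e \<otimes> d = \<zero>" "d \<otimes> e = \<zero>"
        "nrm A (e \<oplus> d) = (nrm A (e \<oplus> c)) ^ (2 ^ n)" by blast
    have "(e \<oplus> d) \<otimes> (e \<oplus> d) = e \<oplus> d \<otimes> d"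
      using d ec ee by (simp add: l_distr r_distr)
    then have "nrm A (e \<oplus> d \<otimes> d) = (nrm A (e \<oplus> c)) ^ (2 ^ Suc n)"
      using nrm_selfadjoint_square[of "e \<oplus> d"] d ec star
      by (simp add: star_add power_mult[symmetric] mult.commute)
    moreover have "e \<otimes> (d \<otimes> d) = \<zero>" "(d \<otimes> d) \<otimes> e = \<zero>"
      using d ec by (simp_all add: m_assoc[symmetric]) (simp add: m_assoc)
    ultimately show ?case
      using d nrm_mult_le[of d d 1 1] by (intro exI[of _ "d \<otimes> d"]) (auto simp: star_mult)
  qed
  have bound: "(nrm A (e \<oplus> c)) ^ (2 ^ n) \<le> 2" for n
  proof -
    obtain d where "d \<in> carrier A" "nrm A d \<le> 1" "nrm A (e \<oplus> d) = (nrm A (e \<oplus> c)) ^ (2 ^ n)"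
      using iter[of n] by blast
    then show ?thesis using nrm_triangle[of e d] proj1[OF ec(1) ee star(1)] ec by simp
  qed
  have "nrm A (e \<oplus> c) \<le> 1"
  proof (rule ccontr)
    assume "\<not> ?thesis"
    then have gt: "nrm A (e \<oplus> c) > 1" by simp
    obtain n where n: "2 < (nrm A (e \<oplus> c)) ^ n" using real_arch_pow[OF gt] by blast
    also have "\<dots> \<le> (nrm A (e \<oplus> c)) ^ (2 ^ n)"
      using gt by (intro power_increasing) (auto simp: less_imp_le)
    finally show False using bound[of n] by simp
  qed
  then show ?thesis using y by simp
qed

text \<open>Compressing the sum by \<open>P k\<close> and cancelling the term \<open>l = k\<close>
  leaves a vanishing sum of the elements \<open>C l = P k P l P k\<close>, each positive in the
  sense that \<open>1 - C l\<close> has norm at most one. So \<open>C j\<close> is also minus a sum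
  of such elements and must be zero by \<open>nrm_one_plus_minus_imp_zero\<close>. Finally
  \<open>C j\<close> is the product of the star of \<open>P j P k\<close> with
  \<open>P j P k\<close>.\<close>

theorem projections_orthogonal:
  assumes J: "finite J" and P: "\<And>j. j \<in> J \<Longrightarrow> P j \<in> carrier A" "\<And>j. j \<in> J \<Longrightarrow> P j \<otimes> P j = P j"
      "\<And>j. j \<in> J \<Longrightarrow> star A (P j) = P j"
    and sum: "finsum A P J = \<one>" and jk: "j \<in> J" "k \<in> J" "j \<noteq> k"
  shows "P j \<otimes> P k = \<zero>"
proof -
  define C where "C = (\<lambda>l. P k \<otimes> P l \<otimes> P k)"
  have C: "C l \<in> carrier A" "star A (C l) = C l" "nrm A (\<one> \<ominus> C l) \<le> 1" if "l \<in> J" for l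
    using P[OF that] P[OF jk(2)] nrm_one_minus_compression_le by (auto simp: C_def star_mult m_assoc)
  have Ck: "C k = P k" using P[OF jk(2)] by (simp add: C_def)
  have "finsum A C J = P k"
  proof -
    have "finsum A C J = P k \<otimes> finsum A P J \<otimes> P k"
      using J P jk by (simp add: C_def finsum_ldistr finsum_rdistr Pi_def)
    then show ?thesis using sum P[OF jk(2)] by simp
  qed
  define K where "K = J - {k} - {j}"
  have K: "finite K" "K \<subseteq> J" using J by (auto simp: K_def)
  have "finsum A C J = C k \<oplus> (C j \<oplus> finsum A C K)"
  proof -
    have "J = insert k (insert j K)" "k \<notin> insert j K" "j \<notin> K" using jk by (auto simp: K_def)
    then show ?thesis using C K jk by (simp add: Pi_def subset_iff)
  qed
  moreover have "finsum A C K \<in> carrier A" by (rule finsum_closed) (use C(1) K in auto)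
  then have z: "C j \<oplus> finsum A C K \<in> carrier A" using C(1) jk by simp
  ultimately have sumK: "C j \<oplus> finsum A C K = \<zero>"
    using \<open>finsum A C J = P k\<close> Ck P(1)[OF jk(2)] r_neg1[of "P k" "C j \<oplus> finsum A C K"] by (simp add: l_neg)
  have ineq: "nrm A (of_nat (card S) \<odot> \<one> \<ominus> finsum A C S) \<le> card S" if "finite S" "S \<subseteq> J" for S
    using that
  proof (induction S)
    case empty
    then show ?case by (simp add: minus_eq)
  next
    case (insert l S)
    have l: "C l \<in> carrier A" "finsum A C S \<in> carrier A" using insert C(1) by (auto intro!: finsum_closed)
    have "of_nat (card (insert l S)) \<odot> \<one> \<ominus> finsum A C (insert l S)
        = (\<one> \<oplus> of_nat (card S) \<odot> \<one>) \<ominus> (C l \<oplus> finsum A C S)"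
      using insert C by (simp add: smult_add_left Pi_def subset_iff)
    also have "\<dots> = (\<one> \<ominus> C l) \<oplus> (of_nat (card S) \<odot> \<one> \<ominus> finsum A C S)"
    proof -
      have "\<lbrakk>a \<in> carrier A; x \<in> carrier A; y \<in> carrier A\<rbrakk> \<Longrightarrow> (\<one> \<oplus> a) \<ominus> (x \<oplus> y) = (\<one> \<ominus> x) \<oplus> (a \<ominus> y)" for a x y
        by algebra
      from this[OF smult_in[OF one_closed] l] show ?thesis .
    qed
    finally show ?case
      using nrm_triangle[of "\<one> \<ominus> C l" "of_nat (card S) \<odot> \<one> \<ominus> finsum A C S"] insert C(3)[of l] l
      by simp
  qed
  \<comment> \<open>With \<open>b = C j / N\<close>, the element \<open>1 + b\<close> is the mean of
    the \<open>N\<close> contractions \<open>1\<close> and \<open>1 - C l\<close> for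
    \<open>l\<close> in \<open>K\<close>, while \<open>1 - b\<close> is a convex combination of
    \<open>1\<close> and \<open>1 - C j\<close>.\<close>
  define N :: real where "N = real (card K) + 1"
  have N: "N > 0" by (simp add: N_def add_nonneg_pos)
  define b where "b = complex_of_real (1/N) \<odot> C j"
  have cj: "C j \<in> carrier A" "finsum A C K \<in> carrier A" using C(1) jk K by (auto intro!: finsum_closed)
  have Cj: "C j = \<ominus> finsum A C K"
    by (rule minus_equality[OF sumK cj(2,1), symmetric])
  have b: "b \<in> carrier A" "star A b = b" using C jk by (auto simp: b_def star_smult)
  have "nrm A (\<one> \<oplus> b) \<le> 1"
  proof -
    have "\<one> \<oplus> b = complex_of_real (1/N) \<odot> (\<one> \<oplus> (of_nat (card K) \<odot> \<one> \<ominus> finsum A C K))"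
    proof -
      have "\<one> \<oplus> (of_nat (card K) \<odot> \<one> \<ominus> finsum A C K) = (of_nat (card K) + 1) \<odot> \<one> \<oplus> C j"
        using cj by (simp add: Cj smult_add_left minus_eq a_ac)
      also have "of_nat (card K) + 1 = complex_of_real N" by (simp add: N_def)
      finally show ?thesis using N cj by (simp add: b_def smult_add_right smult_smult)
    qed
    also have "nrm A \<dots> = (1/N) * nrm A (\<one> \<oplus> (of_nat (card K) \<odot> \<one> \<ominus> finsum A C K))"
      using N cj by (simp add: nrm_smult norm_divide)
    also have "\<dots> \<le> (1/N) * N"
      using nrm_triangle[of \<one> "of_nat (card K) \<odot> \<one> \<ominus> finsum A C K"] ineq[OF K] nrm_one_le cj N
      by (intro mult_left_mono) (auto simp: N_def)
    finally show ?thesis using N by simp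
  qed
  moreover have "nrm A (\<one> \<ominus> b) \<le> 1"
  proof -
    define k where "k = complex_of_real (1/N)"
    have "\<one> \<ominus> b = (1 - k) \<odot> \<one> \<oplus> k \<odot> (\<one> \<ominus> C j)"
    proof -
      have "\<lbrakk>x \<in> carrier A; y \<in> carrier A\<rbrakk> \<Longrightarrow> \<one> \<ominus> y = (\<one> \<ominus> x) \<oplus> (x \<ominus> y)" for x y by algebra
      then have "\<one> \<ominus> b = (\<one> \<ominus> k \<odot> \<one>) \<oplus> (k \<odot> \<one> \<ominus> b)" using b(1) by (metis smult_in one_closed)
      then show ?thesis using cj by (simp add: diff_smult smult_diff b_def k_def)
    qed
    then have "nrm A (\<one> \<ominus> b) \<le> nrm A ((1 - k) \<odot> \<one>) + nrm A (k \<odot> (\<one> \<ominus> C j))"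
      using nrm_triangle cj by simp
    also have "nrm A ((1 - k) \<odot> \<one>) \<le> 1 - 1/N"
    proof -
      have "1 - k = complex_of_real (1 - 1/N)" by (simp add: k_def)
      moreover have "1 - 1/N \<ge> 0" using N by (simp add: N_def)
      ultimately show ?thesis using nrm_smult_one_le[of "1 - k"] by (simp only: norm_of_real abs_of_nonneg)
    qed
    also have "nrm A (k \<odot> (\<one> \<ominus> C j)) \<le> 1/N * 1"
      using C(3)[OF jk(1)] cj N by (simp add: nrm_smult k_def norm_divide divide_right_mono)
    finally show ?thesis by simp
  qed
  ultimately have "b = \<zero>" using nrm_one_plus_minus_imp_zero b by blast
  then have "C j = \<zero>"
  proof -
    have "C j = complex_of_real N \<odot> b" using N cj by (simp add: b_def smult_smult)
    then show ?thesis using \<open>b = \<zero>\<close> by simp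
  qed
  then have "nrm A (P j \<otimes> P k) = 0"
  proof -
    have "star A (P j \<otimes> P k) \<otimes> (P j \<otimes> P k) = P k \<otimes> (P j \<otimes> P j) \<otimes> P k"
      using P(1,3)[OF jk(1)] P(1,3)[OF jk(2)] by (simp add: star_mult m_assoc)
    then have "(nrm A (P j \<otimes> P k))\<^sup>2 = nrm A (C j)"
      using nrm_cstar[of "P j \<otimes> P k"] P jk by (simp add: C_def)
    then show ?thesis using \<open>C j = \<zero>\<close> by simp
  qed
  then show ?thesis using P jk by (intro nrm_definite) auto
qed

end


section \<open>The free star algebra\<close>

lemma star_poly_induct [case_names zero add]:
  fixes f :: "'g star_poly"
  assumes "P 0" and "\<And>w c f. P f \<Longrightarrow> P (Poly_Mapping.single w c + f)"
  shows "P f"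
proof (induction f rule: update_induct)
  case const
  then show ?case by (rule assms(1))
next
  case (update f a b)
  have "Poly_Mapping.update a b f = Poly_Mapping.single a b + f"
    using update(1)
    by (intro poly_mapping_eqI) (auto simp: Poly_Mapping.lookup_update Poly_Mapping.lookup_add Poly_Mapping.lookup_single when_def in_keys_iff)
  then show ?case using assms(2)[OF update(3)] by simp
qed

lemma lookup_poly_star: "Poly_Mapping.lookup (poly_star f) w = cnj (Poly_Mapping.lookup f (word_star w))"
  by transfer simp

lemma word_star_add: "word_star (v + w) = word_star w + word_star v"
  by (simp add: word_star_def plus_word_def)

lemma word_star_zero [simp]: "word_star 0 = 0"
  by (simp add: word_star_def zero_word_def)

lemma poly_star_single: "poly_star (Poly_Mapping.single w c) = Poly_Mapping.single (word_star w) (cnj c)"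
  by (rule poly_mapping_eqI) (metis complex_cnj_zero lookup_poly_star Poly_Mapping.lookup_single_eq Poly_Mapping.lookup_single_not_eq word_star_word_star)

lemma poly_star_zero [simp]: "poly_star 0 = 0"
  by (rule poly_mapping_eqI) (simp add: lookup_poly_star)

lemma poly_star_add: "poly_star (f + g) = poly_star f + poly_star g"
  by (rule poly_mapping_eqI) (simp add: lookup_poly_star Poly_Mapping.lookup_add)

lemma poly_star_poly_star [simp]: "poly_star (poly_star f) = f"
  by (rule poly_mapping_eqI) (simp add: lookup_poly_star)

lemma poly_star_mult: "poly_star (f * g) = poly_star g * poly_star f"
proof (induction f rule: star_poly_induct)
  case (add v c f)
  have "poly_star (Poly_Mapping.single v c * g) = poly_star g * poly_star (Poly_Mapping.single v c)" for g
    by (induction g rule: star_poly_induct)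
      (simp_all add: poly_star_add distrib_left distrib_right mult_single poly_star_single word_star_add mult.commute)
  then show ?case using add by (simp add: distrib_left distrib_right poly_star_add)
qed simp

lemma scalar_commute: "f * scalar c = scalar c * f"
  by (induction f rule: star_poly_induct) (simp_all add: distrib_left distrib_right scalar_def mult_single mult.commute)

lemma scalar_add: "scalar (c + d) = scalar c + scalar d"
  and scalar_mult: "scalar (c * d) = scalar c * scalar d"
  and scalar_one [simp]: "scalar 1 = 1"
  and scalar_zero [simp]: "scalar 0 = 0"
  and scalar_minus_one [simp]: "scalar (-1) = -1"
  and poly_star_scalar [simp]: "poly_star (scalar c) = scalar (cnj c)"
  by (simp_all add: scalar_def single_add mult_single single_uminus poly_star_single)

abbreviation words :: "'g set \<Rightarrow> 'g word set" where
  "words G \<equiv> {w. fst ` set (letters w) \<subseteq> G}"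

lemma star_polys_iff: "f \<in> star_polys G \<longleftrightarrow> Poly_Mapping.keys f \<subseteq> words G"
  by (auto simp: star_polys_def)

lemma words_add: "\<lbrakk>v \<in> words G; w \<in> words G\<rbrakk> \<Longrightarrow> v + w \<in> words G"
  by (auto simp: plus_word_def)

lemma star_polys_add [simp]: "\<lbrakk>f \<in> star_polys G; g \<in> star_polys G\<rbrakk> \<Longrightarrow> f + g \<in> star_polys G"
  using keys_add[of f g] unfolding star_polys_iff by blast

lemma star_polys_mult [simp]: "\<lbrakk>f \<in> star_polys G; g \<in> star_polys G\<rbrakk> \<Longrightarrow> f * g \<in> star_polys G"
  using keys_mult[of f g] words_add[of _ G] unfolding star_polys_iff by blast

lemma star_polys_single: "w \<in> words G \<Longrightarrow> Poly_Mapping.single w c \<in> star_polys G"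
  by (auto simp: star_polys_iff)

lemma star_polys_scalar [simp]: "scalar c \<in> star_polys G"
  unfolding scalar_def by (rule star_polys_single) (simp add: zero_word_def)

lemma star_polys_zero [simp]: "0 \<in> star_polys G"
  and star_polys_one [simp]: "1 \<in> star_polys G"
  using star_polys_scalar[of 0 G] star_polys_scalar[of 1 G] by simp_all

lemma star_polys_gen [simp]: "gen g \<in> star_polys G \<longleftrightarrow> g \<in> G"
  by (simp add: gen_def star_polys_iff)

lemma star_polys_uminus [simp]: "f \<in> star_polys G \<Longrightarrow> - f \<in> star_polys G"
  using star_polys_mult[OF star_polys_scalar[of "-1"]] by force

lemma star_polys_diff [simp]: "\<lbrakk>f \<in> star_polys G; g \<in> star_polys G\<rbrakk> \<Longrightarrow> f - g \<in> star_polys G"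
  using star_polys_add[of f G "- g"] by simp

lemma star_polys_sum [simp]: "(\<And>i. i \<in> S \<Longrightarrow> F i \<in> star_polys G) \<Longrightarrow> sum F S \<in> star_polys G"
  by (induction S rule: infinite_finite_induct) auto

lemma star_polys_poly_star [simp]:
  assumes "f \<in> star_polys G" shows "poly_star f \<in> star_polys G"
  unfolding star_polys_iff
proof
  fix w assume "w \<in> Poly_Mapping.keys (poly_star f)"
  then have "word_star w \<in> Poly_Mapping.keys f" by (simp add: in_keys_iff lookup_poly_star)
  then have "word_star w \<in> words G" using assms by (auto simp: star_polys_iff)
  then show "w \<in> words G" by (force simp: word_star_def)
qed

text \<open>A monomial is peeled letter by letter from the left, each letter being a generator or
  the star of one; its coefficient stays with the empty word.\<close>

lemma star_polys_induct [consumes 1, case_names scalar gen star add mult]: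
  assumes f: "f \<in> star_polys G"
    and sc: "\<And>c. P (scalar c)" and ge: "\<And>g. g \<in> G \<Longrightarrow> P (gen g)" and st: "\<And>g. g \<in> G \<Longrightarrow> P (poly_star (gen g))"
    and ad: "\<And>f g. \<lbrakk>f \<in> star_polys G; g \<in> star_polys G; P f; P g\<rbrakk> \<Longrightarrow> P (f + g)"
    and mu: "\<And>f g. \<lbrakk>f \<in> star_polys G; g \<in> star_polys G; P f; P g\<rbrakk> \<Longrightarrow> P (f * g)"
  shows "P f"
proof -
  have single: "P (Poly_Mapping.single (Word ls) c)" if "Word ls \<in> words G" for ls c
    using that
  proof (induction ls)
    case Nil
    then show ?case using sc[of c] by (simp add: scalar_def zero_word_def)
  next
    case (Cons l ls)
    obtain g b where l: "l = (g, b)" by force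
    have eq: "Poly_Mapping.single (Word (l # ls)) c
        = (if b then poly_star (gen g) else gen g) * Poly_Mapping.single (Word ls) c"
      by (simp add: l gen_def poly_star_single mult_single plus_word_def word_star_def)
    have ls: "Word ls \<in> words G" and g: "g \<in> G" using Cons.prems by (auto simp: l)
    show ?case unfolding eq
      using Cons.IH[OF ls] star_polys_single[OF ls] ge[OF g] st[OF g] g by (intro mu) auto
  qed
  show ?thesis using f
  proof (induction f rule: update_induct)
    case const
    then show ?case using sc[of 0] by simp
  next
    case (update f a b)
    have eq: "Poly_Mapping.update a b f = Poly_Mapping.single a b + f"
      using update(1)
      by (intro poly_mapping_eqI) (auto simp: Poly_Mapping.lookup_update Poly_Mapping.lookup_add Poly_Mapping.lookup_single when_def in_keys_iff)
    have "Poly_Mapping.keys (Poly_Mapping.update a b f) = insert a (Poly_Mapping.keys f)"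
      using update(2) by (auto simp: keys_update)
    then have a: "a \<in> words G" and fG: "f \<in> star_polys G" using update(4) by (auto simp: star_polys_iff)
    show ?case unfolding eq
      using single[of "letters a" b] a fG update(3) star_polys_single[OF a] by (intro ad) auto
  qed
qed

lemma free_star_algebra_simps [simp]:
  "carrier (free_star_algebra G p) = star_polys G"
  "x \<otimes>\<^bsub>free_star_algebra G p\<^esub> y = x * y" "x \<oplus>\<^bsub>free_star_algebra G p\<^esub> y = x + y"
  "\<one>\<^bsub>free_star_algebra G p\<^esub> = 1" "\<zero>\<^bsub>free_star_algebra G p\<^esub> = 0"
  "c \<odot>\<^bsub>free_star_algebra G p\<^esub> x = scalar c * x" "star (free_star_algebra G p) = poly_star"
  "nrm (free_star_algebra G p) = p"
  by (simp_all add: free_star_algebra_def)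

lemma star_algebra_free: "star_algebra (free_star_algebra G p)"
proof (rule star_algebraI)
  fix x y :: "'a star_poly" and c
  show "x \<otimes>\<^bsub>free_star_algebra G p\<^esub> (c \<odot>\<^bsub>free_star_algebra G p\<^esub> y)
      = c \<odot>\<^bsub>free_star_algebra G p\<^esub> (x \<otimes>\<^bsub>free_star_algebra G p\<^esub> y)"
    by (simp, metis mult.assoc scalar_commute)
  show "star (free_star_algebra G p) (c \<odot>\<^bsub>free_star_algebra G p\<^esub> x)
      = cnj c \<odot>\<^bsub>free_star_algebra G p\<^esub> star (free_star_algebra G p) x"
    by (simp add: poly_star_mult scalar_commute[of "poly_star x"])
qed (simp_all add: scalar_add scalar_mult poly_star_add poly_star_mult distrib_left distrib_right ac_simps)

text \<open>The seminorm argument of \<^const>\<open>free_star_algebra\<close> is irrelevant here.\<close>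

definition free_hom :: "'g set \<Rightarrow> 'a cstar \<Rightarrow> ('g star_poly \<Rightarrow> 'a) \<Rightarrow> bool" where
  "free_hom G D h \<longleftrightarrow> star_algebra D \<and> h \<in> star_hom (free_star_algebra G (\<lambda>_. 0)) D"

lemma free_hom_iff: "star_algebra D \<Longrightarrow> h \<in> star_hom (free_star_algebra G p) D \<longleftrightarrow> free_hom G D h"
  by (auto simp: free_hom_def star_hom_def ring_hom_def)

lemma free_homD:
  assumes "free_hom G D h"
  shows "f \<in> star_polys G \<Longrightarrow> h f \<in> carrier D"
    and "\<lbrakk>f \<in> star_polys G; g \<in> star_polys G\<rbrakk> \<Longrightarrow> h (f + g) = h f \<oplus>\<^bsub>D\<^esub> h g"
    and "\<lbrakk>f \<in> star_polys G; g \<in> star_polys G\<rbrakk> \<Longrightarrow> h (f * g) = h f \<otimes>\<^bsub>D\<^esub> h g"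
    and "f \<in> star_polys G \<Longrightarrow> h (poly_star f) = star D (h f)"
    and "f \<in> star_polys G \<Longrightarrow> h (scalar c * f) = c \<odot>\<^bsub>D\<^esub> h f"
    and "h 1 = \<one>\<^bsub>D\<^esub>" and "h 0 = \<zero>\<^bsub>D\<^esub>"
    and "\<lbrakk>f \<in> star_polys G; g \<in> star_polys G\<rbrakk> \<Longrightarrow> h (f - g) = h f \<ominus>\<^bsub>D\<^esub> h g"
    and "\<lbrakk>finite S; \<And>i. i \<in> S \<Longrightarrow> F i \<in> star_polys G\<rbrakk> \<Longrightarrow> h (sum F S) = finsum D (\<lambda>i. h (F i)) S"
proof -
  interpret D: star_algebra D using assms by (simp add: free_hom_def)
  interpret F: star_algebra "free_star_algebra G (\<lambda>_. 0)" by (rule star_algebra_free)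
  have h: "h \<in> star_hom (free_star_algebra G (\<lambda>_. 0)) D" using assms by (simp add: free_hom_def)
  note H = star_homD[OF h, simplified]
  show 1: "\<And>f. f \<in> star_polys G \<Longrightarrow> h f \<in> carrier D" by (rule H(1))
  show 2: "\<And>f g. \<lbrakk>f \<in> star_polys G; g \<in> star_polys G\<rbrakk> \<Longrightarrow> h (f + g) = h f \<oplus>\<^bsub>D\<^esub> h g" by (rule H(2))
  show "\<lbrakk>f \<in> star_polys G; g \<in> star_polys G\<rbrakk> \<Longrightarrow> h (f * g) = h f \<otimes>\<^bsub>D\<^esub> h g" by (rule H(3))
  show "f \<in> star_polys G \<Longrightarrow> h (poly_star f) = star D (h f)" by (rule H(6))
  show 3: "\<And>f c. f \<in> star_polys G \<Longrightarrow> h (scalar c * f) = c \<odot>\<^bsub>D\<^esub> h f" by (rule H(5))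
  show "h 1 = \<one>\<^bsub>D\<^esub>" by (rule H(4))
  show 0: "h 0 = \<zero>\<^bsub>D\<^esub>" using 3[of 0 0] 1[of 0] by simp
  show "\<lbrakk>f \<in> star_polys G; g \<in> star_polys G\<rbrakk> \<Longrightarrow> h (f - g) = h f \<ominus>\<^bsub>D\<^esub> h g"
    using 2[of f "- g"] 3[of g "-1"] 1 by (simp add: D.minus_eq D.minus_smult)
  show "h (sum F S) = finsum D (\<lambda>i. h (F i)) S" if "finite S" "\<And>i. i \<in> S \<Longrightarrow> F i \<in> star_polys G"
    using that
  proof (induction S)
    case (insert i S)
    then have "h (sum F (insert i S)) = h (F i) \<oplus>\<^bsub>D\<^esub> h (sum F S)" using 2[of "F i" "sum F S"] by simp
    also have "\<dots> = finsum D (\<lambda>i. h (F i)) (insert i S)"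
      using insert 1 by (simp add: Pi_def)
    finally show ?case .
  qed (use 0 in simp)
qed

section \<open>Evaluation of noncommutative polynomials\<close>

context star_algebra
begin

definition eval_word :: "('g \<Rightarrow> 'a) \<Rightarrow> 'g word \<Rightarrow> 'a" where
  "eval_word d w = foldr (\<lambda>(g, b) x. (if b then star A (d g) else d g) \<otimes> x) (letters w) \<one>"

definition eval_poly :: "('g \<Rightarrow> 'a) \<Rightarrow> 'g star_poly \<Rightarrow> 'a" where
  "eval_poly d f = finsum A (\<lambda>w. Poly_Mapping.lookup f w \<odot> eval_word d w) (Poly_Mapping.keys f)"

context
  fixes G :: "'g set" and d :: "'g \<Rightarrow> 'a"
  assumes d: "g \<in> G \<Longrightarrow> d g \<in> carrier A"
begin

lemma eval_word_closed: "w \<in> words G \<Longrightarrow> eval_word d w \<in> carrier A"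
proof -
  have "fst ` set ls \<subseteq> G \<Longrightarrow> eval_word d (Word ls) \<in> carrier A" for ls
    by (induction ls) (auto simp: eval_word_def d)
  from this[of "letters w"] show "w \<in> words G \<Longrightarrow> eval_word d w \<in> carrier A" by simp
qed

lemma eval_word_add:
  assumes "v \<in> words G" "w \<in> words G"
  shows "eval_word d (v + w) = eval_word d v \<otimes> eval_word d w"
proof -
  have "fst ` set ls \<subseteq> G \<Longrightarrow> eval_word d (Word ls + w) = eval_word d (Word ls) \<otimes> eval_word d w" for ls
  proof (induction ls)
    case Nil
    then show ?case using eval_word_closed[OF assms(2)] by (simp add: eval_word_def plus_word_def)
  next
    case (Cons l ls)
    have "eval_word d (Word ls) \<in> carrier A" using Cons.prems by (intro eval_word_closed) auto
    then show ?case
      using Cons eval_word_closed[OF assms(2)] by (cases l) (auto simp: eval_word_def plus_word_def m_assoc d)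
  qed
  from this[of "letters v"] show ?thesis using assms by simp
qed

lemma eval_word_star:
  assumes "w \<in> words G" shows "eval_word d (word_star w) = star A (eval_word d w)"
proof -
  have "fst ` set ls \<subseteq> G \<Longrightarrow> eval_word d (word_star (Word ls)) = star A (eval_word d (Word ls))" for ls
  proof (induction ls)
    case Nil
    then show ?case by (simp add: eval_word_def word_star_def)
  next
    case (Cons l ls)
    obtain g b where l: "l = (g, b)" by force
    have g: "g \<in> G" and ls: "Word ls \<in> words G" using Cons.prems by (auto simp: l)
    have "word_star (Word (l # ls)) = word_star (Word ls) + Word [(g, \<not> b)]"
      by (simp add: word_star_def plus_word_def l)
    moreover have "word_star (Word ls) \<in> words G" using ls by (force simp: word_star_def)
    moreover have "Word [(g, \<not> b)] \<in> words G" using g by simp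
    ultimately have "eval_word d (word_star (Word (l # ls)))
        = star A (eval_word d (Word ls)) \<otimes> eval_word d (Word [(g, \<not> b)])"
      using Cons by (simp add: eval_word_add)
    then show ?case
      using eval_word_closed[OF ls] d[OF g]
      by (simp add: eval_word_def l star_mult star_star)
  qed
  from this[of "letters w"] show ?thesis using assms by simp
qed

text \<open>The support of a sum or product can shrink by cancellation; a fixed larger index set
  lets several polynomials be evaluated over the same sum.\<close>

lemma eval_poly_superset:
  assumes "finite S" "S \<subseteq> words G" "Poly_Mapping.keys f \<subseteq> S"
  shows "eval_poly d f = finsum A (\<lambda>w. Poly_Mapping.lookup f w \<odot> eval_word d w) S"
  unfolding eval_poly_def
  by (rule add.finprod_mono_neutral_cong_left[OF assms(1,3)])
    (use assms eval_word_closed in \<open>auto simp: in_keys_iff subset_iff\<close>)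

lemma eval_poly_closed: "f \<in> star_polys G \<Longrightarrow> eval_poly d f \<in> carrier A"
  unfolding eval_poly_def star_polys_iff
  by (rule finsum_closed) (use eval_word_closed in auto)

lemma eval_poly_add:
  assumes "f \<in> star_polys G" "g \<in> star_polys G"
  shows "eval_poly d (f + g) = eval_poly d f \<oplus> eval_poly d g"
proof -
  define S where "S = Poly_Mapping.keys f \<union> Poly_Mapping.keys g"
  have S: "finite S" "S \<subseteq> words G" "Poly_Mapping.keys f \<subseteq> S" "Poly_Mapping.keys g \<subseteq> S" "Poly_Mapping.keys (f + g) \<subseteq> S"
    using assms keys_add[of f g] by (auto simp: S_def star_polys_iff)
  have "finsum A (\<lambda>w. Poly_Mapping.lookup (f + g) w \<odot> eval_word d w) S
      = finsum A (\<lambda>w. Poly_Mapping.lookup f w \<odot> eval_word d w \<oplus> Poly_Mapping.lookup g w \<odot> eval_word d w) S"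
    by (rule finsum_cong') (use S eval_word_closed in \<open>auto simp: Poly_Mapping.lookup_add smult_add_left subset_iff\<close>)
  also have "\<dots> = finsum A (\<lambda>w. Poly_Mapping.lookup f w \<odot> eval_word d w) S \<oplus> finsum A (\<lambda>w. Poly_Mapping.lookup g w \<odot> eval_word d w) S"
    by (rule finsum_addf) (use S eval_word_closed in \<open>auto simp: subset_iff\<close>)
  finally show ?thesis using S by (simp add: eval_poly_superset[of S])
qed

lemma eval_poly_single:
  assumes "w \<in> words G" shows "eval_poly d (Poly_Mapping.single w c) = c \<odot> eval_word d w"
  using eval_poly_superset[of "{w}" "Poly_Mapping.single w c"] assms eval_word_closed[OF assms] by simp

lemma eval_poly_scalar: "eval_poly d (scalar c) = c \<odot> \<one>"
  unfolding scalar_def by (subst eval_poly_single) (auto simp: zero_word_def eval_word_def)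

lemma eval_poly_gen: "g \<in> G \<Longrightarrow> eval_poly d (gen g) = d g"
  unfolding gen_def by (subst eval_poly_single) (auto simp: eval_word_def d)

lemma star_polys_single_induct [consumes 1, case_names zero add]:
  assumes f: "f \<in> star_polys G" and "P 0"
    and "\<And>w c f. \<lbrakk>w \<in> words G; f \<in> star_polys G; P f\<rbrakk> \<Longrightarrow> P (Poly_Mapping.single w c + f)"
  shows "P f"
  using f
proof (induction f rule: update_induct)
  case const
  then show ?case using assms(2) by simp
next
  case (update f a b)
  have eq: "Poly_Mapping.update a b f = Poly_Mapping.single a b + f"
    using update(1)
    by (intro poly_mapping_eqI) (auto simp: Poly_Mapping.lookup_update Poly_Mapping.lookup_add Poly_Mapping.lookup_single when_def in_keys_iff)
  have "Poly_Mapping.keys (Poly_Mapping.update a b f) = insert a (Poly_Mapping.keys f)"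
    using update(2) by (auto simp: keys_update)
  then have "a \<in> words G" "f \<in> star_polys G" using update(4) by (auto simp: star_polys_iff)
  then show ?case unfolding eq using update(3) by (intro assms(3)) auto
qed

lemma eval_poly_zero: "eval_poly d 0 = \<zero>"
  by (simp add: eval_poly_def)

lemma eval_poly_mult:
  assumes f: "f \<in> star_polys G" and g: "g \<in> star_polys G"
  shows "eval_poly d (f * g) = eval_poly d f \<otimes> eval_poly d g"
  using f
proof (induction f rule: star_polys_single_induct)
  case zero
  then show ?case using eval_poly_closed[OF g] by (simp add: eval_poly_zero)
next
  case (add v c f)
  have 1: "eval_poly d (Poly_Mapping.single v c * g) = eval_poly d (Poly_Mapping.single v c) \<otimes> eval_poly d g"
    using g
  proof (induction g rule: star_polys_single_induct)
    case zero
    then show ?case using eval_poly_closed[OF star_polys_single[OF add(1)]] by (simp add: eval_poly_zero)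
  next
    case (add w e g)
    have "v + w \<in> words G" using \<open>v \<in> words G\<close> add(1) by (rule words_add)
    then have "eval_poly d (Poly_Mapping.single v c * Poly_Mapping.single w e)
        = eval_poly d (Poly_Mapping.single v c) \<otimes> eval_poly d (Poly_Mapping.single w e)"
      using \<open>v \<in> words G\<close> add(1) eval_word_closed
      by (simp add: mult_single eval_poly_single eval_word_add smult_mult_left smult_mult_right smult_smult
            mult.commute[of e c])
    then show ?case
      using add \<open>v \<in> words G\<close> star_polys_single[OF \<open>v \<in> words G\<close>] star_polys_single[OF add(1)]
      by (simp add: distrib_left eval_poly_add eval_poly_closed r_distr)
  qed
  show ?case
    using add 1 g star_polys_single[OF add(1)]
    by (simp add: distrib_right eval_poly_add eval_poly_closed l_distr)
qed

lemma eval_poly_star: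
  assumes f: "f \<in> star_polys G" shows "eval_poly d (poly_star f) = star A (eval_poly d f)"
  using f
proof (induction f rule: star_polys_single_induct)
  case zero
  then show ?case by (simp add: eval_poly_zero)
next
  case (add w c f)
  have "word_star w \<in> words G" using add(1) by (force simp: word_star_def)
  then show ?case
    using add star_polys_single[OF add(1)] star_polys_single[of "word_star w" G] eval_word_closed[OF add(1)]
    by (simp add: poly_star_add poly_star_single eval_poly_add eval_poly_closed eval_poly_single eval_word_star
        star_add star_smult)
qed

lemma free_hom_eval_poly: "free_hom G A (eval_poly d)"
  unfolding free_hom_def
  using eval_poly_mult[of "scalar c" for c] eval_poly_scalar[of 1]
  by (auto intro!: star_homI star_algebra_axioms
      simp: eval_poly_closed eval_poly_add eval_poly_mult eval_poly_star eval_poly_scalar smult_mult_left)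

end

end


section \<open>Universal algebras\<close>

definition closed_subalgebra :: "'a cstar \<Rightarrow> 'a set \<Rightarrow> bool" where
  "closed_subalgebra A T \<longleftrightarrow> T \<subseteq> carrier A \<and> \<one>\<^bsub>A\<^esub> \<in> T \<and>
     (\<forall>x\<in>T. \<forall>y\<in>T. x \<oplus>\<^bsub>A\<^esub> y \<in> T) \<and> (\<forall>x\<in>T. \<forall>y\<in>T. x \<otimes>\<^bsub>A\<^esub> y \<in> T) \<and>
     (\<forall>c. \<forall>x\<in>T. c \<odot>\<^bsub>A\<^esub> x \<in> T) \<and> (\<forall>x\<in>T. star A x \<in> T) \<and> closed_in A T"

text \<open>Phrased through closed subalgebras and not through density of words: to extend a
  property from generators to the whole algebra one only has to see that it defines a closed
  subalgebra.\<close>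

definition generates :: "'a cstar \<Rightarrow> 'a set \<Rightarrow> bool" where
  "generates A S \<longleftrightarrow> (\<forall>T. closed_subalgebra A T \<longrightarrow> S \<subseteq> T \<longrightarrow> carrier A \<subseteq> T)"

lemma closed_subalgebra_finsum:
  assumes "star_algebra A" "closed_subalgebra A T" "finite S" "\<And>i. i \<in> S \<Longrightarrow> f i \<in> T"
  shows "finsum A f S \<in> T"
  using assms(3,4)
proof (induction S)
  case empty
  interpret A: star_algebra A by fact
  have "\<zero>\<^bsub>A\<^esub> = 0 \<odot>\<^bsub>A\<^esub> \<one>\<^bsub>A\<^esub>" by simp
  then show ?case using assms(2) unfolding closed_subalgebra_def by (metis A.finsum_empty)
next
  case (insert i S)
  interpret A: star_algebra A by fact
  have "finsum A f (insert i S) = f i \<oplus>\<^bsub>A\<^esub> finsum A f S"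
    using insert assms(2) by (subst A.finsum_insert) (auto simp: closed_subalgebra_def)
  then show ?case using insert assms(2) by (auto simp: closed_subalgebra_def)
qed

lemma closed_subalgebra_vimage:
  assumes A: "cstar_algebra A" and B: "seminormed_star_algebra B" and h: "h \<in> star_hom A B"
    and T: "closed_subalgebra B T"
  shows "closed_subalgebra A {x \<in> carrier A. h x \<in> T}"
proof -
  interpret A: cstar_algebra A by fact
  interpret B: seminormed_star_algebra B by fact
  have "x \<in> {x \<in> carrier A. h x \<in> T}"
    if x: "x \<in> carrier A" and *: "\<forall>e>0. \<exists>y\<in>{x \<in> carrier A. h x \<in> T}. nrm A (x \<ominus>\<^bsub>A\<^esub> y) < e" for x
  proof -
    have "\<exists>z\<in>T. nrm B (h x \<ominus>\<^bsub>B\<^esub> z) < e" if "e > 0" for e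
    proof -
      obtain y where y: "y \<in> carrier A" "h y \<in> T" "nrm A (x \<ominus>\<^bsub>A\<^esub> y) < e" using * \<open>e > 0\<close> by blast
      then have "nrm B (h x \<ominus>\<^bsub>B\<^esub> h y) < e"
        using star_hom_contractive[OF A B h, of "x \<ominus>\<^bsub>A\<^esub> y"] x
        by (simp add: star_hom_diff[OF A.star_algebra_axioms B.star_algebra_axioms h])
      then show ?thesis using y by blast
    qed
    then show ?thesis using T x star_homD(1)[OF h x] by (auto simp: closed_subalgebra_def closed_in_def)
  qed
  then show ?thesis
    using T star_homD[OF h] by (auto simp: closed_subalgebra_def closed_in_def)
qed

text \<open>Contractivity makes the equalizer closed. Together with \<open>generates\<close> this
  gives uniqueness of homomorphisms with prescribed values on generators.\<close>

lemma closed_subalgebra_equalizer: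
  assumes A: "cstar_algebra A" and B: "cstar_algebra B" and h: "h \<in> star_hom A B" and g: "g \<in> star_hom A B"
  shows "closed_subalgebra A {x \<in> carrier A. h x = g x}"
proof -
  interpret A: cstar_algebra A by fact
  interpret B: cstar_algebra B by fact
  have "h x = g x"
    if x: "x \<in> carrier A" and *: "\<forall>e>0. \<exists>y\<in>{x \<in> carrier A. h x = g x}. nrm A (x \<ominus>\<^bsub>A\<^esub> y) < e" for x
  proof -
    note c = star_homD(1)[OF h] star_homD(1)[OF g]
    have "nrm B (h x \<ominus>\<^bsub>B\<^esub> g x) \<le> 0"
    proof (rule field_le_epsilon)
      fix e :: real assume "e > 0"
      then have "e/2 > 0" by simp
      then obtain y where y: "y \<in> carrier A" "h y = g y" "nrm A (x \<ominus>\<^bsub>A\<^esub> y) < e/2" using * by blast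
      have "nrm B (h x \<ominus>\<^bsub>B\<^esub> h y) < e/2" "nrm B (g x \<ominus>\<^bsub>B\<^esub> g y) < e/2"
        using star_hom_contractive[OF A B.seminormed_star_algebra_axioms h, of "x \<ominus>\<^bsub>A\<^esub> y"]
          star_hom_contractive[OF A B.seminormed_star_algebra_axioms g, of "x \<ominus>\<^bsub>A\<^esub> y"] x y
        by (auto simp: star_hom_diff[OF A.star_algebra_axioms B.star_algebra_axioms h]
            star_hom_diff[OF A.star_algebra_axioms B.star_algebra_axioms g])
      then show "nrm B (h x \<ominus>\<^bsub>B\<^esub> g x) \<le> 0 + e"
        using B.nrm_diff_triangle[of "h x" "h y" "g x"] B.nrm_diff_commute[of "g x" "g y"] c x y by simp
    qed
    moreover have "0 \<le> nrm B (h x \<ominus>\<^bsub>B\<^esub> g x)" using c x by (intro B.nrm_nonneg) auto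
    ultimately have "h x \<ominus>\<^bsub>B\<^esub> g x = \<zero>\<^bsub>B\<^esub>" using c x by (intro B.nrm_definite) auto
    then show ?thesis using c x by (simp add: B.minus_eq_zero_iff)
  qed
  then show ?thesis
    using star_homD[OF h] star_homD[OF g] by (auto simp: closed_subalgebra_def closed_in_def)
qed

text \<open>\<open>A\<close> will be a presented algebra before completion. It is not complete, so
  contractivity of \<open>h\<close> has to be assumed and does not follow from
  \<open>star_hom_contractive\<close>.\<close>

lemma generates_image:
  assumes A: "seminormed_star_algebra A" and B: "seminormed_star_algebra B" and h: "h \<in> star_hom A B"
    and le: "\<And>x. x \<in> carrier A \<Longrightarrow> nrm B (h x) \<le> nrm A x"
    and gen: "generates A S" and S: "S \<subseteq> carrier A"
    and dense: "\<And>X e. \<lbrakk>X \<in> carrier B; e > 0\<rbrakk> \<Longrightarrow> \<exists>x\<in>carrier A. nrm B (X \<ominus>\<^bsub>B\<^esub> h x) < e"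
  shows "generates B (h ` S)"
  unfolding generates_def
proof (intro allI impI)
  interpret A: seminormed_star_algebra A by fact
  interpret B: seminormed_star_algebra B by fact
  fix T assume T: "closed_subalgebra B T" "h ` S \<subseteq> T"
  have "x \<in> {x \<in> carrier A. h x \<in> T}"
    if x: "x \<in> carrier A" and *: "\<forall>e>0. \<exists>y\<in>{x \<in> carrier A. h x \<in> T}. nrm A (x \<ominus>\<^bsub>A\<^esub> y) < e" for x
  proof -
    have "\<exists>z\<in>T. nrm B (h x \<ominus>\<^bsub>B\<^esub> z) < e" if "e > 0" for e
    proof -
      obtain y where y: "y \<in> carrier A" "h y \<in> T" "nrm A (x \<ominus>\<^bsub>A\<^esub> y) < e" using * \<open>e > 0\<close> by blast
      then have "nrm B (h x \<ominus>\<^bsub>B\<^esub> h y) < e"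
        using le[of "x \<ominus>\<^bsub>A\<^esub> y"] x
        by (simp add: star_hom_diff[OF A.star_algebra_axioms B.star_algebra_axioms h])
      then show ?thesis using y by blast
    qed
    then show ?thesis using T x star_homD(1)[OF h x] by (auto simp: closed_subalgebra_def closed_in_def)
  qed
  then have "closed_subalgebra A {x \<in> carrier A. h x \<in> T}"
    using T(1) star_homD[OF h] by (auto simp: closed_subalgebra_def closed_in_def)
  moreover have "S \<subseteq> {x \<in> carrier A. h x \<in> T}" using T(2) S by auto
  ultimately have all: "carrier A \<subseteq> {x \<in> carrier A. h x \<in> T}"
    using gen unfolding generates_def by blast
  show "carrier B \<subseteq> T"
  proof
    fix X assume X: "X \<in> carrier B"
    have "\<exists>y\<in>T. nrm B (X \<ominus>\<^bsub>B\<^esub> y) < e" if "e > 0" for e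
      using dense[OF X that] all by blast
    then show "X \<in> T" using T(1) X by (auto simp: closed_subalgebra_def closed_in_def)
  qed
qed

section \<open>Presentations by generators and relations\<close>

definition admissible :: "'g set \<Rightarrow> 'g star_poly set \<Rightarrow> ('g star_poly \<Rightarrow> real) \<Rightarrow> bool" where
  "admissible G R p \<longleftrightarrow> cstar_seminorm (free_star_algebra G p) p \<and> (\<forall>r\<in>R. p r = 0)"

lemma admissible_seminormed: "admissible G R p \<Longrightarrow> seminormed_star_algebra (free_star_algebra G p)"
  by (intro seminormed_star_algebra.intro seminormed_star_algebra_axioms.intro star_algebra_free)
    (simp add: admissible_def)

text \<open>Supplies the nonemptiness that the real supremum in \<open>universal_seminorm\<close>
  needs.\<close>

lemma admissible_zero: "admissible G R (\<lambda>_. 0)"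
  by (simp add: admissible_def cstar_seminorm_def)

text \<open>\<open>bounded_gen\<close> is the condition under which the supremum of the seminorms is
  finite on generators and hence on all polynomials. It is asked of each generator separately, since
  a coproduct has the elements of whole carriers as generators and admits no uniform bound.\<close>

locale presentation =
  fixes G :: "'g set" and R :: "'g star_poly set"
  assumes relations: "R \<subseteq> star_polys G"
    and bounded_gen: "g \<in> G \<Longrightarrow> \<exists>B. \<forall>p. admissible G R p \<longrightarrow> p (gen g) \<le> B"
begin

lemma bounded:
  assumes "f \<in> star_polys G" shows "\<exists>B. \<forall>p. admissible G R p \<longrightarrow> p f \<le> B"
  using assms
proof (induction f rule: star_polys_induct)
  case (scalar c)
  have "p (scalar c) \<le> cmod c" if p: "admissible G R p" for p
  proof -
    interpret p: seminormed_star_algebra "free_star_algebra G p" by (rule admissible_seminormed[OF p])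
    show ?thesis using p.nrm_smult_one_le[of c] by simp
  qed
  then show ?case by blast
next
  case (gen g)
  then show ?case by (rule bounded_gen)
next
  case (star g)
  have "p (poly_star (gen g)) = p (gen g)" if p: "admissible G R p" for p
  proof -
    interpret p: seminormed_star_algebra "free_star_algebra G p" by (rule admissible_seminormed[OF p])
    show ?thesis using p.nrm_star[of "gen g"] star by simp
  qed
  moreover obtain B where "\<And>p. admissible G R p \<Longrightarrow> p (gen g) \<le> B" using bounded_gen[OF star] by blast
  ultimately have "p (poly_star (gen g)) \<le> B" if "admissible G R p" for p using that by metis
  then show ?case by blast
next
  case (add f g)
  then obtain B C where BC: "\<And>p. admissible G R p \<Longrightarrow> p f \<le> B" "\<And>p. admissible G R p \<Longrightarrow> p g \<le> C" by blast
  then have "p (f + g) \<le> B + C" if p: "admissible G R p" for p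
  proof -
    interpret p: seminormed_star_algebra "free_star_algebra G p" by (rule admissible_seminormed[OF p])
    show ?thesis using p.nrm_triangle[of f g] add BC[OF p] by simp
  qed
  then show ?case by blast
next
  case (mult f g)
  then obtain B C where BC: "\<And>p. admissible G R p \<Longrightarrow> p f \<le> B" "\<And>p. admissible G R p \<Longrightarrow> p g \<le> C" by blast
  have "p (f * g) \<le> B * C" if p: "admissible G R p" for p
  proof -
    interpret p: seminormed_star_algebra "free_star_algebra G p" by (rule admissible_seminormed[OF p])
    show ?thesis using p.nrm_mult_le[of f g B C] mult BC[OF p] by simp
  qed
  then show ?case by blast
qed

lemma universal_seminorm_eq: "universal_seminorm G R f = (SUP p \<in> Collect (admissible G R). p f)"
  by (simp add: universal_seminorm_def admissible_def[abs_def])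

lemma le_universal:
  assumes "f \<in> star_polys G" "admissible G R p" shows "p f \<le> universal_seminorm G R f"
  unfolding universal_seminorm_eq
proof (rule cSUP_upper)
  obtain B where "\<And>p. admissible G R p \<Longrightarrow> p f \<le> B" using bounded[OF assms(1)] by blast
  then show "bdd_above ((\<lambda>p. p f) ` Collect (admissible G R))" by (intro bdd_aboveI[of _ B]) auto
qed (use assms in simp)

lemma universal_le: "(\<And>p. admissible G R p \<Longrightarrow> p f \<le> B) \<Longrightarrow> universal_seminorm G R f \<le> B"
  unfolding universal_seminorm_eq using admissible_zero[of G R] by (intro cSUP_least) auto

lemma universal_nonneg: "f \<in> star_polys G \<Longrightarrow> 0 \<le> universal_seminorm G R f"
  using le_universal[OF _ admissible_zero] .

lemma universal_relation:
  assumes "r \<in> R" shows "universal_seminorm G R r = 0"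
proof (rule antisym)
  show "universal_seminorm G R r \<le> 0"
    by (rule universal_le) (use assms in \<open>simp add: admissible_def\<close>)
qed (use assms relations universal_nonneg in auto)

lemma universal_cstar_seminorm: "cstar_seminorm (free_star_algebra G q) (universal_seminorm G R)"
proof -
  let ?U = "universal_seminorm G R"
  note adm = admissible_seminormed
  have tri: "?U (f + g) \<le> ?U f + ?U g" if "f \<in> star_polys G" "g \<in> star_polys G" for f g
  proof (rule universal_le)
    fix p assume p: "admissible G R p"
    interpret p: seminormed_star_algebra "free_star_algebra G p" by (rule adm[OF p])
    show "p (f + g) \<le> ?U f + ?U g"
      using p.nrm_triangle[of f g] le_universal[OF that(1) p] le_universal[OF that(2) p] that by simp
  qed
  have mult: "?U (f * g) \<le> ?U f * ?U g" if "f \<in> star_polys G" "g \<in> star_polys G" for f g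
  proof (rule universal_le)
    fix p assume p: "admissible G R p"
    interpret p: seminormed_star_algebra "free_star_algebra G p" by (rule adm[OF p])
    show "p (f * g) \<le> ?U f * ?U g"
      using p.nrm_mult_le[of f g] le_universal[OF that(1) p] le_universal[OF that(2) p] that by simp
  qed
  have smult: "?U (scalar c * f) = cmod c * ?U f" if f: "f \<in> star_polys G" for c f
  proof (rule antisym)
    show "?U (scalar c * f) \<le> cmod c * ?U f"
    proof (rule universal_le)
      fix p assume p: "admissible G R p"
      interpret p: seminormed_star_algebra "free_star_algebra G p" by (rule adm[OF p])
      show "p (scalar c * f) \<le> cmod c * ?U f"
        using p.nrm_smult[of f c] le_universal[OF f p] f by (simp add: mult_left_mono)
    qed
    show "cmod c * ?U f \<le> ?U (scalar c * f)"
    proof (cases "c = 0")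
      case True
      then show ?thesis by (simp add: universal_nonneg)
    next
      case False
      have "?U f \<le> ?U (scalar c * f) / cmod c"
      proof (rule universal_le)
        fix p assume p: "admissible G R p"
        interpret p: seminormed_star_algebra "free_star_algebra G p" by (rule adm[OF p])
        have "cmod c * p f \<le> ?U (scalar c * f)"
          using p.nrm_smult[of f c] le_universal[OF _ p, of "scalar c * f"] f by simp
        then show "p f \<le> ?U (scalar c * f) / cmod c"
          using False by (simp add: pos_le_divide_eq mult.commute)
      qed
      then show ?thesis using False by (simp add: pos_le_divide_eq mult.commute)
    qed
  qed
  have cst: "?U (poly_star f * f) = (?U f)\<^sup>2" if f: "f \<in> star_polys G" for f
  proof (rule antisym)
    show "?U (poly_star f * f) \<le> (?U f)\<^sup>2"
    proof (rule universal_le)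
      fix p assume p: "admissible G R p"
      interpret p: seminormed_star_algebra "free_star_algebra G p" by (rule adm[OF p])
      show "p (poly_star f * f) \<le> (?U f)\<^sup>2"
        using p.nrm_cstar[of f] p.nrm_nonneg[of f] le_universal[OF f p] f by (simp add: power_mono)
    qed
    \<comment> \<open>Each \<open>p f\<close> is bounded by a root and the result is squared only
      afterwards, so the supremum never has to be interchanged with squaring.\<close>
    have "?U f \<le> sqrt (?U (poly_star f * f))"
    proof (rule universal_le)
      fix p assume p: "admissible G R p"
      interpret p: seminormed_star_algebra "free_star_algebra G p" by (rule adm[OF p])
      show "p f \<le> sqrt (?U (poly_star f * f))"
        using p.nrm_cstar[of f] le_universal[OF _ p, of "poly_star f * f"] f by (intro real_le_rsqrt) simp
    qed
    then have "(?U f)\<^sup>2 \<le> (sqrt (?U (poly_star f * f)))\<^sup>2"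
      using universal_nonneg[OF f] by (rule power_mono)
    then show "(?U f)\<^sup>2 \<le> ?U (poly_star f * f)" using universal_nonneg f by simp
  qed
  show ?thesis
    unfolding cstar_seminorm_def using tri mult smult cst universal_nonneg by simp
qed

abbreviation "P \<equiv> presented_star_algebra G R"

lemma presented_seminormed: "seminormed_star_algebra P"
  unfolding presented_star_algebra_def
  by (intro seminormed_star_algebra.intro seminormed_star_algebra_axioms.intro star_algebra_free)
    (simp add: universal_cstar_seminorm)

lemma universal_cstar_algebra: "cstar_algebra (universal_cstar G R)"
  unfolding universal_cstar_def
  by (rule seminormed_star_algebra.completion_cstar_algebra[OF presented_seminormed])

lemma free_hom_to_completion: "free_hom G (universal_cstar G R) (to_completion P)"
proof -
  interpret U: cstar_algebra "universal_cstar G R" by (rule universal_cstar_algebra)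
  show ?thesis
    using seminormed_star_algebra.to_completion_hom[OF presented_seminormed]
    by (subst free_hom_iff[OF U.star_algebra_axioms, of _ G "universal_seminorm G R", symmetric])
      (simp add: universal_cstar_def presented_star_algebra_def)
qed

lemma to_completion_gen: "to_completion P (gen g) = universal_gen G R g"
  by (simp add: universal_gen_def)

lemma to_completion_relation:
  assumes "r \<in> R" shows "to_completion P r = \<zero>\<^bsub>universal_cstar G R\<^esub>"
proof -
  interpret U: cstar_algebra "universal_cstar G R" by (rule universal_cstar_algebra)
  have r: "r \<in> star_polys G" using assms relations by blast
  have "nrm (universal_cstar G R) (to_completion P r) = 0"
    using seminormed_star_algebra.nrm_to_completion[OF presented_seminormed, of r] r universal_relation[OF assms]
    by (simp add: universal_cstar_def presented_star_algebra_def)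
  then show ?thesis using free_homD(1)[OF free_hom_to_completion r] by (intro U.nrm_definite)
qed

lemma universal_generates: "generates (universal_cstar G R) (universal_gen G R ` G)"
proof -
  have "generates P (gen ` G)"
    unfolding generates_def
  proof (intro allI impI subsetI)
    fix T f assume T: "closed_subalgebra P T" "gen ` G \<subseteq> T" and f: "f \<in> carrier P"
    have T': "1 \<in> T" "\<And>x y. \<lbrakk>x \<in> T; y \<in> T\<rbrakk> \<Longrightarrow> x + y \<in> T" "\<And>x y. \<lbrakk>x \<in> T; y \<in> T\<rbrakk> \<Longrightarrow> x * y \<in> T"
        "\<And>c x. x \<in> T \<Longrightarrow> scalar c * x \<in> T" "\<And>x. x \<in> T \<Longrightarrow> poly_star x \<in> T"
      using T by (auto simp: closed_subalgebra_def presented_star_algebra_def)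
    have "f \<in> star_polys G" using f by (simp add: presented_star_algebra_def)
    then show "f \<in> T"
    proof (induction f rule: star_polys_induct)
      case (scalar c)
      then show ?case using T'(4)[OF T'(1), of c] by simp
    qed (use T' T(2) in auto)
  qed
  moreover have "\<exists>x\<in>carrier P. nrm (cstar_completion P) (X \<ominus>\<^bsub>cstar_completion P\<^esub> to_completion P x) < e"
    if "X \<in> carrier (cstar_completion P)" "e > 0" for X e
    using seminormed_star_algebra.to_completion_dense[OF presented_seminormed that] by blast
  ultimately have "generates (cstar_completion P) (to_completion P ` gen ` G)"
    using seminormed_star_algebra.to_completion_hom[OF presented_seminormed]
      seminormed_star_algebra.nrm_to_completion[OF presented_seminormed]
      seminormed_star_algebra.completion_cstar_algebra[OF presented_seminormed]
    by (intro generates_image[OF presented_seminormed])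
      (auto simp: cstar_algebra_def presented_star_algebra_def)
  then show ?thesis by (simp add: universal_cstar_def image_image to_completion_gen)
qed

text \<open>Pulling the norm of \<open>D\<close> back along \<open>h\<close> gives an admissible
  seminorm. Hence \<open>h\<close> is contractive for the universal seminorm and extends to the
  completion, whatever the type of \<open>D\<close>.\<close>

lemma universal_lift:
  fixes D :: "'d cstar"
  assumes D: "cstar_algebra D" and h: "free_hom G D h" and R: "\<And>r. r \<in> R \<Longrightarrow> h r = \<zero>\<^bsub>D\<^esub>"
  obtains k where "k \<in> star_hom (universal_cstar G R) D" "\<And>g. g \<in> G \<Longrightarrow> k (universal_gen G R g) = h (gen g)"
proof -
  interpret D: cstar_algebra D by fact
  define p where "p f = nrm D (h f)" for f
  have "cstar_seminorm (free_star_algebra G p) p"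
    unfolding p_def[abs_def]
    by (rule cstar_seminorm_hom[OF star_algebra_free D.seminormed_star_algebra_axioms])
      (simp add: free_hom_iff[OF D.star_algebra_axioms] h)
  then have p: "admissible G R p" using R by (auto simp: admissible_def p_def)
  have "h \<in> star_hom P D"
    unfolding presented_star_algebra_def by (simp add: free_hom_iff[OF D.star_algebra_axioms] h)
  moreover have "nrm D (h x) \<le> nrm P x" if "x \<in> carrier P" for x
    using le_universal[OF _ p, of x] that by (simp add: presented_star_algebra_def p_def)
  ultimately obtain k where k: "k \<in> star_hom (cstar_completion P) D"
      "\<And>x. x \<in> carrier P \<Longrightarrow> k (to_completion P x) = h x"
    using completion_hom_lift[OF presented_seminormed D] by blast
  show ?thesis
    by (rule that[of k]) (use k in \<open>auto simp: universal_cstar_def universal_gen_def presented_star_algebra_def\<close>)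
qed

end

section \<open>Coproducts\<close>

lemma hom_relations_subset: "f ` carrier A \<subseteq> G \<Longrightarrow> star_algebra A \<Longrightarrow> hom_relations A f \<subseteq> star_polys G"
proof -
  assume f: "f ` carrier A \<subseteq> G" and "star_algebra A"
  interpret A: star_algebra A by fact
  have "x \<in> carrier A \<Longrightarrow> f x \<in> G" for x using f by auto
  then show ?thesis by (auto simp: hom_relations_def)
qed

lemma Ball_Collect_simps:
  "(\<forall>r\<in>{F x y | x y. x \<in> S \<and> y \<in> T}. Q r) \<longleftrightarrow> (\<forall>x\<in>S. \<forall>y\<in>T. Q (F x y))"
  "(\<forall>r\<in>{F' x | x. x \<in> S}. Q r) \<longleftrightarrow> (\<forall>x\<in>S. Q (F' x))"
  "(\<forall>r\<in>{F'' c x | c x. x \<in> S}. Q r) \<longleftrightarrow> (\<forall>c. \<forall>x\<in>S. Q (F'' c x))"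
  by blast+

lemma hom_relations_iff:
  assumes h: "free_hom G D h" and f: "f ` carrier A \<subseteq> G" and A: "star_algebra A"
  shows "(\<forall>r\<in>hom_relations A f. h r = \<zero>\<^bsub>D\<^esub>) \<longleftrightarrow> (\<lambda>x. h (gen (f x))) \<in> star_hom A D"
proof -
  interpret A: star_algebra A by fact
  interpret D: star_algebra D using h by (simp add: free_hom_def)
  have g [simp]: "f x \<in> G" if "x \<in> carrier A" for x using f that by auto
  note H = free_homD[OF h]
  have D0: "h (a - b) = \<zero>\<^bsub>D\<^esub> \<longleftrightarrow> h a = h b" if "a \<in> star_polys G" "b \<in> star_polys G" for a b
    using that H(1) by (simp add: H(8) D.minus_eq_zero_iff)
  have "(\<forall>r\<in>hom_relations A f. h r = \<zero>\<^bsub>D\<^esub>) \<longleftrightarrow>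
      h (gen (f \<one>\<^bsub>A\<^esub>)) = \<one>\<^bsub>D\<^esub> \<and>
      (\<forall>x\<in>carrier A. \<forall>y\<in>carrier A. h (gen (f (x \<oplus>\<^bsub>A\<^esub> y))) = h (gen (f x)) \<oplus>\<^bsub>D\<^esub> h (gen (f y))) \<and>
      (\<forall>x\<in>carrier A. \<forall>y\<in>carrier A. h (gen (f (x \<otimes>\<^bsub>A\<^esub> y))) = h (gen (f x)) \<otimes>\<^bsub>D\<^esub> h (gen (f y))) \<and>
      (\<forall>c. \<forall>x\<in>carrier A. h (gen (f (c \<odot>\<^bsub>A\<^esub> x))) = c \<odot>\<^bsub>D\<^esub> h (gen (f x))) \<and>
      (\<forall>x\<in>carrier A. h (gen (f (star A x))) = star D (h (gen (f x))))"
    unfolding hom_relations_def ball_Un conj_assoc Ball_Collect_simps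
    by (intro arg_cong2[where f = "(\<and>)"] ball_cong all_cong1 refl) (simp_all add: D0 H(2,4,5,6), simp add: H(3))
  also have "\<dots> \<longleftrightarrow> (\<lambda>x. h (gen (f x))) \<in> star_hom A D"
    using H(1) by (auto simp: star_hom_def ring_hom_def Pi_def)
  finally show ?thesis .
qed

text \<open>Along \<open>x \<mapsto> gen (f x)\<close> an admissible seminorm pulls back to a
  C*-seminorm on the complete algebra \<open>A\<close>, where \<open>cstar_seminorm_le_nrm\<close>
  bounds it by the norm. This is what makes coproducts legitimate presentations.\<close>

lemma hom_relations_bounded:
  assumes A: "cstar_algebra A" and f: "f ` carrier A \<subseteq> G" and R: "hom_relations A f \<subseteq> R" and x: "x \<in> carrier A"
    and p: "admissible G R p"
  shows "p (gen (f x)) \<le> nrm A x"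
proof -
  interpret A: cstar_algebra A by fact
  interpret p: seminormed_star_algebra "free_star_algebra G p" by (rule admissible_seminormed[OF p])
  have g [simp]: "f x \<in> G" if "x \<in> carrier A" for x using f that by auto
  have zero: "p r = 0" if "r \<in> hom_relations A f" for r using p R that by (auto simp: admissible_def)
  have eq: "p a = p b" if "a - b \<in> hom_relations A f" "a \<in> star_polys G" "b \<in> star_polys G" for a b
  proof -
    have "p (a \<ominus>\<^bsub>free_star_algebra G p\<^esub> b) = 0"
    proof -
      have "a \<ominus>\<^bsub>free_star_algebra G p\<^esub> b = a - b"
        using p.minus_smult[of b 1] that(3) by (simp add: p.minus_eq)
      then show ?thesis using zero[OF that(1)] by simp
    qed
    then show ?thesis using p.nrm_diff_abs[of a b] that by simp
  qed
  note M = hom_relations_def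
  have "cstar_seminorm A (\<lambda>x. p (gen (f x)))"
    unfolding cstar_seminorm_def
  proof (intro conjI ballI allI)
    fix x assume x: "x \<in> carrier A"
    show "0 \<le> p (gen (f x))" using p.nrm_nonneg[of "gen (f x)"] x by simp
    fix y assume y: "y \<in> carrier A"
    have "gen (f (x \<oplus>\<^bsub>A\<^esub> y)) - (gen (f x) + gen (f y)) \<in> hom_relations A f"
      unfolding M using x y by blast
    then have "p (gen (f (x \<oplus>\<^bsub>A\<^esub> y))) = p (gen (f x) + gen (f y))"
      by (rule eq) (use x y in simp_all)
    then show "p (gen (f (x \<oplus>\<^bsub>A\<^esub> y))) \<le> p (gen (f x)) + p (gen (f y))"
      using p.nrm_triangle[of "gen (f x)" "gen (f y)"] x y by simp
    have "gen (f (x \<otimes>\<^bsub>A\<^esub> y)) - gen (f x) * gen (f y) \<in> hom_relations A f"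
      unfolding M using x y by blast
    then have "p (gen (f (x \<otimes>\<^bsub>A\<^esub> y))) = p (gen (f x) * gen (f y))"
      by (rule eq) (use x y in simp_all)
    then show "p (gen (f (x \<otimes>\<^bsub>A\<^esub> y))) \<le> p (gen (f x)) * p (gen (f y))"
      using p.nrm_mult[of "gen (f x)" "gen (f y)"] x y by simp
  next
    fix c x assume x: "x \<in> carrier A"
    have "gen (f (c \<odot>\<^bsub>A\<^esub> x)) - scalar c * gen (f x) \<in> hom_relations A f"
      unfolding M using x by blast
    then have "p (gen (f (c \<odot>\<^bsub>A\<^esub> x))) = p (scalar c * gen (f x))"
      by (rule eq) (use x in simp_all)
    then show "p (gen (f (c \<odot>\<^bsub>A\<^esub> x))) = cmod c * p (gen (f x))"
      using p.nrm_smult[of "gen (f x)" c] x by simp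
  next
    fix x assume x: "x \<in> carrier A"
    have "gen (f (star A x \<otimes>\<^bsub>A\<^esub> x)) - gen (f (star A x)) * gen (f x) \<in> hom_relations A f"
      unfolding M using x A.star_in by blast
    then have 1: "p (gen (f (star A x \<otimes>\<^bsub>A\<^esub> x))) = p (gen (f (star A x)) * gen (f x))"
      by (rule eq) (use x in simp_all)
    \<comment> \<open>The generator of \<open>star A x\<close> and the star of the generator of
      \<open>x\<close> are different polynomials; only the seminorm of their difference vanishes,
      and that has to be carried through the product.\<close>
    have "p (gen (f (star A x)) - poly_star (gen (f x))) = 0"
      by (rule zero) (unfold M, use x in blast)
    then have 0: "p ((gen (f (star A x)) - poly_star (gen (f x))) * gen (f x)) = 0"
      using p.nrm_mult[of "gen (f (star A x)) - poly_star (gen (f x))" "gen (f x)"]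
        p.nrm_nonneg[of "(gen (f (star A x)) - poly_star (gen (f x))) * gen (f x)"] x by simp
    have "gen (f (star A x)) * gen (f x)
        = (gen (f (star A x)) - poly_star (gen (f x))) * gen (f x) + poly_star (gen (f x)) * gen (f x)"
      by (simp add: algebra_simps)
    moreover have "p ((gen (f (star A x)) - poly_star (gen (f x))) * gen (f x) + poly_star (gen (f x)) * gen (f x))
        = p (poly_star (gen (f x)) * gen (f x))"
    proof -
      have "p (a + b) = p b" if "a \<in> star_polys G" "b \<in> star_polys G" "p a = 0" for a b
      proof -
        have "p (- a) = 0" using p.nrm_smult[of a "-1"] that by simp
        then have "p b \<le> p (a + b)" using p.nrm_triangle[of "- a" "a + b"] that by simp
        then show ?thesis using p.nrm_triangle[of a b] that by simp
      qed
      then show ?thesis using 0 x by simp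
    qed
    ultimately show "p (gen (f (star A x \<otimes>\<^bsub>A\<^esub> x))) = (p (gen (f x)))\<^sup>2"
      using 1 p.nrm_cstar[of "gen (f x)"] x by simp
  qed
  then show ?thesis using cstar_seminorm_le_nrm[OF A _ x] by blast
qed

lemma presentation_family:
  assumes "\<And>k. k \<in> K \<Longrightarrow> cstar_algebra (A k)"
  shows "presentation (Sigma K (\<lambda>k. carrier (A k))) (\<Union>k\<in>K. hom_relations (A k) (Pair k))"
proof
  have sa: "star_algebra (A k)" if "k \<in> K" for k
    using assms[OF that] by (simp add: cstar_algebra_def seminormed_star_algebra_def)
  have sub: "Pair k ` carrier (A k) \<subseteq> Sigma K (\<lambda>k. carrier (A k))" if "k \<in> K" for k using that by auto
  show "(\<Union>k\<in>K. hom_relations (A k) (Pair k)) \<subseteq> star_polys (Sigma K (\<lambda>k. carrier (A k)))"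
    using hom_relations_subset[OF sub sa] by blast
  fix g assume "g \<in> Sigma K (\<lambda>k. carrier (A k))"
  then obtain k x where g: "g = (k, x)" "k \<in> K" "x \<in> carrier (A k)" by auto
  show "\<exists>B. \<forall>p. admissible (Sigma K (\<lambda>k. carrier (A k))) (\<Union>k\<in>K. hom_relations (A k) (Pair k)) p \<longrightarrow> p (gen g) \<le> B"
    unfolding g(1)
    by (intro exI[of _ "nrm (A k) x"] allI impI hom_relations_bounded[OF assms[OF g(2)] sub[OF g(2)] _ g(3)])
      (use g in auto)
qed

lemma presentation_coproduct:
  assumes A: "cstar_algebra A" and B: "cstar_algebra B"
  shows "presentation (carrier A <+> carrier B) (hom_relations A Inl \<union> hom_relations B Inr)"
proof
  have sa: "star_algebra A" "star_algebra B"
    using assms by (auto simp: cstar_algebra_def seminormed_star_algebra_def)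
  have sub: "Inl ` carrier A \<subseteq> carrier A <+> carrier B" "Inr ` carrier B \<subseteq> carrier A <+> carrier B" by auto
  show "hom_relations A Inl \<union> hom_relations B Inr \<subseteq> star_polys (carrier A <+> carrier B)"
    using hom_relations_subset[OF sub(1) sa(1)] hom_relations_subset[OF sub(2) sa(2)] by blast
  fix g assume "g \<in> carrier A <+> carrier B"
  then show "\<exists>B'. \<forall>p. admissible (carrier A <+> carrier B) (hom_relations A Inl \<union> hom_relations B Inr) p \<longrightarrow> p (gen g) \<le> B'"
  proof (elim PlusE)
    fix x assume "g = Inl x" "x \<in> carrier A"
    then show ?thesis
      using hom_relations_bounded[OF A sub(1), of "hom_relations A Inl \<union> hom_relations B Inr"] by blast
  next
    fix x assume "g = Inr x" "x \<in> carrier B"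
    then show ?thesis
      using hom_relations_bounded[OF B sub(2), of "hom_relations A Inl \<union> hom_relations B Inr"] by blast
  qed
qed

lemma family_coproduct_cstar:
  "(\<And>k. k \<in> K \<Longrightarrow> cstar_algebra (A k)) \<Longrightarrow> cstar_algebra (family_coproduct K A)"
  unfolding family_coproduct_def by (rule presentation.universal_cstar_algebra[OF presentation_family])

lemma family_inj_hom:
  assumes "\<And>k. k \<in> K \<Longrightarrow> cstar_algebra (A k)" "k \<in> K"
  shows "family_inj K A k \<in> star_hom (A k) (family_coproduct K A)"
proof -
  interpret presentation "Sigma K (\<lambda>k. carrier (A k))" "\<Union>k\<in>K. hom_relations (A k) (Pair k)"
    by (rule presentation_family[OF assms(1)])
  have "star_algebra (A k)" using assms by (auto simp: cstar_algebra_def seminormed_star_algebra_def)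
  moreover have "Pair k ` carrier (A k) \<subseteq> Sigma K (\<lambda>k. carrier (A k))" using assms(2) by auto
  ultimately show ?thesis
    using hom_relations_iff[OF free_hom_to_completion, of "Pair k" "A k"] to_completion_relation assms(2)
    by (auto simp: family_inj_def[abs_def] family_coproduct_def to_completion_gen)
qed

lemma family_coproduct_generates:
  assumes "\<And>k. k \<in> K \<Longrightarrow> cstar_algebra (A k)"
  shows "generates (family_coproduct K A) {family_inj K A k x | k x. k \<in> K \<and> x \<in> carrier (A k)}"
proof -
  interpret presentation "Sigma K (\<lambda>k. carrier (A k))" "\<Union>k\<in>K. hom_relations (A k) (Pair k)"
    by (rule presentation_family[OF assms(1)])
  have "{family_inj K A k x | k x. k \<in> K \<and> x \<in> carrier (A k)}
      = universal_gen (Sigma K (\<lambda>k. carrier (A k))) (\<Union>k\<in>K. hom_relations (A k) (Pair k)) ` Sigma K (\<lambda>k. carrier (A k))"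
    by (auto simp: family_inj_def)
  then show ?thesis using universal_generates by (simp add: family_coproduct_def)
qed

lemma free_hom_ex:
  assumes "star_algebra D" "\<And>g. g \<in> G \<Longrightarrow> d g \<in> carrier D"
  shows "\<exists>h. free_hom G D h \<and> (\<forall>g\<in>G. h (gen g) = d g)"
  by (intro exI[of _ "star_algebra.eval_poly D d"] conjI ballI)
    (rule star_algebra.free_hom_eval_poly[OF assms] star_algebra.eval_poly_gen[OF assms]; assumption)+

lemma family_coproduct_lift:
  assumes A: "\<And>k. k \<in> K \<Longrightarrow> cstar_algebra (A k)" and D: "cstar_algebra D"
    and h: "\<And>k. k \<in> K \<Longrightarrow> h k \<in> star_hom (A k) D"
  shows "\<exists>f\<in>star_hom (family_coproduct K A) D. \<forall>k\<in>K. \<forall>x\<in>carrier (A k). f (family_inj K A k x) = h k x"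
proof -
  let ?G = "Sigma K (\<lambda>k. carrier (A k))" and ?R = "\<Union>k\<in>K. hom_relations (A k) (Pair k)"
  interpret presentation ?G ?R by (rule presentation_family[OF A])
  interpret D: cstar_algebra D by fact
  obtain e where e: "free_hom ?G D e" "\<And>g. g \<in> ?G \<Longrightarrow> e (gen g) = h (fst g) (snd g)"
    using free_hom_ex[OF D.star_algebra_axioms, of ?G "\<lambda>g. h (fst g) (snd g)"] star_homD(1)[OF h] by auto
  have "e r = \<zero>\<^bsub>D\<^esub>" if r: "r \<in> ?R" for r
  proof -
    obtain k where k: "k \<in> K" "r \<in> hom_relations (A k) (Pair k)" using r by auto
    interpret Ak: cstar_algebra "A k" by (rule A[OF k(1)])
    have "Pair k ` carrier (A k) \<subseteq> ?G" using k by auto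
    moreover have "(\<lambda>x. e (gen (k, x))) \<in> star_hom (A k) D"
      using star_homD[OF h[OF k(1)]] e(2) k(1) by (intro star_homI) auto
    ultimately show ?thesis using hom_relations_iff[OF e(1) _ Ak.star_algebra_axioms] k(2) by blast
  qed
  then obtain f where "f \<in> star_hom (universal_cstar ?G ?R) D" "\<And>g. g \<in> ?G \<Longrightarrow> f (universal_gen ?G ?R g) = e (gen g)"
    using universal_lift[OF D e(1)] by blast
  then show ?thesis using e(2) by (auto simp: family_coproduct_def family_inj_def intro!: bexI[of _ f])
qed

lemma coproduct_cstar:
  "\<lbrakk>cstar_algebra A; cstar_algebra B\<rbrakk> \<Longrightarrow> cstar_algebra (coproduct A B)"
  unfolding coproduct_def by (rule presentation.universal_cstar_algebra[OF presentation_coproduct])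

lemma coproduct_hom:
  assumes A: "cstar_algebra A" and B: "cstar_algebra B"
  shows "coproduct_inl A B \<in> star_hom A (coproduct A B)" "coproduct_inr A B \<in> star_hom B (coproduct A B)"
proof -
  interpret presentation "carrier A <+> carrier B" "hom_relations A Inl \<union> hom_relations B Inr"
    by (rule presentation_coproduct[OF assms])
  have sa: "star_algebra A" "star_algebra B"
    using assms by (auto simp: cstar_algebra_def seminormed_star_algebra_def)
  have sub: "Inl ` carrier A \<subseteq> carrier A <+> carrier B" "Inr ` carrier B \<subseteq> carrier A <+> carrier B" by auto
  show "coproduct_inl A B \<in> star_hom A (coproduct A B)"
    using hom_relations_iff[OF free_hom_to_completion sub(1) sa(1)] to_completion_relation
    by (auto simp: coproduct_inl_def[abs_def] coproduct_def to_completion_gen)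
  show "coproduct_inr A B \<in> star_hom B (coproduct A B)"
    using hom_relations_iff[OF free_hom_to_completion sub(2) sa(2)] to_completion_relation
    by (auto simp: coproduct_inr_def[abs_def] coproduct_def to_completion_gen)
qed

lemma coproduct_generates:
  assumes A: "cstar_algebra A" and B: "cstar_algebra B"
  shows "generates (coproduct A B) (coproduct_inl A B ` carrier A \<union> coproduct_inr A B ` carrier B)"
proof -
  interpret presentation "carrier A <+> carrier B" "hom_relations A Inl \<union> hom_relations B Inr"
    by (rule presentation_coproduct[OF assms])
  have "coproduct_inl A B ` carrier A \<union> coproduct_inr A B ` carrier B
      = universal_gen (carrier A <+> carrier B) (hom_relations A Inl \<union> hom_relations B Inr) ` (carrier A <+> carrier B)"
    by (auto simp: coproduct_inl_def coproduct_inr_def image_iff)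
  then show ?thesis using universal_generates by (simp add: coproduct_def)
qed

lemma coproduct_lift:
  assumes A: "cstar_algebra A" and B: "cstar_algebra B" and D: "cstar_algebra D"
    and h: "h \<in> star_hom A D" and k: "k \<in> star_hom B D"
  shows "\<exists>f\<in>star_hom (coproduct A B) D.
    (\<forall>x\<in>carrier A. f (coproduct_inl A B x) = h x) \<and> (\<forall>x\<in>carrier B. f (coproduct_inr A B x) = k x)"
proof -
  let ?G = "carrier A <+> carrier B" and ?R = "hom_relations A Inl \<union> hom_relations B Inr"
  interpret presentation ?G ?R by (rule presentation_coproduct[OF A B])
  interpret A: cstar_algebra A by fact
  interpret B: cstar_algebra B by fact
  interpret D: cstar_algebra D by fact
  obtain e where e: "free_hom ?G D e" "\<And>g. g \<in> ?G \<Longrightarrow> e (gen g) = case_sum h k g"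
  proof -
    have "case_sum h k g \<in> carrier D" if "g \<in> ?G" for g
      using that star_homD(1)[OF h] star_homD(1)[OF k] by auto
    then show ?thesis using free_hom_ex[OF D.star_algebra_axioms, of ?G "case_sum h k"] that by blast
  qed
  have sub: "Inl ` carrier A \<subseteq> ?G" "Inr ` carrier B \<subseteq> ?G" by auto
  have eI: "x \<in> carrier A \<Longrightarrow> e (gen (Inl x)) = h x" "y \<in> carrier B \<Longrightarrow> e (gen (Inr y)) = k y" for x y
    using e(2)[of "Inl x"] e(2)[of "Inr y"] by auto
  have "(\<lambda>x. e (gen (Inl x))) \<in> star_hom A D"
    using star_homD[OF h] eI by (intro star_homI) auto
  moreover have "(\<lambda>x. e (gen (Inr x))) \<in> star_hom B D"
    using star_homD[OF k] eI by (intro star_homI) auto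
  ultimately have "e r = \<zero>\<^bsub>D\<^esub>" if "r \<in> ?R" for r
    using that hom_relations_iff[OF e(1) sub(1) A.star_algebra_axioms] hom_relations_iff[OF e(1) sub(2) B.star_algebra_axioms]
    by blast
  then obtain f where f: "f \<in> star_hom (universal_cstar ?G ?R) D" "\<And>g. g \<in> ?G \<Longrightarrow> f (universal_gen ?G ?R g) = e (gen g)"
    using universal_lift[OF D e(1)] by blast
  show ?thesis
    using f(1) f(2)[OF InlI] f(2)[OF InrI] eI
    by (auto simp: coproduct_def coproduct_inl_def coproduct_inr_def intro!: bexI[of _ f])
qed


section \<open>Magic unitaries\<close>

definition magic :: "'a cstar \<Rightarrow> 'i set \<Rightarrow> ('i \<Rightarrow> 'i \<Rightarrow> 'a) \<Rightarrow> bool" where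
  "magic D I u \<longleftrightarrow>
     (\<forall>i\<in>I. \<forall>j\<in>I. u i j \<in> carrier D \<and> u i j \<otimes>\<^bsub>D\<^esub> u i j = u i j \<and> star D (u i j) = u i j) \<and>
     (\<forall>i\<in>I. finsum D (\<lambda>j. u i j) I = \<one>\<^bsub>D\<^esub>) \<and> (\<forall>j\<in>I. finsum D (\<lambda>i. u i j) I = \<one>\<^bsub>D\<^esub>)"

text \<open>For the matrix \<open>A\<close> of \<open>R\<close>, \<open>preserves D I u R\<close> is equivalent to \<open>A u = u A\<close>. Unlike the latter it
  is visibly stable under Boolean combinations of relations.\<close>

definition preserves :: "'a cstar \<Rightarrow> 'i set \<Rightarrow> ('i \<Rightarrow> 'i \<Rightarrow> 'a) \<Rightarrow> 'i rel \<Rightarrow> bool" where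
  "preserves D I u R \<longleftrightarrow>
     (\<forall>i\<in>I. \<forall>j\<in>I. \<forall>k\<in>I. \<forall>l\<in>I. ((i, k) \<in> R) \<noteq> ((j, l) \<in> R) \<longrightarrow> u i j \<otimes>\<^bsub>D\<^esub> u k l = \<zero>\<^bsub>D\<^esub>)"

lemma preservesD:
  "\<lbrakk>preserves D I u R; i \<in> I; j \<in> I; k \<in> I; l \<in> I; ((i, k) \<in> R) \<noteq> ((j, l) \<in> R)\<rbrakk> \<Longrightarrow> u i j \<otimes>\<^bsub>D\<^esub> u k l = \<zero>\<^bsub>D\<^esub>"
  unfolding preserves_def by blast

lemma preserves_cong:
  "\<lbrakk>\<And>i k. \<lbrakk>i \<in> I; k \<in> I\<rbrakk> \<Longrightarrow> (i, k) \<in> R \<longleftrightarrow> (i, k) \<in> S\<rbrakk> \<Longrightarrow> preserves D I u R \<longleftrightarrow> preserves D I u S"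
  unfolding preserves_def by simp

lemma preserves_Un: "\<lbrakk>preserves D I u R; preserves D I u S\<rbrakk> \<Longrightarrow> preserves D I u (R \<union> S)"
  unfolding preserves_def by blast

lemma preserves_Int: "\<lbrakk>preserves D I u R; preserves D I u S\<rbrakk> \<Longrightarrow> preserves D I u (R \<inter> S)"
  unfolding preserves_def by blast

lemma preserves_Compl: "preserves D I u R \<Longrightarrow> preserves D I u (- R)"
  unfolding preserves_def by blast

lemma (in star_algebra) finsum_swap:
  assumes "finite S" "finite T" "\<And>s t. \<lbrakk>s \<in> S; t \<in> T\<rbrakk> \<Longrightarrow> f s t \<in> carrier A"
  shows "finsum A (\<lambda>s. finsum A (f s) T) S = finsum A (\<lambda>t. finsum A (\<lambda>s. f s t) S) T"
  using assms(1,3)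
proof (induction S)
  case empty
  then show ?case using assms(2) by (simp add: finsum_zero)
next
  case (insert s S)
  have c: "f s t \<in> carrier A" "finsum A (\<lambda>s. f s t) S \<in> carrier A" if "t \<in> T" for t
    using insert.prems that by (auto intro!: finsum_closed)
  have c': "finsum A (f s') T \<in> carrier A" if "s' \<in> insert s S" for s'
    using insert.prems that by (auto intro!: finsum_closed)
  have "finsum A (\<lambda>t. finsum A (\<lambda>s. f s t) (insert s S)) T = finsum A (\<lambda>t. f s t \<oplus> finsum A (\<lambda>s. f s t) S) T"
    using insert by (intro finsum_cong') (auto intro!: a_closed c)
  also have "\<dots> = finsum A (f s) T \<oplus> finsum A (\<lambda>t. finsum A (\<lambda>s. f s t) S) T"
    using c by (intro finsum_addf) auto
  finally show ?case using insert c' by (simp add: Pi_def)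
qed

lemma (in star_algebra) finsum_Times:
  assumes "finite S" "finite T" "\<And>s t. \<lbrakk>s \<in> S; t \<in> T\<rbrakk> \<Longrightarrow> f (s, t) \<in> carrier A"
  shows "finsum A f (S \<times> T) = finsum A (\<lambda>s. finsum A (\<lambda>t. f (s, t)) T) S"
  using assms(1,3)
proof (induction S rule: finite_induct)
  case (insert a S)
  have c: "finsum A (\<lambda>t. f (b, t)) T \<in> carrier A" if "b \<in> insert a S" for b
    using insert.prems that by (auto intro!: finsum_closed)
  have "insert a S \<times> T = (\<lambda>t. (a, t)) ` T \<union> S \<times> T" by auto
  then have "finsum A f (insert a S \<times> T) = finsum A f ((\<lambda>t. (a, t)) ` T) \<oplus> finsum A f (S \<times> T)"
    using insert assms(2) by (subst finsum_Un_disjoint[symmetric]) auto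
  also have "finsum A f ((\<lambda>t. (a, t)) ` T) = finsum A (\<lambda>t. f (a, t)) T"
    using insert.prems by (intro finsum_reindex) (auto simp: inj_on_def)
  finally show ?case using insert c by (simp add: Pi_def)
qed simp

lemma (in star_algebra) finsum_of_nat:
  "\<lbrakk>finite S; x \<in> carrier A\<rbrakk> \<Longrightarrow> finsum A (\<lambda>_. x) S = of_nat (card S) \<odot> x"
  by (induction S rule: finite_induct) (auto simp: smult_add_left)

lemma (in star_algebra) finsum_if:
  assumes "finite S" "k \<in> S" "x \<in> carrier A"
  shows "finsum A (\<lambda>s. if s = k then x else \<zero>) S = x"
  using finsum_singleton[of k S "\<lambda>_. x"] assms by (simp add: eq_commute[of k] Pi_def)

locale magic_unitary = cstar_algebra A for A :: "'a cstar" (structure) +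
  fixes I :: "'i set" and u :: "'i \<Rightarrow> 'i \<Rightarrow> 'a"
  assumes fin: "finite I" and magic: "magic A I u"
begin

lemma u_closed [simp]: "\<lbrakk>i \<in> I; j \<in> I\<rbrakk> \<Longrightarrow> u i j \<in> carrier A"
  and u_idem: "\<lbrakk>i \<in> I; j \<in> I\<rbrakk> \<Longrightarrow> u i j \<otimes> u i j = u i j"
  and u_star: "\<lbrakk>i \<in> I; j \<in> I\<rbrakk> \<Longrightarrow> star A (u i j) = u i j"
  and row_sum: "i \<in> I \<Longrightarrow> finsum A (\<lambda>j. u i j) I = \<one>"
  and col_sum: "j \<in> I \<Longrightarrow> finsum A (\<lambda>i. u i j) I = \<one>"
  using magic by (auto simp: magic_def)

lemma row_orth: "\<lbrakk>i \<in> I; j \<in> I; k \<in> I; j \<noteq> k\<rbrakk> \<Longrightarrow> u i j \<otimes> u i k = \<zero>"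
  by (rule projections_orthogonal[OF fin, of "\<lambda>j. u i j"]) (auto simp: u_idem u_star row_sum)

lemma col_orth: "\<lbrakk>i \<in> I; j \<in> I; k \<in> I; j \<noteq> k\<rbrakk> \<Longrightarrow> u j i \<otimes> u k i = \<zero>"
  by (rule projections_orthogonal[OF fin, of "\<lambda>j. u j i"]) (auto simp: u_idem u_star col_sum)

text \<open>Orthogonality of distinct entries in a row and in a column, restated so that equality
  may enter Boolean combinations of preserved relations.\<close>

lemma preserves_Id: "preserves A I u Id"
  unfolding preserves_def using row_orth col_orth by auto

lemma row_select:
  assumes "i \<in> I" "j \<in> I"
  shows "u i j \<otimes> finsum A (\<lambda>m. if Q m then u i m else \<zero>) I = (if Q j then u i j else \<zero>)"
proof -
  have "u i j \<otimes> finsum A (\<lambda>m. if Q m then u i m else \<zero>) I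
      = finsum A (\<lambda>m. u i j \<otimes> (if Q m then u i m else \<zero>)) I"
    by (rule finsum_rdistr) (use assms fin in auto)
  also have "\<dots> = finsum A (\<lambda>m. if m = j then (if Q j then u i j else \<zero>) else \<zero>) I"
    by (rule finsum_cong') (use assms in \<open>auto simp: row_orth u_idem\<close>)
  also have "\<dots> = (if Q j then u i j else \<zero>)" by (rule finsum_if) (use assms fin in auto)
  finally show ?thesis .
qed

lemma col_select:
  assumes "k \<in> I" "l \<in> I"
  shows "finsum A (\<lambda>m. if Q m then u m l else \<zero>) I \<otimes> u k l = (if Q k then u k l else \<zero>)"
proof -
  have "finsum A (\<lambda>m. if Q m then u m l else \<zero>) I \<otimes> u k l
      = finsum A (\<lambda>m. (if Q m then u m l else \<zero>) \<otimes> u k l) I"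
    by (rule finsum_ldistr) (use assms fin in auto)
  also have "\<dots> = finsum A (\<lambda>m. if m = k then (if Q k then u k l else \<zero>) else \<zero>) I"
    by (rule finsum_cong') (use assms in \<open>auto simp: col_orth u_idem\<close>)
  also have "\<dots> = (if Q k then u k l else \<zero>)" by (rule finsum_if) (use assms fin in auto)
  finally show ?thesis .
qed

text \<open>Multiplying the entry \<open>(i, l)\<close> of the matrix identity by
  \<open>u i j\<close> on the left and \<open>u k l\<close> on the right selects a single term on
  each side. Conversely, inserting the row sum of the \<open>u i j\<close> and the column sum of the
  \<open>u m l\<close> expands both sides into products \<open>u i j * u m l\<close>, whose
  surviving terms agree.\<close>

lemma commutes_iff_preserves:
  "(\<forall>i\<in>I. \<forall>l\<in>I. finsum A (\<lambda>m. if (i, m) \<in> R then u m l else \<zero>) I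
      = finsum A (\<lambda>m. if (m, l) \<in> R then u i m else \<zero>) I) \<longleftrightarrow> preserves A I u R"
proof
  assume eq: "\<forall>i\<in>I. \<forall>l\<in>I. finsum A (\<lambda>m. if (i, m) \<in> R then u m l else \<zero>) I
      = finsum A (\<lambda>m. if (m, l) \<in> R then u i m else \<zero>) I"
  show "preserves A I u R"
    unfolding preserves_def
  proof (intro ballI impI)
    fix i j k l assume I: "i \<in> I" "j \<in> I" "k \<in> I" "l \<in> I" and ne: "((i, k) \<in> R) \<noteq> ((j, l) \<in> R)"
    define L where "L = finsum A (\<lambda>m. if (i, m) \<in> R then u m l else \<zero>) I"
    have L: "L \<in> carrier A" unfolding L_def by (rule finsum_closed) (use I in auto)
    have Lk: "L \<otimes> u k l = (if (i, k) \<in> R then u k l else \<zero>)"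
      unfolding L_def by (rule col_select) (use I in auto)
    have "u i j \<otimes> L = (if (j, l) \<in> R then u i j else \<zero>)"
      unfolding L_def using eq I by (simp add: row_select)
    moreover have "(u i j \<otimes> L) \<otimes> u k l = u i j \<otimes> (L \<otimes> u k l)" using L I by (simp add: m_assoc)
    ultimately have "(if (j, l) \<in> R then u i j else \<zero>) \<otimes> u k l = u i j \<otimes> (if (i, k) \<in> R then u k l else \<zero>)"
      using Lk by simp
    then show "u i j \<otimes> u k l = \<zero>" using ne I by (auto split: if_splits)
  qed
next
  assume R: "preserves A I u R"
  show "\<forall>i\<in>I. \<forall>l\<in>I. finsum A (\<lambda>m. if (i, m) \<in> R then u m l else \<zero>) I
      = finsum A (\<lambda>m. if (m, l) \<in> R then u i m else \<zero>) I"
  proof (intro ballI)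
    fix i l assume il: "i \<in> I" "l \<in> I"
    define L where "L = finsum A (\<lambda>m. if (i, m) \<in> R then u m l else \<zero>) I"
    define S where "S = finsum A (\<lambda>m. if (m, l) \<in> R then u i m else \<zero>) I"
    have c: "L \<in> carrier A" "S \<in> carrier A"
      unfolding L_def S_def by (rule finsum_closed; use il in auto)+
    have L: "u i j \<otimes> L = finsum A (\<lambda>m. if (i, m) \<in> R then u i j \<otimes> u m l else \<zero>) I" if "j \<in> I" for j
      unfolding L_def using that il fin
      by (subst finsum_rdistr) (auto intro!: finsum_cong')
    have S: "(if (j, l) \<in> R then u i j else \<zero>) = finsum A (\<lambda>m. if (j, l) \<in> R then u i j \<otimes> u m l else \<zero>) I"
      if "j \<in> I" for j
    proof (cases "(j, l) \<in> R")
      case True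
      then show ?thesis
        using finsum_rdistr[of I "u i j" "\<lambda>m. u m l"] col_sum[of l] that il fin by (simp add: Pi_def)
    qed (simp add: finsum_zero)
    have "L = finsum A (\<lambda>j. u i j) I \<otimes> L" using row_sum il c by simp
    also have "\<dots> = finsum A (\<lambda>j. u i j \<otimes> L) I" by (rule finsum_ldistr) (use il c fin in auto)
    also have "\<dots> = finsum A (\<lambda>j. if (j, l) \<in> R then u i j else \<zero>) I"
    proof (rule finsum_cong')
      fix j assume j: "j \<in> I"
      have "u i j \<otimes> L = finsum A (\<lambda>m. if (j, l) \<in> R then u i j \<otimes> u m l else \<zero>) I"
        unfolding L[OF j]
      proof (rule finsum_cong')
        fix m assume m: "m \<in> I"
        show "(if (i, m) \<in> R then u i j \<otimes> u m l else \<zero>) = (if (j, l) \<in> R then u i j \<otimes> u m l else \<zero>)"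
          using preservesD[OF R il(1) j m il(2)] by auto
      qed (use il j in auto)
      then show "u i j \<otimes> L = (if (j, l) \<in> R then u i j else \<zero>)" using S[OF j] by simp
    qed (use il in auto)
    finally show "finsum A (\<lambda>m. if (i, m) \<in> R then u m l else \<zero>) I
        = finsum A (\<lambda>m. if (m, l) \<in> R then u i m else \<zero>) I"
      unfolding L_def .
  qed
qed

text \<open>Both sums below evaluate \<open>\<Sum>m m'. u i j * u m m' * u k l\<close>, in which only the \<open>m\<close> and \<open>m'\<close>
  being counted for \<open>(i, k)\<close> and \<open>(j, l)\<close> contribute.\<close>

lemma preserves_count:
  assumes R: "preserves A I u R" and S: "preserves A I u S"
  shows "preserves A I u {(i, k). c \<le> card {m \<in> I. (i, m) \<in> R \<and> (m, k) \<in> S}}"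
  unfolding preserves_def
proof (intro ballI impI)
  fix i j k l assume I: "i \<in> I" "j \<in> I" "k \<in> I" "l \<in> I"
    and ne: "((i, k) \<in> {(i, k). c \<le> card {m \<in> I. (i, m) \<in> R \<and> (m, k) \<in> S}}) \<noteq>
      ((j, l) \<in> {(i, k). c \<le> card {m \<in> I. (i, m) \<in> R \<and> (m, k) \<in> S}})"
  define M where "M = {m \<in> I. (i, m) \<in> R \<and> (m, k) \<in> S}"
  define N where "N = {m \<in> I. (j, m) \<in> R \<and> (m, l) \<in> S}"
  have MN: "finite M" "finite N" "M \<subseteq> I" "N \<subseteq> I" using fin by (auto simp: M_def N_def)
  define z where "z = u i j \<otimes> u k l"
  define f where "f = (\<lambda>m m'. u i j \<otimes> u m m' \<otimes> u k l)"
  have z: "z \<in> carrier A" and f: "\<And>m m'. \<lbrakk>m \<in> I; m' \<in> I\<rbrakk> \<Longrightarrow> f m m' \<in> carrier A"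
    using I by (auto simp: z_def f_def)
  have f0: "f m m' = \<zero>" if "m \<in> I" "m' \<in> I" "(m \<in> M) \<noteq> (m' \<in> N)" for m m'
  proof -
    have "u i j \<otimes> u m m' = \<zero> \<or> u m m' \<otimes> u k l = \<zero>"
      using preservesD[OF R I(1,2) that(1,2)] preservesD[OF S that(1,2) I(3,4)] that
      unfolding M_def N_def by blast
    then show ?thesis
    proof
      assume "u i j \<otimes> u m m' = \<zero>"
      then show ?thesis using I by (simp add: f_def)
    next
      assume "u m m' \<otimes> u k l = \<zero>"
      then show ?thesis using I that by (simp add: f_def m_assoc)
    qed
  qed
  have row: "finsum A (f m) I = z" if m: "m \<in> I" for m
  proof -
    have "z = u i j \<otimes> finsum A (\<lambda>m'. u m m') I \<otimes> u k l" using row_sum[OF m] I by (simp add: z_def)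
    then show ?thesis using I m fin by (simp add: f_def finsum_ldistr finsum_rdistr Pi_def)
  qed
  have col: "finsum A (\<lambda>m. f m m') I = z" if m: "m' \<in> I" for m'
  proof -
    have "z = u i j \<otimes> finsum A (\<lambda>m. u m m') I \<otimes> u k l" using col_sum[OF m] I by (simp add: z_def)
    then show ?thesis using I m fin by (simp add: f_def finsum_ldistr finsum_rdistr Pi_def)
  qed
  have "of_nat (card M) \<odot> z = finsum A (\<lambda>m. finsum A (f m) N) M"
  proof -
    have "finsum A (f m) N = z" if m: "m \<in> M" for m
    proof -
      have "finsum A (f m) N = finsum A (f m) I"
        by (rule add.finprod_mono_neutral_cong_left[OF fin MN(4)]) (use m MN f f0 in \<open>auto simp: subset_iff\<close>)
      then show ?thesis using row m MN by auto
    qed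
    then have "finsum A (\<lambda>m. finsum A (f m) N) M = finsum A (\<lambda>_. z) M"
      using z by (intro finsum_cong') auto
    then show ?thesis using finsum_of_nat[OF MN(1) z] by simp
  qed
  also have "\<dots> = finsum A (\<lambda>m'. finsum A (\<lambda>m. f m m') M) N"
    by (rule finsum_swap) (use MN f in auto)
  also have "\<dots> = of_nat (card N) \<odot> z"
  proof -
    have "finsum A (\<lambda>m. f m m') M = z" if m: "m' \<in> N" for m'
    proof -
      have "finsum A (\<lambda>m. f m m') M = finsum A (\<lambda>m. f m m') I"
        by (rule add.finprod_mono_neutral_cong_left[OF fin MN(3)]) (use m MN f f0 in \<open>auto simp: subset_iff\<close>)
      then show ?thesis using col m MN by auto
    qed
    then have "finsum A (\<lambda>m'. finsum A (\<lambda>m. f m m') M) N = finsum A (\<lambda>_. z) N"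
      using z by (intro finsum_cong') auto
    then show ?thesis using finsum_of_nat[OF MN(2) z] by simp
  qed
  finally have "(of_nat (card M) - of_nat (card N)) \<odot> z = \<zero>"
    using z by (simp add: diff_smult minus_eq r_neg)
  \<comment> \<open>The two counts lie on different sides of the threshold \<open>c\<close>, so the
    scalar can be cancelled.\<close>
  moreover have "of_nat (card M) - of_nat (card N) \<noteq> (0 :: complex)"
    using ne by (auto simp: M_def N_def)
  ultimately show "u i j \<otimes> u k l = \<zero>"
    using z smult_smult[of z "inverse (of_nat (card M) - of_nat (card N))" "of_nat (card M) - of_nat (card N)"]
    by (simp add: z_def)
qed

text \<open>Composability means at least one midpoint, which is \<open>preserves_count\<close> with
  threshold one; the inclusion of \<open>R\<close> keeps all midpoints inside
  \<open>I\<close>.\<close>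

lemma preserves_relcomp:
  assumes "preserves A I u R" "preserves A I u S" "R \<subseteq> I \<times> I"
  shows "preserves A I u (R O S)"
proof -
  have "{(i, k). 1 \<le> card {m \<in> I. (i, m) \<in> R \<and> (m, k) \<in> S}} = R O S"
  proof -
    have "1 \<le> card {m \<in> I. (i, m) \<in> R \<and> (m, k) \<in> S} \<longleftrightarrow> (\<exists>m. (i, m) \<in> R \<and> (m, k) \<in> S)" for i k
    proof -
      have "1 \<le> card {m \<in> I. (i, m) \<in> R \<and> (m, k) \<in> S} \<longleftrightarrow> {m \<in> I. (i, m) \<in> R \<and> (m, k) \<in> S} \<noteq> {}"
        using fin by (simp add: Suc_le_eq card_gt_0_iff)
      then show ?thesis using assms(3) by blast
    qed
    then show ?thesis by auto
  qed
  then show ?thesis using preserves_count[OF assms(1,2), of 1] by simp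
qed

text \<open>Two pairs told apart by the closure are told apart by some power of \<open>R\<close>, so
  it suffices to treat powers.\<close>

lemma preserves_rtrancl:
  assumes R: "preserves A I u R" "R \<subseteq> I \<times> I" shows "preserves A I u (R\<^sup>*)"
proof -
  have "preserves A I u (R ^^ n)" for n
  proof (induction n)
    case 0
    then show ?case using preserves_Id by simp
  next
    case (Suc n)
    have "R ^^ Suc n = R O R ^^ n" by (metis relpow_commute relpow.simps(2))
    then show ?case using preserves_relcomp[OF R(1) Suc R(2)] by simp
  qed
  then show ?thesis unfolding preserves_def rtrancl_power by blast
qed

end

section \<open>Quantum permutation groups\<close>

definition qpg_ok :: "('i, 'a) qpg \<Rightarrow> bool" where
  "qpg_ok G \<longleftrightarrow> finite (qpoints G) \<and> qpoints G \<noteq> {} \<and> cstar_algebra (qalg G) \<and>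
     magic (qalg G) (qpoints G) (qrep G) \<and>
     generates (qalg G) {qrep G i j | i j. i \<in> qpoints G \<and> j \<in> qpoints G}"

text \<open>The functor represented by \<open>qalg G\<close>, with a homomorphism recorded by its
  matrix of values on the fundamental representation. The type of \<open>D\<close> is independent of
  that of \<open>G\<close>, so groups over unrelated types can be compared through the same
  \<open>w\<close>.\<close>

definition models :: "'d cstar \<Rightarrow> ('i \<Rightarrow> 'i \<Rightarrow> 'd) \<Rightarrow> ('i, 'a) qpg \<Rightarrow> bool" where
  "models D w G \<longleftrightarrow>
     (\<exists>h\<in>star_hom (qalg G) D. \<forall>i\<in>qpoints G. \<forall>j\<in>qpoints G. h (qrep G i j) = w i j)"

lemma models_self: "models (qalg G) (qrep G) G"
  unfolding models_def by (rule bexI[OF _ star_hom_id]) simp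

lemma models_cong:
  "\<lbrakk>models D w G; \<And>i j. \<lbrakk>i \<in> qpoints G; j \<in> qpoints G\<rbrakk> \<Longrightarrow> w i j = w' i j\<rbrakk> \<Longrightarrow> models D w' G"
  unfolding models_def by (metis (no_types, lifting))

lemma magic_hom:
  assumes A: "star_algebra A" and D: "star_algebra D" and h: "h \<in> star_hom A D" and I: "finite I"
    and u: "magic A I u" and w: "\<And>i j. \<lbrakk>i \<in> I; j \<in> I\<rbrakk> \<Longrightarrow> h (u i j) = w i j"
  shows "magic D I w"
proof -
  interpret A: star_algebra A by fact
  interpret D: star_algebra D by fact
  have c: "u i j \<in> carrier A" "u i j \<otimes>\<^bsub>A\<^esub> u i j = u i j" "star A (u i j) = u i j" if "i \<in> I" "j \<in> I" for i j
    using u that by (auto simp: magic_def)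
  have wc: "w i j \<in> carrier D" if "i \<in> I" "j \<in> I" for i j
    using w[OF that] star_homD(1)[OF h c(1)[OF that]] by simp
  have "w i j \<otimes>\<^bsub>D\<^esub> w i j = w i j \<and> star D (w i j) = w i j" if "i \<in> I" "j \<in> I" for i j
    using w[OF that] c[OF that] star_homD(3,6)[OF h] by metis
  moreover have "finsum D (\<lambda>j. w i j) I = \<one>\<^bsub>D\<^esub>" if "i \<in> I" for i
  proof -
    have "h (finsum A (\<lambda>j. u i j) I) = finsum D (\<lambda>j. h (u i j)) I"
      by (rule star_hom_finsum[OF A D h I]) (use c that in auto)
    also have "\<dots> = finsum D (\<lambda>j. w i j) I"
      by (rule D.finsum_cong') (use w wc that in auto)
    finally show ?thesis using u that star_homD(4)[OF h] by (simp add: magic_def)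
  qed
  moreover have "finsum D (\<lambda>i. w i j) I = \<one>\<^bsub>D\<^esub>" if "j \<in> I" for j
  proof -
    have "h (finsum A (\<lambda>i. u i j) I) = finsum D (\<lambda>i. h (u i j)) I"
      by (rule star_hom_finsum[OF A D h I]) (use c that in auto)
    also have "\<dots> = finsum D (\<lambda>i. w i j) I"
      by (rule D.finsum_cong') (use w wc that in auto)
    finally show ?thesis using u that star_homD(4)[OF h] by (simp add: magic_def)
  qed
  ultimately show ?thesis using wc by (simp add: magic_def)
qed

lemma models_magic:
  assumes G: "qpg_ok G" and D: "star_algebra D" and w: "models D w G"
  shows "magic D (qpoints G) w"
proof -
  have "star_algebra (qalg G)" using G by (simp add: qpg_ok_def cstar_algebra_def seminormed_star_algebra_def)
  then show ?thesis
    using w magic_hom[OF _ D] G unfolding models_def qpg_ok_def by blast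
qed

text \<open>The two homomorphisms are inverse to each other because both composites fix the
  generators and the equalizer with the identity is a closed subalgebra.\<close>

lemma qpg_eqI:
  assumes G: "qpg_ok G" and H: "qpg_ok H" and pts: "qpoints G = qpoints H"
    and GH: "models (qalg H) (qrep H) G" and HG: "models (qalg G) (qrep G) H"
  shows "qpg_eq G H"
proof -
  obtain f where f: "f \<in> star_hom (qalg G) (qalg H)"
      "\<And>i j. \<lbrakk>i \<in> qpoints G; j \<in> qpoints G\<rbrakk> \<Longrightarrow> f (qrep G i j) = qrep H i j"
    using GH by (auto simp: models_def)
  obtain g where g: "g \<in> star_hom (qalg H) (qalg G)"
      "\<And>i j. \<lbrakk>i \<in> qpoints G; j \<in> qpoints G\<rbrakk> \<Longrightarrow> g (qrep H i j) = qrep G i j"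
    using HG pts by (auto simp: models_def)
  have A: "cstar_algebra (qalg G)" "cstar_algebra (qalg H)" using G H by (auto simp: qpg_ok_def)
  have cG: "\<And>i j. \<lbrakk>i \<in> qpoints G; j \<in> qpoints G\<rbrakk> \<Longrightarrow> qrep G i j \<in> carrier (qalg G)"
    and cH: "\<And>i j. \<lbrakk>i \<in> qpoints G; j \<in> qpoints G\<rbrakk> \<Longrightarrow> qrep H i j \<in> carrier (qalg H)"
    using G H pts by (auto simp: qpg_ok_def magic_def)
  have "carrier (qalg G) \<subseteq> {x \<in> carrier (qalg G). g (f x) = x}"
  proof -
    have "closed_subalgebra (qalg G) {x \<in> carrier (qalg G). g (f x) = x}"
      by (rule closed_subalgebra_equalizer[OF A(1) A(1) star_hom_comp[OF f(1) g(1)] star_hom_id])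
    moreover have "{qrep G i j | i j. i \<in> qpoints G \<and> j \<in> qpoints G} \<subseteq> {x \<in> carrier (qalg G). g (f x) = x}"
      using f(2) g(2) cG by auto
    ultimately show ?thesis using G unfolding qpg_ok_def generates_def by blast
  qed
  moreover have "carrier (qalg H) \<subseteq> {x \<in> carrier (qalg H). f (g x) = x}"
  proof -
    have "closed_subalgebra (qalg H) {x \<in> carrier (qalg H). f (g x) = x}"
      by (rule closed_subalgebra_equalizer[OF A(2) A(2) star_hom_comp[OF g(1) f(1)] star_hom_id])
    moreover have "{qrep H i j | i j. i \<in> qpoints H \<and> j \<in> qpoints H} \<subseteq> {x \<in> carrier (qalg H). f (g x) = x}"
      using f(2) g(2) cH pts by auto
    ultimately show ?thesis using H unfolding qpg_ok_def generates_def by blast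
  qed
  ultimately have "bij_betw f (carrier (qalg G)) (carrier (qalg H))"
    using star_homD(1)[OF f(1)] star_homD(1)[OF g(1)] by (intro bij_betwI[of _ _ _ g]) auto
  then show ?thesis using f pts unfolding qpg_eq_def star_iso_def by blast
qed

lemma qpg_relabel_ok:
  assumes G: "qpg_ok G" and f: "inj_on f (qpoints G)"
  shows "qpg_ok (qpg_relabel f G)"
proof -
  let ?g = "the_inv_into (qpoints G) f"
  interpret A: cstar_algebra "qalg G" using G by (simp add: qpg_ok_def)
  have g: "?g (f i) = i" if "i \<in> qpoints G" for i using the_inv_into_f_f[OF f that] .
  have c: "\<And>i j. \<lbrakk>i \<in> qpoints G; j \<in> qpoints G\<rbrakk> \<Longrightarrow> qrep G i j \<in> carrier (qalg G)"
    using G by (auto simp: qpg_ok_def magic_def)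
  have sum: "finsum (qalg G) F (f ` qpoints G) = finsum (qalg G) (\<lambda>i. F (f i)) (qpoints G)"
    if "\<And>i. i \<in> qpoints G \<Longrightarrow> F (f i) \<in> carrier (qalg G)" for F
    by (rule A.finsum_reindex) (use that f in auto)
  have 1: "finsum (qalg G) (\<lambda>j. qrep G i (?g (f j))) (qpoints G) = finsum (qalg G) (\<lambda>j. qrep G i j) (qpoints G)"
    if "i \<in> qpoints G" for i
    by (rule A.finsum_cong') (use g c that in auto)
  have 2: "finsum (qalg G) (\<lambda>j. qrep G (?g (f j)) i) (qpoints G) = finsum (qalg G) (\<lambda>j. qrep G j i) (qpoints G)"
    if "i \<in> qpoints G" for i
    by (rule A.finsum_cong') (use g c that in auto)
  have "magic (qalg G) (f ` qpoints G) (\<lambda>i j. qrep G (?g i) (?g j))"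
    using G g c 1 2 by (auto simp: magic_def qpg_ok_def sum)
  moreover have "{qrep G (?g i) (?g j) | i j. i \<in> f ` qpoints G \<and> j \<in> f ` qpoints G}
      = {qrep G i j | i j. i \<in> qpoints G \<and> j \<in> qpoints G}"
    using g by (auto; metis imageI)
  ultimately show ?thesis using G by (simp add: qpg_ok_def qpg_relabel_def)
qed

section \<open>Presented quantum permutation groups\<close>

lemma magic_relations_subset: "magic_relations I \<subseteq> star_polys (I \<times> I)"
  by (auto simp: magic_relations_def)

lemma magic_relations_iff:
  assumes h: "free_hom (I \<times> I) D h" and I: "finite I"
  shows "(\<forall>r\<in>magic_relations I. h r = \<zero>\<^bsub>D\<^esub>) \<longleftrightarrow> magic D I (\<lambda>i j. h (gen (i, j)))"
proof -
  interpret D: star_algebra D using h by (simp add: free_hom_def)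
  note H = free_homD[OF h]
  have D0: "h (a - b) = \<zero>\<^bsub>D\<^esub> \<longleftrightarrow> h a = h b" if "a \<in> star_polys (I \<times> I)" "b \<in> star_polys (I \<times> I)" for a b
    using that H(1) by (simp add: H(8) D.minus_eq_zero_iff)
  have c: "h (gen (i, j)) \<in> carrier D" if "i \<in> I" "j \<in> I" for i j using H(1) that by simp
  have "(\<forall>r\<in>magic_relations I. h r = \<zero>\<^bsub>D\<^esub>) \<longleftrightarrow>
      (\<forall>i\<in>I. \<forall>j\<in>I. h (gen (i, j)) \<otimes>\<^bsub>D\<^esub> h (gen (i, j)) = h (gen (i, j))) \<and>
      (\<forall>i\<in>I. \<forall>j\<in>I. star D (h (gen (i, j))) = h (gen (i, j))) \<and>
      (\<forall>i\<in>I. finsum D (\<lambda>j. h (gen (i, j))) I = \<one>\<^bsub>D\<^esub>) \<and> (\<forall>j\<in>I. finsum D (\<lambda>i. h (gen (i, j))) I = \<one>\<^bsub>D\<^esub>)"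
    unfolding magic_relations_def ball_Un conj_assoc Ball_Collect_simps
    by (intro arg_cong2[where f = "(\<and>)"] ball_cong refl) (simp_all add: D0 H(3,4,6) H(9)[OF I])
  then show ?thesis using c unfolding magic_def by blast
qed

text \<open>Up to seminorm zero each generator is a projection, so the C*-identity makes its
  seminorm an idempotent real and 1 is a bound.\<close>

lemma presentation_magic:
  assumes R: "R \<subseteq> star_polys (I \<times> I)"
  shows "presentation (I \<times> I) (magic_relations I \<union> R)"
proof
  show "magic_relations I \<union> R \<subseteq> star_polys (I \<times> I)" using R magic_relations_subset by blast
  fix g assume "g \<in> I \<times> I"
  then obtain i j where g: "g = (i, j)" "i \<in> I" "j \<in> I" by auto
  have "p (gen g) \<le> 1" if p: "admissible (I \<times> I) (magic_relations I \<union> R) p" for p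
  proof -
    interpret p: seminormed_star_algebra "free_star_algebra (I \<times> I) p" by (rule admissible_seminormed[OF p])
    have gG [simp]: "g \<in> I \<times> I" using g by simp
    have zero: "p (gen g * gen g - gen g) = 0" "p (poly_star (gen g) - gen g) = 0"
      using p g unfolding admissible_def magic_relations_def by blast+
    have add: "p (a + b) = p b" if "a \<in> star_polys (I \<times> I)" "b \<in> star_polys (I \<times> I)" "p a = 0" for a b
    proof -
      have "p (- a) = 0" using p.nrm_smult[of a "-1"] that by simp
      then have "p b \<le> p (a + b)" using p.nrm_triangle[of "- a" "a + b"] that by simp
      then show ?thesis using p.nrm_triangle[of a b] that by simp
    qed
    have 1: "p (gen g * gen g) = p (gen g)" using add[OF _ _ zero(1), of "gen g"] by simp
    have "p ((poly_star (gen g) - gen g) * gen g) = 0"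
      using p.nrm_mult[of "poly_star (gen g) - gen g" "gen g"] p.nrm_nonneg[of "(poly_star (gen g) - gen g) * gen g"]
      by (simp add: zero(2))
    from add[OF _ _ this, of "gen g * gen g"] have "p (poly_star (gen g) * gen g) = p (gen g * gen g)"
      by (simp add: algebra_simps)
    then have "(p (gen g))\<^sup>2 = p (gen g)" using p.nrm_cstar[of "gen g"] 1 by simp
    then have "p (gen g) = 0 \<or> p (gen g) = 1" by (simp add: power2_eq_square)
    then show ?thesis by auto
  qed
  then show "\<exists>B. \<forall>p. admissible (I \<times> I) (magic_relations I \<union> R) p \<longrightarrow> p (gen g) \<le> B" by blast
qed

lemma presented_qpg_ok:
  assumes R: "R \<subseteq> star_polys (I \<times> I)" and I: "finite I" "I \<noteq> {}"
  shows "qpg_ok (presented_qpg I (magic_relations I \<union> R))"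
proof -
  interpret presentation "I \<times> I" "magic_relations I \<union> R" by (rule presentation_magic[OF R])
  have "magic (universal_cstar (I \<times> I) (magic_relations I \<union> R)) I
      (\<lambda>i j. universal_gen (I \<times> I) (magic_relations I \<union> R) (i, j))"
    using magic_relations_iff[OF free_hom_to_completion I(1)] to_completion_relation
    by (simp add: to_completion_gen)
  moreover have "universal_gen (I \<times> I) (magic_relations I \<union> R) ` (I \<times> I)
      = {universal_gen (I \<times> I) (magic_relations I \<union> R) (i, j) | i j. i \<in> I \<and> j \<in> I}"
    by auto
  ultimately show ?thesis
    using I universal_cstar_algebra universal_generates by (simp add: qpg_ok_def presented_qpg_def)
qed

lemma presented_qpg_relation:
  assumes R: "R \<subseteq> star_polys (I \<times> I)"
  obtains h where "free_hom (I \<times> I) (qalg (presented_qpg I (magic_relations I \<union> R))) h"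
    "\<And>i j. h (gen (i, j)) = qrep (presented_qpg I (magic_relations I \<union> R)) i j"
    "\<And>r. r \<in> R \<Longrightarrow> h r = \<zero>\<^bsub>qalg (presented_qpg I (magic_relations I \<union> R))\<^esub>"
proof -
  interpret presentation "I \<times> I" "magic_relations I \<union> R" by (rule presentation_magic[OF R])
  show ?thesis
    by (rule that[of "to_completion P"])
      (use free_hom_to_completion to_completion_relation in \<open>auto simp: presented_qpg_def to_completion_gen\<close>)
qed

lemma presented_qpg_models:
  assumes R: "R \<subseteq> star_polys (I \<times> I)" and I: "finite I" and D: "cstar_algebra D"
    and h: "free_hom (I \<times> I) D h" and w: "magic D I (\<lambda>i j. h (gen (i, j)))"
    and r: "\<And>r. r \<in> R \<Longrightarrow> h r = \<zero>\<^bsub>D\<^esub>"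
  shows "models D (\<lambda>i j. h (gen (i, j))) (presented_qpg I (magic_relations I \<union> R))"
proof -
  interpret presentation "I \<times> I" "magic_relations I \<union> R" by (rule presentation_magic[OF R])
  have "h r = \<zero>\<^bsub>D\<^esub>" if "r \<in> magic_relations I \<union> R" for r
    using that w magic_relations_iff[OF h I] r by blast
  then obtain k where "k \<in> star_hom (universal_cstar (I \<times> I) (magic_relations I \<union> R)) D"
      "\<And>g. g \<in> I \<times> I \<Longrightarrow> k (universal_gen (I \<times> I) (magic_relations I \<union> R) g) = h (gen g)"
    using universal_lift[OF D h] by blast
  then show ?thesis unfolding models_def presented_qpg_def by (intro bexI[of _ k]) auto
qed

lemma simple_graphD:
  assumes "simple_graph X"
  shows "finite (pverts X)" "pverts X \<noteq> {}" "parcs X \<subseteq> pverts X \<times> pverts X"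
    "(x, y) \<in> parcs X \<Longrightarrow> (y, x) \<in> parcs X" "(x, x) \<notin> parcs X"
proof -
  interpret pair_graph X using assms by (simp add: simple_graph_def)
  show "finite (pverts X)" "pverts X \<noteq> {}" using assms pair_finite_verts by (auto simp: simple_graph_def)
  show "parcs X \<subseteq> pverts X \<times> pverts X" using in_arcsD1 in_arcsD2 by auto
  show "(x, y) \<in> parcs X \<Longrightarrow> (y, x) \<in> parcs X" using pair_sym_arcs by (auto simp: symmetric_def sym_def)
  show "(x, x) \<notin> parcs X" using pair_no_loops by fastforce
qed

lemma commutation_relations_subset: "commutation_relations X \<subseteq> star_polys (pverts X \<times> pverts X)"
  by (auto simp: commutation_relations_def adjacency_def)

lemma commutation_relations_iff:
  assumes X: "finite (pverts X)" and D: "cstar_algebra D" and h: "free_hom (pverts X \<times> pverts X) D h"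
    and u: "magic D (pverts X) (\<lambda>i j. h (gen (i, j)))"
  shows "(\<forall>r\<in>commutation_relations X. h r = \<zero>\<^bsub>D\<^esub>) \<longleftrightarrow> preserves D (pverts X) (\<lambda>i j. h (gen (i, j))) (parcs X)"
proof -
  interpret D: cstar_algebra D by fact
  interpret magic_unitary D "pverts X" "\<lambda>i j. h (gen (i, j))"
    by (intro magic_unitary.intro magic_unitary_axioms.intro D X u)
  note H = free_homD[OF h]
  have D0: "h (a - b) = \<zero>\<^bsub>D\<^esub> \<longleftrightarrow> h a = h b"
    if "a \<in> star_polys (pverts X \<times> pverts X)" "b \<in> star_polys (pverts X \<times> pverts X)" for a b
    using that H(1) by (simp add: H(8) D.minus_eq_zero_iff)
  have a1: "h (\<Sum>k\<in>pverts X. adjacency X i k * gen (k, j))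
      = finsum D (\<lambda>m. if (i, m) \<in> parcs X then h (gen (m, j)) else \<zero>\<^bsub>D\<^esub>) (pverts X)"
    if "i \<in> pverts X" "j \<in> pverts X" for i j
    using that by (subst H(9)[OF X]) (auto simp: adjacency_def H(7) intro!: D.finsum_cong')
  have a2: "h (\<Sum>k\<in>pverts X. gen (i, k) * adjacency X k j)
      = finsum D (\<lambda>m. if (m, j) \<in> parcs X then h (gen (i, m)) else \<zero>\<^bsub>D\<^esub>) (pverts X)"
    if "i \<in> pverts X" "j \<in> pverts X" for i j
    using that by (subst H(9)[OF X]) (auto simp: adjacency_def H(7) intro!: D.finsum_cong')
  have mem: "(\<Sum>k\<in>pverts X. adjacency X i k * gen (k, j)) \<in> star_polys (pverts X \<times> pverts X)"
      "(\<Sum>k\<in>pverts X. gen (i, k) * adjacency X k j) \<in> star_polys (pverts X \<times> pverts X)"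
    if "i \<in> pverts X" "j \<in> pverts X" for i j
    using that by (auto simp: adjacency_def)
  have "(\<forall>r\<in>commutation_relations X. h r = \<zero>\<^bsub>D\<^esub>) \<longleftrightarrow> (\<forall>i\<in>pverts X. \<forall>j\<in>pverts X.
      finsum D (\<lambda>m. if (i, m) \<in> parcs X then h (gen (m, j)) else \<zero>\<^bsub>D\<^esub>) (pverts X)
      = finsum D (\<lambda>m. if (m, j) \<in> parcs X then h (gen (i, m)) else \<zero>\<^bsub>D\<^esub>) (pverts X))"
    unfolding commutation_relations_def Ball_Collect_simps
    by (intro ball_cong refl) (simp add: D0[OF mem] a1 a2)
  also have "\<dots> \<longleftrightarrow> preserves D (pverts X) (\<lambda>i j. h (gen (i, j))) (parcs X)"
    by (rule commutes_iff_preserves)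
  finally show ?thesis .
qed

lemma Qut_ok:
  assumes "finite (pverts X)" "pverts X \<noteq> {}" shows "qpg_ok (Qut X)"
  unfolding Qut_def by (rule presented_qpg_ok[OF commutation_relations_subset assms])

lemma qpoints_Qut [simp]: "qpoints (Qut X) = pverts X"
  by (simp add: Qut_def presented_qpg_def)

lemma preserves_hom:
  assumes A: "star_algebra A" and D: "star_algebra D" and h: "h \<in> star_hom A D"
    and u: "preserves A I u R" and c: "\<And>i j. \<lbrakk>i \<in> I; j \<in> I\<rbrakk> \<Longrightarrow> u i j \<in> carrier A"
    and w: "\<And>i j. \<lbrakk>i \<in> I; j \<in> I\<rbrakk> \<Longrightarrow> h (u i j) = w i j"
  shows "preserves D I w R"
  unfolding preserves_def
proof (intro ballI impI)
  fix i j k l assume I: "i \<in> I" "j \<in> I" "k \<in> I" "l \<in> I" and "((i, k) \<in> R) \<noteq> ((j, l) \<in> R)"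
  then have "u i j \<otimes>\<^bsub>A\<^esub> u k l = \<zero>\<^bsub>A\<^esub>" by (intro preservesD[OF u])
  then show "w i j \<otimes>\<^bsub>D\<^esub> w k l = \<zero>\<^bsub>D\<^esub>"
    using star_homD(3)[OF h c[OF I(1,2)] c[OF I(3,4)]] star_hom_zero[OF A D h] w I by simp
qed

text \<open>From here on presentations are no longer needed for \<open>Qut\<close>: all comparisons
  use the two properties on the right, which make sense in any \<open>D\<close>.\<close>

theorem models_Qut_iff:
  assumes X: "finite (pverts X)" "pverts X \<noteq> {}" and D: "cstar_algebra D"
  shows "models D w (Qut X) \<longleftrightarrow> magic D (pverts X) w \<and> preserves D (pverts X) w (parcs X)"
proof
  interpret D: cstar_algebra D by fact
  note ok = Qut_ok[OF X]
  assume w: "models D w (Qut X)"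
  obtain h where h: "free_hom (pverts X \<times> pverts X) (qalg (Qut X)) h" "\<And>i j. h (gen (i, j)) = qrep (Qut X) i j"
      "\<And>r. r \<in> commutation_relations X \<Longrightarrow> h r = \<zero>\<^bsub>qalg (Qut X)\<^esub>"
    using presented_qpg_relation[OF commutation_relations_subset[of X]] unfolding Qut_def by metis
  have A: "cstar_algebra (qalg (Qut X))" and m: "magic (qalg (Qut X)) (pverts X) (qrep (Qut X))"
    using ok by (auto simp: qpg_ok_def)
  have "preserves (qalg (Qut X)) (pverts X) (qrep (Qut X)) (parcs X)"
    using commutation_relations_iff[OF X(1) A h(1)] h(2,3) m by simp
  then have "preserves D (pverts X) w (parcs X)"
    using w m A unfolding models_def
    by (auto intro!: preserves_hom[of "qalg (Qut X)" D _ _ "qrep (Qut X)"] D.star_algebra_axioms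
        simp: cstar_algebra_def seminormed_star_algebra_def magic_def)
  then show "magic D (pverts X) w \<and> preserves D (pverts X) w (parcs X)"
    using models_magic[OF ok D.star_algebra_axioms w] by simp
next
  interpret D: cstar_algebra D by fact
  assume w: "magic D (pverts X) w \<and> preserves D (pverts X) w (parcs X)"
  have "w (fst g) (snd g) \<in> carrier D" if "g \<in> pverts X \<times> pverts X" for g
    using w that by (auto simp: magic_def)
  then obtain h where h: "free_hom (pverts X \<times> pverts X) D h" "\<And>g. g \<in> pverts X \<times> pverts X \<Longrightarrow> h (gen g) = w (fst g) (snd g)"
    using free_hom_ex[OF D.star_algebra_axioms, of "pverts X \<times> pverts X" "\<lambda>g. w (fst g) (snd g)"] by blast
  then have hw: "h (gen (i, j)) = w i j" if "i \<in> pverts X" "j \<in> pverts X" for i j using that by auto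
  have m: "magic D (pverts X) (\<lambda>i j. h (gen (i, j)))"
    by (rule magic_hom[OF D.star_algebra_axioms D.star_algebra_axioms star_hom_id X(1) conjunct1[OF w]]) (simp add: hw)
  moreover have "preserves D (pverts X) (\<lambda>i j. h (gen (i, j))) (parcs X)"
    using w by (simp add: preserves_def hw)
  ultimately have "models D (\<lambda>i j. h (gen (i, j))) (Qut X)"
    unfolding Qut_def
    using commutation_relations_iff[OF X(1) D h(1) m]
    by (intro presented_qpg_models[OF commutation_relations_subset X(1) D h(1) m]) blast
  then show "models D w (Qut X)" by (rule models_cong) (simp add: hw)
qed

lemma quantum_symmetric_group_ok: "n > 0 \<Longrightarrow> qpg_ok (quantum_symmetric_group n)"
  unfolding quantum_symmetric_group_def using presented_qpg_ok[of "{}" "{..<n}"] by auto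

lemma qpoints_quantum_symmetric_group [simp]: "qpoints (quantum_symmetric_group n) = {..<n}"
  by (simp add: quantum_symmetric_group_def presented_qpg_def)

lemma models_quantum_symmetric_group_iff:
  assumes n: "n > 0" and D: "cstar_algebra D"
  shows "models D w (quantum_symmetric_group n) \<longleftrightarrow> magic D {..<n} w"
proof
  interpret D: cstar_algebra D by fact
  show "models D w (quantum_symmetric_group n) \<Longrightarrow> magic D {..<n} w"
    using models_magic[OF quantum_symmetric_group_ok[OF n] D.star_algebra_axioms] by simp
  assume w: "magic D {..<n} w"
  have "w (fst g) (snd g) \<in> carrier D" if "g \<in> {..<n} \<times> {..<n}" for g
    using w that by (auto simp: magic_def)
  then obtain h where h: "free_hom ({..<n} \<times> {..<n}) D h" "\<And>g. g \<in> {..<n} \<times> {..<n} \<Longrightarrow> h (gen g) = w (fst g) (snd g)"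
    using free_hom_ex[OF D.star_algebra_axioms, of "{..<n} \<times> {..<n}" "\<lambda>g. w (fst g) (snd g)"] by blast
  then have hw: "h (gen (i, j)) = w i j" if "i \<in> {..<n}" "j \<in> {..<n}" for i j using that by auto
  have m: "magic D {..<n} (\<lambda>i j. h (gen (i, j)))"
    by (rule magic_hom[OF D.star_algebra_axioms D.star_algebra_axioms star_hom_id _ w]) (simp_all add: hw)
  have "models D (\<lambda>i j. h (gen (i, j))) (quantum_symmetric_group n)"
    using presented_qpg_models[OF _ _ D h(1) m, of "{}"] by (simp add: quantum_symmetric_group_def)
  then show "models D w (quantum_symmetric_group n)" by (rule models_cong) (simp add: hw)
qed


section \<open>Free wreath products\<close>

text \<open>Stability under the star is not built into the generated ideal. The elements whose star
  lies in a closed ideal \<open>J\<close> containing \<open>S\<close> form again such an ideal,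
  provided that \<open>S\<close> is stable under \<open>s \<mapsto> - star s\<close>; a commutator
  of self-adjoint elements is even fixed by this map.\<close>

lemma closed_ideal_generated_props:
  fixes A :: "'a cstar" (structure)
  assumes A: "seminormed_star_algebra A" and S: "S \<subseteq> carrier A" and neg: "\<And>s. s \<in> S \<Longrightarrow> \<ominus> star A s \<in> S"
  shows "seminormed_star_ideal A (closed_ideal_generated A S)" "closed_in A (closed_ideal_generated A S)"
    "S \<subseteq> closed_ideal_generated A S"
    "\<lbrakk>ideal J A; closed_in A J; S \<subseteq> J\<rbrakk> \<Longrightarrow> closed_ideal_generated A S \<subseteq> J"
proof -
  interpret seminormed_star_algebra A by fact
  let ?F = "{I. ideal I A \<and> closed_in A I \<and> S \<subseteq> I}"
  have carr: "carrier A \<in> ?F" using S oneideal by (auto simp: closed_in_def)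
  have id: "ideal (closed_ideal_generated A S) A"
    unfolding closed_ideal_generated_def by (rule i_Intersect) (use carr in auto)
  show "S \<subseteq> closed_ideal_generated A S" by (auto simp: closed_ideal_generated_def)
  show min: "closed_ideal_generated A S \<subseteq> J" if "ideal J A" "closed_in A J" "S \<subseteq> J" for J
    using that by (auto simp: closed_ideal_generated_def)
  show "closed_in A (closed_ideal_generated A S)"
    unfolding closed_ideal_generated_def closed_in_def by blast
  have "star A x \<in> closed_ideal_generated A S" if x: "x \<in> closed_ideal_generated A S" for x
    unfolding closed_ideal_generated_def
  proof
    fix J assume J: "J \<in> ?F"
    then interpret J: ideal J A by simp
    let ?K = "{y \<in> carrier A. star A y \<in> J}"
    have "subgroup ?K (add_monoid A)"
    proof (rule subgroup.intro)
      fix y assume "y \<in> ?K"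
      then show "inv\<^bsub>add_monoid A\<^esub> y \<in> ?K" by (simp add: a_inv_def[symmetric] star_minus)
    qed (auto simp: star_add)
    then have "ideal ?K A"
      by (rule idealI[OF ring_axioms]) (auto simp: star_mult J.I_l_closed J.I_r_closed)
    moreover have "closed_in A ?K"
      unfolding closed_in_def
    proof (intro ballI impI)
      fix y assume y: "y \<in> carrier A" and *: "\<forall>e>0. \<exists>z\<in>?K. nrm A (y \<ominus> z) < e"
      have "\<exists>z\<in>J. nrm A (star A y \<ominus> z) < e" if "e > 0" for e
      proof -
        obtain z where z: "z \<in> carrier A" "star A z \<in> J" "nrm A (y \<ominus> z) < e" using * \<open>e > 0\<close> by blast
        then have "nrm A (star A y \<ominus> star A z) < e" using y by (simp add: star_diff[symmetric])
        then show ?thesis using z by blast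
      qed
      then show "y \<in> ?K" using J y by (auto simp: closed_in_def)
    qed
    moreover have "S \<subseteq> ?K"
    proof
      fix s assume s: "s \<in> S"
      then have "\<ominus> star A s \<in> J" using neg J by blast
      then have "\<ominus> (\<ominus> star A s) \<in> J" by simp
      then show "s \<in> ?K" using s S by auto
    qed
    ultimately have "closed_ideal_generated A S \<subseteq> ?K" by (rule min)
    then show "star A x \<in> J" using x by blast
  qed
  then show "seminormed_star_ideal A (closed_ideal_generated A S)"
    by (intro seminormed_star_ideal.intro star_ideal.intro star_ideal_axioms.intro
        seminormed_star_algebra_axioms star_algebra_axioms id)
qed

text \<open>Contractivity makes kernels closed, so a homomorphism that kills a set kills the closed
  ideal generated by it.\<close>

lemma star_hom_kernel:
  assumes A: "cstar_algebra A" and D: "cstar_algebra D" and h: "h \<in> star_hom A D"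
  shows "ideal {x \<in> carrier A. h x = \<zero>\<^bsub>D\<^esub>} A" "closed_in A {x \<in> carrier A. h x = \<zero>\<^bsub>D\<^esub>}"
proof -
  interpret A: cstar_algebra A by fact
  interpret D: cstar_algebra D by fact
  have q: "seminormed_star_algebra (A\<lparr>nrm := \<lambda>x. nrm D (h x)\<rparr>)"
    by (rule seminormed_nrm_update[OF A.star_algebra_axioms
          cstar_seminorm_hom[OF A.star_algebra_axioms D.seminormed_star_algebra_axioms h]])
  have eq: "{x \<in> carrier A. h x = \<zero>\<^bsub>D\<^esub>} = {x \<in> carrier A. nrm D (h x) = 0}"
    using star_homD(1)[OF h] D.nrm_definite by auto
  show "ideal {x \<in> carrier A. h x = \<zero>\<^bsub>D\<^esub>} A"
  proof (rule idealI[OF A.ring_axioms])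
    note Z = star_hom_zero[OF A.star_algebra_axioms D.star_algebra_axioms h]
      star_hom_minus[OF A.star_algebra_axioms D.star_algebra_axioms h]
    show "subgroup {x \<in> carrier A. h x = \<zero>\<^bsub>D\<^esub>} (add_monoid A)"
      by (rule subgroup.intro) (auto simp: Z star_homD[OF h] a_inv_def[symmetric])
  qed (auto simp: star_homD[OF h])
  show "closed_in A {x \<in> carrier A. h x = \<zero>\<^bsub>D\<^esub>}"
    unfolding closed_in_def
  proof (intro ballI impI)
    fix x assume x: "x \<in> carrier A" and *: "\<forall>e>0. \<exists>y\<in>{x \<in> carrier A. h x = \<zero>\<^bsub>D\<^esub>}. nrm A (x \<ominus>\<^bsub>A\<^esub> y) < e"
    have "nrm D (h x) \<le> 0"
    proof (rule field_le_epsilon)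
      fix e :: real assume "e > 0"
      then obtain y where y: "y \<in> carrier A" "h y = \<zero>\<^bsub>D\<^esub>" "nrm A (x \<ominus>\<^bsub>A\<^esub> y) < e" using * by blast
      have "nrm D (h (x \<ominus>\<^bsub>A\<^esub> y)) \<le> nrm A (x \<ominus>\<^bsub>A\<^esub> y)"
        using x y by (intro star_hom_contractive[OF A D.seminormed_star_algebra_axioms h]) auto
      then show "nrm D (h x) \<le> 0 + e"
        using x y star_homD(1)[OF h x]
        by (simp add: star_hom_diff[OF A.star_algebra_axioms D.star_algebra_axioms h] D.minus_eq)
    qed
    then have "nrm D (h x) = 0" using D.nrm_nonneg[OF star_homD(1)[OF h x]] by linarith
    then show "x \<in> {x \<in> carrier A. h x = \<zero>\<^bsub>D\<^esub>}" using x D.nrm_definite star_homD(1)[OF h x] by simp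
  qed
qed

locale wreath =
  fixes G :: "('i, 'a) qpg" and H :: "('j, 'b) qpg"
  assumes G: "qpg_ok G" and H: "qpg_ok H"
begin

abbreviation "CG \<equiv> qalg G"
abbreviation "CH \<equiv> qalg H"
abbreviation "VG \<equiv> qpoints G"
abbreviation "VH \<equiv> qpoints H"
abbreviation "PW \<equiv> wreath_power G H"
abbreviation "CW \<equiv> wreath_coproduct G H"
abbreviation "W \<equiv> cstar_quotient CW (wreath_ideal G H)"
abbreviation "fam a \<equiv> family_inj VH (\<lambda>_. CG) a"
abbreviation "U \<equiv> wreath_u G H"
abbreviation "V \<equiv> wreath_v G H"
abbreviation "cl x \<equiv> wreath_ideal G H +>\<^bsub>CW\<^esub> x"

lemma finite_points: "finite VG" "finite VH" and nonempty_points: "VG \<noteq> {}" "VH \<noteq> {}"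
  using G H by (auto simp: qpg_ok_def)

lemma CG: "cstar_algebra CG" and CH: "cstar_algebra CH"
  using G H by (auto simp: qpg_ok_def)

lemma PW: "cstar_algebra PW"
  unfolding wreath_power_def by (rule family_coproduct_cstar[OF CG])

lemma CW: "cstar_algebra CW"
  unfolding wreath_coproduct_def by (rule coproduct_cstar[OF PW CH])

sublocale CG: cstar_algebra CG by (rule CG)
sublocale CH: cstar_algebra CH by (rule CH)
sublocale PW: cstar_algebra PW by (rule PW)
sublocale CW: cstar_algebra CW by (rule CW)

lemma inj_hom: "a \<in> VH \<Longrightarrow> fam a \<in> star_hom CG PW"
  unfolding wreath_power_def by (rule family_inj_hom[OF CG])

lemma inl_hom: "coproduct_inl PW CH \<in> star_hom PW CW" and inr_hom: "coproduct_inr PW CH \<in> star_hom CH CW"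
  unfolding wreath_coproduct_def by (rule coproduct_hom[OF PW CH])+

lemma u_hom: "a \<in> VH \<Longrightarrow> (\<lambda>x. coproduct_inl PW CH (fam a x)) \<in> star_hom CG CW"
  by (rule star_hom_comp[OF inj_hom inl_hom])

lemma magic_G: "magic CG VG (qrep G)" and magic_H: "magic CH VH (qrep H)"
  using G H by (auto simp: qpg_ok_def)

lemma magic_U: "a \<in> VH \<Longrightarrow> magic CW VG (U a)"
  by (rule magic_hom[OF CG.star_algebra_axioms CW.star_algebra_axioms u_hom finite_points(1) magic_G])
    (auto simp: wreath_u_def)

lemma magic_V: "magic CW VH V"
  by (rule magic_hom[OF CH.star_algebra_axioms CW.star_algebra_axioms inr_hom finite_points(2) magic_H])
    (auto simp: wreath_v_def)

lemma UV_closed [simp]: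
  "\<lbrakk>a \<in> VH; i \<in> VG; j \<in> VG\<rbrakk> \<Longrightarrow> U a i j \<in> carrier CW" "\<lbrakk>a \<in> VH; b \<in> VH\<rbrakk> \<Longrightarrow> V a b \<in> carrier CW"
  using magic_U magic_V by (auto simp: magic_def)

lemma UV_star:
  "\<lbrakk>a \<in> VH; i \<in> VG; j \<in> VG\<rbrakk> \<Longrightarrow> star CW (U a i j) = U a i j" "\<lbrakk>a \<in> VH; b \<in> VH\<rbrakk> \<Longrightarrow> star CW (V a b) = V a b"
  using magic_U magic_V by (auto simp: magic_def)

definition S :: "(nat \<Rightarrow> ((nat \<Rightarrow> ('j \<times> 'a) star_poly) set + 'b) star_poly) set set" where
  "S = {U a i j \<otimes>\<^bsub>CW\<^esub> V a b \<ominus>\<^bsub>CW\<^esub> V a b \<otimes>\<^bsub>CW\<^esub> U a i j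
      | i j a b. i \<in> VG \<and> j \<in> VG \<and> a \<in> VH \<and> b \<in> VH}"

lemma wreath_ideal_eq: "wreath_ideal G H = closed_ideal_generated CW S"
  by (simp add: wreath_ideal_def S_def)

lemma S_props: "S \<subseteq> carrier CW" "s \<in> S \<Longrightarrow> \<ominus>\<^bsub>CW\<^esub> star CW s \<in> S"
proof -
  show "S \<subseteq> carrier CW" by (auto simp: S_def)
  assume "s \<in> S"
  then obtain i j a b where s: "s = U a i j \<otimes>\<^bsub>CW\<^esub> V a b \<ominus>\<^bsub>CW\<^esub> V a b \<otimes>\<^bsub>CW\<^esub> U a i j"
    and I: "i \<in> VG" "j \<in> VG" "a \<in> VH" "b \<in> VH" by (auto simp: S_def)
  have "\<ominus>\<^bsub>CW\<^esub> star CW s = s"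
    using I by (simp add: s CW.star_add CW.star_minus CW.star_mult UV_star CW.minus_eq CW.minus_add CW.a_comm)
  then show "\<ominus>\<^bsub>CW\<^esub> star CW s \<in> S" using \<open>s \<in> S\<close> by simp
qed

lemmas generated_ideal = closed_ideal_generated_props[OF CW.seminormed_star_algebra_axioms S_props, folded wreath_ideal_eq]

sublocale WI: seminormed_star_ideal CW "wreath_ideal G H"
  by (rule generated_ideal(1))

lemma W: "cstar_algebra W"
  by (rule WI.quotient_cstar_algebra[OF generated_ideal(2) CW.nrm_complete])

sublocale W: cstar_algebra W by (rule W)

lemma cl_hom: "(+>\<^bsub>CW\<^esub>) (wreath_ideal G H) \<in> star_hom CW W"
  by (rule WI.quotient_hom)

lemma cl_commute:
  assumes "i \<in> VG" "j \<in> VG" "a \<in> VH" "b \<in> VH"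
  shows "cl (U a i j) \<otimes>\<^bsub>W\<^esub> cl (V a b) = cl (V a b) \<otimes>\<^bsub>W\<^esub> cl (U a i j)"
proof -
  have "U a i j \<otimes>\<^bsub>CW\<^esub> V a b \<ominus>\<^bsub>CW\<^esub> V a b \<otimes>\<^bsub>CW\<^esub> U a i j \<in> wreath_ideal G H"
    using generated_ideal(3) assms unfolding S_def by blast
  then show ?thesis using assms by (simp add: WI.quotient_mult WI.coset_eq_iff)
qed

lemma qrep_wreath:
  assumes "i \<in> VG" "j \<in> VG" "a \<in> VH" "b \<in> VH"
  shows "qrep (free_wreath G H) (a, i) (b, j) = cl (U a i j) \<otimes>\<^bsub>W\<^esub> cl (V a b)"
  using assms by (simp add: free_wreath_def WI.quotient_mult)

lemma wreath_simps: "qpoints (free_wreath G H) = VH \<times> VG" "qalg (free_wreath G H) = W"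
  by (simp_all add: free_wreath_def)

lemma magic_clU: "a \<in> VH \<Longrightarrow> magic W VG (\<lambda>i j. cl (U a i j))"
  by (rule magic_hom[OF CW.star_algebra_axioms W.star_algebra_axioms cl_hom finite_points(1) magic_U]) auto

lemma magic_clV: "magic W VH (\<lambda>a b. cl (V a b))"
  by (rule magic_hom[OF CW.star_algebra_axioms W.star_algebra_axioms cl_hom finite_points(2) magic_V]) auto

text \<open>Each stage of the construction contributes one universal property: the family coproduct
  joins the \<open>u a\<close>, the binary coproduct adds \<open>v\<close>, and the commutation of
  \<open>u a\<close> with row \<open>a\<close> of \<open>v\<close> lets the map descend to the
  quotient.\<close>

theorem models_free_wreath_iff:
  assumes D: "cstar_algebra D"
  shows "models D w (free_wreath G H) \<longleftrightarrow>
    (\<exists>u v. (\<forall>a\<in>VH. models D (u a) G) \<and> models D v H \<and>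
      (\<forall>a\<in>VH. \<forall>b\<in>VH. \<forall>i\<in>VG. \<forall>j\<in>VG. u a i j \<otimes>\<^bsub>D\<^esub> v a b = v a b \<otimes>\<^bsub>D\<^esub> u a i j \<and>
        w (a, i) (b, j) = u a i j \<otimes>\<^bsub>D\<^esub> v a b))"
proof
  assume "models D w (free_wreath G H)"
  then obtain h where h: "h \<in> star_hom W D"
    and w: "\<And>p q. \<lbrakk>p \<in> VH \<times> VG; q \<in> VH \<times> VG\<rbrakk> \<Longrightarrow> h (qrep (free_wreath G H) p q) = w p q"
    by (auto simp: models_def wreath_simps)
  define u where "u a i j = h (cl (U a i j))" for a i j
  define v where "v a b = h (cl (V a b))" for a b
  have c: "cl (U a i j) \<in> carrier W" "cl (V a b) \<in> carrier W" if "a \<in> VH" "b \<in> VH" "i \<in> VG" "j \<in> VG" for a b i j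
    using that by (auto simp: WI.quotient_simps)
  have "models D (u a) G" if a: "a \<in> VH" for a
    unfolding models_def u_def wreath_u_def
    by (rule bexI[OF _ star_hom_comp[OF star_hom_comp[OF u_hom[OF a] cl_hom] h]]) simp
  moreover have "models D v H"
    unfolding models_def v_def wreath_v_def
    by (rule bexI[OF _ star_hom_comp[OF star_hom_comp[OF inr_hom cl_hom] h]]) simp
  moreover have "u a i j \<otimes>\<^bsub>D\<^esub> v a b = v a b \<otimes>\<^bsub>D\<^esub> u a i j" "w (a, i) (b, j) = u a i j \<otimes>\<^bsub>D\<^esub> v a b"
    if I: "a \<in> VH" "b \<in> VH" "i \<in> VG" "j \<in> VG" for a b i j
  proof -
    show "u a i j \<otimes>\<^bsub>D\<^esub> v a b = v a b \<otimes>\<^bsub>D\<^esub> u a i j"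
      using cl_commute[OF I(3,4,1,2)] c[OF I] star_homD(3)[OF h] by (metis u_def v_def)
    show "w (a, i) (b, j) = u a i j \<otimes>\<^bsub>D\<^esub> v a b"
      using w[of "(a, i)" "(b, j)"] qrep_wreath[OF I(3,4,1,2)] c[OF I] star_homD(3)[OF h] I
      by (simp add: u_def v_def)
  qed
  ultimately show "\<exists>u v. (\<forall>a\<in>VH. models D (u a) G) \<and> models D v H \<and>
      (\<forall>a\<in>VH. \<forall>b\<in>VH. \<forall>i\<in>VG. \<forall>j\<in>VG. u a i j \<otimes>\<^bsub>D\<^esub> v a b = v a b \<otimes>\<^bsub>D\<^esub> u a i j \<and>
        w (a, i) (b, j) = u a i j \<otimes>\<^bsub>D\<^esub> v a b)"
    by blast
next
  interpret D: cstar_algebra D by fact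
  assume "\<exists>u v. (\<forall>a\<in>VH. models D (u a) G) \<and> models D v H \<and>
      (\<forall>a\<in>VH. \<forall>b\<in>VH. \<forall>i\<in>VG. \<forall>j\<in>VG. u a i j \<otimes>\<^bsub>D\<^esub> v a b = v a b \<otimes>\<^bsub>D\<^esub> u a i j \<and>
        w (a, i) (b, j) = u a i j \<otimes>\<^bsub>D\<^esub> v a b)"
  then obtain u v where u: "\<And>a. a \<in> VH \<Longrightarrow> models D (u a) G" and v: "models D v H"
    and comm: "\<And>a b i j. \<lbrakk>a \<in> VH; b \<in> VH; i \<in> VG; j \<in> VG\<rbrakk> \<Longrightarrow> u a i j \<otimes>\<^bsub>D\<^esub> v a b = v a b \<otimes>\<^bsub>D\<^esub> u a i j"
    and w: "\<And>a b i j. \<lbrakk>a \<in> VH; b \<in> VH; i \<in> VG; j \<in> VG\<rbrakk> \<Longrightarrow> w (a, i) (b, j) = u a i j \<otimes>\<^bsub>D\<^esub> v a b"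
    by blast
  have "\<forall>a. \<exists>h. a \<in> VH \<longrightarrow> h \<in> star_hom CG D \<and> (\<forall>i\<in>VG. \<forall>j\<in>VG. h (qrep G i j) = u a i j)"
    using u unfolding models_def by blast
  then obtain hu where hu: "\<And>a. a \<in> VH \<Longrightarrow> hu a \<in> star_hom CG D"
      "\<And>a i j. \<lbrakk>a \<in> VH; i \<in> VG; j \<in> VG\<rbrakk> \<Longrightarrow> hu a (qrep G i j) = u a i j" by metis
  obtain hv where hv: "hv \<in> star_hom CH D" "\<And>a b. \<lbrakk>a \<in> VH; b \<in> VH\<rbrakk> \<Longrightarrow> hv (qrep H a b) = v a b"
    using v unfolding models_def by blast
  obtain f where f: "f \<in> star_hom PW D" "\<And>a x. \<lbrakk>a \<in> VH; x \<in> carrier CG\<rbrakk> \<Longrightarrow> f (fam a x) = hu a x"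
    using family_coproduct_lift[of VH "\<lambda>_. CG" D hu, OF CG D hu(1)] unfolding wreath_power_def by blast
  obtain g where g: "g \<in> star_hom CW D" "\<And>x. x \<in> carrier PW \<Longrightarrow> g (coproduct_inl PW CH x) = f x"
      "\<And>x. x \<in> carrier CH \<Longrightarrow> g (coproduct_inr PW CH x) = hv x"
    using coproduct_lift[OF PW CH D f(1) hv(1)] unfolding wreath_coproduct_def by blast
  have qc: "\<And>i j. \<lbrakk>i \<in> VG; j \<in> VG\<rbrakk> \<Longrightarrow> qrep G i j \<in> carrier CG" "\<And>i j. \<lbrakk>i \<in> VH; j \<in> VH\<rbrakk> \<Longrightarrow> qrep H i j \<in> carrier CH"
    using magic_G magic_H by (auto simp: magic_def)
  have gU: "g (U a i j) = u a i j" if "a \<in> VH" "i \<in> VG" "j \<in> VG" for a i j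
    using that qc star_homD(1)[OF inj_hom] by (simp add: wreath_u_def g(2) f(2) hu(2))
  have gV: "g (V a b) = v a b" if "a \<in> VH" "b \<in> VH" for a b
    using that qc by (simp add: wreath_v_def g(3) hv(2))
  have "S \<subseteq> {x \<in> carrier CW. g x = \<zero>\<^bsub>D\<^esub>}"
  proof
    fix s assume s: "s \<in> S"
    then obtain i j a b where seq: "s = U a i j \<otimes>\<^bsub>CW\<^esub> V a b \<ominus>\<^bsub>CW\<^esub> V a b \<otimes>\<^bsub>CW\<^esub> U a i j"
      and I: "i \<in> VG" "j \<in> VG" "a \<in> VH" "b \<in> VH" by (auto simp: S_def)
    have "u a i j \<otimes>\<^bsub>D\<^esub> v a b \<in> carrier D"
      using star_homD(1)[OF g(1), of "U a i j"] star_homD(1)[OF g(1), of "V a b"] I by (simp add: gU gV)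
    then have "g s = \<zero>\<^bsub>D\<^esub>"
      using I comm
      by (simp add: seq star_hom_diff[OF CW.star_algebra_axioms D.star_algebra_axioms g(1)] star_homD(3)[OF g(1)] gU gV
          D.minus_eq D.r_neg)
    then show "s \<in> {x \<in> carrier CW. g x = \<zero>\<^bsub>D\<^esub>}" using s S_props(1) by auto
  qed
  \<comment> \<open>The kernel of \<open>g\<close> is a closed ideal containing the commutators, and
    \<open>wreath_ideal G H\<close> is the smallest such ideal.\<close>
  then have "wreath_ideal G H \<subseteq> {x \<in> carrier CW. g x = \<zero>\<^bsub>D\<^esub>}"
    by (intro generated_ideal(4) star_hom_kernel[OF CW D g(1)])
  then obtain k where k: "k \<in> star_hom W D" "\<And>x. x \<in> carrier CW \<Longrightarrow> k (cl x) = g x"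
    using WI.quotient_hom_lift[OF D.star_algebra_axioms g(1)] by blast
  have "k (qrep (free_wreath G H) p q) = w p q" if pq: "p \<in> VH \<times> VG" "q \<in> VH \<times> VG" for p q
  proof -
    obtain a i b j where eq: "p = (a, i)" "q = (b, j)" by force
    have I: "i \<in> VG" "j \<in> VG" "a \<in> VH" "b \<in> VH" using pq by (auto simp: eq)
    have c: "cl (U a i j) \<in> carrier W" "cl (V a b) \<in> carrier W" using I by (auto simp: WI.quotient_simps)
    show ?thesis
      using I c by (simp add: eq qrep_wreath star_homD(3)[OF k(1)] k(2) gU gV w)
  qed
  then show "models D w (free_wreath G H)" using k(1) unfolding models_def wreath_simps by blast
qed

end

text \<open>\<open>wreath_rel E F\<close> is the adjacency relation of the lexicographic product of \<open>E\<close> and \<open>F\<close>.\<close>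

definition wreath_rel :: "'j rel \<Rightarrow> 'i rel \<Rightarrow> ('j \<times> 'i) rel" where
  "wreath_rel E F = {((a, i), (b, j)). (a, b) \<in> E \<or> a = b \<and> (i, j) \<in> F}"

section \<open>Magic unitaries of wreath form\<close>

locale magic_wreath = D: cstar_algebra D for D :: "'d cstar" (structure) +
  fixes X :: "'j set" and Y :: "'i set" and u :: "'j \<Rightarrow> 'i \<Rightarrow> 'i \<Rightarrow> 'd" and v :: "'j \<Rightarrow> 'j \<Rightarrow> 'd"
    and w :: "'j \<times> 'i \<Rightarrow> 'j \<times> 'i \<Rightarrow> 'd"
  assumes fX: "finite X" and fY: "finite Y"
    and u: "a \<in> X \<Longrightarrow> magic D Y (u a)" and v: "magic D X v"
    and comm: "\<lbrakk>a \<in> X; b \<in> X; i \<in> Y; j \<in> Y\<rbrakk> \<Longrightarrow> u a i j \<otimes> v a b = v a b \<otimes> u a i j"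
    and w: "\<lbrakk>a \<in> X; b \<in> X; i \<in> Y; j \<in> Y\<rbrakk> \<Longrightarrow> w (a, i) (b, j) = u a i j \<otimes> v a b"
begin

sublocale v: magic_unitary D X v
  by (intro magic_unitary.intro magic_unitary_axioms.intro D.cstar_algebra_axioms fX v)

lemma u_magic: "a \<in> X \<Longrightarrow> magic_unitary D Y (u a)"
  by (intro magic_unitary.intro magic_unitary_axioms.intro D.cstar_algebra_axioms fY u)

lemma u_closed [simp]: "\<lbrakk>a \<in> X; i \<in> Y; j \<in> Y\<rbrakk> \<Longrightarrow> u a i j \<in> carrier D"
  using u by (auto simp: magic_def)

lemma w_closed: "\<lbrakk>p \<in> X \<times> Y; q \<in> X \<times> Y\<rbrakk> \<Longrightarrow> w p q \<in> carrier D"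
  by (auto simp: w)

theorem magic_w: "magic D (X \<times> Y) w"
proof -
  have row: "finsum D (\<lambda>q. w p q) (X \<times> Y) = \<one>" if p: "p \<in> X \<times> Y" for p
  proof -
    obtain a i where ai: "p = (a, i)" "a \<in> X" "i \<in> Y" using p by auto
    interpret ua: magic_unitary D Y "u a" by (rule u_magic[OF ai(2)])
    have "finsum D (\<lambda>q. w p q) (X \<times> Y) = finsum D (\<lambda>b. finsum D (\<lambda>j. w p (b, j)) Y) X"
      by (rule D.finsum_Times[OF fX fY]) (use p w_closed in auto)
    also have "\<dots> = finsum D (\<lambda>b. v a b) X"
    proof (rule D.finsum_cong')
      fix b assume b: "b \<in> X"
      have "finsum D (\<lambda>j. w p (b, j)) Y = finsum D (\<lambda>j. u a i j \<otimes> v a b) Y"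
        by (rule D.finsum_cong') (use ai b w in auto)
      also have "\<dots> = finsum D (\<lambda>j. u a i j) Y \<otimes> v a b"
        by (rule D.finsum_ldistr[symmetric]) (use ai b fY in auto)
      finally show "finsum D (\<lambda>j. w p (b, j)) Y = v a b" using ua.row_sum[OF ai(3)] ai b by simp
    qed (use ai in auto)
    finally show ?thesis using v.row_sum[OF ai(2)] by simp
  qed
  have col: "finsum D (\<lambda>p. w p q) (X \<times> Y) = \<one>" if q: "q \<in> X \<times> Y" for q
  proof -
    obtain b j where bj: "q = (b, j)" "b \<in> X" "j \<in> Y" using q by auto
    have "finsum D (\<lambda>p. w p q) (X \<times> Y) = finsum D (\<lambda>a. finsum D (\<lambda>i. w (a, i) q) Y) X"
      by (rule D.finsum_Times[OF fX fY]) (use q w_closed in auto)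
    also have "\<dots> = finsum D (\<lambda>a. v a b) X"
    proof (rule D.finsum_cong')
      fix a assume a: "a \<in> X"
      interpret ua: magic_unitary D Y "u a" by (rule u_magic[OF a])
      have "finsum D (\<lambda>i. w (a, i) q) Y = finsum D (\<lambda>i. u a i j \<otimes> v a b) Y"
        by (rule D.finsum_cong') (use a bj w in auto)
      also have "\<dots> = finsum D (\<lambda>i. u a i j) Y \<otimes> v a b"
        by (rule D.finsum_ldistr[symmetric]) (use a bj fY in auto)
      finally show "finsum D (\<lambda>i. w (a, i) q) Y = v a b" using ua.col_sum[OF bj(3)] a bj by simp
    qed (use bj in auto)
    finally show ?thesis using v.col_sum[OF bj(2)] by simp
  qed
  have "w p q \<otimes> w p q = w p q \<and> star D (w p q) = w p q" if pq: "p \<in> X \<times> Y" "q \<in> X \<times> Y" for p q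
  proof -
    obtain a i b j where eq: "p = (a, i)" "q = (b, j)" by force
    have I: "a \<in> X" "b \<in> X" "i \<in> Y" "j \<in> Y" using pq by (auto simp: eq)
    interpret ua: magic_unitary D Y "u a" by (rule u_magic[OF I(1)])
    have "(u a i j \<otimes> v a b) \<otimes> (u a i j \<otimes> v a b) = (u a i j \<otimes> u a i j) \<otimes> (v a b \<otimes> v a b)"
      using I comm[OF I] by (metis D.m_assoc D.m_closed u_closed v.u_closed)
    then show ?thesis
      using I by (simp add: eq w ua.u_idem v.u_idem ua.u_star v.u_star D.star_mult comm)
  qed
  then show ?thesis using row col w_closed by (simp add: magic_def)
qed

lemma preserves_w:
  assumes E: "preserves D X v E" and F: "\<And>a. a \<in> X \<Longrightarrow> preserves D Y (u a) F"
  shows "preserves D (X \<times> Y) w (wreath_rel E F)"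
  unfolding preserves_def
proof (intro ballI impI)
  fix p q r s assume P: "p \<in> X \<times> Y" "q \<in> X \<times> Y" "r \<in> X \<times> Y" "s \<in> X \<times> Y"
    and ne: "((p, r) \<in> wreath_rel E F) \<noteq> ((q, s) \<in> wreath_rel E F)"
  obtain a i b j a' i' b' j' where eq: "p = (a, i)" "q = (b, j)" "r = (a', i')" "s = (b', j')" by force
  have I: "a \<in> X" "b \<in> X" "i \<in> Y" "j \<in> Y" and I': "a' \<in> X" "b' \<in> X" "i' \<in> Y" "j' \<in> Y" using P by (auto simp: eq)
  have w1: "w p q \<otimes> w r s = u a i j \<otimes> (v a b \<otimes> v a' b') \<otimes> u a' i' j'"
    using I I' comm[OF I'] by (simp add: eq w D.m_assoc)
  show "w p q \<otimes> w r s = \<zero>"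
  proof (cases "v a b \<otimes> v a' b' = \<zero>")
    case True
    then show ?thesis using w1 I I' by simp
  next
    case False
    \<comment> \<open>A nonzero product in \<open>v\<close> forces agreement about \<open>E\<close>
      and about equality. The wreath relation can then differ only inside a single fibre, where
      \<open>F\<close> decides.\<close>
    then have ab: "((a, a') \<in> E) = ((b, b') \<in> E)" "(a = a') = (b = b')"
      using preservesD[OF E I(1,2) I'(1,2)] preservesD[OF v.preserves_Id I(1,2) I'(1,2)] by auto
    then have "a = a'" "b = b'" "((i, i') \<in> F) \<noteq> ((j, j') \<in> F)"
      using ne by (auto simp: eq wreath_rel_def)
    then have "u a i j \<otimes> u a i' j' = \<zero>"
      using preservesD[OF F[OF I(1)] I(3,4) I'(3,4)] by simp
    moreover have "w p q \<otimes> w r s = v a b \<otimes> (u a i j \<otimes> u a i' j') \<otimes> v a b"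
      using I I' comm[OF I] \<open>a = a'\<close> \<open>b = b'\<close> by (simp add: eq w D.m_assoc[symmetric])
    ultimately show ?thesis using I by simp
  qed
qed

end

text \<open>If the partition into fibres is preserved, the sum of \<open>w (a, i) (b, j)\<close> over \<open>j\<close>
  depends neither on \<open>i\<close> nor, when the sum is taken over \<open>i\<close> instead, on \<open>j\<close>.\<close>

lemma (in cstar_algebra) magic_wreath_decompose:
  fixes X :: "'j set" and Y :: "'i set"
  assumes fX: "finite X" "finite Y" "Y \<noteq> {}" and w: "magic A (X \<times> Y) w"
    and fib: "preserves A (X \<times> Y) w {((a, i), (b, j)). a = b}"
    and EF: "preserves A (X \<times> Y) w (wreath_rel E F)" and irr: "\<And>a. (a, a) \<notin> E"
  obtains u v where "magic A X v" "preserves A X v E" "\<And>a. a \<in> X \<Longrightarrow> magic A Y (u a)"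
    "\<And>a. a \<in> X \<Longrightarrow> preserves A Y (u a) F"
    "\<And>a b i j. \<lbrakk>a \<in> X; b \<in> X; i \<in> Y; j \<in> Y\<rbrakk> \<Longrightarrow> u a i j \<otimes> v a b = v a b \<otimes> u a i j"
    "\<And>a b i j. \<lbrakk>a \<in> X; b \<in> X; i \<in> Y; j \<in> Y\<rbrakk> \<Longrightarrow> w (a, i) (b, j) = u a i j \<otimes> v a b"
proof -
  interpret w: magic_unitary A "X \<times> Y" w
    by (intro magic_unitary.intro magic_unitary_axioms.intro cstar_algebra_axioms w) (use fX in auto)
  note c = w.u_closed
  have wc [simp]: "w (a, i) (b, j) \<in> carrier A" if "a \<in> X" "i \<in> Y" "b \<in> X" "j \<in> Y" for a i b j
    using that by auto
  note Times = finsum_Times[OF fX(1,2)]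
  \<comment> \<open>Row sum in row \<open>i\<close> and column sum in column \<open>j\<close> of the
    block at \<open>(a, b)\<close>. Both turn out to be the entry \<open>v a b\<close>.\<close>
  define r where "r i a b = finsum A (\<lambda>j. w (a, i) (b, j)) Y" for i a b
  define s where "s j a b = finsum A (\<lambda>i. w (a, i) (b, j)) Y" for j a b
  have rc [simp]: "r i a b \<in> carrier A" if "i \<in> Y" "a \<in> X" "b \<in> X" for i a b
    unfolding r_def by (rule finsum_closed) (use that in auto)
  have sc [simp]: "s j a b \<in> carrier A" if "j \<in> Y" "a \<in> X" "b \<in> X" for j a b
    unfolding s_def by (rule finsum_closed) (use that in auto)
  have rsum: "finsum A (r i a) X = \<one>" if "i \<in> Y" "a \<in> X" for i a
    using w.row_sum[of "(a, i)"] Times[of "w (a, i)"] that by (simp add: r_def[abs_def])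
  have ssum: "finsum A (\<lambda>a. s j a b) X = \<one>" if "j \<in> Y" "b \<in> X" for j b
    using w.col_sum[of "(b, j)"] Times[of "\<lambda>p. w p (b, j)"] that by (simp add: s_def)
  have prod: "finsum A f Y \<otimes> finsum A g Y = \<zero>"
    if "\<And>i. i \<in> Y \<Longrightarrow> f i \<in> carrier A" "\<And>i. i \<in> Y \<Longrightarrow> g i \<in> carrier A"
      "\<And>i j. \<lbrakk>i \<in> Y; j \<in> Y\<rbrakk> \<Longrightarrow> f i \<otimes> g j = \<zero>" for f g
  proof -
    have "f i \<otimes> finsum A g Y = \<zero>" if i: "i \<in> Y" for i
    proof -
      have "f i \<otimes> finsum A g Y = finsum A (\<lambda>j. f i \<otimes> g j) Y"
        by (rule finsum_rdistr) (use that i fX \<open>\<And>i. i \<in> Y \<Longrightarrow> f i \<in> carrier A\<close> \<open>\<And>i. i \<in> Y \<Longrightarrow> g i \<in> carrier A\<close> in auto)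
      also have "\<dots> = finsum A (\<lambda>j. \<zero>) Y"
        by (rule finsum_cong') (use i \<open>\<And>i j. \<lbrakk>i \<in> Y; j \<in> Y\<rbrakk> \<Longrightarrow> f i \<otimes> g j = \<zero>\<close> in auto)
      finally show ?thesis by (simp add: finsum_zero)
    qed
    moreover have "finsum A f Y \<otimes> finsum A g Y = finsum A (\<lambda>i. f i \<otimes> finsum A g Y) Y"
      by (rule finsum_ldistr) (use that fX in \<open>auto intro!: finsum_closed\<close>)
    moreover have "finsum A (\<lambda>i. f i \<otimes> finsum A g Y) Y = finsum A (\<lambda>i. \<zero>) Y"
      using calculation(1) by (intro finsum_cong') auto
    ultimately show ?thesis by (simp add: finsum_zero)
  qed
  have fibD: "w (a, i) (b, j) \<otimes> w (a', i') (b', j') = \<zero>"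
    if "(a = a') \<noteq> (b = b')" "a \<in> X" "a' \<in> X" "b \<in> X" "b' \<in> X" "i \<in> Y" "i' \<in> Y" "j \<in> Y" "j' \<in> Y"
    for a a' b b' i i' j j'
    by (rule preservesD[OF fib]) (use that in auto)
  have rr0: "r i a b \<otimes> r i' a b' = \<zero>" if "b \<noteq> b'" "i \<in> Y" "i' \<in> Y" "a \<in> X" "b \<in> X" "b' \<in> X" for i i' a b b'
    unfolding r_def by (rule prod) (use that fibD in auto)
  have rs0: "r i a b \<otimes> s j a' b = \<zero>" if "a \<noteq> a'" "i \<in> Y" "j \<in> Y" "a \<in> X" "b \<in> X" "a' \<in> X" for i j a a' b
    unfolding r_def s_def by (rule prod) (use that fibD in auto)
  have rs0': "r i a b' \<otimes> s j a b = \<zero>" if "b \<noteq> b'" "i \<in> Y" "j \<in> Y" "a \<in> X" "b \<in> X" "b' \<in> X" for i j a b b'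
    unfolding r_def s_def by (rule prod) (use that fibD in auto)
  have sel_l: "x \<otimes> finsum A f X = x \<otimes> f b"
    if "x \<in> carrier A" "\<And>c. c \<in> X \<Longrightarrow> f c \<in> carrier A" "b \<in> X" "\<And>c. \<lbrakk>c \<in> X; c \<noteq> b\<rbrakk> \<Longrightarrow> x \<otimes> f c = \<zero>" for x f b
  proof -
    have "x \<otimes> finsum A f X = finsum A (\<lambda>c. x \<otimes> f c) X" by (rule finsum_rdistr) (use that fX in auto)
    also have "\<dots> = finsum A (\<lambda>c. if c = b then x \<otimes> f b else \<zero>) X"
      by (rule finsum_cong') (use that in auto)
    also have "\<dots> = x \<otimes> f b" by (rule finsum_if) (use that fX in auto)
    finally show ?thesis .
  qed
  have sel_r: "finsum A f X \<otimes> x = f b \<otimes> x"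
    if "x \<in> carrier A" "\<And>c. c \<in> X \<Longrightarrow> f c \<in> carrier A" "b \<in> X" "\<And>c. \<lbrakk>c \<in> X; c \<noteq> b\<rbrakk> \<Longrightarrow> f c \<otimes> x = \<zero>" for x f b
  proof -
    have "finsum A f X \<otimes> x = finsum A (\<lambda>c. f c \<otimes> x) X" by (rule finsum_ldistr) (use that fX in auto)
    also have "\<dots> = finsum A (\<lambda>c. if c = b then f b \<otimes> x else \<zero>) X"
      by (rule finsum_cong') (use that in auto)
    also have "\<dots> = f b \<otimes> x" by (rule finsum_if) (use that fX in auto)
    finally show ?thesis .
  qed
  \<comment> \<open>For two rows of the same fibre the sums over \<open>b\<close> are both one and
    terms with different \<open>b\<close> are orthogonal, so both block sums equal their
    product.\<close>
  have rr: "r i a b = r i a b \<otimes> r i' a b" "r i' a b = r i a b \<otimes> r i' a b"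
    if I: "i \<in> Y" "i' \<in> Y" "a \<in> X" "b \<in> X" for i i' a b
  proof -
    have "r i a b = r i a b \<otimes> finsum A (r i' a) X" using I by (simp add: rsum)
    also have "\<dots> = r i a b \<otimes> r i' a b" by (rule sel_l) (use I rr0 in auto)
    finally show "r i a b = r i a b \<otimes> r i' a b" .
    have "r i' a b = finsum A (r i a) X \<otimes> r i' a b" using I by (simp add: rsum)
    also have "\<dots> = r i a b \<otimes> r i' a b" by (rule sel_r) (use I rr0 in auto)
    finally show "r i' a b = r i a b \<otimes> r i' a b" .
  qed
  \<comment> \<open>Inserting the column decomposition of one on the right of \<open>r\<close>, or
    the row decomposition on the left of \<open>s\<close>, leaves the same product.\<close>
  have rs: "r i a b = s j a b" if I: "i \<in> Y" "j \<in> Y" "a \<in> X" "b \<in> X" for i j a b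
  proof -
    have "r i a b = r i a b \<otimes> finsum A (\<lambda>a. s j a b) X" using I by (simp add: ssum)
    also have "\<dots> = r i a b \<otimes> s j a b" by (rule sel_l) (use I rs0 in auto)
    also have "\<dots> = finsum A (r i a) X \<otimes> s j a b" by (rule sel_r[symmetric]) (use I rs0' in auto)
    finally show ?thesis using I by (simp add: rsum)
  qed
  obtain i0 where i0: "i0 \<in> Y" using fX(3) by blast
  define v where "v = r i0"
  have vr: "v a b = r i a b" if "i \<in> Y" "a \<in> X" "b \<in> X" for i a b
    using rr[OF i0 that] by (metis v_def)
  \<comment> \<open>Terms with different \<open>b\<close> are orthogonal by \<open>fib\<close>, so
    products of such sums collapse to a single sum over \<open>b\<close>, as \<open>uu\<close>
    records.\<close>
  define u where "u a i j = finsum A (\<lambda>b. w (a, i) (b, j)) X" for a i j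
  have uc [simp]: "u a i j \<in> carrier A" if "a \<in> X" "i \<in> Y" "j \<in> Y" for a i j
    unfolding u_def by (rule finsum_closed) (use that in auto)
  have star_sum: "star A (finsum A f T) = finsum A (\<lambda>t. star A (f t)) T"
    if "finite T" "\<And>t. t \<in> T \<Longrightarrow> f t \<in> carrier A" for f and T :: "'t set"
    using that
  proof (induction T)
    case (insert t T)
    then have "finsum A f T \<in> carrier A" by (auto intro!: finsum_closed)
    then show ?case using insert by (simp add: Pi_def star_add)
  qed simp
  have w0: "w (a, i) (b, j) \<otimes> w (a, i') (b', j') = \<zero>"
    if "b \<noteq> b'" "a \<in> X" "b \<in> X" "b' \<in> X" "i \<in> Y" "i' \<in> Y" "j \<in> Y" "j' \<in> Y" for a b b' i i' j j'
    by (rule fibD) (use that in auto)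
  have uu: "u a i j \<otimes> u a i' j' = finsum A (\<lambda>b. w (a, i) (b, j) \<otimes> w (a, i') (b, j')) X"
    if I: "a \<in> X" "i \<in> Y" "j \<in> Y" "i' \<in> Y" "j' \<in> Y" for a i j i' j'
  proof -
    have "u a i j \<otimes> u a i' j' = finsum A (\<lambda>b. w (a, i) (b, j) \<otimes> u a i' j') X"
      unfolding u_def[of a i j] by (rule finsum_ldistr) (use I fX in auto)
    also have "\<dots> = finsum A (\<lambda>b. w (a, i) (b, j) \<otimes> w (a, i') (b, j')) X"
    proof (rule finsum_cong')
      fix b assume b: "b \<in> X"
      show "w (a, i) (b, j) \<otimes> u a i' j' = w (a, i) (b, j) \<otimes> w (a, i') (b, j')"
        unfolding u_def by (rule sel_l) (use I b w0 in auto)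
    qed (use I in auto)
    finally show ?thesis .
  qed
  show ?thesis
  proof (rule that[of v u])
    show "magic A X v"
      unfolding magic_def
    proof (intro conjI ballI)
      fix a b assume ab: "a \<in> X" "b \<in> X"
      show "v a b \<in> carrier A" using ab i0 by (simp add: v_def)
      show "v a b \<otimes> v a b = v a b" using rr(1)[OF i0 i0 ab] by (simp add: v_def)
      show "star A (v a b) = v a b"
        unfolding v_def r_def using ab i0 fX
        by (subst star_sum) (auto simp: w.u_star intro!: finsum_cong')
    next
      fix a assume a: "a \<in> X"
      show "finsum A (v a) X = \<one>" using rsum[OF i0 a] by (simp add: v_def)
      have "finsum A (\<lambda>b. v b a) X = finsum A (\<lambda>b. s i0 b a) X"
        by (rule finsum_cong') (use a i0 rs in \<open>auto simp: v_def\<close>)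
      then show "finsum A (\<lambda>b. v b a) X = \<one>" using ssum[OF i0 a] by simp
    qed
    show "preserves A X v E"
      unfolding preserves_def
    proof (intro ballI impI)
      fix a b a' b' assume I: "a \<in> X" "b \<in> X" "a' \<in> X" "b' \<in> X" and ne: "((a, a') \<in> E) \<noteq> ((b, b') \<in> E)"
      show "v a b \<otimes> v a' b' = \<zero>"
        unfolding v_def r_def
      proof (rule prod)
        fix j j' assume j: "j \<in> Y" "j' \<in> Y"
        show "w (a, i0) (b, j) \<otimes> w (a', i0) (b', j') = \<zero>"
        proof (cases "(a = a') = (b = b')")
          case True
          \<comment> \<open>Equality would force \<open>b = b'\<close>, and irreflexivity of
            \<open>E\<close> would contradict \<open>ne\<close>. Off the diagonal the wreath
            relation is decided by \<open>E\<close> alone.\<close>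
          have "a \<noteq> a'" using True ne irr by auto
          then show ?thesis
            using True ne I i0 j by (intro preservesD[OF EF]) (auto simp: wreath_rel_def)
        next
          case False
          then show ?thesis by (intro fibD) (use I i0 j in auto)
        qed
      qed (use I i0 in auto)
    qed
  next
    fix a assume a: "a \<in> X"
    show "magic A Y (u a)"
      unfolding magic_def
    proof (intro conjI ballI)
      fix i j assume ij: "i \<in> Y" "j \<in> Y"
      show "u a i j \<in> carrier A" using a ij by simp
      have "u a i j \<otimes> u a i j = finsum A (\<lambda>b. w (a, i) (b, j)) X"
        unfolding uu[OF a ij ij] by (rule finsum_cong') (use a ij w.u_idem in auto)
      then show "u a i j \<otimes> u a i j = u a i j" by (simp add: u_def)
      show "star A (u a i j) = u a i j"
        unfolding u_def using a ij fX
        by (subst star_sum) (auto simp: w.u_star intro!: finsum_cong')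
    next
      fix i assume i: "i \<in> Y"
      have "finsum A (u a i) Y = finsum A (r i a) X"
        unfolding u_def r_def by (rule finsum_swap) (use a i fX in auto)
      then show "finsum A (u a i) Y = \<one>" using rsum i a by simp
      have "finsum A (\<lambda>j. u a j i) Y = finsum A (s i a) X"
        unfolding u_def s_def by (rule finsum_swap) (use a i fX in auto)
      also have "\<dots> = finsum A (r i a) X"
        by (rule finsum_cong') (use a i rs in auto)
      finally show "finsum A (\<lambda>j. u a j i) Y = \<one>" using rsum i a by simp
    qed
    show "preserves A Y (u a) F"
      unfolding preserves_def
    proof (intro ballI impI)
      fix i j i' j' assume I: "i \<in> Y" "j \<in> Y" "i' \<in> Y" "j' \<in> Y" and ne: "((i, i') \<in> F) \<noteq> ((j, j') \<in> F)"
      have "u a i j \<otimes> u a i' j' = finsum A (\<lambda>b. \<zero>) X"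
        unfolding uu[OF a I]
      proof (rule finsum_cong')
        fix b assume b: "b \<in> X"
        show "w (a, i) (b, j) \<otimes> w (a, i') (b, j') = \<zero>"
          by (rule preservesD[OF EF]) (use a b I ne irr in \<open>auto simp: wreath_rel_def\<close>)
      qed auto
      then show "u a i j \<otimes> u a i' j' = \<zero>" by (simp add: finsum_zero)
    qed
  next
    fix a b i j assume I: "a \<in> X" "b \<in> X" "i \<in> Y" "j \<in> Y"
    \<comment> \<open>By \<open>vr\<close> the factor \<open>v a b\<close> may be written with the
      row \<open>i\<close> at hand. Against it only the summand of \<open>u a i j\<close> over
      \<open>b\<close> survives, and next only the term \<open>j' = j\<close> of the row
      sum.\<close>
    have "u a i j \<otimes> v a b = w (a, i) (b, j) \<otimes> r i a b"
      unfolding vr[OF I(3,1,2)] u_def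
    proof (rule sel_r)
      fix c assume "c \<in> X" "c \<noteq> b"
      have "w (a, i) (c, j) \<otimes> r i a b = finsum A (\<lambda>j'. w (a, i) (c, j) \<otimes> w (a, i) (b, j')) Y"
        unfolding r_def by (rule finsum_rdistr) (use I fX \<open>c \<in> X\<close> in auto)
      also have "\<dots> = finsum A (\<lambda>_. \<zero>) Y"
        by (rule finsum_cong') (use I w0 \<open>c \<in> X\<close> \<open>c \<noteq> b\<close> in auto)
      finally show "w (a, i) (c, j) \<otimes> r i a b = \<zero>" by (simp add: finsum_zero)
    qed (use I in auto)
    also have "\<dots> = w (a, i) (b, j)"
    proof -
      have "w (a, i) (b, j) \<otimes> r i a b = finsum A (\<lambda>j'. w (a, i) (b, j) \<otimes> w (a, i) (b, j')) Y"
        unfolding r_def by (rule finsum_rdistr) (use I fX in auto)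
      also have "\<dots> = finsum A (\<lambda>j'. if j' = j then w (a, i) (b, j) else \<zero>) Y"
        by (rule finsum_cong') (use I w.u_idem w.row_orth in auto)
      also have "\<dots> = w (a, i) (b, j)" by (rule finsum_if) (use I fX in auto)
      finally show ?thesis .
    qed
    finally have 1: "u a i j \<otimes> v a b = w (a, i) (b, j)" .
    then show "w (a, i) (b, j) = u a i j \<otimes> v a b" by simp
    have "star A (u a i j) = u a i j" "star A (v a b) = v a b"
      unfolding u_def v_def r_def using I i0 fX
      by (subst star_sum; auto simp: w.u_star intro!: finsum_cong')+
    then have "v a b \<otimes> u a i j = star A (u a i j \<otimes> v a b)" using I i0 by (simp add: star_mult v_def)
    then show "u a i j \<otimes> v a b = v a b \<otimes> u a i j" using 1 w.u_star I by simp
  qed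
qed

context wreath
begin

lemma wreath_magic_wreath:
  "magic_wreath W VH VG (\<lambda>a i j. cl (U a i j)) (\<lambda>a b. cl (V a b)) (qrep (free_wreath G H))"
  by (intro magic_wreath.intro magic_wreath_axioms.intro W finite_points magic_clU magic_clV)
    (auto simp: cl_commute qrep_wreath)

text \<open>Summing the products over \<open>j\<close> recovers \<open>v a b\<close> and summing
  them over \<open>b\<close> recovers \<open>u a i j\<close>. Preimages of a closed subalgebra then
  carry generation back through every stage of the construction.\<close>

lemma free_wreath_generates:
  "generates W {qrep (free_wreath G H) p q | p q. p \<in> VH \<times> VG \<and> q \<in> VH \<times> VG}"
  unfolding generates_def
proof (intro allI impI)
  interpret w: magic_wreath W VH VG "\<lambda>a i j. cl (U a i j)" "\<lambda>a b. cl (V a b)" "qrep (free_wreath G H)"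
    by (rule wreath_magic_wreath)
  fix T assume T: "closed_subalgebra W T" and sub: "{qrep (free_wreath G H) p q | p q. p \<in> VH \<times> VG \<and> q \<in> VH \<times> VG} \<subseteq> T"
  have mem: "cl (U a i j) \<otimes>\<^bsub>W\<^esub> cl (V a b) \<in> T" if "a \<in> VH" "b \<in> VH" "i \<in> VG" "j \<in> VG" for a b i j
  proof -
    have "qrep (free_wreath G H) (a, i) (b, j) \<in> T" using sub that by blast
    then show ?thesis using that by (simp add: qrep_wreath)
  qed
  have c: "cl (U a i j) \<in> carrier W" "cl (V a b) \<in> carrier W" if "a \<in> VH" "b \<in> VH" "i \<in> VG" "j \<in> VG" for a b i j
    using that by (auto simp: WI.quotient_simps)
  have TV: "cl (V a b) \<in> T" if ab: "a \<in> VH" "b \<in> VH" for a b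
  proof -
    obtain i where i: "i \<in> VG" using nonempty_points by blast
    interpret ua: magic_unitary W VG "\<lambda>i j. cl (U a i j)" by (rule w.u_magic[OF ab(1)])
    have "finsum W (\<lambda>j. cl (U a i j) \<otimes>\<^bsub>W\<^esub> cl (V a b)) VG = finsum W (\<lambda>j. cl (U a i j)) VG \<otimes>\<^bsub>W\<^esub> cl (V a b)"
      by (rule W.finsum_ldistr[symmetric]) (use ab i c finite_points in auto)
    then have "finsum W (\<lambda>j. cl (U a i j) \<otimes>\<^bsub>W\<^esub> cl (V a b)) VG = cl (V a b)"
      using ua.row_sum[OF i] c[OF ab i i] by simp
    moreover have "finsum W (\<lambda>j. cl (U a i j) \<otimes>\<^bsub>W\<^esub> cl (V a b)) VG \<in> T"
      by (rule closed_subalgebra_finsum[OF W.star_algebra_axioms T finite_points(1)]) (use mem ab i in auto)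
    ultimately show ?thesis by simp
  qed
  have TU: "cl (U a i j) \<in> T" if I: "a \<in> VH" "i \<in> VG" "j \<in> VG" for a i j
  proof -
    have "finsum W (\<lambda>b. cl (U a i j) \<otimes>\<^bsub>W\<^esub> cl (V a b)) VH = cl (U a i j) \<otimes>\<^bsub>W\<^esub> finsum W (\<lambda>b. cl (V a b)) VH"
      by (rule W.finsum_rdistr[symmetric]) (use I c finite_points in auto)
    then have "finsum W (\<lambda>b. cl (U a i j) \<otimes>\<^bsub>W\<^esub> cl (V a b)) VH = cl (U a i j)"
      using w.v.row_sum[OF I(1)] c(1)[OF I(1) I(1) I(2,3)] by simp
    moreover have "finsum W (\<lambda>b. cl (U a i j) \<otimes>\<^bsub>W\<^esub> cl (V a b)) VH \<in> T"
      by (rule closed_subalgebra_finsum[OF W.star_algebra_axioms T finite_points(2)]) (use mem I in auto)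
    ultimately show ?thesis by simp
  qed
  have pull: "carrier B \<subseteq> {x \<in> carrier B. h x \<in> T}"
    if B: "cstar_algebra B" and h: "h \<in> star_hom B W" and gen: "generates B Z" and Z: "\<And>z. z \<in> Z \<Longrightarrow> z \<in> carrier B \<and> h z \<in> T"
    for h Z and B :: "'z cstar"
    using gen closed_subalgebra_vimage[OF B W.seminormed_star_algebra_axioms h T] Z unfolding generates_def by blast
  have qc: "\<And>i j. \<lbrakk>i \<in> VG; j \<in> VG\<rbrakk> \<Longrightarrow> qrep G i j \<in> carrier CG" "\<And>i j. \<lbrakk>i \<in> VH; j \<in> VH\<rbrakk> \<Longrightarrow> qrep H i j \<in> carrier CH"
    using magic_G magic_H by (auto simp: magic_def)
  have 1: "carrier CG \<subseteq> {x \<in> carrier CG. cl (coproduct_inl PW CH (fam a x)) \<in> T}" if a: "a \<in> VH" for a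
    by (rule pull[OF CG star_hom_comp[OF u_hom[OF a] cl_hom]])
      (use G TU[OF a] qc in \<open>auto simp: qpg_ok_def wreath_u_def\<close>)
  have 2: "carrier CH \<subseteq> {x \<in> carrier CH. cl (coproduct_inr PW CH x) \<in> T}"
    by (rule pull[OF CH star_hom_comp[OF inr_hom cl_hom]])
      (use H TV qc in \<open>auto simp: qpg_ok_def wreath_v_def\<close>)
  have genPW: "generates PW {fam a x | a x. a \<in> VH \<and> x \<in> carrier CG}"
    unfolding wreath_power_def by (rule family_coproduct_generates[OF CG])
  have 3: "carrier PW \<subseteq> {x \<in> carrier PW. cl (coproduct_inl PW CH x) \<in> T}"
    by (rule pull[OF PW star_hom_comp[OF inl_hom cl_hom] genPW])
      (use 1 star_homD(1)[OF inj_hom] in auto)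
  have genCW: "generates CW (coproduct_inl PW CH ` carrier PW \<union> coproduct_inr PW CH ` carrier CH)"
    unfolding wreath_coproduct_def by (rule coproduct_generates[OF PW CH])
  have 4: "carrier CW \<subseteq> {x \<in> carrier CW. cl x \<in> T}"
    by (rule pull[OF CW cl_hom genCW])
      (use 2 3 star_homD(1)[OF inl_hom] star_homD(1)[OF inr_hom] in auto)
  show "carrier W \<subseteq> T" using 4 by (auto simp: WI.quotient_simps)
qed

lemma free_wreath_ok: "qpg_ok (free_wreath G H)"
  using free_wreath_generates magic_wreath.magic_w[OF wreath_magic_wreath] finite_points nonempty_points W
  by (simp add: qpg_ok_def wreath_simps)

end


section \<open>Lexicographic products and twins\<close>

lemma simple_graphI:
  assumes "finite (pverts X)" "pverts X \<noteq> {}" "parcs X \<subseteq> pverts X \<times> pverts X"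
    "\<And>x y. (x, y) \<in> parcs X \<Longrightarrow> (y, x) \<in> parcs X" "\<And>x. (x, x) \<notin> parcs X"
  shows "simple_graph X"
  unfolding simple_graph_def
proof (intro conjI)
  show "pair_graph X"
  proof
    show "finite (parcs X)" using assms by (auto intro: finite_subset)
    show "symmetric (with_proj X)" using assms(4) by (auto simp: symmetric_def sym_def)
    fix e assume e: "e \<in> parcs X"
    obtain x y where xy: "e = (x, y)" by force
    have "x \<in> pverts X" "y \<in> pverts X" "x \<noteq> y" using e assms(3,5) by (auto simp: xy)
    then show "fst e \<in> pverts X" "snd e \<in> pverts X" "fst e \<noteq> snd e" by (simp_all add: xy)
  qed (use assms in auto)
qed (use assms in auto)

lemma lex_product_simps [simp]:
  "pverts (lex_product X Y) = pverts X \<times> pverts Y"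
  "((x, y), (x', y')) \<in> parcs (lex_product X Y) \<longleftrightarrow>
     (x, x') \<in> parcs X \<and> y \<in> pverts Y \<and> y' \<in> pverts Y \<or> x = x' \<and> x \<in> pverts X \<and> (y, y') \<in> parcs Y"
  by (auto simp: lex_product_def)

lemma graph_complement_simps [simp]:
  "pverts (graph_complement X) = pverts X"
  "(x, y) \<in> parcs (graph_complement X) \<longleftrightarrow> x \<in> pverts X \<and> y \<in> pverts X \<and> x \<noteq> y \<and> (x, y) \<notin> parcs X"
  by (auto simp: graph_complement_def)

lemma complete_graph_simps [simp]:
  "pverts (complete_graph n) = {..<n}" "(i, j) \<in> parcs (complete_graph n) \<longleftrightarrow> i < n \<and> j < n \<and> i \<noteq> j"
  by (auto simp: complete_graph_def)

lemma edgeless_graph_simps [simp]: "pverts (edgeless_graph n) = {..<n}" "parcs (edgeless_graph n) = {}"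
  by (auto simp: edgeless_graph_def graph_complement_def complete_graph_def)

lemma simple_complement: "simple_graph X \<Longrightarrow> simple_graph (graph_complement X)"
  using simple_graphD[of X] by (intro simple_graphI) auto

lemma complement_complement: "simple_graph X \<Longrightarrow> graph_complement (graph_complement X) = X"
  using simple_graphD(3,5)[of X] by (auto simp: graph_complement_def intro!: pair_pre_digraph.equality)

lemma simple_lex_product:
  assumes "simple_graph X" "simple_graph Y" shows "simple_graph (lex_product X Y)"
  using simple_graphD[OF assms(1)] simple_graphD[OF assms(2)] by (intro simple_graphI) auto

text \<open>Complementation acts on both factors at once, so results on adjacent twins and on
  disconnected complements follow from those on non-adjacent twins and on components.\<close>

lemma complement_lex_product:
  assumes "simple_graph X" "simple_graph Y"
  shows "graph_complement (lex_product X Y) = lex_product (graph_complement X) (graph_complement Y)"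
proof (rule pair_pre_digraph.equality)
  show "parcs (graph_complement (lex_product X Y)) = parcs (lex_product (graph_complement X) (graph_complement Y))"
    using simple_graphD(3,5)[OF assms(1)] by auto
qed simp_all

lemma simple_complete: "n > 0 \<Longrightarrow> simple_graph (complete_graph n)"
  by (rule simple_graphI) auto

lemma complement_edgeless: "graph_complement (edgeless_graph n) = complete_graph n"
  by (auto simp: graph_complement_def complete_graph_def intro!: pair_pre_digraph.equality)

lemma simple_edgeless: "n > 0 \<Longrightarrow> simple_graph (edgeless_graph n)"
  by (rule simple_graphI) auto

lemma graph_isomorphismD:
  assumes "graph_isomorphism f X Y"
  shows "bij_betw f (pverts X) (pverts Y)" "x \<in> pverts X \<Longrightarrow> f x \<in> pverts Y"
    "\<lbrakk>x \<in> pverts X; y \<in> pverts X\<rbrakk> \<Longrightarrow> (f x, f y) \<in> parcs Y \<longleftrightarrow> (x, y) \<in> parcs X"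
    "\<lbrakk>x \<in> pverts X; y \<in> pverts X\<rbrakk> \<Longrightarrow> f x = f y \<longleftrightarrow> x = y"
    "z \<in> pverts Y \<Longrightarrow> \<exists>x\<in>pverts X. f x = z"
proof -
  have bij: "bij_betw f (pverts X) (pverts Y)" using assms by (simp add: graph_isomorphism_def)
  then show "z \<in> pverts Y \<Longrightarrow> \<exists>x\<in>pverts X. f x = z" unfolding bij_betw_def by (metis imageE)
qed (use assms in \<open>auto simp: graph_isomorphism_def bij_betw_def inj_on_def\<close>)

lemma graph_isomorphism_comp:
  assumes "graph_isomorphism f X Y" "graph_isomorphism g Y Z" shows "graph_isomorphism (\<lambda>x. g (f x)) X Z"
  using graph_isomorphismD(2,3)[OF assms(1)] graph_isomorphismD(3)[OF assms(2)]
    bij_betw_trans[OF graph_isomorphismD(1)[OF assms(1)] graph_isomorphismD(1)[OF assms(2)]]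
  unfolding graph_isomorphism_def by (auto simp: comp_def)

lemma graph_isomorphism_inv:
  assumes f: "graph_isomorphism f X Y" shows "graph_isomorphism (the_inv_into (pverts X) f) Y X"
proof -
  let ?g = "the_inv_into (pverts X) f"
  have inj: "inj_on f (pverts X)" and im: "f ` pverts X = pverts Y"
    using graph_isomorphismD(1)[OF f] by (auto simp: bij_betw_def)
  have g: "?g y \<in> pverts X" "f (?g y) = y" if "y \<in> pverts Y" for y
    using that im the_inv_into_into[OF inj] f_the_inv_into_f[OF inj] by auto
  show ?thesis
    unfolding graph_isomorphism_def
    using bij_betw_the_inv_into[OF graph_isomorphismD(1)[OF f]] graph_isomorphismD(3)[OF f] g by metis
qed

lemma isomorphic_trans: "\<lbrakk>isomorphic X Y; isomorphic Y Z\<rbrakk> \<Longrightarrow> isomorphic X Z"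
  unfolding isomorphic_def by (elim exE, rule exI) (rule graph_isomorphism_comp)

lemma graph_isomorphism_complement:
  assumes f: "graph_isomorphism f X Y"
  shows "graph_isomorphism f (graph_complement X) (graph_complement Y)"
  unfolding graph_isomorphism_def using graph_isomorphismD(1-4)[OF f] by simp

lemma vertex_transitive_iso:
  assumes f: "graph_isomorphism f X Y" and X: "vertex_transitive X" shows "vertex_transitive Y"
  unfolding vertex_transitive_def
proof (intro ballI)
  fix y z assume yz: "y \<in> pverts Y" "z \<in> pverts Y"
  let ?g = "the_inv_into (pverts X) f"
  have g: "graph_isomorphism ?g Y X" by (rule graph_isomorphism_inv[OF f])
  obtain k where k: "graph_isomorphism k X X" "k (?g y) = ?g z"
    using X graph_isomorphismD(2)[OF g] yz unfolding vertex_transitive_def by blast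
  have "f (k (?g y)) = z"
    using k(2) yz graph_isomorphismD(1)[OF f] by (simp add: f_the_inv_into_f_bij_betw)
  then show "\<exists>h. graph_isomorphism h Y Y \<and> h y = z"
    using graph_isomorphism_comp[OF graph_isomorphism_comp[OF g k(1)] f] by blast
qed

lemma vertex_transitive_complement: "vertex_transitive X \<Longrightarrow> vertex_transitive (graph_complement X)"
  using graph_isomorphism_complement unfolding vertex_transitive_def by fastforce

lemma lex_product_iso:
  assumes f: "graph_isomorphism f X X'" and g: "graph_isomorphism g Y Y'"
  shows "graph_isomorphism (map_prod f g) (lex_product X Y) (lex_product X' Y')"
  unfolding graph_isomorphism_def
  using graph_isomorphismD(2-4)[OF f] graph_isomorphismD(2-4)[OF g]
    bij_betw_map_prod[OF graph_isomorphismD(1)[OF f] graph_isomorphismD(1)[OF g]]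
  by simp

section \<open>Neighbourhoods, twins and connectedness\<close>

definition nbrs :: "'v pair_pre_digraph \<Rightarrow> 'v \<Rightarrow> 'v set" where
  "nbrs X a = {b. (a, b) \<in> parcs X}"

text \<open>Without loops, vertices with equal open neighbourhoods are non-adjacent, so this
  excludes non-adjacent twins only. Adjacent twins are the twins of the complement.\<close>

definition twin_free :: "'v pair_pre_digraph \<Rightarrow> bool" where
  "twin_free X \<longleftrightarrow> inj_on (nbrs X) (pverts X)"

definition graph_connected :: "'v pair_pre_digraph \<Rightarrow> bool" where
  "graph_connected X \<longleftrightarrow> (\<forall>x\<in>pverts X. \<forall>y\<in>pverts X. (x, y) \<in> (parcs X)\<^sup>*)"

lemma nbrs_subset: "simple_graph X \<Longrightarrow> nbrs X a \<subseteq> pverts X"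
  using simple_graphD(3)[of X] by (auto simp: nbrs_def)

lemma nbrs_automorphism:
  assumes X: "simple_graph X" and f: "graph_isomorphism f X X" and a: "a \<in> pverts X"
  shows "nbrs X (f a) = f ` nbrs X a"
proof
  show "f ` nbrs X a \<subseteq> nbrs X (f a)"
    using graph_isomorphismD(3)[OF f a] nbrs_subset[OF X, of a] by (auto simp: nbrs_def)
  show "nbrs X (f a) \<subseteq> f ` nbrs X a"
  proof
    fix z assume z: "z \<in> nbrs X (f a)"
    then obtain x where x: "x \<in> pverts X" "f x = z"
      using graph_isomorphismD(5)[OF f] nbrs_subset[OF X] by blast
    then show "z \<in> f ` nbrs X a" using z graph_isomorphismD(3)[OF f a x(1)] by (auto simp: nbrs_def)
  qed
qed

lemma nbrs_eq_automorphism: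
  assumes X: "simple_graph X" and f: "graph_isomorphism f X X" and "a \<in> pverts X" "b \<in> pverts X"
  shows "nbrs X (f a) = nbrs X (f b) \<longleftrightarrow> nbrs X a = nbrs X b"
  using nbrs_automorphism[OF X f] assms(3,4) inj_on_image_eq_iff[of f "pverts X"] nbrs_subset[OF X]
    graph_isomorphismD(1)[OF f] by (simp add: bij_betw_def)

lemma vertex_transitive_regular:
  assumes X: "simple_graph X" "vertex_transitive X" and ab: "a \<in> pverts X" "b \<in> pverts X"
  shows "card (nbrs X a) = card (nbrs X b)"
proof -
  obtain f where f: "graph_isomorphism f X X" "f a = b" using X ab unfolding vertex_transitive_def by blast
  have "card (f ` nbrs X a) = card (nbrs X a)"
    using graph_isomorphismD(1)[OF f(1)] nbrs_subset[OF X(1), of a]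
    by (intro card_image) (auto simp: bij_betw_def inj_on_subset)
  then show ?thesis using nbrs_automorphism[OF X(1) f(1) ab(1)] f(2) by simp
qed

text \<open>A vertex with both a non-adjacent twin \<open>a'\<close> and an adjacent twin \<open>c\<close> would have \<open>a'\<close> both
  adjacent and non-adjacent to \<open>c\<close>.\<close>

lemma vertex_transitive_twin_free:
  assumes X: "simple_graph X" "vertex_transitive X"
  shows "twin_free X \<or> twin_free (graph_complement X)"
proof (rule ccontr)
  assume "\<not> ?thesis"
  then obtain a a' b b' where a: "a \<in> pverts X" "a' \<in> pverts X" "a \<noteq> a'" "nbrs X a = nbrs X a'"
    and b: "b \<in> pverts X" "b' \<in> pverts X" "b \<noteq> b'" "nbrs (graph_complement X) b = nbrs (graph_complement X) b'"
    by (auto simp: twin_free_def inj_on_def)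
  obtain f where f: "graph_isomorphism f X X" "f b = a" using X a b unfolding vertex_transitive_def by blast
  define c where "c = f b'"
  have c: "c \<in> pverts X" "c \<noteq> a" using graph_isomorphismD(2,4)[OF f(1)] b f(2) by (auto simp: c_def)
  have N: "nbrs (graph_complement X) a = nbrs (graph_complement X) c"
    using nbrs_eq_automorphism[OF simple_complement[OF X(1)] graph_isomorphism_complement[OF f(1)], of b b'] b f(2)
    by (simp add: c_def)
  note S = simple_graphD[OF X(1)]
  have "(a, c) \<in> parcs X" using N a c by (auto simp: nbrs_def set_eq_iff)
  then have 1: "(a', c) \<in> parcs X" using a(4) by (auto simp: nbrs_def)
  have "(a, a') \<notin> parcs X" using a(4) S(5)[of a'] by (auto simp: nbrs_def)
  then have "a' \<in> nbrs (graph_complement X) a" using a by (simp add: nbrs_def)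
  then have "a' \<in> nbrs (graph_complement X) c" using N by simp
  then have "(c, a') \<notin> parcs X" by (simp add: nbrs_def)
  then show False using S(4)[OF 1] by simp
qed

section \<open>When the fibres of a lexicographic product are preserved\<close>

definition fibres :: "('a \<times> 'b) rel" where
  "fibres = {((a, i), (b, j)). a = b}"

text \<open>Two vertices of a common fibre over \<open>X\<close> have at least \<open>deg X * card Y\<close> common neighbours, while
  non-adjacent vertices of distinct fibres have fewer if \<open>X\<close> is regular and twin-free.\<close>

lemma nonadjacent_in_fibre_preserved:
  assumes X: "simple_graph X" "\<And>a b. \<lbrakk>a \<in> pverts X; b \<in> pverts X\<rbrakk> \<Longrightarrow> card (nbrs X a) = card (nbrs X b)"
      "twin_free X"
    and Y: "simple_graph Y" and u: "magic_unitary A (pverts X \<times> pverts Y) u"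
    and pres: "preserves A (pverts X \<times> pverts Y) u (parcs (lex_product X Y))"
  shows "preserves A (pverts X \<times> pverts Y) u {((a, i), (b, j)). a = b \<and> (i, j) \<notin> parcs Y}"
proof -
  let ?I = "pverts X \<times> pverts Y" and ?Z = "parcs (lex_product X Y)"
  interpret u: magic_unitary A ?I u by fact
  note SX = simple_graphD[OF X(1)] and SY = simple_graphD[OF Y]
  obtain a0 where a0: "a0 \<in> pverts X" using SX(2) by blast
  define k where "k = card (nbrs X a0)"
  have k: "card (nbrs X a) = k" if "a \<in> pverts X" for a using X(2)[OF that a0] by (simp add: k_def)
  have finN: "finite (nbrs X a)" for a using nbrs_subset[OF X(1)] SX(1) by (rule finite_subset)
  define n where "n = card (pverts Y)"
  have n: "n > 0" using SY by (simp add: n_def card_gt_0_iff)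
  let ?C = "{(p, q). k * n \<le> card {m \<in> ?I. (p, m) \<in> ?Z \<and> (m, q) \<in> ?Z}}"
  have "preserves A ?I u (- ?Z \<inter> ?C)"
    by (intro preserves_Int preserves_Compl pres u.preserves_count)
  moreover have "(p, q) \<in> - ?Z \<inter> ?C \<longleftrightarrow> (p, q) \<in> {((a, i), (b, j)). a = b \<and> (i, j) \<notin> parcs Y}"
    if pq: "p \<in> ?I" "q \<in> ?I" for p q
  proof -
    obtain a i b j where eq: "p = (a, i)" "q = (b, j)" by force
    have I: "a \<in> pverts X" "b \<in> pverts X" "i \<in> pverts Y" "j \<in> pverts Y" using pq by (auto simp: eq)
    let ?M = "{m \<in> ?I. (p, m) \<in> ?Z \<and> (m, q) \<in> ?Z}"
    have finM: "finite ?M" using u.fin by simp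
    show ?thesis
    proof (cases "a = b")
      case True
      have "nbrs X a \<times> pverts Y \<subseteq> ?M"
        using I SX(3,4) True by (auto simp: eq nbrs_def)
      then have "card (nbrs X a \<times> pverts Y) \<le> card ?M" using finM by (rule card_mono[rotated])
      then have "k * n \<le> card ?M" using k[OF I(1)] by (simp add: card_cartesian_product n_def)
      then show ?thesis using True SX(5) I by (auto simp: eq)
    next
      case ab: False
      have "k * n > card ?M" if "(a, b) \<notin> parcs X"
      proof -
        have "?M = (nbrs X a \<inter> nbrs X b) \<times> pverts Y"
          using ab that SX(3,4) I by (auto simp: eq nbrs_def)
        then have M: "card ?M = card (nbrs X a \<inter> nbrs X b) * n" by (simp add: card_cartesian_product n_def)
        have ne: "nbrs X a \<noteq> nbrs X b" using X(3) ab I by (auto simp: twin_free_def inj_on_def)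
        \<comment> \<open>Regularity enters here: neighbourhoods of equal size that differ are not
          nested, so the common part is strictly smaller.\<close>
        have "\<not> nbrs X a \<subseteq> nbrs X b"
        proof
          assume "nbrs X a \<subseteq> nbrs X b"
          then have "nbrs X a = nbrs X b"
            by (rule card_subset_eq[OF finN]) (simp add: k[OF I(1)] k[OF I(2)])
          then show False using ne by simp
        qed
        then have "nbrs X a \<inter> nbrs X b \<subset> nbrs X a" by blast
        then have "card (nbrs X a \<inter> nbrs X b) < card (nbrs X a)" by (rule psubset_card_mono[OF finN])
        then have "card (nbrs X a \<inter> nbrs X b) < k" by (simp add: k[OF I(1)])
        then show ?thesis using M n by simp
      qed
      then show ?thesis using ab I by (auto simp: eq)
    qed
  qed
  ultimately show ?thesis using preserves_cong[of ?I] by blast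
qed

text \<open>\<open>R\<close> joins only vertices of a common fibre and contains the arcs of
  \<open>Y\<close> inside each fibre. As \<open>Y\<close> is connected, the reflexive-transitive
  closure of \<open>R\<close> fills the fibres exactly.\<close>

lemma fibres_preserved_by_connected:
  assumes u: "magic_unitary A (V \<times> pverts Y) u" and Y: "graph_connected Y"
    and R: "preserves A (V \<times> pverts Y) u R" and sub: "R \<inter> ((V \<times> pverts Y) \<times> (V \<times> pverts Y)) \<subseteq> fibres"
    and arcs: "\<And>a i j. \<lbrakk>a \<in> V; (i, j) \<in> parcs Y\<rbrakk> \<Longrightarrow> ((a, i), (a, j)) \<in> R"
      and Ysub: "parcs Y \<subseteq> pverts Y \<times> pverts Y"
  shows "preserves A (V \<times> pverts Y) u fibres"
proof -
  let ?I = "V \<times> pverts Y"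
  interpret u: magic_unitary A ?I u by fact
  \<comment> \<open>Restricting to the index set keeps paths inside it, as
    \<open>preserves_rtrancl\<close> requires.\<close>
  define S where "S = R \<inter> (?I \<times> ?I)"
  have "preserves A ?I u S" using R by (rule iffD1[OF preserves_cong, rotated]) (auto simp: S_def)
  then have "preserves A ?I u (S\<^sup>*)" by (rule u.preserves_rtrancl) (auto simp: S_def)
  moreover have "(p, q) \<in> S\<^sup>* \<longleftrightarrow> (p, q) \<in> fibres" if pq: "p \<in> ?I" "q \<in> ?I" for p q
  proof
    assume "(p, q) \<in> S\<^sup>*"
    then show "(p, q) \<in> fibres"
      by induction (use sub in \<open>force simp: fibres_def S_def\<close>)+
  next
    assume "(p, q) \<in> fibres"
    then obtain a i j where eq: "p = (a, i)" "q = (a, j)" by (auto simp: fibres_def)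
    have a: "a \<in> V" and ij: "i \<in> pverts Y" "j \<in> pverts Y" using pq by (auto simp: eq)
    have "(i, j) \<in> (parcs Y)\<^sup>*" using Y ij by (auto simp: graph_connected_def)
    then have "((a, i), (a, j)) \<in> S\<^sup>*"
    proof induction
      case (step k l)
      have "((a, k), (a, l)) \<in> S" using arcs[OF a step(2)] a step(2) Ysub by (auto simp: S_def)
      then show ?case using step(3) by (rule rtrancl_into_rtrancl[rotated])
    qed simp
    then show "(p, q) \<in> S\<^sup>*" by (simp add: eq)
  qed
  ultimately show ?thesis using preserves_cong[of ?I] by blast
qed

text \<open>By Sabidussi's theorem this condition characterises when the classical automorphism group of the
  lexicographic product is the wreath product of the automorphism groups.\<close>

definition sabidussi :: "'x pair_pre_digraph \<Rightarrow> 'y pair_pre_digraph \<Rightarrow> bool" where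
  "sabidussi X Y \<longleftrightarrow> (twin_free X \<or> graph_connected Y) \<and>
     (twin_free (graph_complement X) \<or> graph_connected (graph_complement Y))"

theorem fibres_preserved:
  assumes X: "simple_graph X" "vertex_transitive X" and Y: "simple_graph Y" and s: "sabidussi X Y"
    and u: "magic_unitary A (pverts X \<times> pverts Y) u"
    and pres: "preserves A (pverts X \<times> pverts Y) u (parcs (lex_product X Y))"
  shows "preserves A (pverts X \<times> pverts Y) u fibres"
proof -
  let ?I = "pverts X \<times> pverts Y"
  interpret u: magic_unitary A ?I u by fact
  let ?N = "{((a, i), (b, j)). a = b \<and> (i, j) \<notin> parcs Y} :: ('a \<times> 'b) rel"
  let ?N' = "{((a, i), (b, j)). a = b \<and> (i, j) \<notin> parcs (graph_complement Y)} :: ('a \<times> 'b) rel"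
  have N: "preserves A ?I u ?N" if "twin_free X"
    by (rule nonadjacent_in_fibre_preserved[OF X(1) vertex_transitive_regular[OF X] that Y u pres])
  have N': "preserves A ?I u ?N'" if "twin_free (graph_complement X)"
  proof -
    \<comment> \<open>Being neither equal nor adjacent is adjacency in the complement of the
      product, which is the product of the complements.\<close>
    have "preserves A ?I u (- (parcs (lex_product X Y) \<union> Id))"
      by (intro preserves_Compl preserves_Un pres u.preserves_Id)
    then have "preserves A ?I u (parcs (lex_product (graph_complement X) (graph_complement Y)))"
      by (rule iffD1[OF preserves_cong, rotated]) (auto simp: complement_lex_product[OF X(1) Y, symmetric])
    then show ?thesis
      using nonadjacent_in_fibre_preserved[OF simple_complement[OF X(1)]
          vertex_transitive_regular[OF simple_complement[OF X(1)] vertex_transitive_complement[OF X(2)]] that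
          simple_complement[OF Y], of A u] u by simp
  qed
  note SY = simple_graphD[OF Y]
  consider "twin_free X" "twin_free (graph_complement X)" | "twin_free X" "graph_connected (graph_complement Y)"
    | "twin_free (graph_complement X)" "graph_connected Y"
    using vertex_transitive_twin_free[OF X] s unfolding sabidussi_def by blast
  then show ?thesis
  proof cases
    case 1
    \<comment> \<open>Any two vertices are non-adjacent in \<open>Y\<close> or in its complement, so
      the union is the whole fibre relation and connectedness is not involved.\<close>
    have "preserves A ?I u (?N \<union> ?N')" using N[OF 1(1)] N'[OF 1(2)] by (rule preserves_Un)
    then show ?thesis by (rule iffD1[OF preserves_cong, rotated]) (auto simp: fibres_def)
  next
    case 2
    have "preserves A (pverts X \<times> pverts (graph_complement Y)) u fibres"
      by (rule fibres_preserved_by_connected[of A _ _ u ?N]) (use u N[OF 2(1)] 2(2) in \<open>auto simp: fibres_def\<close>)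
    then show ?thesis by simp
  next
    case 3
    show ?thesis
      by (rule fibres_preserved_by_connected[OF u 3(2) N'[OF 3(1)]]) (use SY(3) in \<open>auto simp: fibres_def\<close>)
  qed
qed

text \<open>An arbitrary \<open>D\<close> is needed, not just the two algebras in question, because
  the equivalence is applied again to the inner factor of a free wreath product.\<close>

theorem models_lex_product_iff:
  assumes X: "simple_graph X" "vertex_transitive X" and Y: "simple_graph Y" and s: "sabidussi X Y"
    and D: "cstar_algebra D"
  shows "models D w (Qut (lex_product X Y)) \<longleftrightarrow> models D w (free_wreath (Qut Y) (Qut X))"
proof -
  let ?I = "pverts X \<times> pverts Y"
  interpret D: cstar_algebra D by fact
  note SX = simple_graphD[OF X(1)] and SY = simple_graphD[OF Y]
  interpret W: wreath "Qut Y" "Qut X" by (intro wreath.intro Qut_ok SX(1,2) SY(1,2))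
  have Z: "finite (pverts (lex_product X Y))" "pverts (lex_product X Y) \<noteq> {}" using SX SY by auto
  have rel: "preserves D ?I w (parcs (lex_product X Y)) \<longleftrightarrow> preserves D ?I w (wreath_rel (parcs X) (parcs Y))" for w
    by (rule preserves_cong) (auto simp: wreath_rel_def)
  have "models D w (Qut (lex_product X Y)) \<longleftrightarrow> magic D ?I w \<and> preserves D ?I w (parcs (lex_product X Y))"
    using models_Qut_iff[OF Z D] by simp
  also have "\<dots> \<longleftrightarrow> (\<exists>u v. (\<forall>a\<in>pverts X. models D (u a) (Qut Y)) \<and> models D v (Qut X) \<and>
      (\<forall>a\<in>pverts X. \<forall>b\<in>pverts X. \<forall>i\<in>pverts Y. \<forall>j\<in>pverts Y. u a i j \<otimes>\<^bsub>D\<^esub> v a b = v a b \<otimes>\<^bsub>D\<^esub> u a i j \<and>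
        w (a, i) (b, j) = u a i j \<otimes>\<^bsub>D\<^esub> v a b))" (is "?L \<longleftrightarrow> ?R")
  proof
    assume w: ?L
    have mu: "magic_unitary D ?I w"
      by (intro magic_unitary.intro magic_unitary_axioms.intro D conjunct1[OF w]) (use SX SY in auto)
    have fib: "preserves D ?I w {((a, i), (b, j)). a = b}"
      using fibres_preserved[OF X Y s mu] w by (simp add: fibres_def)
    obtain u v where uv: "magic D (pverts X) v" "preserves D (pverts X) v (parcs X)"
      "\<And>a. a \<in> pverts X \<Longrightarrow> magic D (pverts Y) (u a)"
      "\<And>a. a \<in> pverts X \<Longrightarrow> preserves D (pverts Y) (u a) (parcs Y)"
      "\<And>a b i j. \<lbrakk>a \<in> pverts X; b \<in> pverts X; i \<in> pverts Y; j \<in> pverts Y\<rbrakk> \<Longrightarrow> u a i j \<otimes>\<^bsub>D\<^esub> v a b = v a b \<otimes>\<^bsub>D\<^esub> u a i j"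
      "\<And>a b i j. \<lbrakk>a \<in> pverts X; b \<in> pverts X; i \<in> pverts Y; j \<in> pverts Y\<rbrakk> \<Longrightarrow> w (a, i) (b, j) = u a i j \<otimes>\<^bsub>D\<^esub> v a b"
      by (rule D.magic_wreath_decompose[OF SX(1) SY(1,2) conjunct1[OF w] fib iffD1[OF rel conjunct2[OF w]] SX(5)])
        (rule that)
    then show ?R
      using models_Qut_iff[OF SX(1,2) D] models_Qut_iff[OF SY(1,2) D] by (intro exI[of _ u] exI[of _ v]) blast
  next
    assume ?R
    then obtain u v where uv: "\<And>a. a \<in> pverts X \<Longrightarrow> models D (u a) (Qut Y)" "models D v (Qut X)"
      "\<And>a b i j. \<lbrakk>a \<in> pverts X; b \<in> pverts X; i \<in> pverts Y; j \<in> pverts Y\<rbrakk> \<Longrightarrow> u a i j \<otimes>\<^bsub>D\<^esub> v a b = v a b \<otimes>\<^bsub>D\<^esub> u a i j"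
      "\<And>a b i j. \<lbrakk>a \<in> pverts X; b \<in> pverts X; i \<in> pverts Y; j \<in> pverts Y\<rbrakk> \<Longrightarrow> w (a, i) (b, j) = u a i j \<otimes>\<^bsub>D\<^esub> v a b"
      by blast
    note m = uv(1,2)[unfolded models_Qut_iff[OF SX(1,2) D] models_Qut_iff[OF SY(1,2) D]]
    interpret mw: magic_wreath D "pverts X" "pverts Y" u v w
      by (intro magic_wreath.intro magic_wreath_axioms.intro D SX(1) SY(1)) (use m uv in auto)
    show ?L using mw.magic_w mw.preserves_w[of "parcs X" "parcs Y"] m rel by blast
  qed
  also have "\<dots> \<longleftrightarrow> models D w (free_wreath (Qut Y) (Qut X))"
    using W.models_free_wreath_iff[OF D] by simp
  finally show ?thesis .
qed


section \<open>Decomposing vertex-transitive graphs\<close>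

definition quotient_graph :: "'v pair_pre_digraph \<Rightarrow> 'v rel \<Rightarrow> 'v set pair_pre_digraph" where
  "quotient_graph X E = \<lparr> pverts = pverts X // E,
     parcs = {(C, D). C \<in> pverts X // E \<and> D \<in> pverts X // E \<and> C \<noteq> D \<and> (\<exists>x\<in>C. \<exists>y\<in>D. (x, y) \<in> parcs X)} \<rparr>"

definition induced_graph :: "'v pair_pre_digraph \<Rightarrow> 'v set \<Rightarrow> 'v pair_pre_digraph" where
  "induced_graph X S = \<lparr> pverts = S, parcs = parcs X \<inter> (S \<times> S) \<rparr>"

text \<open>Classes are modules in the sense of modular decomposition: between distinct classes
  adjacency is all or nothing. Invariance under automorphisms makes both the quotient and the blocks
  vertex-transitive.\<close>

locale invariant_modules =
  fixes X :: "'v pair_pre_digraph" and E :: "'v rel"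
  assumes X: "simple_graph X" "vertex_transitive X" and E: "equiv (pverts X) E"
    and inv: "\<lbrakk>graph_isomorphism f X X; x \<in> pverts X; y \<in> pverts X\<rbrakk> \<Longrightarrow> (f x, f y) \<in> E \<longleftrightarrow> (x, y) \<in> E"
    and module: "\<lbrakk>(x, x') \<in> E; (y, y') \<in> E; (x, y) \<notin> E; (x, y) \<in> parcs X\<rbrakk> \<Longrightarrow> (x', y') \<in> parcs X"
begin

abbreviation "cls x \<equiv> E `` {x}"

lemma E_verts: "(x, y) \<in> E \<Longrightarrow> x \<in> pverts X" "(x, y) \<in> E \<Longrightarrow> y \<in> pverts X"
  using E by (auto simp: equiv_def refl_on_def)

lemma E_refl: "x \<in> pverts X \<Longrightarrow> (x, x) \<in> E" and E_sym: "(x, y) \<in> E \<Longrightarrow> (y, x) \<in> E"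
  and E_trans: "\<lbrakk>(x, y) \<in> E; (y, z) \<in> E\<rbrakk> \<Longrightarrow> (x, z) \<in> E"
  using E unfolding equiv_def refl_on_def sym_def trans_def by blast+

lemma cls_eq_iff: "\<lbrakk>x \<in> pverts X; y \<in> pverts X\<rbrakk> \<Longrightarrow> cls x = cls y \<longleftrightarrow> (x, y) \<in> E"
  using eq_equiv_class_iff[OF E] by blast

lemma cls_mem: "x \<in> pverts X \<Longrightarrow> cls x \<in> pverts X // E"
  by (rule quotientI)

lemma quotient_cases:
  assumes "C \<in> pverts X // E" obtains x where "x \<in> pverts X" "C = cls x"
  using assms by (rule quotientE) (rule that)

lemma quotient_arcs_iff:
  assumes "x \<in> pverts X" "y \<in> pverts X"
  shows "(cls x, cls y) \<in> parcs (quotient_graph X E) \<longleftrightarrow> (x, y) \<notin> E \<and> (x, y) \<in> parcs X"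
proof
  assume "(cls x, cls y) \<in> parcs (quotient_graph X E)"
  then obtain x' y' where "cls x \<noteq> cls y" "(x, x') \<in> E" "(y, y') \<in> E" "(x', y') \<in> parcs X"
    by (auto simp: quotient_graph_def)
  moreover from this have "(x', y') \<notin> E" using cls_eq_iff[OF assms] E_trans E_sym by blast
  ultimately show "(x, y) \<notin> E \<and> (x, y) \<in> parcs X"
    using module[of x' x y' y] cls_eq_iff[OF assms] E_sym by blast
next
  assume "(x, y) \<notin> E \<and> (x, y) \<in> parcs X"
  then show "(cls x, cls y) \<in> parcs (quotient_graph X E)"
    using assms cls_mem cls_eq_iff[OF assms] E_refl by (auto simp: quotient_graph_def)
qed

lemma simple_quotient: "simple_graph (quotient_graph X E)"
proof (rule simple_graphI)
  note S = simple_graphD[OF X(1)]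
  show "finite (pverts (quotient_graph X E))"
    using S(1) E_verts by (auto simp: quotient_graph_def intro!: finite_quotient)
  show "pverts (quotient_graph X E) \<noteq> {}" using S(2) by (auto simp: quotient_graph_def quotient_def)
  show "(D, C) \<in> parcs (quotient_graph X E)" if "(C, D) \<in> parcs (quotient_graph X E)" for C D
    using that S(4) unfolding quotient_graph_def by force
qed (auto simp: quotient_graph_def)

lemma vertex_transitive_quotient: "vertex_transitive (quotient_graph X E)"
  unfolding vertex_transitive_def
proof (intro ballI)
  fix C D assume "C \<in> pverts (quotient_graph X E)" "D \<in> pverts (quotient_graph X E)"
  then obtain x y where xy: "x \<in> pverts X" "C = cls x" "y \<in> pverts X" "D = cls y"
    by (auto simp: quotient_graph_def elim!: quotient_cases)
  obtain f where f: "graph_isomorphism f X X" "f x = y" using X xy unfolding vertex_transitive_def by blast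
  note F = graph_isomorphismD[OF f(1)]
  have im: "f ` cls z = cls (f z)" if z: "z \<in> pverts X" for z
  proof
    show "f ` cls z \<subseteq> cls (f z)" using inv[OF f(1) z] E_verts by blast
    show "cls (f z) \<subseteq> f ` cls z"
    proof
      fix w assume w: "w \<in> cls (f z)"
      then obtain v where "v \<in> pverts X" "f v = w" using F(5) E_verts by blast
      then show "w \<in> f ` cls z" using inv[OF f(1) z] w by auto
    qed
  qed
  have "graph_isomorphism (\<lambda>C. f ` C) (quotient_graph X E) (quotient_graph X E)"
    unfolding graph_isomorphism_def
  proof (intro conjI ballI)
    have "inj_on (\<lambda>C. f ` C) (pverts X // E)"
    proof (rule inj_onI)
      fix C D assume "C \<in> pverts X // E" "D \<in> pverts X // E" and eq: "f ` C = f ` D"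
      then obtain x y where "x \<in> pverts X" "C = cls x" "y \<in> pverts X" "D = cls y" by (metis quotient_cases)
      then show "C = D" using eq im cls_eq_iff inv[OF f(1)] F(2) by metis
    qed
    moreover have "(\<lambda>C. f ` C) ` (pverts X // E) = pverts X // E"
    proof
      show "(\<lambda>C. f ` C) ` (pverts X // E) \<subseteq> pverts X // E"
        using im F(2) cls_mem by (auto elim!: quotient_cases)
      show "pverts X // E \<subseteq> (\<lambda>C. f ` C) ` (pverts X // E)"
      proof
        fix C assume "C \<in> pverts X // E"
        then obtain y where y: "y \<in> pverts X" "C = cls y" by (rule quotient_cases)
        then obtain x where x: "x \<in> pverts X" "f x = y" using F(5) by blast
        then show "C \<in> (\<lambda>C. f ` C) ` (pverts X // E)" using im[OF x(1)] y cls_mem[OF x(1)] by auto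
      qed
    qed
    ultimately show "bij_betw (\<lambda>C. f ` C) (pverts (quotient_graph X E)) (pverts (quotient_graph X E))"
      by (simp add: bij_betw_def quotient_graph_def)
    fix C D assume "C \<in> pverts (quotient_graph X E)" "D \<in> pverts (quotient_graph X E)"
    then obtain x y where xy: "x \<in> pverts X" "C = cls x" "y \<in> pverts X" "D = cls y"
      by (auto simp: quotient_graph_def elim!: quotient_cases)
    show "(C, D) \<in> parcs (quotient_graph X E) \<longleftrightarrow> (f ` C, f ` D) \<in> parcs (quotient_graph X E)"
      unfolding xy im[OF xy(1)] im[OF xy(3)] quotient_arcs_iff[OF xy(1,3)] quotient_arcs_iff[OF F(2)[OF xy(1)] F(2)[OF xy(3)]]
      using inv[OF f(1) xy(1,3)] F(3)[OF xy(1,3)] by simp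
  qed
  then show "\<exists>g. graph_isomorphism g (quotient_graph X E) (quotient_graph X E) \<and> g C = D"
    using im[OF xy(1)] xy f(2) by blast
qed

lemma simple_block:
  assumes "x \<in> pverts X" shows "simple_graph (induced_graph X (cls x))"
proof (rule simple_graphI)
  note S = simple_graphD[OF X(1)]
  show "finite (pverts (induced_graph X (cls x)))"
    using S(1) E_verts by (auto simp: induced_graph_def intro: finite_subset[of _ "pverts X"])
  show "pverts (induced_graph X (cls x)) \<noteq> {}" using E_refl[OF assms] by (auto simp: induced_graph_def)
qed (use simple_graphD(4,5)[OF X(1)] in \<open>auto simp: induced_graph_def\<close>)

text \<open>An automorphism that carries one vertex of a block into the block maps the block onto
  itself, by invariance of \<open>E\<close>, and so restricts to it.\<close>

lemma vertex_transitive_block: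
  assumes x: "x \<in> pverts X" shows "vertex_transitive (induced_graph X (cls x))"
  unfolding vertex_transitive_def
proof (intro ballI)
  fix y z assume "y \<in> pverts (induced_graph X (cls x))" "z \<in> pverts (induced_graph X (cls x))"
  then have yz: "(x, y) \<in> E" "(x, z) \<in> E" by (auto simp: induced_graph_def)
  obtain f where f: "graph_isomorphism f X X" "f y = z"
    using X E_verts(2)[OF yz(1)] E_verts(2)[OF yz(2)] unfolding vertex_transitive_def by blast
  note F = graph_isomorphismD[OF f(1)]
  have mem: "f v \<in> cls x \<longleftrightarrow> v \<in> cls x" if v: "v \<in> pverts X" for v
  proof -
    have "(z, f v) \<in> E \<longleftrightarrow> (y, v) \<in> E" using inv[OF f(1) E_verts(2)[OF yz(1)] v] f(2) by simp
    then show ?thesis using yz E_trans E_sym by blast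
  qed
  have "f ` cls x = cls x"
  proof
    show "f ` cls x \<subseteq> cls x" using mem E_verts by blast
    show "cls x \<subseteq> f ` cls x"
    proof
      fix w assume w: "w \<in> cls x"
      then obtain v where "v \<in> pverts X" "f v = w" using F(5) E_verts by blast
      then show "w \<in> f ` cls x" using mem w by auto
    qed
  qed
  moreover have "inj_on f (cls x)"
    using F(1) E_verts by (auto simp: bij_betw_def intro: inj_on_subset)
  ultimately have "graph_isomorphism f (induced_graph X (cls x)) (induced_graph X (cls x))"
    using mem F(3) E_verts by (auto simp: graph_isomorphism_def bij_betw_def induced_graph_def)
  then show "\<exists>f. graph_isomorphism f (induced_graph X (cls x)) (induced_graph X (cls x)) \<and> f y = z"
    using f(2) by blast
qed

text \<open>For each class an automorphism \<open>\<phi> C\<close> carrying \<open>x0\<close> into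
  it identifies the block of \<open>x0\<close> with \<open>C\<close>. The coordinates of
  \<open>x\<close> are its class and its preimage under that automorphism. Within a class adjacency
  is compared by the common automorphism, between classes by the module property.\<close>

theorem isomorphic_lex_product:
  assumes x0: "x0 \<in> pverts X"
  shows "isomorphic X (lex_product (quotient_graph X E) (induced_graph X (cls x0)))"
proof -
  have "\<exists>f. graph_isomorphism f X X \<and> f x0 \<in> C" if C: "C \<in> pverts X // E" for C
  proof -
    obtain x where x: "x \<in> pverts X" "C = cls x" using C by (rule quotient_cases)
    obtain f where "graph_isomorphism f X X" "f x0 = x"
      using X(2) x0 x(1) unfolding vertex_transitive_def by blast
    then show ?thesis using E_refl[OF x(1)] x(2) by blast
  qed
  then obtain \<phi> where \<phi>: "\<And>C. C \<in> pverts X // E \<Longrightarrow> graph_isomorphism (\<phi> C) X X"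
      "\<And>C. C \<in> pverts X // E \<Longrightarrow> \<phi> C x0 \<in> C" by metis
  define \<psi> where "\<psi> x = the_inv_into (pverts X) (\<phi> (cls x)) x" for x
  have \<psi>: "\<psi> x \<in> pverts X" "\<phi> (cls x) (\<psi> x) = x" "(x0, \<psi> x) \<in> E" if x: "x \<in> pverts X" for x
  proof -
    note P = \<phi>[OF cls_mem[OF x]]
    show 1: "\<psi> x \<in> pverts X"
      unfolding \<psi>_def using graph_isomorphismD(2)[OF graph_isomorphism_inv[OF P(1)] x] .
    show 2: "\<phi> (cls x) (\<psi> x) = x"
      unfolding \<psi>_def using graph_isomorphismD(1)[OF P(1)] x by (rule f_the_inv_into_f_bij_betw)
    have "(\<phi> (cls x) x0, \<phi> (cls x) (\<psi> x)) \<in> E" using P(2) 2 E_sym by auto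
    then show "(x0, \<psi> x) \<in> E" using inv[OF P(1) x0 1] by simp
  qed
  define f where "f x = (cls x, \<psi> x)" for x
  have inj: "inj_on f (pverts X)"
    using \<psi>(2) by (intro inj_onI) (metis f_def prod.inject)
  have im: "f ` pverts X = (pverts X // E) \<times> cls x0"
  proof
    show "f ` pverts X \<subseteq> (pverts X // E) \<times> cls x0" using \<psi>(3) cls_mem by (auto simp: f_def)
    show "(pverts X // E) \<times> cls x0 \<subseteq> f ` pverts X"
    proof clarify
      fix C b assume C: "C \<in> pverts X // E" and b: "(x0, b) \<in> E"
      note P = \<phi>[OF C]
      have bX: "b \<in> pverts X" using E_verts b by blast
      define x where "x = \<phi> C b"
      have x: "x \<in> pverts X" using graph_isomorphismD(2)[OF P(1) bX] by (simp add: x_def)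
      obtain y where y: "y \<in> pverts X" "C = cls y" using C by (rule quotient_cases)
      have "(\<phi> C x0, x) \<in> E" using inv[OF P(1) x0 bX] b by (simp add: x_def)
      then have cx: "cls x = C" using P(2) y x cls_eq_iff E_trans E_sym by blast
      have "\<phi> C (\<psi> x) = \<phi> C b" using \<psi>(2)[OF x] unfolding cx by (simp add: x_def)
      then have "\<psi> x = b" using graph_isomorphismD(4)[OF P(1) \<psi>(1)[OF x] bX] by simp
      then show "(C, b) \<in> f ` pverts X" using x cx by (auto simp: f_def image_iff intro!: bexI[of _ x])
    qed
  qed
  have "(f x, f y) \<in> parcs (lex_product (quotient_graph X E) (induced_graph X (cls x0))) \<longleftrightarrow> (x, y) \<in> parcs X"
    if x: "x \<in> pverts X" and y: "y \<in> pverts X" for x y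
  proof (cases "(x, y) \<in> E")
    case True
    then have c: "cls x = cls y" using cls_eq_iff x y by simp
    note P = graph_isomorphismD[OF \<phi>(1)[OF cls_mem[OF x]]]
    have "(\<psi> x, \<psi> y) \<in> parcs X \<longleftrightarrow> (x, y) \<in> parcs X"
      using P(3)[OF \<psi>(1)[OF x] \<psi>(1)[OF y]] \<psi>(2)[OF x] \<psi>(2)[OF y] c by simp
    moreover have "(cls x, cls y) \<notin> parcs (quotient_graph X E)" using quotient_arcs_iff[OF x y] True by simp
    ultimately show ?thesis
      using c \<psi>(3)[OF x] \<psi>(3)[OF y] cls_mem[OF x] by (auto simp: f_def induced_graph_def quotient_graph_def)
  next
    case False
    then have "cls x \<noteq> cls y" using cls_eq_iff x y by simp
    then show ?thesis
      using quotient_arcs_iff[OF x y] False \<psi>(3)[OF x] \<psi>(3)[OF y] by (auto simp: f_def induced_graph_def)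
  qed
  then show ?thesis
    unfolding isomorphic_def graph_isomorphism_def
    using inj im by (intro exI[of _ f]) (auto simp: bij_betw_def quotient_graph_def induced_graph_def)
qed

end

text \<open>Quotient graphs have sets of vertices as vertices, while the decompositions and the
  maximality conditions are stated for graphs on natural numbers.\<close>

lemma nat_copy:
  assumes "simple_graph X"
  obtains X' :: "nat pair_pre_digraph" and f where
    "graph_isomorphism f X X'" "simple_graph X'" "pverts X' = {..<card (pverts X)}"
proof -
  note S = simple_graphD[OF assms]
  obtain f where f: "bij_betw f (pverts X) {..<card (pverts X)}"
    using ex_bij_betw_finite_nat[OF S(1)] by (auto simp: lessThan_atLeast0)
  define X' where "X' = \<lparr> pverts = {..<card (pverts X)}, parcs = {(f x, f y) | x y. (x, y) \<in> parcs X} \<rparr>"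
  have inj: "f x = f y \<longleftrightarrow> x = y" if "x \<in> pverts X" "y \<in> pverts X" for x y
    using f that by (auto simp: bij_betw_def inj_on_def)
  have iso: "graph_isomorphism f X X'"
    using f inj S(3) by (auto simp: graph_isomorphism_def X'_def)
  have "simple_graph X'"
  proof (rule simple_graphI)
    show "finite (pverts X')" by (simp add: X'_def)
    show "pverts X' \<noteq> {}" using S(1,2) by (auto simp: X'_def card_gt_0_iff lessThan_empty_iff)
    have "f x \<in> {..<card (pverts X)}" if "x \<in> pverts X" for x using f that by (auto simp: bij_betw_def)
    then show "parcs X' \<subseteq> pverts X' \<times> pverts X'" using S(3) by (auto simp: X'_def)
    show "(y, x) \<in> parcs X'" if "(x, y) \<in> parcs X'" for x y using that S(4) by (auto simp: X'_def)
    show "(x, x) \<notin> parcs X'" for x using inj S(3,5) by (force simp: X'_def)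
  qed
  then show ?thesis using that iso by (simp add: X'_def)
qed

lemma isomorphic_lex_product_cong:
  "\<lbrakk>isomorphic X X'; isomorphic Y Y'\<rbrakk> \<Longrightarrow> isomorphic (lex_product X Y) (lex_product X' Y')"
  unfolding isomorphic_def by (elim exE, rule exI) (rule lex_product_iso)

lemma isomorphic_edgeless:
  assumes "finite (pverts X)" "parcs X = {}" shows "isomorphic X (edgeless_graph (card (pverts X)))"
proof -
  obtain f where "bij_betw f (pverts X) {..<card (pverts X)}"
    using ex_bij_betw_finite_nat[OF assms(1)] by (auto simp: lessThan_atLeast0)
  then show ?thesis using assms(2) by (auto simp: isomorphic_def graph_isomorphism_def)
qed

lemma isomorphic_refl: "isomorphic X X"
  unfolding isomorphic_def graph_isomorphism_def by (rule exI[of _ "\<lambda>x. x"]) (auto simp: bij_betw_def)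

lemma isomorphic_complement: "isomorphic X Y \<Longrightarrow> isomorphic (graph_complement X) (graph_complement Y)"
  unfolding isomorphic_def by (elim exE, rule exI) (rule graph_isomorphism_complement)

text \<open>Twins are non-adjacent, so a twin class induces an edgeless graph;
  \<open>\<alpha>\<close> is the class size, which exceeds one as soon as a pair of twins
  exists.\<close>

lemma not_twin_free_decompose:
  assumes X: "simple_graph X" "vertex_transitive X" and "\<not> twin_free X"
  obtains \<alpha> and X' :: "nat pair_pre_digraph" where "\<alpha> > 1" "simple_graph X'" "vertex_transitive X'"
    "isomorphic X (lex_product X' (edgeless_graph \<alpha>))"
proof -
  note S = simple_graphD[OF X(1)]
  define E where "E = {(x, y). x \<in> pverts X \<and> y \<in> pverts X \<and> nbrs X x = nbrs X y}"
  interpret invariant_modules X E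
  proof
    show "equiv (pverts X) E" by (auto simp: E_def equiv_def refl_on_def sym_def trans_def)
    show "(f x, f y) \<in> E \<longleftrightarrow> (x, y) \<in> E" if "graph_isomorphism f X X" "x \<in> pverts X" "y \<in> pverts X" for f x y
      using nbrs_eq_automorphism[OF X(1) that] graph_isomorphismD(2)[OF that(1)] that by (auto simp: E_def)
    show "(x', y') \<in> parcs X" if "(x, x') \<in> E" "(y, y') \<in> E" "(x, y) \<in> parcs X" for x x' y y'
    proof -
      have "(x', y) \<in> parcs X" using that by (auto simp: E_def nbrs_def)
      then have "(y', x') \<in> parcs X" using that S(4) by (auto simp: E_def nbrs_def)
      then show ?thesis by (rule S(4))
    qed
  qed (use X in auto)
  obtain a b where ab: "a \<in> pverts X" "b \<in> pverts X" "a \<noteq> b" "nbrs X a = nbrs X b"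
    using assms(3) by (auto simp: twin_free_def inj_on_def)
  let ?B = "induced_graph X (cls a)"
  have "parcs ?B = {}"
    using S(5) by (auto simp: induced_graph_def E_def nbrs_def set_eq_iff)
  then have B: "isomorphic ?B (edgeless_graph (card (cls a)))"
    using isomorphic_edgeless[of ?B] simple_graphD(1)[OF simple_block[OF ab(1)]] by (simp add: induced_graph_def)
  have fin: "finite (cls a)" using simple_graphD(1)[OF simple_block[OF ab(1)]] by (simp add: induced_graph_def)
  have "card {a, b} \<le> card (cls a)" using ab fin by (intro card_mono) (auto simp: E_def)
  then have 1: "card (cls a) > 1" using ab(3) by simp
  obtain X' :: "nat pair_pre_digraph" and f where X': "graph_isomorphism f (quotient_graph X E) X'" "simple_graph X'"
    using nat_copy[OF simple_quotient] by metis
  have "isomorphic X (lex_product X' (edgeless_graph (card (cls a))))"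
    using isomorphic_trans[OF isomorphic_lex_product[OF ab(1)] isomorphic_lex_product_cong[OF _ B]] X'(1)
    by (auto simp: isomorphic_def)
  then show ?thesis
    using that 1 X'(2) vertex_transitive_iso[OF X'(1) vertex_transitive_quotient] by blast
qed

lemma rtrancl_automorphism:
  assumes X: "simple_graph X" and f: "graph_isomorphism f X X" and "(x, y) \<in> (parcs X)\<^sup>*" "x \<in> pverts X"
  shows "(f x, f y) \<in> (parcs X)\<^sup>* \<and> y \<in> pverts X"
  using assms(3,4)
proof induction
  case (step y z)
  have "z \<in> pverts X" using step(2) simple_graphD(3)[OF X] by auto
  then have "(f y, f z) \<in> parcs X" using step graph_isomorphismD(3)[OF f] by blast
  then show ?case using step \<open>z \<in> pverts X\<close> by (meson rtrancl.rtrancl_into_rtrancl)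
qed simp

text \<open>No arc joins two components, so the module condition is vacuous and the quotient has no
  arcs; \<open>\<beta>\<close> is the number of components.\<close>

lemma not_connected_decompose:
  assumes X: "simple_graph X" "vertex_transitive X" and "\<not> graph_connected X"
  obtains \<beta> and Y' :: "nat pair_pre_digraph" where "\<beta> > 1" "simple_graph Y'" "vertex_transitive Y'"
    "isomorphic X (lex_product (edgeless_graph \<beta>) Y')"
proof -
  note S = simple_graphD[OF X(1)]
  define E where "E = {(x, y). x \<in> pverts X \<and> y \<in> pverts X \<and> (x, y) \<in> (parcs X)\<^sup>*}"
  have symr: "(y, x) \<in> (parcs X)\<^sup>*" if "(x, y) \<in> (parcs X)\<^sup>*" for x y
  proof -
    have "sym (parcs X)" using S(4) by (auto simp: sym_def)
    then show ?thesis using that sym_rtrancl[of "parcs X"] by (auto dest: symD)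
  qed
  interpret invariant_modules X E
  proof
    show "equiv (pverts X) E"
      using symr by (auto simp: E_def equiv_def refl_on_def sym_def trans_def)
    show "(f x, f y) \<in> E \<longleftrightarrow> (x, y) \<in> E" if f: "graph_isomorphism f X X" and xy: "x \<in> pverts X" "y \<in> pverts X" for f x y
    proof -
      let ?g = "the_inv_into (pverts X) f"
      have g: "?g (f z) = z" if "z \<in> pverts X" for z
        using graph_isomorphismD(1)[OF f] that by (auto simp: bij_betw_def the_inv_into_f_f)
      show ?thesis
        using rtrancl_automorphism[OF X(1) f, of x y] rtrancl_automorphism[OF X(1) graph_isomorphism_inv[OF f], of "f x" "f y"]
          graph_isomorphismD(2)[OF f] xy g by (auto simp: E_def)
    qed
    show "(x', y') \<in> parcs X" if "(x, y) \<notin> E" "(x, y) \<in> parcs X" for x x' y y'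
      using that S(3) by (auto simp: E_def)
  qed (use X in auto)
  obtain a b where ab: "a \<in> pverts X" "b \<in> pverts X" "(a, b) \<notin> E"
    using assms(3) by (auto simp: graph_connected_def E_def)
  let ?Q = "quotient_graph X E"
  have "parcs ?Q = {}"
  proof -
    have "(C, D) \<notin> parcs ?Q" for C D
    proof
      assume CD: "(C, D) \<in> parcs ?Q"
      then have "C \<in> pverts X // E" "D \<in> pverts X // E" by (auto simp: quotient_graph_def)
      then obtain x y where xy: "x \<in> pverts X" "y \<in> pverts X" "C = cls x" "D = cls y" by (metis quotient_cases)
      then have "(x, y) \<notin> E" "(x, y) \<in> parcs X" using CD quotient_arcs_iff by auto
      then show False using xy by (auto simp: E_def)
    qed
    then show ?thesis by auto
  qed
  then have Q: "isomorphic ?Q (edgeless_graph (card (pverts ?Q)))"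
    using isomorphic_edgeless simple_graphD(1)[OF simple_quotient] by blast
  have "card {cls a, cls b} \<le> card (pverts ?Q)"
    using ab cls_mem simple_graphD(1)[OF simple_quotient] by (intro card_mono) (auto simp: quotient_graph_def)
  then have 1: "card (pverts ?Q) > 1" using ab cls_eq_iff by auto
  obtain Y' :: "nat pair_pre_digraph" and f where Y': "graph_isomorphism f (induced_graph X (cls a)) Y'" "simple_graph Y'"
    using nat_copy[OF simple_block[OF ab(1)]] by metis
  have "isomorphic X (lex_product (edgeless_graph (card (pverts ?Q))) Y')"
    using isomorphic_trans[OF isomorphic_lex_product[OF ab(1)] isomorphic_lex_product_cong[OF Q]] Y'(1)
    by (auto simp: isomorphic_def)
  then show ?thesis
    using that 1 Y'(2) vertex_transitive_iso[OF Y'(1) vertex_transitive_block[OF ab(1)]] by blast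
qed

lemma not_twin_free_complement_decompose:
  assumes X: "simple_graph X" "vertex_transitive X" and "\<not> twin_free (graph_complement X)"
  obtains \<alpha> and X' :: "nat pair_pre_digraph" where "\<alpha> > 1" "simple_graph X'" "vertex_transitive X'"
    "isomorphic X (lex_product X' (complete_graph \<alpha>))"
proof -
  obtain \<alpha> and X' :: "nat pair_pre_digraph" where *: "\<alpha> > 1" "simple_graph X'" "vertex_transitive X'"
    "isomorphic (graph_complement X) (lex_product X' (edgeless_graph \<alpha>))"
    using not_twin_free_decompose[OF simple_complement[OF X(1)] vertex_transitive_complement[OF X(2)] assms(3)] by metis
  have "isomorphic X (lex_product (graph_complement X') (complete_graph \<alpha>))"
    using isomorphic_complement[OF *(4)] simple_edgeless[of \<alpha>] *(1)
    by (simp add: complement_complement[OF X(1)] complement_lex_product[OF *(2)] complement_edgeless)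
  then show ?thesis
    using that *(1) simple_complement[OF *(2)] vertex_transitive_complement[OF *(3)] by blast
qed

lemma not_connected_complement_decompose:
  assumes X: "simple_graph X" "vertex_transitive X" and "\<not> graph_connected (graph_complement X)"
  obtains \<beta> and Y' :: "nat pair_pre_digraph" where "\<beta> > 1" "simple_graph Y'" "vertex_transitive Y'"
    "isomorphic X (lex_product (complete_graph \<beta>) Y')"
proof -
  obtain \<beta> and Y' :: "nat pair_pre_digraph" where *: "\<beta> > 1" "simple_graph Y'" "vertex_transitive Y'"
    "isomorphic (graph_complement X) (lex_product (edgeless_graph \<beta>) Y')"
    using not_connected_decompose[OF simple_complement[OF X(1)] vertex_transitive_complement[OF X(2)] assms(3)] by metis
  have "isomorphic X (lex_product (complete_graph \<beta>) (graph_complement Y'))"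
    using isomorphic_complement[OF *(4)] simple_edgeless[of \<beta>] *(1)
    by (simp add: complement_complement[OF X(1)] complement_lex_product[OF _ *(2)] complement_edgeless)
  then show ?thesis
    using that *(1) simple_complement[OF *(2)] vertex_transitive_complement[OF *(3)] by blast
qed


section \<open>The main theorem\<close>

lemma ex_pairing:
  obtains h where "bij_betw h ({..<m::nat} \<times> {..<n::nat}) {..<m * n}"
  using finite_same_card_bij[of "{..<m} \<times> {..<n}" "{..<m * n}"] by (auto simp: card_cartesian_product)

text \<open>The middle factors \<open>K \<alpha>\<close> and \<open>K \<beta>\<close> become
  adjacent in the nested product and merge, because edgeless and complete graphs are each closed
  under lexicographic products. The map is the explicit relabelling under which the two quantum
  groups are compared.\<close>

lemma lex_product_merge:
  fixes X' :: "'x1 pair_pre_digraph" and Y' :: "'y1 pair_pre_digraph"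
  assumes K: "K \<in> {edgeless_graph, complete_graph}"
    and f: "graph_isomorphism f X (lex_product X' (K \<alpha>))" and g: "graph_isomorphism g Y (lex_product (K \<beta>) Y')"
    and h: "bij_betw h ({..<\<alpha>} \<times> {..<\<beta>}) {..<\<alpha> * \<beta>}"
  shows "graph_isomorphism (\<lambda>(x, y). (fst (f x), h (snd (f x), fst (g y)), snd (g y)))
    (lex_product X Y) (lex_product X' (lex_product (K (\<alpha> * \<beta>)) Y'))"
proof -
  let ?F = "\<lambda>(x, y). (fst (f x), h (snd (f x), fst (g y)), snd (g y))"
  have KV: "pverts (K n) = {..<n}" for n using K by auto
  note F = graph_isomorphismD[OF f] and G = graph_isomorphismD[OF g]
  have hinj: "h p = h q \<longleftrightarrow> p = q" if "p \<in> {..<\<alpha>} \<times> {..<\<beta>}" "q \<in> {..<\<alpha>} \<times> {..<\<beta>}" for p q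
    using h that by (auto simp: bij_betw_def inj_on_def)
  have hV: "h p \<in> {..<\<alpha> * \<beta>}" if "p \<in> {..<\<alpha>} \<times> {..<\<beta>}" for p
    using h that by (auto simp: bij_betw_def)
  have FV: "fst (f x) \<in> pverts X'" "snd (f x) \<in> {..<\<alpha>}" if "x \<in> pverts X" for x
    using F(2)[OF that] by (auto simp: KV mem_Times_iff)
  have GV: "fst (g y) \<in> {..<\<beta>}" "snd (g y) \<in> pverts Y'" if "y \<in> pverts Y" for y
    using G(2)[OF that] by (auto simp: KV mem_Times_iff)
  have arcs: "(?F (x, y), ?F (x', y')) \<in> parcs (lex_product X' (lex_product (K (\<alpha> * \<beta>)) Y')) \<longleftrightarrow>
      ((x, y), (x', y')) \<in> parcs (lex_product X Y)"
    if x: "x \<in> pverts X" "x' \<in> pverts X" and y: "y \<in> pverts Y" "y' \<in> pverts Y" for x y x' y'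
  proof -
    obtain a s a' s' b t b' t' where e: "f x = (a, s)" "f x' = (a', s')" "g y = (t, b)" "g y' = (t', b')"
      by (metis surj_pair)
    have V: "a \<in> pverts X'" "a' \<in> pverts X'" "s < \<alpha>" "s' < \<alpha>" "t < \<beta>" "t' < \<beta>" "b \<in> pverts Y'" "b' \<in> pverts Y'"
      using FV[OF x(1)] FV[OF x(2)] GV[OF y(1)] GV[OF y(2)] by (auto simp: e)
    have 1: "(x, x') \<in> parcs X \<longleftrightarrow> (a, a') \<in> parcs X' \<or> a = a' \<and> (s, s') \<in> parcs (K \<alpha>)"
      using F(3)[OF x] V by (auto simp: e KV)
    have 2: "(y, y') \<in> parcs Y \<longleftrightarrow> (t, t') \<in> parcs (K \<beta>) \<or> t = t' \<and> (b, b') \<in> parcs Y'"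
      using G(3)[OF y] V by (auto simp: e KV)
    have 3: "x = x' \<longleftrightarrow> a = a' \<and> s = s'" using F(4)[OF x] by (simp add: e)
    have H: "h (s, t) = h (s', t') \<longleftrightarrow> s = s' \<and> t = t'" "h (s, t) < \<alpha> * \<beta>" "h (s', t') < \<alpha> * \<beta>"
      using hinj[of "(s, t)" "(s', t')"] hV[of "(s, t)"] hV[of "(s', t')"] V by auto
    have "((x, y), (x', y')) \<in> parcs (lex_product X Y) \<longleftrightarrow>
        ((a, a') \<in> parcs X' \<or> a = a' \<and> (s, s') \<in> parcs (K \<alpha>)) \<or>
        (a = a' \<and> s = s') \<and> ((t, t') \<in> parcs (K \<beta>) \<or> t = t' \<and> (b, b') \<in> parcs Y')"
      unfolding lex_product_simps(2) 1 2 3 using x y by simp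
    also have "\<dots> \<longleftrightarrow> (a, a') \<in> parcs X' \<or> a = a' \<and> ((h (s, t), h (s', t')) \<in> parcs (K (\<alpha> * \<beta>)) \<or>
        h (s, t) = h (s', t') \<and> (b, b') \<in> parcs Y')"
    proof -
      \<comment> \<open>For complete graphs this says that pairs differ when their first entries do
        or, these being equal, their second ones; for edgeless graphs both sides are false.\<close>
      have "(h (s, t), h (s', t')) \<in> parcs (K (\<alpha> * \<beta>)) \<longleftrightarrow>
          (s, s') \<in> parcs (K \<alpha>) \<or> s = s' \<and> (t, t') \<in> parcs (K \<beta>)"
        using K
      proof (elim insertE emptyE)
        assume "K = complete_graph"
        then show ?thesis using H V by auto
      qed simp
      then show ?thesis unfolding H(1) by blast
    qed
    also have "\<dots> \<longleftrightarrow> (?F (x, y), ?F (x', y')) \<in> parcs (lex_product X' (lex_product (K (\<alpha> * \<beta>)) Y'))"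
      using V H(2,3) by (simp add: e KV)
    finally show ?thesis by (rule sym)
  qed
  have "bij_betw ?F (pverts X \<times> pverts Y) (pverts X' \<times> {..<\<alpha> * \<beta>} \<times> pverts Y')"
    unfolding bij_betw_def
  proof
    show "inj_on ?F (pverts X \<times> pverts Y)"
    proof (rule inj_onI; clarify)
      fix x y x' y' assume V: "x \<in> pverts X" "y \<in> pverts Y" "x' \<in> pverts X" "y' \<in> pverts Y"
        and eq: "fst (f x) = fst (f x')" "h (snd (f x), fst (g y)) = h (snd (f x'), fst (g y'))" "snd (g y) = snd (g y')"
      have "snd (f x) = snd (f x') \<and> fst (g y) = fst (g y')"
        using hinj[of "(snd (f x), fst (g y))" "(snd (f x'), fst (g y'))"] eq(2) FV GV V by auto
      then have "f x = f x'" "g y = g y'" using eq by (simp_all add: prod_eq_iff)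
      then show "x = x' \<and> y = y'" using F(4) G(4) V by blast
    qed
    show "?F ` (pverts X \<times> pverts Y) = pverts X' \<times> {..<\<alpha> * \<beta>} \<times> pverts Y'"
    proof
      show "?F ` (pverts X \<times> pverts Y) \<subseteq> pverts X' \<times> {..<\<alpha> * \<beta>} \<times> pverts Y'"
        using FV GV hV by auto
      show "pverts X' \<times> {..<\<alpha> * \<beta>} \<times> pverts Y' \<subseteq> ?F ` (pverts X \<times> pverts Y)"
      proof clarify
        fix a r b assume V: "a \<in> pverts X'" "r < \<alpha> * \<beta>" "b \<in> pverts Y'"
        have "r \<in> h ` ({..<\<alpha>} \<times> {..<\<beta>})" using h V(2) by (simp add: bij_betw_def)
        then obtain s t where st: "s < \<alpha>" "t < \<beta>" "h (s, t) = r" by auto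
        obtain x where x: "x \<in> pverts X" "f x = (a, s)" using F(5)[of "(a, s)"] V st by (auto simp: KV)
        obtain y where y: "y \<in> pverts Y" "g y = (t, b)" using G(5)[of "(t, b)"] V st by (auto simp: KV)
        show "(a, r, b) \<in> ?F ` (pverts X \<times> pverts Y)"
          by (rule image_eqI[of _ _ "(x, y)"]) (use x y st in auto)
      qed
    qed
  qed
  then show ?thesis
    unfolding graph_isomorphism_def lex_product_simps(1) KV
    using arcs by (simp add: split_paired_all)
qed

text \<open>Serves the maximality argument: a further factor split off from \<open>X'\<close>
  multiplies onto \<open>\<alpha>\<close>.\<close>

lemma lex_product_merge_right:
  assumes K: "K \<in> {edgeless_graph, complete_graph}"
    and X: "isomorphic X (lex_product X' (K \<alpha>))" and X': "isomorphic X' (lex_product X'' (K \<gamma>))"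
  shows "isomorphic X (lex_product X'' (K (\<gamma> * \<alpha>)))"
proof -
  have KV: "pverts (K n) = {..<n}" for n using K by auto
  obtain h where h: "bij_betw h ({..<\<gamma>} \<times> {..<\<alpha>}) {..<\<gamma> * \<alpha>}" by (rule ex_pairing)
  have hinj: "h (s, t) = h (s', t') \<longleftrightarrow> s = s' \<and> t = t'"
    if "s < \<gamma>" "t < \<alpha>" "s' < \<gamma>" "t' < \<alpha>" for s t s' t'
    using h that by (auto simp: bij_betw_def inj_on_def)
  have hV: "h (s, t) < \<gamma> * \<alpha>" if "s < \<gamma>" "t < \<alpha>" for s t
    using h that by (auto simp: bij_betw_def)
  let ?F = "\<lambda>((x, s), t). (x, h (s, t))"
  have "bij_betw ?F ((pverts X'' \<times> {..<\<gamma>}) \<times> {..<\<alpha>}) (pverts X'' \<times> {..<\<gamma> * \<alpha>})"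
    unfolding bij_betw_def
  proof
    show "inj_on ?F ((pverts X'' \<times> {..<\<gamma>}) \<times> {..<\<alpha>})" by (rule inj_onI) (auto simp: hinj)
    have "r \<in> h ` ({..<\<gamma>} \<times> {..<\<alpha>})" if "r < \<gamma> * \<alpha>" for r using h that by (simp add: bij_betw_def)
    then show "?F ` ((pverts X'' \<times> {..<\<gamma>}) \<times> {..<\<alpha>}) = pverts X'' \<times> {..<\<gamma> * \<alpha>}"
      using hV by (fastforce simp: image_iff)
  qed
  then have "graph_isomorphism ?F (lex_product (lex_product X'' (K \<gamma>)) (K \<alpha>)) (lex_product X'' (K (\<gamma> * \<alpha>)))"
    unfolding graph_isomorphism_def lex_product_simps(1) KV
    using K hinj hV by (auto simp: split_paired_all)
  then have "isomorphic (lex_product (lex_product X'' (K \<gamma>)) (K \<alpha>)) (lex_product X'' (K (\<gamma> * \<alpha>)))"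
    unfolding isomorphic_def by blast
  then show ?thesis
    using isomorphic_trans[OF X isomorphic_trans[OF isomorphic_lex_product_cong[OF X' isomorphic_refl]]] by blast
qed

lemma lex_product_merge_left:
  assumes K: "K \<in> {edgeless_graph, complete_graph}"
    and Y: "isomorphic Y (lex_product (K \<beta>) Y')" and Y': "isomorphic Y' (lex_product (K \<gamma>) Y'')"
  shows "isomorphic Y (lex_product (K (\<beta> * \<gamma>)) Y'')"
proof -
  have KV: "pverts (K n) = {..<n}" for n using K by auto
  obtain h where h: "bij_betw h ({..<\<beta>} \<times> {..<\<gamma>}) {..<\<beta> * \<gamma>}" by (rule ex_pairing)
  have hinj: "h (s, t) = h (s', t') \<longleftrightarrow> s = s' \<and> t = t'"
    if "s < \<beta>" "t < \<gamma>" "s' < \<beta>" "t' < \<gamma>" for s t s' t'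
    using h that by (auto simp: bij_betw_def inj_on_def)
  have hV: "h (s, t) < \<beta> * \<gamma>" if "s < \<beta>" "t < \<gamma>" for s t
    using h that by (auto simp: bij_betw_def)
  let ?F = "\<lambda>(s, (t, y)). (h (s, t), y)"
  have "bij_betw ?F ({..<\<beta>} \<times> {..<\<gamma>} \<times> pverts Y'') ({..<\<beta> * \<gamma>} \<times> pverts Y'')"
    unfolding bij_betw_def
  proof
    show "inj_on ?F ({..<\<beta>} \<times> {..<\<gamma>} \<times> pverts Y'')" by (rule inj_onI) (auto simp: hinj)
    have "r \<in> h ` ({..<\<beta>} \<times> {..<\<gamma>})" if "r < \<beta> * \<gamma>" for r using h that by (simp add: bij_betw_def)
    then show "?F ` ({..<\<beta>} \<times> {..<\<gamma>} \<times> pverts Y'') = {..<\<beta> * \<gamma>} \<times> pverts Y''"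
      using hV by (fastforce simp: image_iff)
  qed
  then have "graph_isomorphism ?F (lex_product (K \<beta>) (lex_product (K \<gamma>) Y'')) (lex_product (K (\<beta> * \<gamma>)) Y'')"
    unfolding graph_isomorphism_def lex_product_simps(1) KV
    using K hinj hV by (auto simp: split_paired_all)
  then have "isomorphic (lex_product (K \<beta>) (lex_product (K \<gamma>) Y'')) (lex_product (K (\<beta> * \<gamma>)) Y'')"
    unfolding isomorphic_def by blast
  then show ?thesis
    using isomorphic_trans[OF Y isomorphic_trans[OF isomorphic_lex_product_cong[OF isomorphic_refl Y']]] by blast
qed

text \<open>Twins of the kind removed by \<open>K\<close> would allow another factor
  \<open>K \<gamma>\<close> with \<open>\<gamma> > 1\<close> to be split off from \<open>X'\<close>,
  so that \<open>\<gamma> * \<alpha>\<close> exceeds \<open>\<alpha>\<close>. Testing maximality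
  against graphs on natural numbers suffices, because the splitting lemmas produce such
  graphs.\<close>

lemma maximal_imp_twin_free:
  fixes X' :: "'x1 pair_pre_digraph"
  assumes X': "simple_graph X'" "vertex_transitive X'" and \<alpha>: "\<alpha> > 0"
    and K: "K \<in> {edgeless_graph, complete_graph}" and X: "isomorphic X (lex_product X' (K \<alpha>))"
    and max: "\<And>\<gamma> (X''::nat pair_pre_digraph). \<lbrakk>simple_graph X''; vertex_transitive X'';
           isomorphic X (lex_product X'' (K \<gamma>))\<rbrakk> \<Longrightarrow> \<gamma> \<le> \<alpha>"
  shows "(K = edgeless_graph \<longrightarrow> twin_free X') \<and> (K = complete_graph \<longrightarrow> twin_free (graph_complement X'))"
proof -
  have False if "\<gamma> > 1" "simple_graph X''" "vertex_transitive X''" "isomorphic X' (lex_product X'' (K \<gamma>))"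
    for \<gamma> and X'' :: "nat pair_pre_digraph"
    using max[OF that(2,3) lex_product_merge_right[OF K X that(4)]] that(1) \<alpha> by simp
  then show ?thesis
    using not_twin_free_decompose[OF X'] not_twin_free_complement_decompose[OF X'] by metis
qed

lemma maximal_imp_connected:
  fixes Y' :: "'y1 pair_pre_digraph"
  assumes Y': "simple_graph Y'" "vertex_transitive Y'" and \<beta>: "\<beta> > 0"
    and K: "K \<in> {edgeless_graph, complete_graph}" and Y: "isomorphic Y (lex_product (K \<beta>) Y')"
    and max: "\<And>\<gamma> (Y''::nat pair_pre_digraph). \<lbrakk>simple_graph Y''; vertex_transitive Y'';
           isomorphic Y (lex_product (K \<gamma>) Y'')\<rbrakk> \<Longrightarrow> \<gamma> \<le> \<beta>"
  shows "(K = edgeless_graph \<longrightarrow> graph_connected Y') \<and> (K = complete_graph \<longrightarrow> graph_connected (graph_complement Y'))"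
proof -
  have False if "\<gamma> > 1" "simple_graph Y''" "vertex_transitive Y''" "isomorphic Y' (lex_product (K \<gamma>) Y'')"
    for \<gamma> and Y'' :: "nat pair_pre_digraph"
    using max[OF that(2,3) lex_product_merge_left[OF K Y that(4)]] that(1) \<beta> by simp
  then show ?thesis
    using not_connected_decompose[OF Y'] not_connected_complement_decompose[OF Y'] by metis
qed

section \<open>Complete and edgeless graphs as factors\<close>

lemma connected_complete_lex:
  assumes "n > 1" shows "graph_connected (lex_product (complete_graph n) Y)"
  unfolding graph_connected_def
proof (intro ballI)
  let ?E = "parcs (lex_product (complete_graph n) Y)"
  fix p q assume pq: "p \<in> pverts (lex_product (complete_graph n) Y)" "q \<in> pverts (lex_product (complete_graph n) Y)"
  obtain s y t z where e: "p = (s, y)" "q = (t, z)" by force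
  \<comment> \<open>Vertices of a common fibre are joined by a detour through another one, which
    exists since \<open>n > 1\<close>.\<close>
  obtain r where r: "r < n" "r \<noteq> s"
    using assms by (metis less_trans zero_less_one less_one zero_neq_one)
  show "(p, q) \<in> ?E\<^sup>*"
  proof (cases "s = t")
    case True
    have "(p, (r, y)) \<in> ?E" "((r, y), q) \<in> ?E" using pq r True by (auto simp: e)
    then show ?thesis by (meson r_into_rtrancl rtrancl_trans)
  next
    case False
    then have "(p, q) \<in> ?E" using pq by (auto simp: e)
    then show ?thesis by blast
  qed
qed

lemma twin_free_complete: "twin_free (complete_graph n)"
  by (auto simp: twin_free_def inj_on_def nbrs_def set_eq_iff)

lemma vertex_transitive_complete: "vertex_transitive (complete_graph n)"
  unfolding vertex_transitive_def
proof (intro ballI)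
  fix i j assume "i \<in> pverts (complete_graph n)" "j \<in> pverts (complete_graph n)"
  then have ij: "i < n" "j < n" by auto
  let ?t = "\<lambda>k. if k = i then j else if k = j then i else k"
  have "graph_isomorphism ?t (complete_graph n) (complete_graph n)"
    unfolding graph_isomorphism_def
  proof
    show "bij_betw ?t (pverts (complete_graph n)) (pverts (complete_graph n))"
      by (rule bij_betwI[of _ _ _ ?t]) (use ij in auto)
  qed (use ij in auto)
  then show "\<exists>f. graph_isomorphism f (complete_graph n) (complete_graph n) \<and> f i = j" by (intro exI[of _ ?t]) auto
qed

lemma vertex_transitive_edgeless: "vertex_transitive (edgeless_graph n)"
  unfolding edgeless_graph_def by (rule vertex_transitive_complement[OF vertex_transitive_complete])

text \<open>Every magic unitary preserves equality and hence inequality, which is adjacency in the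
  complete graph; the empty relation is preserved trivially.\<close>

lemma models_complete_or_edgeless_iff:
  assumes K: "K \<in> {edgeless_graph, complete_graph}" and n: "n > 0" and D: "cstar_algebra D"
  shows "models D w (Qut (K n)) \<longleftrightarrow> models D w (quantum_symmetric_group n)"
proof -
  have V: "pverts (K n) = {..<n}" using K by auto
  have "preserves D {..<n} w (parcs (K n))" if w: "magic D {..<n} w"
  proof -
    interpret magic_unitary D "{..<n}" w
      by (intro magic_unitary.intro magic_unitary_axioms.intro D w) simp
    have "preserves D {..<n} w (- Id)" by (intro preserves_Compl preserves_Id)
    then have "preserves D {..<n} w (parcs (complete_graph n))"
      by (rule iffD1[OF preserves_cong, rotated]) auto
    moreover have "preserves D {..<n} w (parcs (edgeless_graph n))" by (simp add: preserves_def)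
    ultimately show ?thesis using K by auto
  qed
  then show ?thesis
    using models_Qut_iff[of "K n" D w] models_quantum_symmetric_group_iff[OF n D] V D n
    by (auto simp: lessThan_empty_iff)
qed

text \<open>Lets a factor of a free wreath product be replaced by one with the same matrices over
  \<open>D\<close>, even when the algebras of the two factors have different types.\<close>

lemma models_free_wreath_cong:
  assumes ok: "qpg_ok G" "qpg_ok G'" "qpg_ok H" "qpg_ok H'" and D: "cstar_algebra D"
    and pts: "qpoints G = qpoints G'" "qpoints H = qpoints H'"
    and eq: "\<And>w. models D w G \<longleftrightarrow> models D w G'" "\<And>w. models D w H \<longleftrightarrow> models D w H'"
  shows "models D w (free_wreath G H) \<longleftrightarrow> models D w (free_wreath G' H')"
  using wreath.models_free_wreath_iff[OF wreath.intro[OF ok(1,3)] D, of w]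
    wreath.models_free_wreath_iff[OF wreath.intro[OF ok(2,4)] D, of w] by (simp add: pts eq)

lemma models_relabel_Qut_iff:
  assumes F: "graph_isomorphism F Z Z'" and Z: "finite (pverts Z)" "pverts Z \<noteq> {}" and D: "cstar_algebra D"
  shows "models D w (qpg_relabel F (Qut Z)) \<longleftrightarrow> models D w (Qut Z')"
proof -
  interpret D: cstar_algebra D by fact
  have inj: "inj_on F (pverts Z)" and im: "F ` pverts Z = pverts Z'"
    using graph_isomorphismD(1)[OF F] by (auto simp: bij_betw_def)
  have Z': "finite (pverts Z')" "pverts Z' \<noteq> {}" using Z by (simp_all add: im[symmetric])
  let ?w = "\<lambda>i j. w (F i) (F j)"
  have "models D w (qpg_relabel F (Qut Z)) \<longleftrightarrow> models D ?w (Qut Z)"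
    by (simp add: models_def qpg_relabel_def the_inv_into_f_f[OF inj])
  also have "\<dots> \<longleftrightarrow> magic D (pverts Z) ?w \<and> preserves D (pverts Z) ?w (parcs Z)"
    by (rule models_Qut_iff[OF Z D])
  also have "magic D (pverts Z) ?w \<longleftrightarrow> magic D (pverts Z') w"
  proof -
    have "finsum D f (F ` pverts Z) = finsum D (\<lambda>i. f (F i)) (pverts Z)"
      if "\<And>i. i \<in> pverts Z \<Longrightarrow> f (F i) \<in> carrier D" for f
      by (rule D.finsum_reindex) (use that inj in auto)
    then show ?thesis unfolding im[symmetric] magic_def by (auto cong: conj_cong)
  qed
  also have "preserves D (pverts Z) ?w (parcs Z) \<longleftrightarrow> preserves D (pverts Z') w (parcs Z')"
    unfolding preserves_def im[symmetric] using graph_isomorphismD(3)[OF F] by simp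
  also have "magic D (pverts Z') w \<and> preserves D (pverts Z') w (parcs Z') \<longleftrightarrow> models D w (Qut Z')"
    by (rule models_Qut_iff[OF Z' D, symmetric])
  finally show ?thesis .
qed

text \<open>Each algebra is used as test algebra for its own fundamental representation, which is a
  model of one side and, by the equivalence, of the other.\<close>

theorem Qut_lex_product_eq:
  assumes X: "simple_graph X" "vertex_transitive X" and Y: "simple_graph Y" and s: "sabidussi X Y"
  shows "qpg_eq (Qut (lex_product X Y)) (free_wreath (Qut Y) (Qut X))"
proof (rule qpg_eqI)
  note SX = simple_graphD[OF X(1)] and SY = simple_graphD[OF Y]
  interpret W: wreath "Qut Y" "Qut X" by (intro wreath.intro Qut_ok SX(1,2) SY(1,2))
  show ok: "qpg_ok (Qut (lex_product X Y))" "qpg_ok (free_wreath (Qut Y) (Qut X))"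
    using SX SY W.free_wreath_ok by (auto intro!: Qut_ok)
  show "qpoints (Qut (lex_product X Y)) = qpoints (free_wreath (Qut Y) (Qut X))" by (simp add: W.wreath_simps)
  have A: "cstar_algebra (qalg (Qut (lex_product X Y)))" "cstar_algebra (qalg (free_wreath (Qut Y) (Qut X)))"
    using ok by (auto simp: qpg_ok_def)
  show "models (qalg (free_wreath (Qut Y) (Qut X))) (qrep (free_wreath (Qut Y) (Qut X))) (Qut (lex_product X Y))"
    using models_lex_product_iff[OF X Y s A(2)] models_self by blast
  show "models (qalg (Qut (lex_product X Y))) (qrep (Qut (lex_product X Y))) (free_wreath (Qut Y) (Qut X))"
    using models_lex_product_iff[OF X Y s A(1)] models_self by blast
qed

theorem Qut_nested_lex_product_eq:
  assumes K: "K \<in> {edgeless_graph, complete_graph}" and n: "n > 1"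
    and X: "simple_graph X" "vertex_transitive X" and Y: "simple_graph Y"
    and tf: "K = edgeless_graph \<longrightarrow> twin_free X \<and> graph_connected Y"
      "K = complete_graph \<longrightarrow> twin_free (graph_complement X) \<and> graph_connected (graph_complement Y)"
    and F: "graph_isomorphism F Z (lex_product X (lex_product (K n) Y))" and Z: "simple_graph Z"
  shows "qpg_eq (qpg_relabel F (Qut Z)) (free_wreath (free_wreath (Qut Y) (quantum_symmetric_group n)) (Qut X))"
proof -
  note SX = simple_graphD[OF X(1)] and SY = simple_graphD[OF Y] and SZ = simple_graphD[OF Z]
  have Kn: "simple_graph (K n)" "vertex_transitive (K n)" and KV: "pverts (K n) = {..<n}"
    using K n simple_edgeless[of n] simple_complete[of n] vertex_transitive_edgeless vertex_transitive_complete by auto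
  let ?W = "lex_product (K n) Y"
  let ?S = "quantum_symmetric_group n"
  have W: "simple_graph ?W" by (rule simple_lex_product[OF Kn(1) Y])
  note SW = simple_graphD[OF W]
  have ccW: "graph_connected (graph_complement (lex_product (edgeless_graph n) Y))"
    using connected_complete_lex[OF n] simple_edgeless[of n] n
    by (simp add: complement_lex_product[OF _ Y] complement_edgeless)
  \<comment> \<open>In the edgeless case \<open>X\<close> is twin-free and the complement of
    \<open>?W\<close> has a complete outer factor on \<open>n > 1\<close> vertices, hence is
    connected. In the complete case the complement of \<open>X\<close> is twin-free and
    \<open>?W\<close> itself is connected.\<close>
  have s1: "sabidussi X ?W" using K tf connected_complete_lex[OF n] ccW by (auto simp: sabidussi_def)
  \<comment> \<open>One of \<open>K n\<close> and its complement is complete and therefore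
    twin-free; the remaining condition is the assumed connectedness of \<open>Y\<close> or of its
    complement.\<close>
  have s2: "sabidussi (K n) Y"
    using K tf twin_free_complete[of n] complement_edgeless[of n] by (auto simp: sabidussi_def)
  interpret inner: wreath "Qut Y" ?S
    by (intro wreath.intro Qut_ok quantum_symmetric_group_ok SY(1,2)) (use n in simp)
  interpret outer: wreath "free_wreath (Qut Y) ?S" "Qut X"
    by (intro wreath.intro Qut_ok inner.free_wreath_ok SX(1,2))
  let ?G = "qpg_relabel F (Qut Z)" and ?H = "free_wreath (free_wreath (Qut Y) ?S) (Qut X)"
  \<comment> \<open>Kept polymorphic in \<open>D\<close>, since it is instantiated below at the two
    algebras, whose types differ.\<close>
  have key: "models D w ?G \<longleftrightarrow> models D w ?H" if D: "cstar_algebra D" for D :: "'d cstar" and w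
  proof -
    have "models D w ?G \<longleftrightarrow> models D w (Qut (lex_product X ?W))"
      by (rule models_relabel_Qut_iff[OF F SZ(1,2) D])
    also have "\<dots> \<longleftrightarrow> models D w (free_wreath (Qut ?W) (Qut X))"
      by (rule models_lex_product_iff[OF X W s1 D])
    also have "\<dots> \<longleftrightarrow> models D w ?H"
    proof (rule models_free_wreath_cong[OF _ _ _ _ D])
      fix w
      have "models D w (Qut ?W) \<longleftrightarrow> models D w (free_wreath (Qut Y) (Qut (K n)))"
        by (rule models_lex_product_iff[OF Kn Y s2 D])
      also have "\<dots> \<longleftrightarrow> models D w (free_wreath (Qut Y) ?S)"
        by (rule models_free_wreath_cong[OF _ _ _ _ D])
          (use SY n KV inner.H models_complete_or_edgeless_iff[OF K _ D] simple_graphD(1,2)[OF Kn(1)] in \<open>auto intro!: Qut_ok\<close>)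
      finally show "models D w (Qut ?W) \<longleftrightarrow> models D w (free_wreath (Qut Y) ?S)" .
    qed (use SW SX inner.free_wreath_ok KV in \<open>auto intro!: Qut_ok simp: inner.wreath_simps\<close>)
    finally show ?thesis .
  qed
  have FZ: "F ` pverts Z = pverts X \<times> {..<n} \<times> pverts Y" and inj: "inj_on F (pverts Z)"
    using graph_isomorphismD(1)[OF F] by (auto simp: bij_betw_def KV)
  have ok: "qpg_ok ?G" "qpg_ok ?H"
    using qpg_relabel_ok[of "Qut Z" F] inj Qut_ok[OF SZ(1,2)] outer.free_wreath_ok by auto
  show ?thesis
  proof (rule qpg_eqI[OF ok])
    show "qpoints ?G = qpoints ?H"
      using FZ by (simp add: qpg_relabel_def outer.wreath_simps inner.wreath_simps)
    have A: "cstar_algebra (qalg ?G)" "cstar_algebra (qalg ?H)" using ok unfolding qpg_ok_def by blast+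
    show "models (qalg ?H) (qrep ?H) ?G" by (rule iffD2[OF key[OF A(2)] models_self])
    show "models (qalg ?G) (qrep ?G) ?H" by (rule iffD1[OF key[OF A(1)] models_self])
  qed
qed

theorem theorem6p7:
  fixes X :: "'x pair_pre_digraph" and Y :: "'y pair_pre_digraph"
  assumes "simple_graph X" and "vertex_transitive X"
    and "simple_graph Y" and "vertex_transitive Y"
    and "\<not> qpg_eq (Qut (lex_product X Y)) (free_wreath (Qut Y) (Qut X))"
  shows
    "(\<exists>(\<alpha>::nat) (\<beta>::nat) (X'::nat pair_pre_digraph) (Y'::nat pair_pre_digraph).
        \<alpha> > 1 \<and> \<beta> > 1 \<and>
        simple_graph X' \<and> vertex_transitive X' \<and> simple_graph Y' \<and> vertex_transitive Y' \<and>
        (isomorphic X (lex_product X' (edgeless_graph \<alpha>)) \<and>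
           isomorphic Y (lex_product (edgeless_graph \<beta>) Y') \<or>
         isomorphic X (lex_product X' (complete_graph \<alpha>)) \<and>
           isomorphic Y (lex_product (complete_graph \<beta>) Y'))) \<and>
     (\<forall>K \<in> {edgeless_graph, complete_graph}.
      \<forall>(\<alpha>::nat) (\<beta>::nat) (X'::'x1 pair_pre_digraph) (Y'::'y1 pair_pre_digraph) f g h.
        \<alpha> > 1 \<and> \<beta> > 1 \<and>
        simple_graph X' \<and> vertex_transitive X' \<and> simple_graph Y' \<and> vertex_transitive Y' \<and>
        graph_isomorphism f X (lex_product X' (K \<alpha>)) \<and>
        graph_isomorphism g Y (lex_product (K \<beta>) Y') \<and>
        (\<forall>\<gamma> (X''::nat pair_pre_digraph).
           simple_graph X'' \<and> vertex_transitive X'' \<and>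
           isomorphic X (lex_product X'' (K \<gamma>)) \<longrightarrow> \<gamma> \<le> \<alpha>) \<and>
        (\<forall>\<gamma> (Y''::nat pair_pre_digraph).
           simple_graph Y'' \<and> vertex_transitive Y'' \<and>
           isomorphic Y (lex_product (K \<gamma>) Y'') \<longrightarrow> \<gamma> \<le> \<beta>) \<and>
        bij_betw h ({..<\<alpha>} \<times> {..<\<beta>}) {..<\<alpha> * \<beta>} \<longrightarrow>
        qpg_eq
          (qpg_relabel
             (\<lambda>(x, y). (fst (f x), h (snd (f x), fst (g y)), snd (g y)))
             (Qut (lex_product X Y)))
          (free_wreath (free_wreath (Qut Y') (quantum_symmetric_group (\<alpha> * \<beta>))) (Qut X')))"
proof (intro conjI ballI allI impI)
  have "\<not> sabidussi X Y" using Qut_lex_product_eq[OF assms(1-3)] assms(5) by blast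
  \<comment> \<open>Violating a conjunct of \<open>sabidussi\<close> denies both of its
    alternatives, so the defect of \<open>X\<close> and that of \<open>Y\<close> are of the same
    kind; this is why one \<open>K\<close> serves both factors.\<close>
  then consider "\<not> twin_free X" "\<not> graph_connected Y"
    | "\<not> twin_free (graph_complement X)" "\<not> graph_connected (graph_complement Y)"
    by (auto simp: sabidussi_def)
  then show "\<exists>(\<alpha>::nat) (\<beta>::nat) (X'::nat pair_pre_digraph) (Y'::nat pair_pre_digraph).
        \<alpha> > 1 \<and> \<beta> > 1 \<and>
        simple_graph X' \<and> vertex_transitive X' \<and> simple_graph Y' \<and> vertex_transitive Y' \<and>
        (isomorphic X (lex_product X' (edgeless_graph \<alpha>)) \<and>
           isomorphic Y (lex_product (edgeless_graph \<beta>) Y') \<or>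
         isomorphic X (lex_product X' (complete_graph \<alpha>)) \<and>
           isomorphic Y (lex_product (complete_graph \<beta>) Y'))"
  proof cases
    case 1
    show ?thesis
      by (rule not_twin_free_decompose[OF assms(1,2) 1(1)], rule not_connected_decompose[OF assms(3,4) 1(2)]) blast
  next
    case 2
    show ?thesis
      by (rule not_twin_free_complement_decompose[OF assms(1,2) 2(1)],
          rule not_connected_complement_decompose[OF assms(3,4) 2(2)]) blast
  qed
next
  fix K :: "nat \<Rightarrow> nat pair_pre_digraph" and \<alpha> \<beta> :: nat
    and X' :: "'x1 pair_pre_digraph" and Y' :: "'y1 pair_pre_digraph" and f g h
  assume K: "K \<in> {edgeless_graph, complete_graph}"
    and *: "\<alpha> > 1 \<and> \<beta> > 1 \<and>
        simple_graph X' \<and> vertex_transitive X' \<and> simple_graph Y' \<and> vertex_transitive Y' \<and>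
        graph_isomorphism f X (lex_product X' (K \<alpha>)) \<and>
        graph_isomorphism g Y (lex_product (K \<beta>) Y') \<and>
        (\<forall>\<gamma> (X''::nat pair_pre_digraph).
           simple_graph X'' \<and> vertex_transitive X'' \<and>
           isomorphic X (lex_product X'' (K \<gamma>)) \<longrightarrow> \<gamma> \<le> \<alpha>) \<and>
        (\<forall>\<gamma> (Y''::nat pair_pre_digraph).
           simple_graph Y'' \<and> vertex_transitive Y'' \<and>
           isomorphic Y (lex_product (K \<gamma>) Y'') \<longrightarrow> \<gamma> \<le> \<beta>) \<and>
        bij_betw h ({..<\<alpha>} \<times> {..<\<beta>}) {..<\<alpha> * \<beta>}"
  then have ab: "\<alpha> > 1" "\<beta> > 1" and X': "simple_graph X'" "vertex_transitive X'"
    and Y': "simple_graph Y'" "vertex_transitive Y'"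
    and f: "graph_isomorphism f X (lex_product X' (K \<alpha>))" and g: "graph_isomorphism g Y (lex_product (K \<beta>) Y')"
    and h: "bij_betw h ({..<\<alpha>} \<times> {..<\<beta>}) {..<\<alpha> * \<beta>}" by blast+
  have iso: "isomorphic X (lex_product X' (K \<alpha>))" "isomorphic Y (lex_product (K \<beta>) Y')"
    using f g unfolding isomorphic_def by blast+
  have "(K = edgeless_graph \<longrightarrow> twin_free X') \<and> (K = complete_graph \<longrightarrow> twin_free (graph_complement X'))"
    by (rule maximal_imp_twin_free[OF X' _ K iso(1)]) (use * in auto)
  moreover have "(K = edgeless_graph \<longrightarrow> graph_connected Y') \<and> (K = complete_graph \<longrightarrow> graph_connected (graph_complement Y'))"
    by (rule maximal_imp_connected[OF Y' _ K iso(2)]) (use * in auto)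
  moreover have "1 < \<alpha> * \<beta>" using ab less_1_mult by blast
  ultimately show "qpg_eq
          (qpg_relabel
             (\<lambda>(x, y). (fst (f x), h (snd (f x), fst (g y)), snd (g y)))
             (Qut (lex_product X Y)))
          (free_wreath (free_wreath (Qut Y') (quantum_symmetric_group (\<alpha> * \<beta>))) (Qut X'))"
    by (intro Qut_nested_lex_product_eq[OF K _ X' Y'(1) _ _ lex_product_merge[OF K f g h] simple_lex_product[OF assms(1,3)]])
      blast+
qed

end
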